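(* Assume that $\frac12<H<1$. Let $\theta=(\mu_1,\dots,\mu_p,\alpha)^{\top}$ and let $\widehat{\theta}_n=Q_n^{-1}P_n$ be the least squares estimator of $\theta$ for the fractional Ornstein-Uhlenbeck process with periodic mean $X$ given by $$dX_t=\Big(\sum_{i=1}^p\mu_i\varphi_i(t)-\alpha X_t\Big)dt+dB^H_t,\qquad X_0=0,$$ observed continuously on $[0,n]$ (with $P_n,Q_n$ as defined in the context). Then $\widehat{\theta}_n\longrightarrow\theta$ almost surely as $n\to\infty$.
   Context: Setting. $B^H=\{B^H_t,t\ge 0\}$ is a fractional Brownian motion with Hurst parameter $H$, i.e. a centered Gaussian process with covariance $R_H(t,s)=\frac12(t^{2H}+s^{2H}-|t-s|^{2H})$. The integer $p\ge1$ and the functions $\varphi_1,\dots,\varphi_p:[0,\infty)\to\mathbb{R}$ are given; the $\varphi_i$ are bounded by a constant $C>0$, periodic with period $1$ (extended periodically to $\mathbb{R}$), and orthonormal: $\int_0^1\varphi_i(t)\varphi_j(t)\,dt=\delta_{ij}$. The parameters $\mu_1,\dots,\mu_p\in\mathbb{R}$ and $\alpha>0$ are unknown. Skorohod integral. For $n\ge1$ let $\mathcal{H}$ be the Hilbert space obtained as closure of the real step functions on $[0,n]$ for the scalar product $\langle \mathbf 1_{[0,t]},\mathbf 1_{[0,s]}\rangle_{\mathcal H}=R_H(t,s)$, and let $\phi\mapsto B^H(\phi)$ be the isometry extending $\mathbf 1_{[0,t]}\mapsto B^H_t$. For $F=f(B^H(\phi_1),\dots,B^H(\phi_k))$ with $f\in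 C^\infty(\mathbb{R}^k)$ having, with all derivatives, at most polynomial growth, the Malliavin derivative is $DF=\sum_i\partial_i f(B^H(\phi_1),\dots,B^H(\phi_k))\phi_i$. The Skorohod (divergence) integral $\delta$ is the adjoint of $D$: $E[F\delta(u)]=E[\langle DF,u\rangle_{\mathcal H}]$; one writes $\int_0^n u_t\,\delta B^H_t=\delta(u)$. For deterministic integrands it is the Wiener integral $\int_0^n u_t\,dB^H_t$. Estimator. $$P_n=\Big(\int_0^n\varphi_1(t)dX_t,\dots,\int_0^n\varphi_p(t)dX_t,-\int_0^nX_t\,dX_t\Big)^{\top},\qquad Q_n=\begin{pmatrix}G_n&-a_n\\-a_n^{\top}&b_n\end{pmatrix},$$ where $G_n=\big(\int_0^n\varphi_i(t)\varphi_j(t)dt\big)_{1\le i,j\le p}$, $a_n^{\top}=\big(\int_0^n\varphi_1(t)X_tdt,\dots,\int_0^n\varphi_p(t)X_tdt\big)$, $b_n=\int_0^nX_t^2dt$. The integral $\int_0^nX_tdX_t$ is understood in the Skorohod sense, i.e. $\int_0^nX_t\,dX_t=\int_0^nX_t\big(\sum_i\mu_i\varphi_i(t)-\alpha X_t\big)dt+\int_0^nX_t\,\delta B^H_t$. Equivalently $\widehat\theta_n=\theta+Q_n^{-1}R_n$ with $R_n=\big(\int_0^n\varphi_1dB^H,\dots,\int_0^n\varphi_pdB^H,-\int_0^nX_t\,\delta B^H_t\big)^{\top}$. *)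

theory Defs
  imports "HOL-Probability.Probability"
begin

section \<open>Fractional Brownian motion\<close>

definition fbm_cov :: "real \<Rightarrow> real \<Rightarrow> real \<Rightarrow> real" where
  "fbm_cov H t s = (t powr (2 * H) + s powr (2 * H) - \<bar>t - s\<bar> powr (2 * H)) / 2"

text \<open>Degenerate (almost surely zero) variables count as Gaussian.\<close>

definition centered_gaussian :: "'w measure \<Rightarrow> ('w \<Rightarrow> real) \<Rightarrow> bool" where
  "centered_gaussian M Y \<longleftrightarrow> Y \<in> borel_measurable M \<and>
     ((AE \<omega> in M. Y \<omega> = 0) \<or>
      (\<exists>\<sigma>>0. distributed M lborel Y (\<lambda>x. ennreal (normal_density 0 \<sigma> x))))"

text \<open>The process is indexed by \<open>t \<ge> 0\<close>; its values at negative times are irrelevant.  As usual,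
  fractional Brownian motion means the version with continuous paths, which is what makes the
  pathwise reading of the stochastic differential equation below meaningful.\<close>

definition fractional_brownian_motion ::
    "'w measure \<Rightarrow> real \<Rightarrow> (real \<Rightarrow> 'w \<Rightarrow> real) \<Rightarrow> bool" where
  "fractional_brownian_motion M H B \<longleftrightarrow>
     (\<forall>T c. finite T \<and> T \<subseteq> {0..} \<longrightarrow> centered_gaussian M (\<lambda>\<omega>. \<Sum>t\<in>T. c t * B t \<omega>)) \<and>
     (\<forall>t\<ge>0. \<forall>s\<ge>0. integrable M (\<lambda>\<omega>. B t \<omega> * B s \<omega>) \<and>
        (LINT \<omega>|M. B t \<omega> * B s \<omega>) = fbm_cov H t s) \<and>
     (AE \<omega> in M. continuous_on {0..} (\<lambda>t. B t \<omega>))"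


section \<open>The Hilbert space of the fractional Brownian motion on [0,T]\<close>

text \<open>A finitely supported coefficient function \<open>a\<close> stands for the step function
  \<open>\<Sum>\<^sub>t a(t) \<cdot> 1\<^bsub>[0,t]\<^esub>\<close>.\<close>

definition supp :: "(real \<Rightarrow> real) \<Rightarrow> real set" where
  "supp a = {t. a t \<noteq> 0}"

definition step_coeffs :: "real \<Rightarrow> (real \<Rightarrow> real) set" where
  "step_coeffs T = {a. finite (supp a) \<and> supp a \<subseteq> {0..T}}"

definition step_fun :: "(real \<Rightarrow> real) \<Rightarrow> real \<Rightarrow> real" where
  "step_fun a x = (\<Sum>t\<in>supp a. a t * indicator {0..t} x)"

definition step_inner :: "real \<Rightarrow> (real \<Rightarrow> real) \<Rightarrow> (real \<Rightarrow> real) \<Rightarrow> real" where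
  "step_inner H a b = (\<Sum>t\<in>supp a. \<Sum>s\<in>supp b. a t * b s * fbm_cov H t s)"

text \<open>The closure (completion) of the step functions, presented by Cauchy sequences.  Sequences
  with difference tending to zero represent the same vector; the quotient is not formed, since
  all notions below depend on the sequence only through \<open>hinner\<close> and \<open>isonormal\<close>.\<close>

definition hspace :: "real \<Rightarrow> real \<Rightarrow> (nat \<Rightarrow> real \<Rightarrow> real) set" where
  "hspace H T = {h. (\<forall>k. h k \<in> step_coeffs T) \<and>
     (\<forall>e>0. \<exists>N. \<forall>j\<ge>N. \<forall>k\<ge>N.
        step_inner H (\<lambda>t. h j t - h k t) (\<lambda>t. h j t - h k t) < e)}"

definition hinner :: "real \<Rightarrow> (nat \<Rightarrow> real \<Rightarrow> real) \<Rightarrow> (nat \<Rightarrow> real \<Rightarrow> real) \<Rightarrow> real" where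
  "hinner H g h = lim (\<lambda>k. step_inner H (g k) (h k))"

text \<open>The isometry \<open>h \<mapsto> B(h)\<close>: the limit in mean square of the elementary integrals
  (unique up to null sets).\<close>

definition isonormal ::
    "'w measure \<Rightarrow> (real \<Rightarrow> 'w \<Rightarrow> real) \<Rightarrow> (nat \<Rightarrow> real \<Rightarrow> real) \<Rightarrow> 'w \<Rightarrow> real" where
  "isonormal M B h = (SOME Y. Y \<in> borel_measurable M \<and> integrable M (\<lambda>\<omega>. (Y \<omega>)\<^sup>2) \<and>
     (\<lambda>k. LINT \<omega>|M. (Y \<omega> - (\<Sum>t\<in>supp (h k). h k t * B t \<omega>))\<^sup>2) \<longlonglongrightarrow> 0)"

text \<open>Identification of functions with vectors.  For \<open>H > 1/2\<close> one has
  \<open>R\<^sub>H(t,s) = H(2H-1) \<integral>\<^sub>0\<^sup>t \<integral>\<^sub>0\<^sup>s |u-v|\<^bsup>2H-2\<^esup> dv du\<close>, so that \<open>habs2\<close> dominates the squared norm of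
  a step function.  A measurable function \<open>f\<close> on [0,T] is the vector \<open>h\<close> if the step functions
  \<open>h k\<close> converge to \<open>f\<close> in the norm with square \<open>habs2\<close>.\<close>

definition habs2 :: "real \<Rightarrow> (real \<Rightarrow> real) \<Rightarrow> ennreal" where
  "habs2 H g = (\<integral>\<^sup>+ u. (\<integral>\<^sup>+ v.
     ennreal (H * (2 * H - 1) * \<bar>g u\<bar> * \<bar>g v\<bar> * \<bar>u - v\<bar> powr (2 * H - 2)) \<partial>lborel) \<partial>lborel)"

definition represents ::
    "real \<Rightarrow> real \<Rightarrow> (nat \<Rightarrow> real \<Rightarrow> real) \<Rightarrow> (real \<Rightarrow> real) \<Rightarrow> bool" where
  "represents H T h f \<longleftrightarrow> h \<in> hspace H T \<and> set_borel_measurable lborel {0..T} f \<and>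
     (\<lambda>k. habs2 H (\<lambda>x. indicator {0..T} x * f x - step_fun (h k) x)) \<longlonglongrightarrow> 0"

definition wiener_integral ::
    "'w measure \<Rightarrow> real \<Rightarrow> (real \<Rightarrow> 'w \<Rightarrow> real) \<Rightarrow> real \<Rightarrow> (real \<Rightarrow> real) \<Rightarrow> 'w \<Rightarrow> real" where
  "wiener_integral M H B T f = isonormal M B (SOME h. represents H T h f)"


section \<open>Malliavin derivative and Skorohod integral\<close>

text \<open>Functions on \<open>\<real>\<^sup>k\<close> are functions of \<open>x :: nat \<Rightarrow> real\<close> that depend only on \<open>x 0, \<dots>, x (k-1)\<close>;
  for these, continuity in the product topology of \<open>nat \<Rightarrow> real\<close> is continuity on \<open>\<real>\<^sup>k\<close>.\<close>

definition pdiff :: "nat \<Rightarrow> ((nat \<Rightarrow> real) \<Rightarrow> real) \<Rightarrow> (nat \<Rightarrow> real) \<Rightarrow> real" where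
  "pdiff i f x = deriv (\<lambda>s. f (x(i := s))) (x i)"

definition smooth_poly_growth :: "nat \<Rightarrow> ((nat \<Rightarrow> real) \<Rightarrow> real) \<Rightarrow> bool" where
  "smooth_poly_growth k f \<longleftrightarrow>
     (\<forall>x y. (\<forall>i<k. x i = y i) \<longrightarrow> f x = f y) \<and>
     (\<forall>is. set is \<subseteq> {..<k} \<longrightarrow>
        continuous_on UNIV (foldr pdiff is f) \<and>
        (\<forall>i<k. \<forall>x. (\<lambda>s. foldr pdiff is f (x(i := s))) differentiable at (x i)) \<and>
        (\<exists>C m. \<forall>x. \<bar>foldr pdiff is f x\<bar> \<le> C * (1 + (\<Sum>i<k. \<bar>x i\<bar>)) ^ m))"

definition gauss_args ::
    "'w measure \<Rightarrow> (real \<Rightarrow> 'w \<Rightarrow> real) \<Rightarrow> nat \<Rightarrow> (nat \<Rightarrow> nat \<Rightarrow> real \<Rightarrow> real) \<Rightarrow> 'w \<Rightarrow> nat \<Rightarrow> real" where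
  "gauss_args M B k \<phi> \<omega> i = (if i < k then isonormal M B (\<phi> i) \<omega> else 0)"

definition smooth_functional ::
    "'w measure \<Rightarrow> (real \<Rightarrow> 'w \<Rightarrow> real) \<Rightarrow> nat \<Rightarrow> ((nat \<Rightarrow> real) \<Rightarrow> real) \<Rightarrow>
     (nat \<Rightarrow> nat \<Rightarrow> real \<Rightarrow> real) \<Rightarrow> 'w \<Rightarrow> real" where
  "smooth_functional M B k f \<phi> \<omega> = f (gauss_args M B k \<phi> \<omega>)"

text \<open>The derivative \<open>\<Sum>\<^sub>i \<partial>\<^sub>i f(B(\<phi>\<^sub>0),\<dots>) \<phi>\<^sub>i\<close>, a linear combination of the Cauchy sequences
  \<open>\<phi> i\<close> with coefficients depending on \<open>\<omega>\<close>.\<close>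

definition malliavin ::
    "'w measure \<Rightarrow> (real \<Rightarrow> 'w \<Rightarrow> real) \<Rightarrow> nat \<Rightarrow> ((nat \<Rightarrow> real) \<Rightarrow> real) \<Rightarrow>
     (nat \<Rightarrow> nat \<Rightarrow> real \<Rightarrow> real) \<Rightarrow> 'w \<Rightarrow> nat \<Rightarrow> real \<Rightarrow> real" where
  "malliavin M B k f \<phi> \<omega> m t = (\<Sum>i<k. pdiff i f (gauss_args M B k \<phi> \<omega>) * \<phi> i m t)"

definition hspace_L2 ::
    "'w measure \<Rightarrow> real \<Rightarrow> real \<Rightarrow> ('w \<Rightarrow> nat \<Rightarrow> real \<Rightarrow> real) \<Rightarrow> bool" where
  "hspace_L2 M H T U \<longleftrightarrow> (\<forall>\<omega>\<in>space M. U \<omega> \<in> hspace H T) \<and>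
     (\<forall>h\<in>hspace H T. (\<lambda>\<omega>. hinner H h (U \<omega>)) \<in> borel_measurable M) \<and>
     integrable M (\<lambda>\<omega>. hinner H (U \<omega>) (U \<omega>))"

definition history :: "'w measure \<Rightarrow> (real \<Rightarrow> 'w \<Rightarrow> real) \<Rightarrow> real \<Rightarrow> 'w measure" where
  "history M B T = sigma (space M) {B t -` A \<inter> space M | t A. t \<in> {0..T} \<and> A \<in> sets borel}"

text \<open>The duality \<open>E[F \<delta>(u)] = E[\<langle>DF, u\<rangle>]\<close>.  The functionals \<open>F\<close> are dense only in the square
  integrable variables that are measurable for \<open>history M B T\<close>, so this measurability is what makes
  \<open>\<delta>(u)\<close> unique (up to null sets).\<close>

definition is_skorohod_integral ::
    "'w measure \<Rightarrow> real \<Rightarrow> (real \<Rightarrow> 'w \<Rightarrow> real) \<Rightarrow> real \<Rightarrow> (real \<Rightarrow> 'w \<Rightarrow> real) \<Rightarrow> ('w \<Rightarrow> real) \<Rightarrow> bool" where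
  "is_skorohod_integral M H B T u Z \<longleftrightarrow>
     Z \<in> borel_measurable (history M B T) \<and> integrable M (\<lambda>\<omega>. (Z \<omega>)\<^sup>2) \<and>
     (\<exists>U. hspace_L2 M H T U \<and> (AE \<omega> in M. represents H T (U \<omega>) (\<lambda>t. u t \<omega>)) \<and>
        (\<forall>k f \<phi>. smooth_poly_growth k f \<and> (\<forall>i<k. \<phi> i \<in> hspace H T) \<longrightarrow>
           (LINT \<omega>|M. smooth_functional M B k f \<phi> \<omega> * Z \<omega>) =
           (LINT \<omega>|M. hinner H (malliavin M B k f \<phi> \<omega>) (U \<omega>))))"

definition skorohod_integral ::
    "'w measure \<Rightarrow> real \<Rightarrow> (real \<Rightarrow> 'w \<Rightarrow> real) \<Rightarrow> real \<Rightarrow> (real \<Rightarrow> 'w \<Rightarrow> real) \<Rightarrow> 'w \<Rightarrow> real" where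
  "skorohod_integral M H B T u = (SOME Z. is_skorohod_integral M H B T u Z)"


section \<open>The fractional Ornstein-Uhlenbeck process with periodic mean and its estimator\<close>

definition drift ::
    "('p::finite \<Rightarrow> real \<Rightarrow> real) \<Rightarrow> real^'p \<Rightarrow> real \<Rightarrow> (real \<Rightarrow> 'w \<Rightarrow> real) \<Rightarrow> 'w \<Rightarrow> real \<Rightarrow> real" where
  "drift \<phi> \<mu> \<alpha> X \<omega> t = (\<Sum>i\<in>UNIV. \<mu> $ i * \<phi> i t) - \<alpha> * X t \<omega>"

definition periodic_fOU ::
    "'w measure \<Rightarrow> (real \<Rightarrow> 'w \<Rightarrow> real) \<Rightarrow> ('p::finite \<Rightarrow> real \<Rightarrow> real) \<Rightarrow> real^'p \<Rightarrow> real \<Rightarrow>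
     (real \<Rightarrow> 'w \<Rightarrow> real) \<Rightarrow> bool" where
  "periodic_fOU M B \<phi> \<mu> \<alpha> X \<longleftrightarrow>
     (\<forall>t\<ge>0. X t \<in> borel_measurable M) \<and>
     (AE \<omega> in M. X 0 \<omega> = 0 \<and>
        (\<forall>t\<ge>0. set_integrable lborel {0..t} (drift \<phi> \<mu> \<alpha> X \<omega>) \<and>
           X t \<omega> = (LINT s:{0..t}|lborel. drift \<phi> \<mu> \<alpha> X \<omega> s) + B t \<omega>))"

text \<open>Vectors in \<open>\<real>\<^bsup>p+1\<^esup>\<close> are indexed by \<open>'p option\<close>: \<open>Some i\<close> is the position of \<open>\<mu>\<^sub>i\<close>, \<open>None\<close> the
  last position, that of \<open>\<alpha>\<close>.\<close>

definition param :: "real^'p::finite \<Rightarrow> real \<Rightarrow> real^('p option)" where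
  "param \<mu> \<alpha> = (\<chi> k. case k of Some i \<Rightarrow> \<mu> $ i | None \<Rightarrow> \<alpha>)"

text \<open>The integrals against \<open>dX\<close>, with \<open>dX\<^sub>t = drift dt + dB\<^sub>t\<close> and the integral of \<open>X\<close> against
  \<open>dB\<close> in the Skorohod sense.\<close>

definition lse_P ::
    "'w measure \<Rightarrow> real \<Rightarrow> (real \<Rightarrow> 'w \<Rightarrow> real) \<Rightarrow> ('p::finite \<Rightarrow> real \<Rightarrow> real) \<Rightarrow> real^'p \<Rightarrow> real \<Rightarrow>
     (real \<Rightarrow> 'w \<Rightarrow> real) \<Rightarrow> real \<Rightarrow> 'w \<Rightarrow> real^('p option)" where
  "lse_P M H B \<phi> \<mu> \<alpha> X T \<omega> = (\<chi> k. case k of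
      Some i \<Rightarrow> (LINT t:{0..T}|lborel. \<phi> i t * drift \<phi> \<mu> \<alpha> X \<omega> t) + wiener_integral M H B T (\<phi> i) \<omega>
    | None \<Rightarrow> - ((LINT t:{0..T}|lborel. X t \<omega> * drift \<phi> \<mu> \<alpha> X \<omega> t) + skorohod_integral M H B T X \<omega>))"

definition lse_Q ::
    "('p::finite \<Rightarrow> real \<Rightarrow> real) \<Rightarrow> (real \<Rightarrow> 'w \<Rightarrow> real) \<Rightarrow> real \<Rightarrow> 'w \<Rightarrow> real^('p option)^('p option)" where
  "lse_Q \<phi> X T \<omega> = (\<chi> k l. case (k, l) of
      (Some i, Some j) \<Rightarrow> (LINT t:{0..T}|lborel. \<phi> i t * \<phi> j t)
    | (Some i, None) \<Rightarrow> - (LINT t:{0..T}|lborel. \<phi> i t * X t \<omega>)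
    | (None, Some j) \<Rightarrow> - (LINT t:{0..T}|lborel. \<phi> j t * X t \<omega>)
    | (None, None) \<Rightarrow> (LINT t:{0..T}|lborel. (X t \<omega>)\<^sup>2))"

definition lse ::
    "'w measure \<Rightarrow> real \<Rightarrow> (real \<Rightarrow> 'w \<Rightarrow> real) \<Rightarrow> ('p::finite \<Rightarrow> real \<Rightarrow> real) \<Rightarrow> real^'p \<Rightarrow> real \<Rightarrow>
     (real \<Rightarrow> 'w \<Rightarrow> real) \<Rightarrow> real \<Rightarrow> 'w \<Rightarrow> real^('p option)" where
  "lse M H B \<phi> \<mu> \<alpha> X T \<omega> = matrix_inv (lse_Q \<phi> X T \<omega>) *v lse_P M H B \<phi> \<mu> \<alpha> X T \<omega>"

end

theory Submission imports Defs begin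

text \<open>Why the estimator is consistent. The equation gives \<open>P\<^sub>n = Q\<^sub>n \<theta> + R\<^sub>n\<close>, where \<open>R\<^sub>n\<close> consists of the Wiener integrals
  of the \<open>\<phi>\<^sub>i\<close> and of minus the divergence integral of \<open>X\<close>. Hence the error is \<open>Q\<^sub>n\<^sup>-\<^sup>1 R\<^sub>n\<close>, and it suffices that
  \<open>R\<^sub>n / n\<close> tends to zero and that \<open>Q\<^sub>n / n\<close> stays bounded and bounded away from singularity. By orthonormality and
  periodicity \<open>Q\<^sub>n / n\<close> is the identity bordered by one row and one column (\<open>bordered_consistent\<close>), so that only its Schur
  complement has to be bounded below.

  The process splits as \<open>X = m + Z\<close> into a bounded deterministic part, driven by the periodic drift, and a centred
  Gaussian part, driven by the noise (\<open>X_eq\<close>). Bessel's inequality (\<open>m_bessel\<close>) disposes of \<open>m\<close> in the Schur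
  complement; what remains is asymptotically the time average of \<open>E Z\<^sub>t\<^sup>2\<close>, which stays away from zero
  (\<open>Z_second_moment_lower\<close>).

  All limits come from one law of large numbers. Since \<open>H > 1/2\<close>, the covariance of fractional Brownian motion is a
  double integral of a positive kernel, and so \<open>Z\<close> has nonnegative covariances. Therefore the variance of the time
  integral of \<open>g Z\<close> or of \<open>Z\<^sup>2\<close> is at most a multiple of that of the integral of \<open>Z\<close> (\<open>cov_compare\<close>), and the latter is
  of order \<open>t\<^bsup>2H\<^esup>\<close> by the equation itself. As \<open>H < 1\<close>, variances are summable along a polynomial subsequence, and
  monotonicity fills the gaps (\<open>monotone_lln\<close>). The Wiener integrals are Gaussian with variance of order \<open>n\<^bsup>2H\<^esup>\<close>, and high
  moments do the rest.

  The divergence integral is handled by an explicit formula (\<open>skorohod_X\<close>): it equals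
  \<open>X\<^sub>T\<^sup>2 / 2\<close> minus the integral of \<open>X\<close> against the drift, minus the mean of this difference. Indeed Riemann sums
  \<open>\<Sum> X(t\<^sub>j) (B(t\<^sub>j\<^sub>+\<^sub>1) - B(t\<^sub>j))\<close> converge to that difference because the quadratic variation vanishes for \<open>H > 1/2\<close>
  (\<open>Rs_L2_tendsto\<close>), and Gaussian integration by parts (\<open>gaussian_ibp\<close>, \<open>affine_ibp\<close>) shows that the centred limit satisfies the
  duality relation (\<open>Sk_duality\<close>). The relation determines the integral: trigonometric functionals of the motion
  separate the square integrable variables of its history (\<open>history_orthogonal_zero\<close>, \<open>skorohod_unique\<close>). Throughout, the abstract
  Hilbert space is realised inside \<open>L\<^sup>2\<close> by the isometry, so that its scalar product is an expectation (\<open>hinner_eq\<close>).\<close>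

section \<open>Square integrable random variables\<close>

definition sqint :: "'w measure => ('w => real) => bool" where
 "sqint M Y \<longleftrightarrow> Y \<in> borel_measurable M \<and> integrable M (\<lambda>w. (Y w)^2)"

lemma sqint_measurable [measurable_dest, dest]: "sqint M Y ==> Y \<in> borel_measurable M"
 by (simp add: sqint_def)

lemma sqint_sq [intro, dest]: "sqint M Y ==> integrable M (\<lambda>w. (Y w)^2)"
 by (simp add: sqint_def)

lemma sqint_mult:
 assumes "sqint M Y" "sqint M Z" shows "integrable M (\<lambda>w. Y w * Z w)"
proof (rule Bochner_Integration.integrable_bound)
 show "integrable M (\<lambda>w. (Y w)^2 + (Z w)^2)" using assms by auto
 show "(\<lambda>w. Y w * Z w) \<in> borel_measurable M" using assms by measurable
 have "\<bar>y * z\<bar> \<le> y^2 + z^2" for y z :: real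
 proof -
  have "0 \<le> (\<bar>y\<bar> - \<bar>z\<bar>)^2" by simp
  hence "2 * (\<bar>y\<bar> * \<bar>z\<bar>) \<le> y^2 + z^2" by (simp add: power2_diff)
  thus ?thesis by (simp add: abs_mult) (smt (verit) mult_nonneg_nonneg abs_ge_zero)
 qed
 thus "AE w in M. norm (Y w * Z w) \<le> norm ((Y w)^2 + (Z w)^2)" by simp
qed

lemma sqint_add [intro]:
 assumes "sqint M Y" "sqint M Z" shows "sqint M (\<lambda>w. Y w + Z w)"
 using sqint_mult[OF assms] assms unfolding sqint_def
 by (auto simp: power2_sum mult.assoc intro!: borel_measurable_add)

lemma sqint_cmult [intro]: "sqint M Y ==> sqint M (\<lambda>w. c * Y w)"
 unfolding sqint_def by (auto simp: power_mult_distrib intro!: borel_measurable_times)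

lemma sqint_diff [intro]:
 assumes "sqint M Y" "sqint M Z" shows "sqint M (\<lambda>w. Y w - Z w)"
 using sqint_add[OF assms(1) sqint_cmult[OF assms(2), of "-1"]] by simp

lemma sqint_zero [simp]: "sqint M (\<lambda>_. 0)" by (simp add: sqint_def)

lemma sqint_sum [intro]:
 assumes "\<And>i. i \<in> I ==> sqint M (Y i)" shows "sqint M (\<lambda>w. \<Sum>i\<in>I. Y i w)"
 using assms by (induction I rule: infinite_finite_induct) auto

lemma (in finite_measure) sqint_const [simp, intro]: "sqint M (\<lambda>_. c)" by (simp add: sqint_def)

lemma (in finite_measure) sqint_integrable [intro]: "sqint M Y ==> integrable M Y"
 using sqint_mult[of M Y "\<lambda>_. 1"] by simp

lemma sqint_cong_AE:
 assumes "sqint M Y" "AE w in M. Y w = Z w" "Z \<in> borel_measurable M" shows "sqint M Z"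
proof -
 have "integrable M (\<lambda>w. (Z w)^2)"
  by (rule integrable_cong_AE_imp[where g="\<lambda>w. (Y w)^2"]) (use assms in auto)
 thus ?thesis using assms by (simp add: sqint_def)
qed

lemma cauchy_schwarz_integral:
 assumes "sqint M Y" "sqint M Z"
 shows "(LINT w|M. Y w * Z w)^2 \<le> (LINT w|M. (Y w)^2) * (LINT w|M. (Z w)^2)"
proof -
 define a b c where "a = (LINT w|M. (Y w)^2)" and "b = (LINT w|M. Y w * Z w)"
  and "c = (LINT w|M. (Z w)^2)"
 have q: "0 \<le> a - 2 * t * b + t^2 * c" for t
 proof -
  have "0 \<le> (LINT w|M. (Y w - t * Z w)^2)" by simp
  also have "... = (LINT w|M. (Y w)^2 - 2 * t * (Y w * Z w) + t^2 * (Z w)^2)"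
   by (simp add: power2_diff power_mult_distrib algebra_simps)
  also have "... = a - 2 * t * b + t^2 * c"
   using sqint_mult[OF assms] assms by (subst Bochner_Integration.integral_add) (auto simp: a_def b_def c_def)
  finally show ?thesis .
 qed
 have c0: "c \<ge> 0" by (simp add: c_def)
 show ?thesis
 proof (cases "c = 0")
  case True
  have "b = 0"
  proof (rule ccontr)
   assume "b \<noteq> 0"
   thus False using q[of "(a + 1) / (2 * b)"] True by simp
  qed
  thus ?thesis using True by (simp add: a_def[symmetric] b_def[symmetric] c_def[symmetric])
 next
  case False
  hence "0 \<le> a - b\<^sup>2 / c" using q[of "b / c"] c0 by (simp add: power2_eq_square field_simps)
  hence "b^2 \<le> a * c" using False c0 by (simp add: field_simps)
  thus ?thesis by (simp add: a_def b_def c_def)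
 qed
qed

lemma square_sum_le: "((a::real) + b)^2 \<le> 2 * a^2 + 2 * b^2"
 using sum_squares_ge_zero[of "a - b" 0] by (simp add: power2_eq_square algebra_simps)

lemma integral_square_add_le:
 assumes "sqint M Y" "sqint M Z"
 shows "(LINT w|M. (Y w + Z w)^2) \<le> 2 * (LINT w|M. (Y w)^2) + 2 * (LINT w|M. (Z w)^2)"
proof -
 have "(LINT w|M. (Y w + Z w)^2) \<le> (LINT w|M. 2 * (Y w)^2 + 2 * (Z w)^2)"
  by (rule integral_mono) (use assms square_sum_le sqint_add[OF assms] in \<open>auto intro!: Bochner_Integration.integrable_add integrable_mult_right\<close>)
 also have "... = 2 * (LINT w|M. (Y w)^2) + 2 * (LINT w|M. (Z w)^2)"
  using sqint_sq[OF assms(1)] sqint_sq[OF assms(2)] by simp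
 finally show ?thesis .
qed

definition L2_tendsto :: "'w measure => (nat => 'w => real) => ('w => real) => bool" where
 "L2_tendsto M Y Z \<longleftrightarrow> (\<forall>k. sqint M (Y k)) \<and> sqint M Z \<and>
   (\<lambda>k. LINT w|M. (Z w - Y k w)^2) \<longlonglongrightarrow> 0"

lemma L2_tendstoD:
 assumes "L2_tendsto M Y Z"
 shows "sqint M (Y k)" "sqint M Z" "(\<lambda>k. LINT w|M. (Z w - Y k w)^2) \<longlonglongrightarrow> 0"
 using assms by (auto simp: L2_tendsto_def)

lemma tendsto_sqrt_0: "f \<longlonglongrightarrow> (0::real) ==> (\<lambda>k. sqrt (f k)) \<longlonglongrightarrow> 0"
 using tendsto_real_sqrt[of f 0] by simp

lemma L2_tendsto_const: "sqint M Y ==> L2_tendsto M (\<lambda>_. Y) Y"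
 by (simp add: L2_tendsto_def)

lemma L2_tendsto_cmult:
 assumes "L2_tendsto M Y Z" shows "L2_tendsto M (\<lambda>k w. c * Y k w) (\<lambda>w. c * Z w)"
proof -
 have "(LINT w|M. (c * Z w - c * Y k w)^2) = c^2 * (LINT w|M. (Z w - Y k w)^2)" for k
  by (simp add: right_diff_distrib[symmetric] power_mult_distrib)
 thus ?thesis using assms tendsto_mult_left[of "\<lambda>k. LINT w|M. (Z w - Y k w)^2" 0 sequentially "c^2"]
  by (auto simp: L2_tendsto_def)
qed

lemma L2_tendsto_add:
 assumes "L2_tendsto M Y Z" "L2_tendsto M Y' Z'"
 shows "L2_tendsto M (\<lambda>k w. Y k w + Y' k w) (\<lambda>w. Z w + Z' w)"
proof -
 note a = L2_tendstoD[OF assms(1)] and b = L2_tendstoD[OF assms(2)]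
 have "(\<lambda>k. LINT w|M. (Z w + Z' w - (Y k w + Y' k w))^2) \<longlonglongrightarrow> 0"
 proof (rule tendsto_sandwich[OF _ _ tendsto_const])
  show "(\<lambda>k. 2 * (LINT w|M. (Z w - Y k w)^2) + 2 * (LINT w|M. (Z' w - Y' k w)^2)) \<longlonglongrightarrow> 0"
   using tendsto_add[OF tendsto_mult_left[OF a(3), of 2] tendsto_mult_left[OF b(3), of 2]] by simp
  show "\<forall>\<^sub>F k in sequentially. (LINT w|M. (Z w + Z' w - (Y k w + Y' k w))^2)
    \<le> 2 * (LINT w|M. (Z w - Y k w)^2) + 2 * (LINT w|M. (Z' w - Y' k w)^2)"
  proof (intro always_eventually allI)
   fix k
   show "(LINT w|M. (Z w + Z' w - (Y k w + Y' k w))^2)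
    \<le> 2 * (LINT w|M. (Z w - Y k w)^2) + 2 * (LINT w|M. (Z' w - Y' k w)^2)"
    using integral_square_add_le[OF sqint_diff[OF a(2) a(1)[of k]] sqint_diff[OF b(2) b(1)[of k]]]
    by (simp add: algebra_simps)
  qed
 qed simp
 thus ?thesis using a b by (auto simp: L2_tendsto_def)
qed

lemma L2_tendsto_diff:
 assumes "L2_tendsto M Y Z" "L2_tendsto M Y' Z'"
 shows "L2_tendsto M (\<lambda>k w. Y k w - Y' k w) (\<lambda>w. Z w - Z' w)"
 using L2_tendsto_add[OF assms(1) L2_tendsto_cmult[OF assms(2), of "-1"]] by simp

text \<open>By the Cauchy-Schwarz inequality, applied to \<open>Y Y' - Z Z' = (Y - Z) Y' + Z (Y' - Z')\<close>.\<close>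

lemma L2_tendsto_mult:
 assumes "L2_tendsto M Y Z" "L2_tendsto M Y' Z'"
 shows "(\<lambda>k. LINT w|M. Y k w * Y' k w) \<longlonglongrightarrow> (LINT w|M. Z w * Z' w)"
proof -
 note a = L2_tendstoD[OF assms(1)] and b = L2_tendstoD[OF assms(2)]
 define d where "d k = (LINT w|M. (Z w - Y k w)^2)" for k
 define d' where "d' k = (LINT w|M. (Z' w - Y' k w)^2)" for k
 define z where "z = (LINT w|M. (Z w)^2)"
 define z' where "z' = (LINT w|M. (Z' w)^2)"
 have cs: "\<bar>LINT w|M. F w * G w\<bar> \<le> sqrt (LINT w|M. (F w)^2) * sqrt (LINT w|M. (G w)^2)"
  if "sqint M F" "sqint M G" for F G
  using real_sqrt_le_mono[OF cauchy_schwarz_integral[OF that]] by (simp add: real_sqrt_mult)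
 have "(\<lambda>k. (LINT w|M. Y k w * Y' k w) - (LINT w|M. Z w * Z' w)) \<longlonglongrightarrow> 0"
 proof (rule Lim_null_comparison)
  have "(\<lambda>k. sqrt (d k)) \<longlonglongrightarrow> 0" "(\<lambda>k. sqrt (d' k)) \<longlonglongrightarrow> 0"
   using a(3) b(3) by (auto simp: d_def d'_def intro!: tendsto_sqrt_0)
  hence "(\<lambda>k. sqrt (d k) * sqrt z' + sqrt z * sqrt (d' k) + sqrt (d k) * sqrt (d' k))
    \<longlonglongrightarrow> 0 * sqrt z' + sqrt z * 0 + 0 * 0" by (intro tendsto_intros)
  thus "(\<lambda>k. sqrt (d k) * sqrt z' + sqrt z * sqrt (d' k) + sqrt (d k) * sqrt (d' k)) \<longlonglongrightarrow> 0" by simp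
  show "\<forall>\<^sub>F k in sequentially. norm ((LINT w|M. Y k w * Y' k w) - (LINT w|M. Z w * Z' w))
    \<le> sqrt (d k) * sqrt z' + sqrt z * sqrt (d' k) + sqrt (d k) * sqrt (d' k)"
  proof (intro always_eventually allI)
   fix k
   have i: "sqint M (\<lambda>w. Z w - Y k w)" "sqint M (\<lambda>w. Z' w - Y' k w)" using a b by auto
   have "(LINT w|M. Y k w * Y' k w) = (LINT w|M. Z w * Z' w - (Z w - Y k w) * Z' w
      - Z w * (Z' w - Y' k w) + (Z w - Y k w) * (Z' w - Y' k w))"
    by (intro Bochner_Integration.integral_cong) (auto simp: algebra_simps)
   also have "... = (LINT w|M. Z w * Z' w) - (LINT w|M. (Z w - Y k w) * Z' w)
      - (LINT w|M. Z w * (Z' w - Y' k w)) + (LINT w|M. (Z w - Y k w) * (Z' w - Y' k w))"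
    using sqint_mult[OF a(2) b(2)] sqint_mult[OF i(1) b(2)] sqint_mult[OF a(2) i(2)] sqint_mult[OF i]
    by simp
   finally show "norm ((LINT w|M. Y k w * Y' k w) - (LINT w|M. Z w * Z' w))
     \<le> sqrt (d k) * sqrt z' + sqrt z * sqrt (d' k) + sqrt (d k) * sqrt (d' k)"
    using cs[OF i(1) b(2)] cs[OF a(2) i(2)] cs[OF i]
    by (simp add: d_def d'_def z_def z'_def)
  qed
 qed
 thus ?thesis by (simp add: LIM_zero_iff)
qed

lemma L2_tendsto_square:
 assumes "L2_tendsto M Y Z"
 shows "(\<lambda>k. LINT w|M. (Y k w)^2) \<longlonglongrightarrow> (LINT w|M. (Z w)^2)"
 using L2_tendsto_mult[OF assms assms] by (simp add: power2_eq_square)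

lemma (in prob_space) L2_tendsto_integral:
 assumes "L2_tendsto M Y Z" shows "(\<lambda>k. LINT w|M. Y k w) \<longlonglongrightarrow> (LINT w|M. Z w)"
 using L2_tendsto_mult[OF assms L2_tendsto_const[of M "\<lambda>_. 1"]] by simp

lemma integral_square_eq_0:
 assumes "sqint M Y" "(LINT w|M. (Y w)^2) = 0" shows "AE w in M. Y w = 0"
 using integral_nonneg_eq_0_iff_AE[of M "\<lambda>w. (Y w)^2"] assms by auto

lemma L2_tendsto_unique:
 assumes "L2_tendsto M Y Z" "L2_tendsto M Y Z'" shows "AE w in M. Z w = Z' w"
proof -
 have "L2_tendsto M (\<lambda>k w. 0) (\<lambda>w. Z w - Z' w)"
  using L2_tendsto_diff[OF assms] by simp
 hence "(LINT w|M. (Z w - Z' w)^2) = 0" "sqint M (\<lambda>w. Z w - Z' w)"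
  using LIMSEQ_const_iff by (auto simp: L2_tendsto_def)
 from integral_square_eq_0[OF this(2,1)] show ?thesis by simp
qed

text \<open>Fatou's lemma: an almost sure limit of an \<open>L\<^sup>2\<close> Cauchy sequence is its \<open>L\<^sup>2\<close> limit.\<close>

lemma L2_Cauchy_AE_tendsto:
 assumes Y: "\<And>k. sqint M (Y k)"
  and Cauchy: "\<And>e. e > 0 ==> \<exists>N. \<forall>j\<ge>N. \<forall>k\<ge>N. (LINT w|M. (Y j w - Y k w)^2) \<le> e"
  and Z: "Z \<in> borel_measurable M"
  and r: "strict_mono r" and AE: "AE w in M. (\<lambda>k. Y (r k) w) \<longlonglongrightarrow> Z w"
 shows "L2_tendsto M Y Z"
proof -
 have [measurable]: "\<And>k. Y k \<in> borel_measurable M" using Y by auto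
 note [measurable] = Z
 have *: "\<exists>N. \<forall>j\<ge>N. sqint M (\<lambda>w. Z w - Y j w) \<and> (LINT w|M. (Z w - Y j w)^2) \<le> e" if e: "e > 0" for e :: real
 proof -
  obtain N where N: "\<And>j k. j \<ge> N ==> k \<ge> N ==> (LINT w|M. (Y j w - Y k w)^2) \<le> e" using Cauchy[OF e] by blast
  have "sqint M (\<lambda>w. Z w - Y j w) \<and> (LINT w|M. (Z w - Y j w)^2) \<le> e" if j: "j \<ge> N" for j
  proof -
   have "(\<integral>\<^sup>+w. ennreal ((Z w - Y j w)^2) \<partial>M) = (\<integral>\<^sup>+w. liminf (\<lambda>k. ennreal ((Y (r k) w - Y j w)^2)) \<partial>M)"
   proof (rule nn_integral_cong_AE, use AE in eventually_elim)
    case (elim w)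
    hence "(\<lambda>k. ennreal ((Y (r k) w - Y j w)^2)) \<longlonglongrightarrow> ennreal ((Z w - Y j w)^2)"
     by (intro tendsto_ennrealI tendsto_intros)
    from lim_imp_Liminf[OF sequentially_bot this] show ?case by simp
   qed
   also have "... \<le> liminf (\<lambda>k. \<integral>\<^sup>+w. ennreal ((Y (r k) w - Y j w)^2) \<partial>M)"
    by (rule nn_integral_liminf) measurable
   also have "... \<le> ennreal e"
   proof (rule Liminf_le)
    show "\<forall>\<^sub>F k in sequentially. (\<integral>\<^sup>+w. ennreal ((Y (r k) w - Y j w)^2) \<partial>M) \<le> ennreal e"
    proof (rule eventually_sequentiallyI[of N])
     fix k assume "k \<ge> N"
     hence "r k \<ge> N" using seq_suble[OF r, of k] by simp
     thus "(\<integral>\<^sup>+w. ennreal ((Y (r k) w - Y j w)^2) \<partial>M) \<le> ennreal e"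
      using N[of "r k" j] j sqint_sq[OF sqint_diff[OF Y[of "r k"] Y[of j]]]
      by (subst nn_integral_eq_integral) (auto simp: ennreal_leI)
    qed
   qed simp
   finally have le: "(\<integral>\<^sup>+w. ennreal ((Z w - Y j w)^2) \<partial>M) \<le> ennreal e" .
   have i: "integrable M (\<lambda>w. (Z w - Y j w)^2)"
    by (rule integrableI_nonneg) (use le in \<open>auto simp: less_top[symmetric] top_unique\<close>)
   moreover have "(LINT w|M. (Z w - Y j w)^2) \<le> e"
    using le e nn_integral_eq_integral[OF i] by simp
   ultimately show ?thesis by (simp add: sqint_def)
  qed
  thus ?thesis by blast
 qed
 obtain N where "sqint M (\<lambda>w. Z w - Y N w)" using *[of 1] by auto
 from sqint_add[OF this Y[of N]] have "sqint M Z" by simp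
 moreover have "(\<lambda>k. LINT w|M. (Z w - Y k w)^2) \<longlonglongrightarrow> 0"
 proof (rule LIMSEQ_I)
  fix e :: real assume "e > 0"
  then obtain N where "\<forall>j\<ge>N. (LINT w|M. (Z w - Y j w)^2) \<le> e / 2" using *[of "e / 2"] by auto
  thus "\<exists>N. \<forall>k\<ge>N. norm ((LINT w|M. (Z w - Y k w)^2) - 0) < e" using \<open>e > 0\<close>
   by (intro exI[of _ N]) fastforce
 qed
 ultimately show ?thesis using Y by (simp add: L2_tendsto_def)
qed

text \<open>The form of the Borel-Cantelli argument used for all almost sure limits: the sum of the squares is integrable, hence finite.\<close>

lemma summable_square_integrals_AE_tendsto_0:
 assumes Y: "\<And>k. sqint M (Y k)" and s: "summable (\<lambda>k. LINT w|M. (Y k w)^2)"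
 shows "AE w in M. summable (\<lambda>k. (Y k w)^2)" "AE w in M. (\<lambda>k. Y k w) \<longlonglongrightarrow> 0"
proof -
 have [measurable]: "\<And>k. Y k \<in> borel_measurable M" using Y by auto
 have "(\<integral>\<^sup>+w. (\<Sum>k. ennreal ((Y k w)^2)) \<partial>M) = (\<Sum>k. \<integral>\<^sup>+w. ennreal ((Y k w)^2) \<partial>M)"
  by (rule nn_integral_suminf) measurable
 also have "... = (\<Sum>k. ennreal (LINT w|M. (Y k w)^2))"
  by (intro suminf_cong nn_integral_eq_integral) (use Y in auto)
 also have "... = ennreal (\<Sum>k. LINT w|M. (Y k w)^2)" by (intro suminf_ennreal2 s) simp
 finally have "(\<integral>\<^sup>+w. (\<Sum>k. ennreal ((Y k w)^2)) \<partial>M) \<noteq> \<infinity>" by simp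
 hence "AE w in M. (\<Sum>k. ennreal ((Y k w)^2)) \<noteq> \<infinity>" by (intro nn_integral_noteq_infinite) auto
 thus 1: "AE w in M. summable (\<lambda>k. (Y k w)^2)"
  by eventually_elim (auto intro!: summable_suminf_not_top)
 show "AE w in M. (\<lambda>k. Y k w) \<longlonglongrightarrow> 0" using 1
 proof eventually_elim
  case (elim w)
  from summable_LIMSEQ_zero[OF this] show ?case
   using tendsto_sqrt_0[of "\<lambda>k. (Y k w)^2"] by (simp add: tendsto_rabs_zero_iff)
 qed
qed

text \<open>A subsequence with increments of square norm at most \<open>8\<^sup>-\<^sup>k\<close> converges almost surely, since
  \<open>\<bar>x\<bar> \<le> 2\<^sup>-\<^sup>k + 2\<^sup>k x\<^sup>2\<close> makes the increments summable. The limit inherits measurability for the \<open>\<sigma>\<close>-algebra \<open>F\<close>.\<close>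

lemma L2_complete:
 fixes M F :: "'w measure"
 assumes Y: "\<And>k. sqint M (Y k)"
  and Cauchy: "\<And>e. e > 0 ==> \<exists>N. \<forall>j\<ge>N. \<forall>k\<ge>N. (LINT w|M. (Y j w - Y k w)^2) \<le> e"
  and sub: "\<And>k. Y k \<in> borel_measurable F" "\<And>f :: 'w => real. f \<in> borel_measurable F ==> f \<in> borel_measurable M"
 shows "\<exists>Z. Z \<in> borel_measurable F \<and> L2_tendsto M Y Z \<and> (\<exists>r. strict_mono r \<and> (AE w in M. (\<lambda>k. Y (r k) w) \<longlonglongrightarrow> Z w))"
proof -
 have "\<forall>n. \<exists>N. \<forall>j\<ge>N. \<forall>k\<ge>N. (LINT w|M. (Y j w - Y k w)^2) \<le> (1/8)^n" by (intro allI Cauchy) simp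
 then obtain N where N: "\<And>n j k. j \<ge> N n ==> k \<ge> N n ==> (LINT w|M. (Y j w - Y k w)^2) \<le> (1/8)^n" by metis
 define r where "r n = (\<Sum>i\<le>n. Suc (N i))" for n
 have rmono: "strict_mono r" by (rule strict_monoI_Suc) (simp add: r_def)
 have rN: "r n \<ge> N n" for n
 proof -
  have "Suc (N n) \<le> (\<Sum>i\<le>n. Suc (N i))" by (rule member_le_sum) auto
  thus ?thesis by (simp add: r_def)
 qed
 define D where "D k w = sqrt (2^k) * (Y (r (Suc k)) w - Y (r k) w)" for k w
 have D: "sqint M (D k)" for k unfolding D_def by (intro sqint_cmult sqint_diff Y)
 have "(LINT w|M. (D k w)^2) \<le> (1/4)^k" for k
 proof -
  have "(LINT w|M. (D k w)^2) = 2^k * (LINT w|M. (Y (r (Suc k)) w - Y (r k) w)^2)"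
   by (simp add: D_def power_mult_distrib)
  also have "... \<le> 2^k * (1/8)^k"
   using N[of k "r (Suc k)" "r k"] rN[of k] strict_mono_leD[OF rmono, of k "Suc k"]
   by (intro mult_left_mono) auto
  also have "... = (1/4)^k" by (simp add: power_mult_distrib[symmetric])
  finally show ?thesis .
 qed
 hence "summable (\<lambda>k. LINT w|M. (D k w)^2)"
  by (intro summable_comparison_test'[OF summable_geometric[of "1/4::real"], of 0]) auto
 from summable_square_integrals_AE_tendsto_0(1)[OF D this]
 have conv: "AE w in M. convergent (\<lambda>k. Y (r k) w)"
 proof eventually_elim
  case (elim w)
  have "summable (\<lambda>k. Y (r (Suc k)) w - Y (r k) w)"
  proof (rule summable_comparison_test'[of "\<lambda>k. (1/2)^k + (D k w)^2" 0])
   show "summable (\<lambda>k. (1/2)^k + (D k w)^2)"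
    by (intro summable_add elim summable_geometric) simp
   fix k
   define x where "x = \<bar>Y (r (Suc k)) w - Y (r k) w\<bar>"
   have "0 \<le> (1/2)^k * (2^k * x - 1)^2" by simp
   also have "... = ((1/2)^k * 2^k) * 2^k * x^2 - 2 * ((1/2)^k * 2^k) * x + (1/2)^k"
    by (simp add: power2_eq_square algebra_simps)
   also have "(1/2)^k * 2^k = (1::real)" by (simp add: power_mult_distrib[symmetric])
   finally have "2 * x \<le> 2^k * x^2 + (1/2)^k" by simp
   moreover have "x \<ge> 0" by (simp add: x_def)
   ultimately have "x \<le> 2^k * x^2 + (1/2)^k" by linarith
   thus "norm (Y (r (Suc k)) w - Y (r k) w) \<le> (1/2)^k + (D k w)^2"
    by (simp add: D_def power_mult_distrib x_def)
  qed
  hence "convergent (\<lambda>n. \<Sum>k<n. Y (r (Suc k)) w - Y (r k) w)"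
   by (simp add: summable_iff_convergent)
  hence "convergent (\<lambda>n. Y (r n) w - Y (r 0) w)"
   using sum_lessThan_telescope[of "\<lambda>k. Y (r k) w"] by simp
  hence "convergent (\<lambda>n. (Y (r n) w - Y (r 0) w) + Y (r 0) w)"
   by (rule convergent_add) (simp add: convergent_const)
  thus ?case by simp
 qed
 define Z where "Z w = lim (\<lambda>k. Y (r k) w)" for w
 have Zm: "Z \<in> borel_measurable F" unfolding Z_def using sub(1) by measurable
 have AE: "AE w in M. (\<lambda>k. Y (r k) w) \<longlonglongrightarrow> Z w"
  using conv by eventually_elim (simp add: Z_def convergent_LIMSEQ_iff)
 show ?thesis using L2_Cauchy_AE_tendsto[OF Y Cauchy sub(2)[OF Zm] rmono AE] Zm rmono AE by blast
qed

lemma L2_tendsto_Cauchy: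
 assumes "L2_tendsto M Y Z" "e > 0"
 shows "\<exists>N. \<forall>j\<ge>N. \<forall>k\<ge>N. (LINT w|M. (Y j w - Y k w)^2) \<le> e"
proof -
 note a = L2_tendstoD[OF assms(1)]
 from order_tendstoD(2)[OF a(3), of "e / 4"] assms(2)
 obtain N where N: "\<And>k. k \<ge> N ==> (LINT w|M. (Z w - Y k w)^2) < e / 4"
  by (auto simp: eventually_sequentially)
 have "(LINT w|M. (Y j w - Y k w)^2) \<le> e" if "j \<ge> N" "k \<ge> N" for j k
  using integral_square_add_le[OF sqint_diff[OF a(1)[of j] a(2)] sqint_diff[OF a(2) a(1)[of k]]]
   N[OF that(1)] N[OF that(2)] by (simp add: power2_commute)
 thus ?thesis by blast
qed

section \<open>Step functions and the kernel of fractional Brownian motion\<close>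

text \<open>Finitely supported coefficients act linearly on functions of the time; step functions, their scalar
  product and the elementary integrals are all of this form.\<close>

definition lin :: "(real => real) => (real => real) => real" where
 "lin g a = (\<Sum>t\<in>supp a. a t * g t)"

lemma lin_superset: "finite S ==> supp a \<subseteq> S ==> lin g a = (\<Sum>t\<in>S. a t * g t)"
 unfolding lin_def by (rule sum.mono_neutral_left) (auto simp: supp_def)

lemma finite_supp_diff: "finite (supp a) ==> finite (supp b) ==> finite (supp (\<lambda>t. a t - b t))"
 by (rule finite_subset[of _ "supp a \<union> supp b"]) (auto simp: supp_def)

lemma finite_supp_add: "finite (supp a) ==> finite (supp b) ==> finite (supp (\<lambda>t. a t + b t))"
 by (rule finite_subset[of _ "supp a \<union> supp b"]) (auto simp: supp_def)

lemma finite_supp_cmult: "finite (supp a) ==> finite (supp (\<lambda>t. c * a t))"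
 by (rule finite_subset[of _ "supp a"]) (auto simp: supp_def)

lemma lin_add:
 assumes "finite (supp a)" "finite (supp b)" shows "lin g (\<lambda>t. a t + b t) = lin g a + lin g b"
proof -
 have "finite (supp a \<union> supp b)" using assms by simp
 moreover have "supp (\<lambda>t. a t + b t) \<subseteq> supp a \<union> supp b" by (auto simp: supp_def)
 ultimately show ?thesis using assms
  by (simp add: lin_superset[where S="supp a \<union> supp b"] sum.distrib[symmetric] algebra_simps)
qed

lemma lin_cmult: "lin g (\<lambda>t. c * a t) = c * lin g a"
proof (cases "c = 0")
 case False
 hence "supp (\<lambda>t. c * a t) = supp a" by (auto simp: supp_def)
 hence "lin g (\<lambda>t. c * a t) = (\<Sum>t\<in>supp a. c * (a t * g t))" unfolding lin_def by (intro sum.cong) auto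
 also have "... = c * lin g a" unfolding lin_def sum_distrib_left ..
 finally show ?thesis .
qed (simp add: lin_def supp_def)

lemma lin_diff:
 assumes "finite (supp a)" "finite (supp b)" shows "lin g (\<lambda>t. a t - b t) = lin g a - lin g b"
 using lin_add[OF assms(1) finite_supp_cmult[OF assms(2), of "-1"], of g] lin_cmult[of g "-1" b] by simp

lemma lin_zero [simp]: "lin g (\<lambda>t. 0) = 0" by (simp add: lin_def supp_def)

lemma finite_supp_sum: "(\<And>i. i \<in> I ==> finite (supp (a i))) ==> finite (supp (\<lambda>t. \<Sum>i\<in>I. a i t))"
proof (induction I rule: infinite_finite_induct)
 case (insert x F) thus ?case using finite_supp_add[of "a x" "\<lambda>t. \<Sum>i\<in>F. a i t"] by simp
qed (auto simp: supp_def)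

lemma lin_sum:
 assumes "\<And>i. i \<in> I ==> finite (supp (a i))"
 shows "lin g (\<lambda>t. \<Sum>i\<in>I. c i * a i t) = (\<Sum>i\<in>I. c i * lin g (a i))"
 using assms
proof (induction I rule: infinite_finite_induct)
 case (insert x F)
 hence "finite (supp (\<lambda>t. \<Sum>i\<in>F. c i * a i t))" "finite (supp (\<lambda>t. c x * a x t))"
  by (auto intro!: finite_supp_sum finite_supp_cmult)
 with insert show ?case by (simp add: lin_add lin_cmult)
qed auto

lemma step_fun_lin: "step_fun a x = lin (\<lambda>t. indicator {0..t} x) a"
 by (simp add: step_fun_def lin_def)

lemma step_inner_lin: "step_inner H a b = lin (\<lambda>t. lin (\<lambda>s. fbm_cov H t s) b) a"
 by (simp add: step_inner_def lin_def sum_distrib_left mult.assoc)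

definition unit_coeff :: "real => real => real" where
 "unit_coeff s t = (if t = s then 1 else 0)"

lemma supp_unit [simp]: "supp (unit_coeff s) = {s}" by (auto simp: supp_def unit_coeff_def)

lemma lin_unit [simp]: "lin g (unit_coeff s) = g s" unfolding lin_def by (simp add: unit_coeff_def)

text \<open>In the encoding by intervals \<open>[0,t]\<close>, the indicator of a cell is the difference of two units.\<close>

definition node :: "real => nat => nat => real" where "node T N j = T * real j / real N"

definition cells :: "real => nat => (nat => real) => real => real" where
 "cells T N c t = (\<Sum>j<N. c j * (unit_coeff (node T N (Suc j)) t - unit_coeff (node T N j) t))"

lemma finite_supp_cells [simp]: "finite (supp (cells T N c))"
 unfolding cells_def by (intro finite_supp_sum finite_supp_cmult finite_supp_diff) auto

lemma lin_cells: "lin g (cells T N c) = (\<Sum>j<N. c j * (g (node T N (Suc j)) - g (node T N j)))"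
 unfolding cells_def by (subst lin_sum) (auto simp: finite_supp_diff lin_diff)

lemma node_nonneg: "0 \<le> T ==> 0 \<le> node T N j" by (simp add: node_def)

lemma node_le: "0 \<le> T ==> j \<le> N ==> node T N j \<le> T"
 by (cases "N = 0") (auto simp: node_def field_simps mult_left_mono)

lemma node_mono: "0 \<le> T ==> i \<le> j ==> node T N i \<le> node T N j"
 by (auto simp: node_def intro!: divide_right_mono mult_left_mono)

lemma node_0 [simp]: "node T N 0 = 0" by (simp add: node_def)

lemma node_last [simp]: "N > 0 ==> node T N N = T" by (simp add: node_def)

lemma node_Suc: "node T N (Suc j) = node T N j + T / N" by (simp add: node_def field_simps add_divide_distrib)

lemma step_coeffs_diff: "a \<in> step_coeffs T ==> b \<in> step_coeffs T ==> (\<lambda>t. a t - b t) \<in> step_coeffs T"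
proof -
 assume *: "a \<in> step_coeffs T" "b \<in> step_coeffs T"
 have "supp (\<lambda>t. a t - b t) \<subseteq> supp a \<union> supp b" by (auto simp: supp_def)
 thus ?thesis using * finite_supp_diff[of a b] by (auto simp: step_coeffs_def)
qed

lemma step_coeffs_sum:
 assumes "\<And>i. i \<in> I ==> a i \<in> step_coeffs T" shows "(\<lambda>t. \<Sum>i\<in>I. c i * a i t) \<in> step_coeffs T"
proof -
 have "supp (\<lambda>t. \<Sum>i\<in>I. c i * a i t) \<subseteq> {0..T}"
 proof
  fix t assume "t \<in> supp (\<lambda>t. \<Sum>i\<in>I. c i * a i t)"
  then obtain i where "i \<in> I" "c i * a i t \<noteq> 0" by (auto simp: supp_def elim: sum.not_neutral_contains_not_neutral)
  thus "t \<in> {0..T}" using assms[of i] by (auto simp: step_coeffs_def supp_def)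
 qed
 thus ?thesis using assms by (auto simp: step_coeffs_def intro!: finite_supp_sum finite_supp_cmult)
qed

lemma unit_step_coeffs: "0 \<le> t ==> t \<le> T ==> unit_coeff t \<in> step_coeffs T"
 by (simp add: step_coeffs_def)

lemma cells_step_coeffs:
 assumes "0 \<le> T" shows "cells T N c \<in> step_coeffs T"
 unfolding cells_def
 by (intro step_coeffs_sum step_coeffs_diff unit_step_coeffs) (auto simp: assms node_nonneg node_le)

lemma step_fun_diff: "finite (supp a) ==> finite (supp b) ==> step_fun (\<lambda>t. a t - b t) x = step_fun a x - step_fun b x"
 by (simp add: step_fun_lin lin_diff)

lemma step_fun_measurable [measurable]: "step_fun a \<in> borel_measurable borel"
 unfolding step_fun_def[abs_def] by measurable

lemma step_fun_support: "a \<in> step_coeffs T ==> x \<notin> {0..T} ==> step_fun a x = 0"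
 unfolding step_fun_def step_coeffs_def by (rule sum.neutral) (auto simp: indicator_def)

lemma step_fun_cells_eq:
 assumes "0 < T" "j < N" "node T N j < x" "x \<le> node T N (Suc j)"
 shows "step_fun (cells T N c) x = c j"
proof -
 have "step_fun (cells T N c) x = (\<Sum>i<N. c i * (indicator {0..node T N (Suc i)} x - indicator {0..node T N i} x))"
  by (simp add: step_fun_lin lin_cells)
 also have "... = (\<Sum>i<N. if i = j then c j else 0)"
 proof (rule sum.cong)
  fix i assume "i \<in> {..<N}"
  have x0: "x > 0" using assms node_nonneg[of T N j] by simp
  consider "i < j" | "i = j" | "i > j" by linarith
  thus "c i * (indicator {0..node T N (Suc i)} x - indicator {0..node T N i} x) = (if i = j then c j else 0)"
  proof cases
   case 1
   hence "node T N (Suc i) \<le> node T N j" "node T N i \<le> node T N j" using assms by (auto intro: node_mono)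
   thus ?thesis using assms 1 by (auto simp: indicator_def)
  next
   case 2 thus ?thesis using assms x0 by (auto simp: indicator_def)
  next
   case 3
   hence "node T N (Suc j) \<le> node T N i" "node T N (Suc j) \<le> node T N (Suc i)" using assms by (auto intro: node_mono)
   thus ?thesis using assms 3 x0 by (auto simp: indicator_def)
  qed
 qed simp
 also have "... = c j" using assms by simp
 finally show ?thesis .
qed

lemma cell_exists:
 assumes "0 < T" "0 < N" "0 < x" "x \<le> T"
 shows "\<exists>j<N. node T N j < x \<and> x \<le> node T N (Suc j)"
proof -
 define j where "j = nat (\<lceil>x * N / T\<rceil> - 1)"
 have p: "x * N / T > 0" "x * N / T \<le> N" using assms by (auto simp: field_simps)
 hence c: "\<lceil>x * N / T\<rceil> \<ge> 1" "\<lceil>x * N / T\<rceil> \<le> int N" by (auto simp: ceiling_le_iff)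
 have j: "real j = of_int \<lceil>x * N / T\<rceil> - 1" using c(1) by (simp add: j_def)
 hence j': "j < N" using c(2) by linarith
 have "real j < x * N / T" "x * N / T \<le> real (Suc j)" using j by linarith+
 thus ?thesis using assms j' by (intro exI[of _ j]) (auto simp: node_def field_simps)
qed

lemma step_fun_cells_nonneg:
 assumes "0 < T" "0 < N" "\<And>j. j < N ==> c j \<ge> 0" "x \<noteq> 0" shows "step_fun (cells T N c) x \<ge> 0"
proof (cases "0 < x \<and> x \<le> T")
 case True
 then obtain j where "j < N" "node T N j < x" "x \<le> node T N (Suc j)" using cell_exists[of T N x] assms by auto
 thus ?thesis using step_fun_cells_eq[of T j N x c] assms by auto
next
 case False thus ?thesis using assms step_fun_support[OF cells_step_coeffs, of T x N c] by auto
qed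

locale hurst = fixes H :: real assumes H_gt: "1/2 < H" and H_lt: "H < 1"
begin

text \<open>The kernel of the covariance and its first and second primitive.\<close>

definition kern :: "real => real" where "kern x = H * (2 * H - 1) * \<bar>x\<bar> powr (2 * H - 2)"

definition kern1 :: "real => real" where
 "kern1 x = H * (max x 0 powr (2 * H - 1) - max (- x) 0 powr (2 * H - 1))"

definition kern2 :: "real => real" where "kern2 x = \<bar>x\<bar> powr (2 * H) / 2"

lemma kern_nonneg: "0 \<le> kern x" using H_gt by (simp add: kern_def)

lemma kern_measurable [measurable]: "kern \<in> borel_measurable borel" unfolding kern_def[abs_def] by measurable

lemma kern_minus: "kern (- x) = kern x" by (simp add: kern_def)

lemma kern_integral:
 assumes "a \<le> b"
 shows "(kern has_integral (kern1 b - kern1 a)) {a..b}"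
proof (rule fundamental_theorem_of_calculus_interior_strong[of "{0}"])
 show "continuous_on {a..b} kern1" unfolding kern1_def[abs_def]
  using H_gt by (intro continuous_intros continuous_on_powr') auto
 fix x assume "x \<in> {a<..<b} - {0::real}"
 hence "x \<noteq> 0" by simp
 have "(kern1 has_real_derivative kern x) (at x)"
 proof (cases "x > 0")
  case True
  have "((\<lambda>x. H * x powr (2 * H - 1)) has_real_derivative kern x) (at x)"
   using True by (auto intro!: derivative_eq_intros simp: kern_def algebra_simps)
  thus ?thesis
   by (rule has_field_derivative_transform_within_open[of _ _ _ "{0<..}"]) (use True H_gt in \<open>auto simp: kern1_def\<close>)
 next
  case False
  hence "x < 0" using \<open>x \<noteq> 0\<close> by simp
  have "((\<lambda>x. - H * (- x) powr (2 * H - 1)) has_real_derivative kern x) (at x)"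
   using \<open>x < 0\<close> by (auto intro!: derivative_eq_intros simp: kern_def algebra_simps)
  thus ?thesis
   by (rule has_field_derivative_transform_within_open[of _ _ _ "{..<0}"]) (use \<open>x < 0\<close> H_gt in \<open>auto simp: kern1_def\<close>)
 qed
 thus "(kern1 has_vector_derivative kern x) (at x)"
  by (simp add: has_real_derivative_iff_has_vector_derivative)
qed (use assms in auto)

lemma kern1_integral:
 assumes "a \<le> b"
 shows "(kern1 has_integral (kern2 b - kern2 a)) {a..b}"
proof (rule fundamental_theorem_of_calculus_interior_strong[of "{0}"])
 show "continuous_on {a..b} kern2" unfolding kern2_def[abs_def]
  using H_gt by (intro continuous_intros continuous_on_powr') auto
 fix x assume "x \<in> {a<..<b} - {0::real}"
 hence "x \<noteq> 0" by simp
 have "(kern2 has_real_derivative kern1 x) (at x)"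
 proof (cases "x > 0")
  case True
  have "((\<lambda>x. x powr (2 * H) / 2) has_real_derivative kern1 x) (at x)"
   using True H_gt by (auto intro!: derivative_eq_intros simp: kern1_def algebra_simps)
  thus ?thesis
   by (rule has_field_derivative_transform_within_open[of _ _ _ "{0<..}"]) (use True in \<open>auto simp: kern2_def\<close>)
 next
  case False
  hence "x < 0" using \<open>x \<noteq> 0\<close> by simp
  have "((\<lambda>x. (- x) powr (2 * H) / 2) has_real_derivative kern1 x) (at x)"
   using \<open>x < 0\<close> H_gt by (auto intro!: derivative_eq_intros simp: kern1_def algebra_simps)
  thus ?thesis
   by (rule has_field_derivative_transform_within_open[of _ _ _ "{..<0}"]) (use \<open>x < 0\<close> in \<open>auto simp: kern2_def\<close>)
 qed
 thus "(kern2 has_vector_derivative kern1 x) (at x)"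
  by (simp add: has_real_derivative_iff_has_vector_derivative)
qed (use assms in auto)

lemma kern1_mono: "a \<le> b ==> kern1 a \<le> kern1 b"
 using has_integral_nonneg[OF kern_integral[of a b]] kern_nonneg by simp

lemma nn_integral_kern:
 assumes "a \<le> b" shows "(\<integral>\<^sup>+x. ennreal (kern x) * indicator {a..b} x \<partial>lborel) = ennreal (kern1 b - kern1 a)"
 by (rule nn_integral_has_integral_lebesgue'[OF kern_nonneg kern_integral[OF assms]])

lemma nn_integral_kern_diff:
 assumes "a \<le> b"
 shows "(\<integral>\<^sup>+v. ennreal (kern (u - v)) * indicator {a..b} v \<partial>lborel) = ennreal (kern1 (u - a) - kern1 (u - b))"
proof -
 have "(\<integral>\<^sup>+x. ennreal (kern x) * indicator {u-b..u-a} x \<partial>lborel)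
   = (\<integral>\<^sup>+x. ennreal (kern (u + (-1) * x)) * indicator {u-b..u-a} (u + (-1) * x) \<partial>lborel)"
  by (subst nn_integral_real_affine[of _ "-1" u]) auto
 also have "... = (\<integral>\<^sup>+v. ennreal (kern (u - v)) * indicator {a..b} v \<partial>lborel)"
  by (intro nn_integral_cong) (auto simp: indicator_def)
 finally show ?thesis using nn_integral_kern[of "u-b" "u-a"] assms by simp
qed

lemma kern1_diff_integral:
 assumes "0 \<le> t" "0 \<le> s"
 shows "((\<lambda>u. kern1 u - kern1 (u - s)) has_integral fbm_cov H t s) {0..t}"
proof -
 have "((\<lambda>u. kern1 u - kern1 (- s + u)) has_integral ((kern2 t - kern2 0) - (kern2 (t - s) - kern2 (0 - s)))) {0..t}"
  using has_integral_shift_Icc_real[of kern1 "-s" "kern2 (t - s) - kern2 (0 - s)" 0 t] kern1_integral[of "0 - s" "t - s"] assms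
  by (intro has_integral_diff kern1_integral) (auto simp: o_def)
 moreover have "(kern2 t - kern2 0) - (kern2 (t - s) - kern2 (0 - s)) = fbm_cov H t s"
  using assms by (simp add: kern2_def fbm_cov_def field_simps)
 ultimately show ?thesis by simp
qed

text \<open>The three terms of the covariance are the boundary values of the second primitive of the kernel.\<close>

lemma fbm_cov_integral:
 assumes "0 \<le> t" "0 \<le> s"
 shows "(\<integral>\<^sup>+u. (\<integral>\<^sup>+v. ennreal (kern (u - v)) * indicator {0..s} v \<partial>lborel) * indicator {0..t} u \<partial>lborel)
  = ennreal (fbm_cov H t s)"
 using nn_integral_has_integral_lebesgue'[OF _ kern1_diff_integral[OF assms]] kern1_mono assms
 by (simp add: nn_integral_kern_diff)

lemma fbm_cov_nonneg: "0 \<le> t ==> 0 \<le> s ==> 0 \<le> fbm_cov H t s"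
 using has_integral_nonneg[OF kern1_diff_integral[of t s]] kern1_mono by simp

end

section \<open>The norm of the reproducing space\<close>

context hurst begin

lemma habs2_kern: "habs2 H g = (\<integral>\<^sup>+u. (\<integral>\<^sup>+v. ennreal (\<bar>g u\<bar> * \<bar>g v\<bar> * kern (u - v)) \<partial>lborel) \<partial>lborel)"
 unfolding habs2_def kern_def by (simp add: mult_ac)

text \<open>The density over window lengths that is used in \<open>kern_windows\<close>.\<close>

definition wgt :: "real => ennreal" where
 "wgt r = ennreal (H * (2 * H - 1) * (2 - 2 * H) * (3 - 2 * H) * r powr (2 * H - 4)) * indicator {0<..} r"

lemma wgt_measurable [measurable]: "wgt \<in> borel_measurable borel" unfolding wgt_def[abs_def] by measurable

definition win :: "real => real => real => ennreal" where
 "win r w u = (if w \<le> u \<and> u \<le> w + r then 1 else 0)"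

lemma win_measurable [measurable (raw)]:
 assumes [measurable]: "f \<in> borel_measurable N" "g \<in> borel_measurable N" "h \<in> borel_measurable N"
 shows "(\<lambda>x. win (f x) (g x) (h x)) \<in> borel_measurable N"
 unfolding win_def by measurable

lemma layer_integral:
 assumes "d > 0"
 shows "(\<integral>\<^sup>+r. ennreal ((r - d) * r powr (2 * H - 4)) * indicator {d..} r \<partial>lborel)
  = ennreal (d powr (2 * H - 2) / ((2 - 2 * H) * (3 - 2 * H)))"
proof -
 define F where "F r = - (r powr (2 * H - 2)) / (2 - 2 * H) + d * r powr (2 * H - 3) / (3 - 2 * H)" for r
 have "(\<integral>\<^sup>+r. ennreal ((r - d) * r powr (2 * H - 4)) * indicator {d..} r \<partial>lborel) = ennreal (0 - F d)"
 proof (rule nn_integral_FTC_atLeast)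
  show "(\<lambda>r. (r - d) * r powr (2 * H - 4)) \<in> borel_measurable borel" by measurable
  show "(F has_real_derivative (x - d) * x powr (2 * H - 4)) (at x)" if "d \<le> x" for x
  proof -
   have x: "x > 0" using that assms by simp
   have 1: "x powr (2 * H - 3) = x * x powr (2 * H - 4)"
    using x powr_add[of x 1 "2 * H - 4"] by simp
   have "((\<lambda>r. r powr (2 * H - 2)) has_real_derivative (2 * H - 2) * x powr (2 * H - 3)) (at x)"
    "((\<lambda>r. r powr (2 * H - 3)) has_real_derivative (2 * H - 3) * x powr (2 * H - 4)) (at x)"
    using x by (auto intro!: derivative_eq_intros)
   from DERIV_add[OF DERIV_cdivide[OF DERIV_minus[OF this(1)], of "2 - 2 * H"] DERIV_cdivide[OF DERIV_cmult[OF this(2), of d], of "3 - 2 * H"]]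
   have "(F has_real_derivative - ((2 * H - 2) * x powr (2 * H - 3)) / (2 - 2 * H) + d * ((2 * H - 3) * x powr (2 * H - 4)) / (3 - 2 * H)) (at x)"
    by (simp add: F_def[abs_def])
   moreover have e1: "- ((2 * H - 2) * y) / (2 - 2 * H) = y" for y using H_lt by (simp add: divide_simps) (simp add: algebra_simps)
   moreover have e2: "d * ((2 * H - 3) * y) / (3 - 2 * H) = - d * y" for y using H_lt by (simp add: divide_simps) (simp add: algebra_simps)
   ultimately have "(F has_real_derivative x powr (2 * H - 3) + - d * x powr (2 * H - 4)) (at x)" by (simp only: e1 e2)
   thus ?thesis unfolding 1 by (simp add: left_diff_distrib)
  qed
  show "0 \<le> (x - d) * x powr (2 * H - 4)" if "d \<le> x" for x using that by simp
  have "((\<lambda>r. - (r powr (2 * H - 2)) / (2 - 2 * H) + d * r powr (2 * H - 3) / (3 - 2 * H)) \<longlongrightarrow> - 0 / (2 - 2 * H) + d * 0 / (3 - 2 * H)) at_top"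
   using H_lt by (intro tendsto_intros tendsto_neg_powr filterlim_ident) auto
  thus "(F \<longlongrightarrow> 0) at_top" by (simp add: F_def[abs_def])
 qed
 also have "0 - F d = d powr (2 * H - 2) / ((2 - 2 * H) * (3 - 2 * H))"
 proof -
  have "d powr (2 * H - 2) = d * d powr (2 * H - 3)" using assms powr_add[of d 1 "2 * H - 3"] by simp
  thus ?thesis using H_lt by (simp add: F_def divide_simps) (simp add: algebra_simps)
 qed
 finally show ?thesis .
qed

text \<open>The kernel is a mixture of products of window indicators: two points at distance \<open>d\<close> lie in a
  common window of length \<open>r\<close> for a set of windows of measure \<open>(r - d)\<^sup>+\<close>, and \<open>r \<mapsto> r\<^bsup>2H-4\<^esup>\<close> is the
  density that turns this into a multiple of \<open>d\<^bsup>2H-2\<^esup>\<close>.  So the norm \<open>habs2\<close> is a genuine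
  \<open>L\<^sup>2\<close> norm of window averages.\<close>

lemma kern_windows:
 assumes "u \<noteq> v"
 shows "ennreal (kern (u - v)) = (\<integral>\<^sup>+r. wgt r * (\<integral>\<^sup>+w. win r w u * win r w v \<partial>lborel) \<partial>lborel)"
proof -
 define d where "d = \<bar>u - v\<bar>"
 have d: "d > 0" using assms by (simp add: d_def)
 define k where "k = H * (2 * H - 1) * (2 - 2 * H) * (3 - 2 * H)"
 have k: "k \<ge> 0" using H_gt H_lt by (simp add: k_def)
 have "(\<integral>\<^sup>+w. win r w u * win r w v \<partial>lborel) = ennreal (r - d)" for r
 proof -
  have "(\<integral>\<^sup>+w. win r w u * win r w v \<partial>lborel) = (\<integral>\<^sup>+w. indicator {max u v - r..min u v} w \<partial>lborel)"
   by (intro nn_integral_cong) (auto simp: win_def indicator_def)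
  also have "... = ennreal (r - d)"
  proof (cases "r \<ge> d")
   case True thus ?thesis by (simp add: d_def abs_if max_def min_def split: if_splits)
  next
   case False
   hence "max u v - r > min u v" by (auto simp: d_def abs_if max_def min_def split: if_splits)
   thus ?thesis using False by (simp add: ennreal_neg)
  qed
  finally show ?thesis .
 qed
 hence "(\<integral>\<^sup>+r. wgt r * (\<integral>\<^sup>+w. win r w u * win r w v \<partial>lborel) \<partial>lborel)
   = (\<integral>\<^sup>+r. ennreal k * (ennreal ((r - d) * r powr (2 * H - 4)) * indicator {d..} r) \<partial>lborel)"
 proof (intro nn_integral_cong, goal_cases)
  case (1 r)
  show ?case
  proof (cases "r \<ge> d")
   case True
   have "wgt r = ennreal (k * r powr (2 * H - 4))" using True d by (simp add: wgt_def k_def)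
   thus ?thesis using 1 True d k by (simp add: ennreal_mult'[symmetric] mult_ac)
  qed (use 1 in \<open>simp add: ennreal_neg\<close>)
 qed
 also have "... = ennreal k * ennreal (d powr (2 * H - 2) / ((2 - 2 * H) * (3 - 2 * H)))"
  by (subst nn_integral_cmult) (simp_all add: layer_integral[OF d])
 also have "... = ennreal (k * (d powr (2 * H - 2) / ((2 - 2 * H) * (3 - 2 * H))))"
  using k by (simp add: ennreal_mult'[symmetric])
 also have "k * (d powr (2 * H - 2) / ((2 - 2 * H) * (3 - 2 * H))) = kern (u - v)"
  using H_lt by (simp add: k_def kern_def d_def)
 finally show ?thesis ..
qed

text \<open>As a mixture of squares of window averages of \<open>\<bar>g\<bar>\<close>, the form \<open>habs2\<close> inherits \<open>(a + b)\<^sup>2 \<le> 2 a\<^sup>2 + 2 b\<^sup>2\<close>.\<close>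

lemma habs2_windows:
 assumes [measurable]: "g \<in> borel_measurable borel"
 shows "habs2 H g = (\<integral>\<^sup>+r. (\<integral>\<^sup>+w. wgt r * (\<integral>\<^sup>+u. ennreal \<bar>g u\<bar> * win r w u \<partial>lborel)^2 \<partial>lborel) \<partial>lborel)"
proof -
 define G where "G u v r w = ennreal \<bar>g u\<bar> * ennreal \<bar>g v\<bar> * (wgt r * (win r w u * win r w v))" for u v r w
 have "habs2 H g = (\<integral>\<^sup>+u. (\<integral>\<^sup>+v. (\<integral>\<^sup>+r. (\<integral>\<^sup>+w. G u v r w \<partial>lborel) \<partial>lborel) \<partial>lborel) \<partial>lborel)"
  unfolding habs2_kern
 proof (rule nn_integral_cong, rule nn_integral_cong_AE)
  fix u :: real
  have "AE v in lborel. v \<noteq> u" by (rule AE_lborel_singleton)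
  thus "AE v in lborel. ennreal (\<bar>g u\<bar> * \<bar>g v\<bar> * kern (u - v)) = (\<integral>\<^sup>+r. (\<integral>\<^sup>+w. G u v r w \<partial>lborel) \<partial>lborel)"
  proof eventually_elim
   case (elim v)
   have "(\<integral>\<^sup>+r. (\<integral>\<^sup>+w. G u v r w \<partial>lborel) \<partial>lborel) = ennreal \<bar>g u\<bar> * ennreal \<bar>g v\<bar> * ennreal (kern (u - v))"
    unfolding G_def kern_windows[OF elim[symmetric]] by (simp add: nn_integral_cmult)
   thus ?case using kern_nonneg by (simp add: ennreal_mult')
  qed
 qed
 also have "... = (\<integral>\<^sup>+u. (\<integral>\<^sup>+r. (\<integral>\<^sup>+v. (\<integral>\<^sup>+w. G u v r w \<partial>lborel) \<partial>lborel) \<partial>lborel) \<partial>lborel)"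
  unfolding G_def by (intro nn_integral_cong lborel_pair.Fubini') measurable
 also have "... = (\<integral>\<^sup>+r. (\<integral>\<^sup>+u. (\<integral>\<^sup>+v. (\<integral>\<^sup>+w. G u v r w \<partial>lborel) \<partial>lborel) \<partial>lborel) \<partial>lborel)"
  unfolding G_def by (intro lborel_pair.Fubini') measurable
 also have "... = (\<integral>\<^sup>+r. (\<integral>\<^sup>+u. (\<integral>\<^sup>+w. (\<integral>\<^sup>+v. G u v r w \<partial>lborel) \<partial>lborel) \<partial>lborel) \<partial>lborel)"
  unfolding G_def by (intro nn_integral_cong lborel_pair.Fubini') measurable
 also have "... = (\<integral>\<^sup>+r. (\<integral>\<^sup>+w. (\<integral>\<^sup>+u. (\<integral>\<^sup>+v. G u v r w \<partial>lborel) \<partial>lborel) \<partial>lborel) \<partial>lborel)"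
  unfolding G_def by (intro nn_integral_cong lborel_pair.Fubini') measurable
 also have "... = (\<integral>\<^sup>+r. (\<integral>\<^sup>+w. wgt r * (\<integral>\<^sup>+u. ennreal \<bar>g u\<bar> * win r w u \<partial>lborel)^2 \<partial>lborel) \<partial>lborel)"
 proof (intro nn_integral_cong)
  fix r w :: real
  define I where "I = (\<integral>\<^sup>+v. ennreal \<bar>g v\<bar> * win r w v \<partial>lborel)"
  have "(\<integral>\<^sup>+u. (\<integral>\<^sup>+v. G u v r w \<partial>lborel) \<partial>lborel)
   = (\<integral>\<^sup>+u. (\<integral>\<^sup>+v. (wgt r * (ennreal \<bar>g u\<bar> * win r w u)) * (ennreal \<bar>g v\<bar> * win r w v) \<partial>lborel) \<partial>lborel)"
   unfolding G_def by (simp add: mult_ac)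
  also have "... = (\<integral>\<^sup>+u. (wgt r * I) * (ennreal \<bar>g u\<bar> * win r w u) \<partial>lborel)"
   by (subst nn_integral_cmult) (auto simp: I_def mult_ac)
  also have "... = (wgt r * I) * I" unfolding I_def by (subst nn_integral_cmult) auto
  finally show "(\<integral>\<^sup>+u. (\<integral>\<^sup>+v. G u v r w \<partial>lborel) \<partial>lborel) = wgt r * (\<integral>\<^sup>+u. ennreal \<bar>g u\<bar> * win r w u \<partial>lborel)^2"
   by (simp add: I_def power2_eq_square mult.assoc)
 qed
 finally show ?thesis .
qed

lemma ennreal_square_sum_le: "(a + b)^2 \<le> 2 * a^2 + 2 * (b::ennreal)^2"
proof (cases a; cases b)
 fix x y :: real assume "a = ennreal x" "0 \<le> x" "b = ennreal y" "0 \<le> y"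
 moreover have "ennreal ((x + y)^2) \<le> ennreal (2 * x^2 + 2 * y^2)" by (intro ennreal_leI square_sum_le)
 moreover have "(ennreal x + ennreal y)^2 = ennreal ((x + y)^2)" if "0 \<le> x" "0 \<le> y"
  using that by (simp add: ennreal_plus[symmetric] ennreal_power del: ennreal_plus)
 moreover have "2 * (ennreal x)^2 + 2 * (ennreal y)^2 = ennreal (2 * x^2 + 2 * y^2)" if "0 \<le> x" "0 \<le> y"
  using that by (simp add: ennreal_power ennreal_mult)
 ultimately show ?thesis by simp
qed (auto simp: power2_eq_square ennreal_top_mult ennreal_mult_top)

lemma habs2_add_le:
 assumes [measurable]: "f \<in> borel_measurable borel" "g \<in> borel_measurable borel"
 shows "habs2 H (\<lambda>x. f x + g x) \<le> 2 * habs2 H f + 2 * habs2 H g"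
proof -
 define I where "I f r w = (\<integral>\<^sup>+u. ennreal \<bar>f u\<bar> * win r w u \<partial>lborel)" for f :: "real => real" and r w
 define A where "A f r = (\<integral>\<^sup>+w. wgt r * (I f r w)^2 \<partial>lborel)" for f r
 have [measurable]: "(\<lambda>w. I h r w) \<in> borel_measurable borel" "A h \<in> borel_measurable borel"
  if [measurable]: "h \<in> borel_measurable borel" for h r
  unfolding I_def A_def[abs_def] by measurable
 have "habs2 H (\<lambda>x. f x + g x) = (\<integral>\<^sup>+r. (\<integral>\<^sup>+w. wgt r * (I (\<lambda>x. f x + g x) r w)^2 \<partial>lborel) \<partial>lborel)"
  unfolding I_def by (rule habs2_windows) measurable
 also have "... \<le> (\<integral>\<^sup>+r. (\<integral>\<^sup>+w. 2 * (wgt r * (I f r w)^2) + 2 * (wgt r * (I g r w)^2) \<partial>lborel) \<partial>lborel)"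
 proof (intro nn_integral_mono)
  fix r w
  have "I (\<lambda>x. f x + g x) r w \<le> (\<integral>\<^sup>+u. ennreal \<bar>f u\<bar> * win r w u + ennreal \<bar>g u\<bar> * win r w u \<partial>lborel)"
   unfolding I_def
  proof (intro nn_integral_mono)
   fix u
   have "ennreal \<bar>f u + g u\<bar> \<le> ennreal \<bar>f u\<bar> + ennreal \<bar>g u\<bar>"
    using ennreal_leI[OF abs_triangle_ineq[of "f u" "g u"]] by simp
   from mult_right_mono[OF this] show "ennreal \<bar>f u + g u\<bar> * win r w u \<le> ennreal \<bar>f u\<bar> * win r w u + ennreal \<bar>g u\<bar> * win r w u"
    by (simp add: distrib_right)
  qed
  also have "... = I f r w + I g r w" unfolding I_def by (rule nn_integral_add) measurable
  finally have "(I (\<lambda>x. f x + g x) r w)^2 \<le> (I f r w + I g r w)^2" by (rule power_mono) simp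
  also have "... \<le> 2 * (I f r w)^2 + 2 * (I g r w)^2" by (rule ennreal_square_sum_le)
  finally have "wgt r * (I (\<lambda>x. f x + g x) r w)^2 \<le> wgt r * (2 * (I f r w)^2 + 2 * (I g r w)^2)" by (rule mult_left_mono) simp
  thus "wgt r * (I (\<lambda>x. f x + g x) r w)^2 \<le> 2 * (wgt r * (I f r w)^2) + 2 * (wgt r * (I g r w)^2)"
   by (simp add: distrib_left mult_ac)
 qed
 also have "... = (\<integral>\<^sup>+r. 2 * A f r + 2 * A g r \<partial>lborel)"
  unfolding A_def by (intro nn_integral_cong) (simp add: nn_integral_add nn_integral_cmult)
 also have "... = 2 * (\<integral>\<^sup>+r. A f r \<partial>lborel) + 2 * (\<integral>\<^sup>+r. A g r \<partial>lborel)"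
  by (simp add: nn_integral_add nn_integral_cmult)
 also have "... = 2 * habs2 H f + 2 * habs2 H g"
  unfolding A_def I_def by (simp add: habs2_windows)
 finally show ?thesis .
qed

lemma habs2_minus: "habs2 H (\<lambda>x. - g x) = habs2 H g" by (simp add: habs2_def)

lemma habs2_mono: "(\<And>x. \<bar>f x\<bar> \<le> \<bar>g x\<bar>) ==> habs2 H f \<le> habs2 H g"
 unfolding habs2_kern by (intro nn_integral_mono ennreal_leI mult_right_mono mult_mono kern_nonneg) auto

lemma habs2_diff_le:
 assumes [measurable]: "f \<in> borel_measurable borel" "g \<in> borel_measurable borel"
 shows "habs2 H (\<lambda>x. f x - g x) \<le> 2 * habs2 H f + 2 * habs2 H g"
 using habs2_add_le[of f "\<lambda>x. - g x"] by (simp add: habs2_minus)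

text \<open>Schur's test: the kernel integrates over \<open>[0,T]\<close> to at most \<open>2 kern1 T\<close>, uniformly in the other variable.\<close>

lemma habs2_le_L2:
 assumes [measurable]: "g \<in> borel_measurable borel" and supp: "\<And>x. x \<notin> {0..T} ==> g x = 0" and T: "0 \<le> T"
 shows "habs2 H g \<le> ennreal (2 * kern1 T) * (\<integral>\<^sup>+x. ennreal ((g x)^2) \<partial>lborel)"
proof -
 define J where "J u v = ennreal ((g u)^2) * (ennreal (kern (u - v)) * indicator {0..T} v)" for u v
 have [measurable]: "(\<lambda>(u, v). J u v) \<in> borel_measurable (lborel \<Otimes>\<^sub>M lborel)" unfolding J_def by measurable
 have "habs2 H g \<le> (\<integral>\<^sup>+u. (\<integral>\<^sup>+v. (J u v + J v u) / 2 \<partial>lborel) \<partial>lborel)"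
  unfolding habs2_kern
 proof (intro nn_integral_mono)
  fix u v
  show "ennreal (\<bar>g u\<bar> * \<bar>g v\<bar> * kern (u - v)) \<le> (J u v + J v u) / 2"
  proof (cases "u \<in> {0..T} \<and> v \<in> {0..T}")
   case True
   have "0 \<le> (\<bar>g u\<bar> - \<bar>g v\<bar>)^2" by simp
   hence "\<bar>g u\<bar> * \<bar>g v\<bar> \<le> ((g u)^2 + (g v)^2) / 2" by (simp add: power2_diff)
   hence "\<bar>g u\<bar> * \<bar>g v\<bar> * kern (u - v) \<le> ((g u)^2 * kern (u - v) + (g v)^2 * kern (v - u)) / 2"
    using mult_right_mono[OF _ kern_nonneg[of "u - v"]] kern_minus[of "u - v"] by (fastforce simp: field_simps)
   hence "ennreal (\<bar>g u\<bar> * \<bar>g v\<bar> * kern (u - v)) \<le> ennreal (((g u)^2 * kern (u - v) + (g v)^2 * kern (v - u)) / 2)"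
    by (rule ennreal_leI)
   also have "... = (J u v + J v u) / 2"
    using True kern_nonneg by (simp add: J_def divide_ennreal[symmetric] ennreal_mult')
   finally show ?thesis .
  qed (use supp in auto)
 qed
 also have "... = ((\<integral>\<^sup>+u. (\<integral>\<^sup>+v. J u v \<partial>lborel) \<partial>lborel) + (\<integral>\<^sup>+u. (\<integral>\<^sup>+v. J v u \<partial>lborel) \<partial>lborel)) / 2"
  by (simp add: nn_integral_divide nn_integral_add)
 also have "(\<integral>\<^sup>+u. (\<integral>\<^sup>+v. J v u \<partial>lborel) \<partial>lborel) = (\<integral>\<^sup>+u. (\<integral>\<^sup>+v. J u v \<partial>lborel) \<partial>lborel)"
  by (rule lborel_pair.Fubini') measurable
 also have "(X + X) / 2 = X" for X :: ennreal
 proof (cases X)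
  case (real x)
  hence "(X + X) / 2 = ennreal (2 * x) / ennreal 2" by (simp add: ennreal_plus[symmetric] del: ennreal_plus)
  also have "... = X" using real by (subst divide_ennreal) auto
  finally show ?thesis .
 qed (simp add: ennreal_top_divide)
 also have "(\<integral>\<^sup>+u. (\<integral>\<^sup>+v. J u v \<partial>lborel) \<partial>lborel) \<le> (\<integral>\<^sup>+u. ennreal (2 * kern1 T) * ennreal ((g u)^2) \<partial>lborel)"
 proof (intro nn_integral_mono)
  fix u
  have "(\<integral>\<^sup>+v. J u v \<partial>lborel) = ennreal ((g u)^2) * ennreal (kern1 u - kern1 (u - T))"
   unfolding J_def by (simp add: nn_integral_cmult nn_integral_kern_diff[OF T, of u])
  also have "... \<le> ennreal (2 * kern1 T) * ennreal ((g u)^2)"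
  proof (cases "u \<in> {0..T}")
   case True
   have "kern1 (u - T) = - kern1 (T - u)" by (simp add: kern1_def algebra_simps)
   hence "kern1 u - kern1 (u - T) \<le> 2 * kern1 T" using kern1_mono[of u T] kern1_mono[of "T - u" T] True by auto
   hence "ennreal (kern1 u - kern1 (u - T)) \<le> ennreal (2 * kern1 T)" by (rule ennreal_leI)
   thus ?thesis by (metis mult.commute mult_left_mono zero_le)
  qed (simp add: supp)
  finally show "(\<integral>\<^sup>+v. J u v \<partial>lborel) \<le> ennreal (2 * kern1 T) * ennreal ((g u)^2)" .
 qed
 also have "... = ennreal (2 * kern1 T) * (\<integral>\<^sup>+x. ennreal ((g x)^2) \<partial>lborel)" by (rule nn_integral_cmult) measurable
 finally show ?thesis .
qed

lemma nn_integral_kern_indicator: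
 assumes "0 \<le> t" "0 \<le> s"
 shows "(\<integral>\<^sup>+u. \<integral>\<^sup>+v. ennreal (indicator {0..t} u * indicator {0..s} v * kern (u - v)) \<partial>lborel \<partial>lborel) = ennreal (fbm_cov H t s)"
 unfolding fbm_cov_integral[OF assms, symmetric]
proof (rule nn_integral_cong)
 fix u :: real
 show "(\<integral>\<^sup>+v. ennreal (indicator {0..t} u * indicator {0..s} v * kern (u - v)) \<partial>lborel)
  = (\<integral>\<^sup>+v. ennreal (kern (u - v)) * indicator {0..s} v \<partial>lborel) * indicator {0..t} u"
 proof (cases "u \<in> {0..t}")
  case True
  hence "(\<integral>\<^sup>+v. ennreal (indicator {0..t} u * indicator {0..s} v * kern (u - v)) \<partial>lborel)
   = (\<integral>\<^sup>+v. ennreal (kern (u - v)) * indicator {0..s} v \<partial>lborel)"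
   by (intro nn_integral_cong) (auto simp: indicator_def)
  thus ?thesis using True by simp
 qed simp
qed

lemma kern_indicator_integral:
 assumes "0 \<le> t" "0 \<le> s"
 shows "has_bochner_integral (lborel \<Otimes>\<^sub>M lborel)
  (\<lambda>p. indicator {0..t} (fst p) * indicator {0..s} (snd p) * kern (fst p - snd p)) (fbm_cov H t s)"
proof (rule has_bochner_integral_nn_integral)
 show "(\<integral>\<^sup>+p. ennreal (indicator {0..t} (fst p) * indicator {0..s} (snd p) * kern (fst p - snd p)) \<partial>(lborel \<Otimes>\<^sub>M lborel)) = ennreal (fbm_cov H t s)"
  unfolding nn_integral_kern_indicator[OF assms, symmetric] by (subst lborel.nn_integral_fst[symmetric]) simp_all
qed (auto simp: kern_nonneg fbm_cov_nonneg[OF assms])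

lemma step_inner_integral:
 assumes "a \<in> step_coeffs T" "b \<in> step_coeffs T'"
 shows "has_bochner_integral (lborel \<Otimes>\<^sub>M lborel)
  (\<lambda>p. step_fun a (fst p) * step_fun b (snd p) * kern (fst p - snd p)) (step_inner H a b)"
proof -
 have "has_bochner_integral (lborel \<Otimes>\<^sub>M lborel)
  (\<lambda>p. \<Sum>t\<in>supp a. \<Sum>s\<in>supp b. a t * b s * (indicator {0..t} (fst p) * indicator {0..s} (snd p) * kern (fst p - snd p)))
  (\<Sum>t\<in>supp a. \<Sum>s\<in>supp b. a t * b s * fbm_cov H t s)"
  using assms by (intro has_bochner_integral_sum has_bochner_integral_mult_right kern_indicator_integral) (auto simp: step_coeffs_def)
 moreover have "step_fun a x * step_fun b y * z = (\<Sum>t\<in>supp a. \<Sum>s\<in>supp b. a t * b s * (indicator {0..t} x * indicator {0..s} y * z))" for x y z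
 proof -
  have "step_fun a x * step_fun b y = (\<Sum>t\<in>supp a. \<Sum>s\<in>supp b. (a t * indicator {0..t} x) * (b s * indicator {0..s} y))"
   unfolding step_fun_def by (rule sum_product)
  thus ?thesis by (simp only: sum_distrib_right) (intro sum.cong refl, simp only: mult_ac)
 qed
 ultimately show ?thesis by (simp add: step_inner_def)
qed

lemma step_inner_le_habs2:
 assumes "a \<in> step_coeffs T"
 shows "ennreal (step_inner H a a) \<le> habs2 H (step_fun a)"
proof -
 note * = step_inner_integral[OF assms assms]
 have "ennreal (step_inner H a a) \<le> ennreal (norm (LINT p|(lborel \<Otimes>\<^sub>M lborel). step_fun a (fst p) * step_fun a (snd p) * kern (fst p - snd p)))"
  using * by (simp add: has_bochner_integral_iff ennreal_leI)
 also have "... \<le> (\<integral>\<^sup>+p. ennreal (norm (step_fun a (fst p) * step_fun a (snd p) * kern (fst p - snd p))) \<partial>(lborel \<Otimes>\<^sub>M lborel))"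
  using * by (intro integral_norm_bound_ennreal) (simp add: has_bochner_integral_iff)
 also have "... = habs2 H (step_fun a)"
  unfolding habs2_kern by (subst lborel.nn_integral_fst[symmetric]) (auto simp: abs_mult kern_nonneg)
 finally show ?thesis .
qed

text \<open>The positivity of the kernel, which makes the covariances of the process nonnegative.\<close>

lemma step_inner_nonneg_of_nonneg:
 assumes "a \<in> step_coeffs T" "b \<in> step_coeffs T'" "\<And>x. x \<noteq> 0 ==> step_fun a x \<ge> 0" "\<And>x. x \<noteq> 0 ==> step_fun b x \<ge> 0"
 shows "step_inner H a b \<ge> 0"
proof -
 define f where "f = (\<lambda>p. step_fun a (fst p) * step_fun b (snd p) * kern (fst p - snd p))"
 note * = step_inner_integral[OF assms(1,2), folded f_def]
 have "AE x in lborel. x \<noteq> (0::real)" by (rule AE_lborel_singleton)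
 hence "AE x in lborel. AE y in lborel. f (x, y) \<ge> 0"
 proof eventually_elim
  case (elim x)
  have "AE x in lborel. x \<noteq> (0::real)" by (rule AE_lborel_singleton)
  thus ?case by eventually_elim (use assms elim kern_nonneg in \<open>simp add: f_def\<close>)
 qed
 moreover have [measurable]: "f \<in> borel_measurable (lborel \<Otimes>\<^sub>M lborel)" unfolding f_def by measurable
 hence "{p \<in> space (lborel \<Otimes>\<^sub>M lborel). 0 \<le> f p} \<in> sets (lborel \<Otimes>\<^sub>M lborel)" by (rule borel_measurable_le[OF borel_measurable_const])
 ultimately have "AE p in (lborel \<Otimes>\<^sub>M lborel). f p \<ge> 0" by (intro lborel_pair.AE_pair_measure)
 from integral_nonneg_AE[OF this] * show ?thesis by (simp add: has_bochner_integral_iff)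
qed

lemma habs2_indicator:
 assumes "0 \<le> T" shows "habs2 H (\<lambda>x. indicator {0..T} x) = ennreal (T powr (2 * H))"
proof -
 have "fbm_cov H T T = T powr (2 * H)" by (simp add: fbm_cov_def)
 thus ?thesis unfolding habs2_kern using nn_integral_kern_indicator[OF assms assms] by simp
qed

lemma habs2_cmult: "habs2 H (\<lambda>x. c * g x) = ennreal (c^2) * habs2 H g" if [measurable]: "g \<in> borel_measurable borel"
proof -
 have "ennreal (\<bar>c * g u\<bar> * \<bar>c * g v\<bar> * kern (u - v)) = ennreal (c^2) * ennreal (\<bar>g u\<bar> * \<bar>g v\<bar> * kern (u - v))" for u v
 proof -
  have "\<bar>c * g u\<bar> * \<bar>c * g v\<bar> * kern (u - v) = c^2 * (\<bar>g u\<bar> * \<bar>g v\<bar> * kern (u - v))"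
   by (simp add: abs_mult power2_eq_square mult_ac)
  thus ?thesis by (simp only: ennreal_mult'[OF zero_le_power2])
 qed
 thus ?thesis unfolding habs2_kern by (simp add: nn_integral_cmult)
qed

end

section \<open>Functions as vectors\<close>

context hurst begin

lemma kern1_nonneg: "0 \<le> T ==> 0 \<le> kern1 T"
 using kern1_mono[of 0 T] by (simp add: kern1_def)

lemma step_fun_square_integrable:
 assumes "a \<in> step_coeffs T" shows "integrable lborel (\<lambda>x. (step_fun a x)^2)"
proof -
 have "(\<lambda>x. (step_fun a x)^2) = (\<lambda>x. \<Sum>t\<in>supp a. \<Sum>s\<in>supp a. a t * a s * indicator ({0..t} \<inter> {0..s}) x)"
  unfolding step_fun_def power2_eq_square sum_product by (intro ext sum.cong refl) (auto simp: indicator_def)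
 moreover have "integrable lborel (\<lambda>x. \<Sum>t\<in>supp a. \<Sum>s\<in>supp a. a t * a s * indicator ({0..t} \<inter> {0..s}) x)"
  by (intro Bochner_Integration.integrable_sum integrable_mult_right integrable_real_indicator) (auto simp: emeasure_lborel_Icc_eq)
 ultimately show ?thesis by simp
qed

lemma step_inner_le_L2:
 assumes "a \<in> step_coeffs T" "0 \<le> T"
 shows "step_inner H a a \<le> 2 * kern1 T * (LINT x|lborel. (step_fun a x)^2)"
proof -
 have "ennreal (step_inner H a a) \<le> ennreal (2 * kern1 T) * (\<integral>\<^sup>+x. ennreal ((step_fun a x)^2) \<partial>lborel)"
  using step_inner_le_habs2[OF assms(1)] habs2_le_L2[of "step_fun a" T] step_fun_support[OF assms(1)] assms(2)
  by (meson order_trans step_fun_measurable)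
 also have "(\<integral>\<^sup>+x. ennreal ((step_fun a x)^2) \<partial>lborel) = ennreal (LINT x|lborel. (step_fun a x)^2)"
  by (rule nn_integral_eq_integral[OF step_fun_square_integrable[OF assms(1)]]) simp
 also have "ennreal (2 * kern1 T) * ... = ennreal (2 * kern1 T * (LINT x|lborel. (step_fun a x)^2))"
  using kern1_nonneg[OF assms(2)] by (simp add: ennreal_mult'[symmetric])
 finally show ?thesis using kern1_nonneg[OF assms(2)] by (simp add: ennreal_le_iff)
qed

lemma cells_approx:
 assumes T: "0 < T" "0 < N" and e: "\<And>x y. x \<in> {0..T} ==> y \<in> {0..T} ==> \<bar>x - y\<bar> \<le> T / N ==> \<bar>f x - f y\<bar> \<le> e"
  and x: "0 < x" "x \<le> T"
 shows "\<bar>f x - step_fun (cells T N (\<lambda>j. f (node T N j))) x\<bar> \<le> e"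
proof -
 obtain j where j: "j < N" "node T N j < x" "x \<le> node T N (Suc j)" using cell_exists[OF T x] by auto
 have "\<bar>f x - f (node T N j)\<bar> \<le> e"
  using j T x node_le[of T j N] node_nonneg[of T N j] by (intro e) (auto simp: node_Suc)
 thus ?thesis using step_fun_cells_eq[OF T(1) j, of "\<lambda>j. f (node T N j)"] by simp
qed

lemma habs2_cells_approx:
 assumes T: "0 < T" "0 < N" and e: "\<And>x y. x \<in> {0..T} ==> y \<in> {0..T} ==> \<bar>x - y\<bar> \<le> T / N ==> \<bar>f x - f y\<bar> \<le> e"
  and [measurable]: "(\<lambda>x. indicator {0..T} x * f x) \<in> borel_measurable borel"
 shows "habs2 H (\<lambda>x. indicator {0..T} x * f x - step_fun (cells T N (\<lambda>j. f (node T N j))) x)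
  \<le> ennreal (2 * kern1 T * (T * e^2))"
proof -
 define s where "s = step_fun (cells T N (\<lambda>j. f (node T N j)))"
 have [measurable]: "s \<in> borel_measurable borel" by (simp add: s_def)
 have s0: "s x = 0" if "x \<notin> {0..T}" for x
  unfolding s_def using T that by (intro step_fun_support[OF cells_step_coeffs]) auto
 have "habs2 H (\<lambda>x. indicator {0..T} x * f x - s x) \<le> ennreal (2 * kern1 T) * (\<integral>\<^sup>+x. ennreal ((indicator {0..T} x * f x - s x)^2) \<partial>lborel)"
  using T s0 by (intro habs2_le_L2) auto
 also have "... \<le> ennreal (2 * kern1 T) * (\<integral>\<^sup>+x. ennreal (e^2) * indicator {0..T} x \<partial>lborel)"
 proof (intro mult_left_mono nn_integral_mono_AE)
  have "AE x in lborel. x \<noteq> (0::real)" by (rule AE_lborel_singleton)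
  thus "AE x in lborel. ennreal ((indicator {0..T} x * f x - s x)^2) \<le> ennreal (e^2) * indicator {0..T} x"
  proof eventually_elim
   case (elim x)
   show ?case
   proof (cases "x \<in> {0..T}")
    case True
    hence "\<bar>f x - s x\<bar> \<le> e" unfolding s_def using elim by (intro cells_approx T e) auto
    hence "(f x - s x)^2 \<le> e^2" by (metis abs_le_square_iff abs_of_nonneg abs_ge_zero order_trans)
    thus ?thesis using True by (simp add: ennreal_leI)
   qed (simp add: s0)
  qed
 qed simp
 also have "... = ennreal (2 * kern1 T * (T * e^2))"
  using T kern1_nonneg[of T] by (subst nn_integral_cmult_indicator) (auto simp: ennreal_mult'[symmetric] mult_ac)
 finally show ?thesis by (simp add: s_def)
qed

lemma set_measurable_iff: "set_borel_measurable lborel {0..T} f \<longleftrightarrow> (\<lambda>x. indicator {0..T} x * f x) \<in> borel_measurable borel" for f :: "real => real"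
 by (simp add: set_borel_measurable_def)

text \<open>Step functions close to a common function in the norm of \<open>habs2\<close> are close in the Hilbert space; this yields both the
  Cauchy property and the independence of the representing sequence.\<close>

lemma habs2_diff_of_approx:
 assumes [measurable]: "F \<in> borel_measurable borel"
  and "a \<in> step_coeffs T" "b \<in> step_coeffs T'"
 shows "ennreal (step_inner H (\<lambda>t. a t - b t) (\<lambda>t. a t - b t))
  \<le> 2 * habs2 H (\<lambda>x. F x - step_fun a x) + 2 * habs2 H (\<lambda>x. F x - step_fun b x)"
proof -
 have "a \<in> step_coeffs (max T T')" "b \<in> step_coeffs (max T T')" using assms by (force simp: step_coeffs_def)+
 from step_inner_le_habs2[OF step_coeffs_diff[OF this]]
 have "ennreal (step_inner H (\<lambda>t. a t - b t) (\<lambda>t. a t - b t)) \<le> habs2 H (step_fun (\<lambda>t. a t - b t))" .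
 also have "step_fun (\<lambda>t. a t - b t) = (\<lambda>x. (F x - step_fun b x) - (F x - step_fun a x))"
  using assms by (auto simp: step_fun_diff step_coeffs_def)
 also have "habs2 H ... \<le> 2 * habs2 H (\<lambda>x. F x - step_fun b x) + 2 * habs2 H (\<lambda>x. F x - step_fun a x)"
  by (rule habs2_diff_le) measurable
 finally show ?thesis by (simp add: add.commute)
qed

lemma representsI:
 assumes a: "\<And>k. a k \<in> step_coeffs T" and f: "set_borel_measurable lborel {0..T} f"
  and lim: "(\<lambda>k. habs2 H (\<lambda>x. indicator {0..T} x * f x - step_fun (a k) x)) \<longlonglongrightarrow> 0"
 shows "represents H T a f"
proof -
 have "a \<in> hspace H T" unfolding hspace_def
 proof (intro CollectI conjI allI impI a)
  fix e :: real assume e: "e > 0"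
  hence "\<forall>\<^sub>F k in sequentially. habs2 H (\<lambda>x. indicator {0..T} x * f x - step_fun (a k) x) < ennreal (e / 8)"
   using order_tendstoD(2)[OF lim, of "ennreal (e / 8)"] by simp
  then obtain N where N: "\<And>k. k \<ge> N ==> habs2 H (\<lambda>x. indicator {0..T} x * f x - step_fun (a k) x) < ennreal (e / 8)"
   by (auto simp: eventually_sequentially)
  show "\<exists>N. \<forall>j\<ge>N. \<forall>k\<ge>N. step_inner H (\<lambda>t. a j t - a k t) (\<lambda>t. a j t - a k t) < e"
  proof (intro exI[of _ N] allI impI)
   fix j k assume jk: "N \<le> j" "N \<le> k"
   have "ennreal (step_inner H (\<lambda>t. a j t - a k t) (\<lambda>t. a j t - a k t)) \<le> 2 * ennreal (e / 8) + 2 * ennreal (e / 8)"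
    using habs2_diff_of_approx[OF _ a[of j] a[of k], of "\<lambda>x. indicator {0..T} x * f x"] f N[OF jk(1)] N[OF jk(2)]
    by (simp add: set_measurable_iff) (smt (verit, best) add_mono mult_left_mono order_less_imp_le order_trans zero_le)
   also have "... = ennreal (e / 2)"
    using e by (simp add: ennreal_mult'[symmetric] ennreal_plus[symmetric] ennreal_numeral[symmetric] del: ennreal_plus ennreal_numeral)
   finally show "step_inner H (\<lambda>t. a j t - a k t) (\<lambda>t. a j t - a k t) < e"
    using e by (simp add: ennreal_le_iff)
  qed
 qed
 thus ?thesis using f lim by (simp add: represents_def)
qed

lemma tendsto_ennreal_zeroD:
 assumes "(\<lambda>k. F k) \<longlonglongrightarrow> (0::ennreal)" "\<And>k. ennreal (f k) \<le> F k" "\<And>k. 0 \<le> f k"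
 shows "f \<longlonglongrightarrow> 0"
proof (rule LIMSEQ_I)
 fix r :: real assume r: "0 < r"
 have "\<forall>\<^sub>F k in sequentially. F k < ennreal r" using order_tendstoD(2)[OF assms(1), of "ennreal r"] r by simp
 then obtain N where "\<forall>k\<ge>N. F k < ennreal r" by (auto simp: eventually_sequentially)
 hence "\<forall>k\<ge>N. ennreal (f k) < ennreal r" using assms(2) by (meson order_le_less_trans)
 thus "\<exists>no. \<forall>n\<ge>no. norm (f n - 0) < r" using assms(3) by (intro exI[of _ N]) (auto simp: ennreal_less_iff)
qed

lemma represents_cells:
 assumes T: "0 < T" and f: "continuous_on {0..T} f"
 shows "represents H T (\<lambda>k. cells T (Suc k) (\<lambda>j. f (node T (Suc k) j))) f"
proof (rule representsI)
 show "cells T (Suc k) (\<lambda>j. f (node T (Suc k) j)) \<in> step_coeffs T" for k using T by (simp add: cells_step_coeffs)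
 have m: "(\<lambda>x. indicator {0..T} x * f x) \<in> borel_measurable borel"
  using borel_measurable_continuous_on_indicator[OF _ f] by simp
 thus "set_borel_measurable lborel {0..T} f" by (simp add: set_measurable_iff)
 have uc: "uniformly_continuous_on {0..T} f" using f by (intro compact_uniformly_continuous) auto
 show "(\<lambda>k. habs2 H (\<lambda>x. indicator {0..T} x * f x - step_fun (cells T (Suc k) (\<lambda>j. f (node T (Suc k) j))) x)) \<longlonglongrightarrow> 0"
 proof (rule tendsto_zero_ennreal)
  fix r :: real assume r: "0 < r"
  define e where "e = sqrt (r / (4 * (kern1 T + 1) * T))"
  have k0: "kern1 T \<ge> 0" using kern1_nonneg T by simp
  have e: "e > 0" using r T k0 by (simp add: e_def)
  have "2 * kern1 T * (T * e^2) = 2 * kern1 T * (T * (r / (4 * (kern1 T + 1) * T)))"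
   using r T k0 by (simp add: e_def)
  also have "... = (kern1 T / (kern1 T + 1)) * (r / 2)"
  proof -
   have "2 * k * (T * (r / (4 * K * T))) = (k / K) * (r / 2)" if "K > 0" for k K :: real
    using T that by (simp add: field_simps)
   from this[of "kern1 T + 1" "kern1 T"] k0 show ?thesis by simp
  qed
  also have "... \<le> 1 * (r / 2)" using k0 r by (intro mult_right_mono) (auto simp: field_simps)
  finally have small: "2 * kern1 T * (T * e^2) < r" using r by simp
  obtain d where d: "d > 0" "\<And>x y. x \<in> {0..T} ==> y \<in> {0..T} ==> dist y x < d ==> dist (f y) (f x) < e"
   using uc e unfolding uniformly_continuous_on_def by metis
  have "(\<lambda>k. T * inverse (real (Suc k))) \<longlonglongrightarrow> T * 0" by (intro tendsto_intros LIMSEQ_inverse_real_of_nat)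
  hence "\<forall>\<^sub>F k in sequentially. T * inverse (real (Suc k)) < d" using d(1) by (intro order_tendstoD) auto
  thus "\<forall>\<^sub>F k in sequentially. habs2 H (\<lambda>x. indicator {0..T} x * f x - step_fun (cells T (Suc k) (\<lambda>j. f (node T (Suc k) j))) x) < ennreal r"
  proof eventually_elim
   case (elim k)
   have "habs2 H (\<lambda>x. indicator {0..T} x * f x - step_fun (cells T (Suc k) (\<lambda>j. f (node T (Suc k) j))) x) \<le> ennreal (2 * kern1 T * (T * e^2))"
   proof (rule habs2_cells_approx[OF T _ _ m])
    fix x y assume xy: "x \<in> {0..T}" "y \<in> {0..T}" "\<bar>x - y\<bar> \<le> T / real (Suc k)"
    hence "dist x y < d" using elim by (simp add: dist_real_def divide_inverse)
    from d(2)[OF xy(2,1) this] show "\<bar>f x - f y\<bar> \<le> e" by (simp add: dist_real_def)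
   qed simp
   also have "... < ennreal r" using small r by (simp add: ennreal_less_iff k0 T less_imp_le)
   finally show ?case .
  qed
 qed
qed

text \<open>A bounded measurable function is an almost everywhere limit of continuous functions, which
  may be truncated, and each of these is uniformly close to a step function.\<close>

lemma represents_bounded_exists:
 assumes T: "0 < T" and [measurable]: "f \<in> borel_measurable borel" and C: "\<And>x. \<bar>f x\<bar> \<le> C"
 shows "\<exists>h. represents H T h f"
proof -
 have C0: "C \<ge> 0" using C[of 0] by linarith
 have "f \<in> borel_measurable (lebesgue_on UNIV)" by (intro measurable_restrict_space1 measurable_completion) measurable
 hence "f measurable_on UNIV" by (subst measurable_on_iff_borel_measurable) auto
 then obtain N g where N: "negligible N" and g: "\<And>n. continuous_on UNIV (g n)"
  and lim: "\<And>x. x \<notin> N ==> (\<lambda>n. g n x) \<longlonglongrightarrow> f x" by (auto simp: measurable_on_def)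
 define c where "c n x = max (- C) (min C (g n x))" for n x
 have c: "continuous_on {0..T} (c n)" for n unfolding c_def[abs_def]
  by (intro continuous_intros continuous_on_subset[OF g]) auto
 have cb: "\<bar>c n x\<bar> \<le> C" for n x using C0 by (auto simp: c_def)
 have limc: "(\<lambda>n. c n x) \<longlonglongrightarrow> f x" if "x \<notin> N" for x
 proof -
  have "(\<lambda>n. c n x) \<longlonglongrightarrow> max (- C) (min C (f x))" unfolding c_def by (intro tendsto_intros lim that)
  moreover have "max (- C) (min C (f x)) = f x" using C[of x] by auto
  ultimately show ?thesis by simp
 qed
 have "\<exists>a. a \<in> step_coeffs T \<and> (\<forall>x. 0 < x \<and> x \<le> T \<longrightarrow> \<bar>c n x - step_fun a x\<bar> \<le> inverse (real (Suc n)))" for n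
 proof -
  have "uniformly_continuous_on {0..T} (c n)" using c by (intro compact_uniformly_continuous) auto
  then obtain d where d: "d > 0" "\<And>x y. x \<in> {0..T} ==> y \<in> {0..T} ==> dist y x < d ==> dist (c n y) (c n x) < inverse (real (Suc n))"
   unfolding uniformly_continuous_on_def by (metis inverse_positive_iff_positive of_nat_0_less_iff zero_less_Suc)
  obtain K :: nat where K: "real K > T / d" using reals_Archimedean2 by blast
  hence K0: "K > 0" using T d by (metis divide_pos_pos gr0I less_asym of_nat_0)
  have "\<bar>c n x - step_fun (cells T K (\<lambda>j. c n (node T K j))) x\<bar> \<le> inverse (real (Suc n))" if "0 < x" "x \<le> T" for x
  proof (rule cells_approx[OF T K0 _ that])
   fix x y assume xy: "x \<in> {0..T}" "y \<in> {0..T}" "\<bar>x - y\<bar> \<le> T / real K"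
   have "T / real K < d" using K K0 d T by (simp add: field_simps)
   hence "dist x y < d" using xy by (simp add: dist_real_def)
   from d(2)[OF xy(2,1) this] show "\<bar>c n x - c n y\<bar> \<le> inverse (real (Suc n))" by (simp add: dist_real_def)
  qed
  thus ?thesis using T by (intro exI[of _ "cells T K (\<lambda>j. c n (node T K j))"]) (auto intro: cells_step_coeffs)
 qed
 then obtain a where a: "\<And>n. a n \<in> step_coeffs T"
  and ab: "\<And>n x. 0 < x ==> x \<le> T ==> \<bar>c n x - step_fun (a n) x\<bar> \<le> inverse (real (Suc n))" by metis
 define F where "F x = indicator {0..T} x * f x" for x
 have [measurable]: "F \<in> borel_measurable borel" unfolding F_def by measurable
 have AE: "AE x in lborel. x \<notin> N \<and> x \<noteq> 0"
 proof -
  have "AE x in lebesgue. x \<notin> N" using N by (intro AE_not_in) (simp add: negligible_iff_null_sets)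
  hence "AE x in lborel. x \<notin> N" by (simp add: AE_completion_iff)
  thus ?thesis using AE_lborel_singleton[of 0] by eventually_elim simp
 qed
 have L2: "(\<lambda>n. \<integral>\<^sup>+x. ennreal ((F x - step_fun (a n) x)^2) \<partial>lborel) \<longlonglongrightarrow> (\<integral>\<^sup>+(x::real). 0 \<partial>lborel)"
 proof (rule nn_integral_dominated_convergence[where w="\<lambda>x. ennreal ((2 * C + 1)^2) * indicator {0..T} x"])
  show "(\<integral>\<^sup>+x. ennreal ((2 * C + 1)^2) * indicator {0..T} x \<partial>lborel) < \<infinity>"
   by (simp add: nn_integral_cmult ennreal_mult_less_top emeasure_lborel_Icc_eq)
  fix n
  show "AE x in lborel. ennreal ((F x - step_fun (a n) x)^2) \<le> ennreal ((2 * C + 1)^2) * indicator {0..T} x"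
   using AE
  proof eventually_elim
   case (elim x)
   show ?case
   proof (cases "x \<in> {0..T}")
    case True
    have "inverse (real (Suc n)) \<le> 1" by (simp add: field_simps)
    hence "\<bar>F x - step_fun (a n) x\<bar> \<le> 2 * C + 1"
     using ab[of x n] cb[of n x] C[of x] elim True by (auto simp: F_def)
    hence "(F x - step_fun (a n) x)^2 \<le> (2 * C + 1)^2" using C0 by (simp add: abs_le_square_iff[symmetric])
    thus ?thesis using True by (simp add: ennreal_leI)
   qed (simp add: F_def step_fun_support[OF a])
  qed
 next
  show "AE x in lborel. (\<lambda>n. ennreal ((F x - step_fun (a n) x)^2)) \<longlonglongrightarrow> 0"
   using AE
  proof eventually_elim
   case (elim x)
   show ?case
   proof (cases "x \<in> {0..T}")
    case True
    have "(\<lambda>n. c n x - step_fun (a n) x) \<longlonglongrightarrow> 0"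
     by (rule Lim_null_comparison[OF _ LIMSEQ_inverse_real_of_nat]) (use ab[of x] True elim in auto)
    from tendsto_diff[OF limc[of x] this] have "(\<lambda>n. step_fun (a n) x) \<longlonglongrightarrow> F x" using True elim by (simp add: F_def)
    hence "(\<lambda>n. ennreal ((F x - step_fun (a n) x)^2)) \<longlonglongrightarrow> ennreal ((F x - F x)^2)"
     by (intro tendsto_ennrealI tendsto_intros)
    thus ?thesis by simp
   qed (simp add: F_def step_fun_support[OF a])
  qed
 qed auto
 have "(\<lambda>n. habs2 H (\<lambda>x. F x - step_fun (a n) x)) \<longlonglongrightarrow> 0"
 proof (rule tendsto_sandwich[OF _ _ tendsto_const])
  show "(\<lambda>n. ennreal (2 * kern1 T) * (\<integral>\<^sup>+x. ennreal ((F x - step_fun (a n) x)^2) \<partial>lborel)) \<longlonglongrightarrow> 0"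
   using ennreal_tendsto_cmult[OF _ L2, of "ennreal (2 * kern1 T)"] by simp
  show "\<forall>\<^sub>F n in sequentially. habs2 H (\<lambda>x. F x - step_fun (a n) x) \<le> ennreal (2 * kern1 T) * (\<integral>\<^sup>+x. ennreal ((F x - step_fun (a n) x)^2) \<partial>lborel)"
   using T by (intro always_eventually allI habs2_le_L2) (auto simp: F_def step_fun_support[OF a])
 qed simp
 hence "represents H T a f"
  by (intro representsI a) (auto simp: set_measurable_iff F_def[abs_def])
 thus ?thesis by blast
qed


lemma represents_norm_le:
 assumes "represents H T h f" and C: "\<And>x. \<bar>f x\<bar> \<le> C" and T: "0 \<le> T" and lim: "(\<lambda>k. step_inner H (h k) (h k)) \<longlonglongrightarrow> v"
 shows "v \<le> 2 * C^2 * T powr (2 * H)"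
proof -
 have a: "h k \<in> step_coeffs T" for k using assms(1) by (auto simp: represents_def hspace_def)
 have [measurable]: "(\<lambda>x. indicator {0..T} x * f x) \<in> borel_measurable borel"
  using assms(1) by (simp add: represents_def set_measurable_iff)
 have C0: "C \<ge> 0" using C[of 0] by linarith
 define d where "d k = habs2 H (\<lambda>x. indicator {0..T} x * f x - step_fun (h k) x)" for k
 have d: "d \<longlonglongrightarrow> 0" using assms(1) by (simp add: represents_def d_def[abs_def])
 have "habs2 H (\<lambda>x. indicator {0..T} x * f x) \<le> habs2 H (\<lambda>x. C * indicator {0..T} x)"
  by (rule habs2_mono) (use C C0 in \<open>auto simp: abs_mult indicator_def\<close>)
 also have "... = ennreal (C^2 * T powr (2 * H))"
  by (subst habs2_cmult) (auto simp: habs2_indicator[OF T] ennreal_mult')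
 finally have F: "habs2 H (\<lambda>x. indicator {0..T} x * f x) \<le> ennreal (C^2 * T powr (2 * H))" .
 have le: "ennreal (step_inner H (h k) (h k)) \<le> ennreal (2 * C^2 * T powr (2 * H)) + 2 * d k" for k
 proof -
  have "ennreal (step_inner H (h k) (h k)) \<le> habs2 H (step_fun (h k))" by (rule step_inner_le_habs2[OF a])
  also have "step_fun (h k) = (\<lambda>x. indicator {0..T} x * f x - (indicator {0..T} x * f x - step_fun (h k) x))" by simp
  also have "habs2 H ... \<le> 2 * habs2 H (\<lambda>x. indicator {0..T} x * f x) + 2 * d k"
   unfolding d_def by (rule habs2_diff_le) measurable
  also have "2 * habs2 H (\<lambda>x. indicator {0..T} x * f x) \<le> 2 * ennreal (C^2 * T powr (2 * H))"
   using F by (rule mult_left_mono) simp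
  also have "2 * ennreal (C^2 * T powr (2 * H)) = ennreal (2 * C^2 * T powr (2 * H))"
   by (simp add: ennreal_mult mult.assoc)
  finally show ?thesis by simp
 qed
 have "ennreal v \<le> ennreal (2 * C^2 * T powr (2 * H)) + 2 * 0"
 proof (rule LIMSEQ_le)
  show "(\<lambda>k. ennreal (step_inner H (h k) (h k))) \<longlonglongrightarrow> ennreal v" by (intro tendsto_ennrealI lim)
  show "(\<lambda>k. ennreal (2 * C^2 * T powr (2 * H)) + 2 * d k) \<longlonglongrightarrow> ennreal (2 * C^2 * T powr (2 * H)) + 2 * 0"
   by (intro tendsto_add tendsto_const ennreal_tendsto_cmult d) simp
 qed (use le in auto)
 thus ?thesis by (simp add: ennreal_le_iff)
qed

end

section \<open>The Gaussian space of fractional Brownian motion\<close>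

locale fbm = hurst H + prob_space M for H :: real and M :: "'w measure" +
 fixes B :: "real => 'w => real"
 assumes fBm: "fractional_brownian_motion M H B"
begin

definition coeffs :: "(real => real) set" where "coeffs = {a. finite (supp a) \<and> supp a \<subseteq> {0..}}"

lemma step_coeffs_coeffs: "a \<in> step_coeffs T ==> a \<in> coeffs" by (auto simp: step_coeffs_def coeffs_def)

lemma coeffs_add: "a \<in> coeffs ==> b \<in> coeffs ==> (\<lambda>t. a t + b t) \<in> coeffs"
proof -
 assume *: "a \<in> coeffs" "b \<in> coeffs"
 have "supp (\<lambda>t. a t + b t) \<subseteq> supp a \<union> supp b" by (auto simp: supp_def)
 thus ?thesis using * finite_supp_add[of a b] by (auto simp: coeffs_def)
qed

lemma coeffs_cmult: "a \<in> coeffs ==> (\<lambda>t. c * a t) \<in> coeffs"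
proof -
 assume *: "a \<in> coeffs"
 have "supp (\<lambda>t. c * a t) \<subseteq> supp a" by (auto simp: supp_def)
 thus ?thesis using * finite_supp_cmult[of a c] by (auto simp: coeffs_def)
qed

definition BB :: "(real => real) => 'w => real" where "BB a w = lin (\<lambda>t. B t w) a"

lemma B_centered_gaussian: "finite T ==> T \<subseteq> {0..} ==> centered_gaussian M (\<lambda>w. \<Sum>t\<in>T. c t * B t w)"
 using fBm unfolding fractional_brownian_motion_def by blast

lemma B_sqint: "0 \<le> t ==> sqint M (B t)"
proof -
 assume t: "0 \<le> t"
 have "centered_gaussian M (\<lambda>w. \<Sum>t\<in>{t}. 1 * B t w)" using t by (intro B_centered_gaussian) auto
 hence "B t \<in> borel_measurable M" by (simp add: centered_gaussian_def)
 moreover have "integrable M (\<lambda>w. B t w * B t w)" using fBm t by (simp add: fractional_brownian_motion_def)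
 ultimately show ?thesis by (simp add: sqint_def power2_eq_square)
qed

lemma B_cov: "0 \<le> t ==> 0 \<le> s ==> (LINT w|M. B t w * B s w) = fbm_cov H t s"
 using fBm by (simp add: fractional_brownian_motion_def)

lemma BB_sqint: "a \<in> coeffs ==> sqint M (BB a)"
 unfolding BB_def[abs_def] lin_def by (intro sqint_sum sqint_cmult B_sqint) (auto simp: coeffs_def)

lemma BB_diff: "a \<in> coeffs ==> b \<in> coeffs ==> BB (\<lambda>t. a t - b t) w = BB a w - BB b w"
 by (simp add: BB_def lin_diff coeffs_def)

lemma BB_inner:
 assumes "a \<in> coeffs" "b \<in> coeffs"
 shows "(LINT w|M. BB a w * BB b w) = step_inner H a b"
proof -
 have nn: "t \<in> supp a ==> 0 \<le> t" "s \<in> supp b ==> 0 \<le> s" for t s using assms by (auto simp: coeffs_def)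
 have "(LINT w|M. BB a w * BB b w) = (LINT w|M. (\<Sum>t\<in>supp a. \<Sum>s\<in>supp b. a t * b s * (B t w * B s w)))"
  unfolding BB_def lin_def sum_product by (intro Bochner_Integration.integral_cong refl sum.cong) (simp add: mult_ac)
 also have "... = (\<Sum>t\<in>supp a. \<Sum>s\<in>supp b. a t * b s * (LINT w|M. B t w * B s w))"
 proof -
  have i: "integrable M (\<lambda>w. a t * b s * (B t w * B s w))" if "t \<in> supp a" "s \<in> supp b" for t s
   using that nn by (intro integrable_mult_right sqint_mult B_sqint)
  have "(LINT w|M. (\<Sum>t\<in>supp a. \<Sum>s\<in>supp b. a t * b s * (B t w * B s w)))
   = (\<Sum>t\<in>supp a. LINT w|M. (\<Sum>s\<in>supp b. a t * b s * (B t w * B s w)))"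
   by (intro Bochner_Integration.integral_sum Bochner_Integration.integrable_sum i)
  also have "... = (\<Sum>t\<in>supp a. \<Sum>s\<in>supp b. LINT w|M. a t * b s * (B t w * B s w))"
   by (intro sum.cong refl Bochner_Integration.integral_sum i)
  finally show ?thesis by simp
 qed
 also have "... = step_inner H a b" unfolding step_inner_def by (intro sum.cong refl) (simp add: B_cov nn)
 finally show ?thesis .
qed

lemma BB_norm: "a \<in> coeffs ==> (LINT w|M. (BB a w)^2) = step_inner H a a"
 using BB_inner[of a a] by (simp add: power2_eq_square)

lemma step_inner_self_nonneg: "a \<in> coeffs ==> 0 \<le> step_inner H a a"
 using BB_norm[of a] by (metis integral_nonneg_AE AE_I2 zero_le_power2)

lemma BB_dist: "a \<in> coeffs ==> b \<in> coeffs ==> (LINT w|M. (BB a w - BB b w)^2) = step_inner H (\<lambda>t. a t - b t) (\<lambda>t. a t - b t)"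
 using BB_norm[of "\<lambda>t. a t - b t"] coeffs_add[OF _ coeffs_cmult[of b "-1"], of a] by (simp add: BB_diff)

subsection \<open>The abstract Hilbert space is realised by square integrable variables\<close>

lemma hspace_step_coeffs: "h \<in> hspace H T ==> h k \<in> step_coeffs T" by (simp add: hspace_def)

lemma hspace_coeffs: "h \<in> hspace H T ==> h k \<in> coeffs" using hspace_step_coeffs step_coeffs_coeffs by blast

lemma hspace_iff_Cauchy:
 assumes "\<And>k. h k \<in> step_coeffs T"
 shows "h \<in> hspace H T \<longleftrightarrow> (\<forall>e>0. \<exists>N. \<forall>j\<ge>N. \<forall>k\<ge>N. (LINT w|M. (BB (h j) w - BB (h k) w)^2) \<le> e)" (is "?l \<longleftrightarrow> ?r")
proof
 assume l: ?l
 show ?r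
 proof (intro allI impI)
  fix e :: real assume "e > 0"
  then obtain N where N: "\<And>j k. j \<ge> N ==> k \<ge> N ==> step_inner H (\<lambda>t. h j t - h k t) (\<lambda>t. h j t - h k t) < e"
   using l unfolding hspace_def by blast
  thus "\<exists>N. \<forall>j\<ge>N. \<forall>k\<ge>N. (LINT w|M. (BB (h j) w - BB (h k) w)^2) \<le> e"
   by (intro exI[of _ N]) (simp add: BB_dist step_coeffs_coeffs[OF assms] less_imp_le)
 qed
next
 assume r: ?r
 show ?l unfolding hspace_def
 proof (intro CollectI conjI allI impI assms)
  fix e :: real assume "e > 0"
  then obtain N where "\<forall>j\<ge>N. \<forall>k\<ge>N. (LINT w|M. (BB (h j) w - BB (h k) w)^2) \<le> e / 2"
   using r[rule_format, of "e / 2"] by auto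
  hence N: "\<forall>j\<ge>N. \<forall>k\<ge>N. step_inner H (\<lambda>t. h j t - h k t) (\<lambda>t. h j t - h k t) \<le> e / 2"
   by (simp add: BB_dist step_coeffs_coeffs[OF assms])
  have "e / 2 < e" using \<open>e > 0\<close> by simp
  thus "\<exists>N. \<forall>j\<ge>N. \<forall>k\<ge>N. step_inner H (\<lambda>t. h j t - h k t) (\<lambda>t. h j t - h k t) < e"
   by (intro exI[of _ N] allI impI le_less_trans[OF N[rule_format]])
 qed
qed

lemma L2_tendsto_hspace:
 assumes "\<And>k. h k \<in> step_coeffs T" "L2_tendsto M (\<lambda>k. BB (h k)) Y" shows "h \<in> hspace H T"
 using L2_tendsto_Cauchy[OF assms(2)] by (subst hspace_iff_Cauchy[OF assms(1)]) blast

text \<open>The limit that defines \<open>isonormal\<close> exists by completeness.\<close>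

lemma isonormal_L2:
 assumes "h \<in> hspace H T" shows "L2_tendsto M (\<lambda>k. BB (h k)) (isonormal M B h)"
proof -
 have s: "sqint M (BB (h k))" for k by (intro BB_sqint hspace_coeffs[OF assms])
 have "\<exists>Z. Z \<in> borel_measurable M \<and> L2_tendsto M (\<lambda>k. BB (h k)) Z \<and> (\<exists>r. strict_mono r \<and> (AE w in M. (\<lambda>k. BB (h (r k)) w) \<longlonglongrightarrow> Z w))"
 proof (rule L2_complete[OF s])
  show "\<exists>N. \<forall>j\<ge>N. \<forall>k\<ge>N. (LINT w|M. (BB (h j) w - BB (h k) w)^2) \<le> e" if "0 < e" for e
   using assms that hspace_iff_Cauchy[of h T] hspace_step_coeffs[OF assms] by blast
 qed (use s in auto)
 then obtain Z where Z: "L2_tendsto M (\<lambda>k. BB (h k)) Z" by blast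
 define P where "P Y \<longleftrightarrow> Y \<in> borel_measurable M \<and> integrable M (\<lambda>w. (Y w)^2) \<and>
   (\<lambda>k. LINT w|M. (Y w - (\<Sum>t\<in>supp (h k). h k t * B t w))^2) \<longlonglongrightarrow> 0" for Y
 have P: "P Y \<longleftrightarrow> L2_tendsto M (\<lambda>k. BB (h k)) Y" for Y
  using s unfolding P_def L2_tendsto_def sqint_def BB_def lin_def by auto
 have "P (isonormal M B h)" unfolding isonormal_def P_def[symmetric] by (rule someI[of P Z]) (simp add: P Z)
 thus ?thesis by (simp add: P)
qed

lemma isonormal_sqint: "h \<in> hspace H T ==> sqint M (isonormal M B h)"
 using isonormal_L2 L2_tendstoD(2) by blast

lemma hinner_tendsto:
 assumes "g \<in> hspace H T" "h \<in> hspace H T'"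
 shows "(\<lambda>k. step_inner H (g k) (h k)) \<longlonglongrightarrow> (LINT w|M. isonormal M B g w * isonormal M B h w)"
 using L2_tendsto_mult[OF isonormal_L2[OF assms(1)] isonormal_L2[OF assms(2)]]
 by (simp add: BB_inner hspace_coeffs[OF assms(1)] hspace_coeffs[OF assms(2)])

text \<open>The abstract scalar product becomes an expectation.\<close>

lemma hinner_eq:
 assumes "g \<in> hspace H T" "h \<in> hspace H T'"
 shows "hinner H g h = (LINT w|M. isonormal M B g w * isonormal M B h w)"
 unfolding hinner_def by (rule limI[OF hinner_tendsto[OF assms]])

lemma hspace_sum:
 assumes "\<And>i. i \<in> I ==> \<psi> i \<in> hspace H T"
 shows "(\<lambda>m t. \<Sum>i\<in>I. c i * \<psi> i m t) \<in> hspace H T"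
  and "L2_tendsto M (\<lambda>m. BB (\<lambda>t. \<Sum>i\<in>I. c i * \<psi> i m t)) (\<lambda>w. \<Sum>i\<in>I. c i * isonormal M B (\<psi> i) w)"
proof -
 have eq: "BB (\<lambda>t. \<Sum>i\<in>I. c i * \<psi> i m t) w = (\<Sum>i\<in>I. c i * BB (\<psi> i m) w)" for m w
  unfolding BB_def using hspace_step_coeffs[OF assms] by (intro lin_sum) (auto simp: step_coeffs_def)
 have "L2_tendsto M (\<lambda>m w. \<Sum>i\<in>I. c i * BB (\<psi> i m) w) (\<lambda>w. \<Sum>i\<in>I. c i * isonormal M B (\<psi> i) w)"
  using assms
 proof (induction I rule: infinite_finite_induct)
  case (insert i F)
  have "L2_tendsto M (\<lambda>m w. c i * BB (\<psi> i m) w) (\<lambda>w. c i * isonormal M B (\<psi> i) w)"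
   using insert by (intro L2_tendsto_cmult isonormal_L2) auto
  from L2_tendsto_add[OF this] insert show ?case by simp
 qed (auto intro: L2_tendsto_const)
 thus 2: "L2_tendsto M (\<lambda>m. BB (\<lambda>t. \<Sum>i\<in>I. c i * \<psi> i m t)) (\<lambda>w. \<Sum>i\<in>I. c i * isonormal M B (\<psi> i) w)"
  by (simp add: eq[abs_def])
 show "(\<lambda>m t. \<Sum>i\<in>I. c i * \<psi> i m t) \<in> hspace H T"
  using hspace_step_coeffs[OF assms] by (intro L2_tendsto_hspace[OF _ 2] step_coeffs_sum) auto
qed

lemma hinner_sum:
 assumes \<psi>: "\<And>i. i \<in> I ==> \<psi> i \<in> hspace H T" and h: "h \<in> hspace H T'"
 shows "hinner H (\<lambda>m t. \<Sum>i\<in>I. c i * \<psi> i m t) h = (\<Sum>i\<in>I. c i * hinner H (\<psi> i) h)"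
proof -
 have "(\<lambda>k. LINT w|M. BB (\<lambda>t. \<Sum>i\<in>I. c i * \<psi> i k t) w * BB (h k) w)
   \<longlonglongrightarrow> (LINT w|M. (\<Sum>i\<in>I. c i * isonormal M B (\<psi> i) w) * isonormal M B h w)"
  by (rule L2_tendsto_mult[OF hspace_sum(2)[OF \<psi>] isonormal_L2[OF h]])
 moreover have "(LINT w|M. BB (\<lambda>t. \<Sum>i\<in>I. c i * \<psi> i k t) w * BB (h k) w) = step_inner H (\<lambda>t. \<Sum>i\<in>I. c i * \<psi> i k t) (h k)" for k
  by (intro BB_inner hspace_coeffs[OF h] hspace_coeffs[OF hspace_sum(1)[OF \<psi>]])
 ultimately have "hinner H (\<lambda>m t. \<Sum>i\<in>I. c i * \<psi> i m t) h = (LINT w|M. (\<Sum>i\<in>I. c i * isonormal M B (\<psi> i) w) * isonormal M B h w)"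
  unfolding hinner_def by (intro limI) simp
 also have "... = (LINT w|M. (\<Sum>i\<in>I. c i * (isonormal M B (\<psi> i) w * isonormal M B h w)))"
  by (simp add: sum_distrib_right mult.assoc)
 also have "... = (\<Sum>i\<in>I. c i * hinner H (\<psi> i) h)"
  using isonormal_sqint[OF \<psi>] isonormal_sqint[OF h]
  by (subst Bochner_Integration.integral_sum) (auto intro!: integrable_mult_right sqint_mult sum.cong simp: hinner_eq[OF \<psi> h])
 finally show ?thesis .
qed

lemma isonormal_unique:
 assumes "h \<in> hspace H T" "h' \<in> hspace H T'"
  and lim: "(\<lambda>k. step_inner H (\<lambda>t. h k t - h' k t) (\<lambda>t. h k t - h' k t)) \<longlonglongrightarrow> 0"
 shows "AE w in M. isonormal M B h w = isonormal M B h' w"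
proof -
 have "(\<lambda>k. LINT w|M. (BB (h k) w - BB (h' k) w)^2) \<longlonglongrightarrow> (LINT w|M. (isonormal M B h w - isonormal M B h' w)^2)"
  by (intro L2_tendsto_square L2_tendsto_diff isonormal_L2[OF assms(1)] isonormal_L2[OF assms(2)])
 hence "(LINT w|M. (isonormal M B h w - isonormal M B h' w)^2) = 0"
  using lim LIMSEQ_unique by (auto simp: BB_dist hspace_coeffs[OF assms(1)] hspace_coeffs[OF assms(2)])
 from integral_square_eq_0[OF _ this] isonormal_sqint assms show ?thesis by auto
qed

text \<open>The vector represented by a function is unique, so that the two integrands in \<open>skorohod_unique\<close> may be exchanged.\<close>

lemma hinner_represents_unique:
 assumes h: "represents H T h f" "represents H T h' f" and g: "g \<in> hspace H T'"
 shows "hinner H g h = hinner H g h'"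
proof -
 have hs: "h \<in> hspace H T" "h' \<in> hspace H T" using h by (auto simp: represents_def)
 define F where "F x = indicator {0..T} x * f x" for x
 define D where "D h k = habs2 H (\<lambda>x. F x - step_fun (h k) x)" for h :: "nat => real => real" and k
 have D: "D h \<longlonglongrightarrow> 0" "D h' \<longlonglongrightarrow> 0" using h by (auto simp: represents_def D_def[abs_def] F_def)
 have "(\<lambda>k. step_inner H (\<lambda>t. h k t - h' k t) (\<lambda>t. h k t - h' k t)) \<longlonglongrightarrow> 0"
 proof (rule tendsto_ennreal_zeroD[where F="\<lambda>k. 2 * D h k + 2 * D h' k"])
  show "(\<lambda>k. 2 * D h k + 2 * D h' k) \<longlonglongrightarrow> 0"
   using tendsto_add[OF ennreal_tendsto_cmult[OF _ D(1), of 2] ennreal_tendsto_cmult[OF _ D(2), of 2]] by simp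
  fix k
  have "F \<in> borel_measurable borel" using h(1) unfolding F_def[abs_def] by (simp add: represents_def set_measurable_iff)
  from habs2_diff_of_approx[OF this hspace_step_coeffs[OF hs(1)] hspace_step_coeffs[OF hs(2)], of k k]
  show "ennreal (step_inner H (\<lambda>t. h k t - h' k t) (\<lambda>t. h k t - h' k t)) \<le> 2 * D h k + 2 * D h' k" by (simp add: D_def)
  show "0 \<le> step_inner H (\<lambda>t. h k t - h' k t) (\<lambda>t. h k t - h' k t)"
   by (intro step_inner_self_nonneg step_coeffs_coeffs[of _ T] step_coeffs_diff hspace_step_coeffs hs)
 qed
 from isonormal_unique[OF hs this]
 have "(LINT w|M. isonormal M B g w * isonormal M B h w) = (LINT w|M. isonormal M B g w * isonormal M B h' w)"
  using isonormal_sqint[OF g] isonormal_sqint[OF hs(1)] isonormal_sqint[OF hs(2)]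
  by (intro integral_cong_AE) (auto dest!: sqint_measurable intro!: borel_measurable_times)
 thus ?thesis by (simp add: hinner_eq[OF g hs(1)] hinner_eq[OF g hs(2)])
qed

subsection \<open>Jointly Gaussian variables\<close>

text \<open>The closed linear span of the motion in \<open>L\<^sup>2\<close>; all its elements are centred Gaussian.\<close>

definition gsp :: "('w => real) set" where
 "gsp = {Y. \<exists>a. (\<forall>k. a k \<in> coeffs) \<and> L2_tendsto M (\<lambda>k. BB (a k)) Y}"

lemma gsp_sqint: "Y \<in> gsp ==> sqint M Y" by (auto simp: gsp_def L2_tendsto_def)

lemma gsp_BB: "a \<in> coeffs ==> BB a \<in> gsp"
 unfolding gsp_def by (intro CollectI exI[of _ "\<lambda>_. a"]) (auto intro!: L2_tendsto_const BB_sqint)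

lemma gsp_B: "0 \<le> t ==> B t \<in> gsp"
proof -
 assume "0 \<le> t"
 hence "BB (unit_coeff t) \<in> gsp" by (intro gsp_BB) (simp add: coeffs_def)
 moreover have "BB (unit_coeff t) = B t" by (auto simp: BB_def)
 ultimately show ?thesis by simp
qed

lemma gsp_isonormal: "h \<in> hspace H T ==> isonormal M B h \<in> gsp"
 unfolding gsp_def using isonormal_L2 hspace_coeffs by (intro CollectI exI[of _ h]) blast

lemma gsp_add: "Y \<in> gsp ==> Z \<in> gsp ==> (\<lambda>w. Y w + Z w) \<in> gsp"
proof -
 assume "Y \<in> gsp" "Z \<in> gsp"
 then obtain a b where a: "\<And>k. a k \<in> coeffs" "L2_tendsto M (\<lambda>k. BB (a k)) Y"
  and b: "\<And>k. b k \<in> coeffs" "L2_tendsto M (\<lambda>k. BB (b k)) Z" by (auto simp: gsp_def)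
 have "BB (\<lambda>t. a k t + b k t) = (\<lambda>w. BB (a k) w + BB (b k) w)" for k
  using a(1)[of k] b(1)[of k] by (auto simp: BB_def lin_add coeffs_def)
 hence "L2_tendsto M (\<lambda>k. BB (\<lambda>t. a k t + b k t)) (\<lambda>w. Y w + Z w)"
  using L2_tendsto_add[OF a(2) b(2)] by simp
 thus ?thesis using coeffs_add[OF a(1) b(1)] unfolding gsp_def by (intro CollectI exI[of _ "\<lambda>k t. a k t + b k t"]) auto
qed

lemma gsp_cmult: "Y \<in> gsp ==> (\<lambda>w. c * Y w) \<in> gsp"
proof -
 assume "Y \<in> gsp"
 then obtain a where a: "\<And>k. a k \<in> coeffs" "L2_tendsto M (\<lambda>k. BB (a k)) Y" by (auto simp: gsp_def)
 have "BB (\<lambda>t. c * a k t) = (\<lambda>w. c * BB (a k) w)" for k by (auto simp: BB_def lin_cmult)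
 hence "L2_tendsto M (\<lambda>k. BB (\<lambda>t. c * a k t)) (\<lambda>w. c * Y w)"
  using L2_tendsto_cmult[OF a(2), of c] by simp
 thus ?thesis using coeffs_cmult[OF a(1)] unfolding gsp_def by (intro CollectI exI[of _ "\<lambda>k t. c * a k t"]) auto
qed

lemma gsp_diff: "Y \<in> gsp ==> Z \<in> gsp ==> (\<lambda>w. Y w - Z w) \<in> gsp"
 using gsp_add[OF _ gsp_cmult[of Z "-1"], of Y] by simp

lemma gsp_zero: "(\<lambda>w. 0) \<in> gsp" using gsp_cmult[OF gsp_B[of 0], of 0] by simp

lemma gsp_sum: "(\<And>i. i \<in> I ==> Y i \<in> gsp) ==> (\<lambda>w. \<Sum>i\<in>I. Y i w) \<in> gsp"
 by (induction I rule: infinite_finite_induct) (auto intro: gsp_zero gsp_add)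

lemma char_centered_gaussian:
 assumes "centered_gaussian M Y"
 shows "(CLINT w|M. iexp (Y w)) = exp (- (LINT w|M. (Y w)^2) / 2)"
 using assms unfolding centered_gaussian_def
proof (elim conjE disjE exE)
 assume [measurable]: "Y \<in> borel_measurable M" and 0: "AE w in M. Y w = 0"
 have "(CLINT w|M. iexp (Y w)) = (CLINT w|M. 1)" by (rule integral_cong_AE) (use 0 in auto)
 moreover have "(LINT w|M. (Y w)^2) = (LINT w|M. 0)" by (rule integral_cong_AE) (use 0 in auto)
 ultimately show ?thesis by (simp add: prob_space)
next
 fix \<sigma> assume [measurable]: "Y \<in> borel_measurable M" and s: "\<sigma> > 0" and D: "distributed M lborel Y (\<lambda>x. ennreal (normal_density 0 \<sigma> x))"
 have v: "(LINT w|M. (Y w)^2) = \<sigma>^2"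
  using normal_distributed_variance[OF s D] normal_distributed_expectation[OF s D] by simp
 have "distributed M lborel (\<lambda>x. (Y x - 0) / \<sigma>) std_normal_density"
  using D normal_standard_normal_convert[OF s] by simp
 hence "distr M lborel (\<lambda>x. Y x / \<sigma>) = std_normal_distribution" by (simp add: distributed_def)
 hence d: "distr M borel (\<lambda>x. Y x / \<sigma>) = std_normal_distribution" by (simp cong: distr_cong)
 have "char (distr M borel (\<lambda>x. Y x / \<sigma>)) \<sigma> = (CLINT w|M. iexp (\<sigma> * (Y w / \<sigma>)))"
  unfolding char_def by (subst integral_distr) auto
 also have "... = (CLINT w|M. iexp (Y w))" using s by simp
 finally show ?thesis by (simp add: d char_std_normal_distribution v)
qed

text \<open>Characteristic functions and variances both pass to limits in \<open>L\<^sup>2\<close>.\<close>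

lemma char_gsp:
 assumes "Y \<in> gsp" shows "(CLINT w|M. iexp (Y w)) = exp (- (LINT w|M. (Y w)^2) / 2)"
proof -
 obtain a where a: "\<And>k. a k \<in> coeffs" "L2_tendsto M (\<lambda>k. BB (a k)) Y" using assms by (auto simp: gsp_def)
 have [measurable]: "\<And>k. BB (a k) \<in> borel_measurable M" "Y \<in> borel_measurable M" using a by (auto simp: L2_tendsto_def)
 have "centered_gaussian M (BB (a k))" for k
  unfolding BB_def[abs_def] lin_def using a(1)[of k] by (intro B_centered_gaussian) (auto simp: coeffs_def)
 note c = char_centered_gaussian[OF this]
 have L2: "(\<lambda>k. LINT w|M. (BB (a k) w)^2) \<longlonglongrightarrow> (LINT w|M. (Y w)^2)" by (rule L2_tendsto_square[OF a(2)])
 have 1: "(\<lambda>k. CLINT w|M. iexp (BB (a k) w)) \<longlonglongrightarrow> complex_of_real (exp (- (LINT w|M. (Y w)^2) / 2))"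
  unfolding c by (intro tendsto_of_real tendsto_intros L2) simp
 have "(\<lambda>k. (CLINT w|M. iexp (Y w)) - (CLINT w|M. iexp (BB (a k) w))) \<longlonglongrightarrow> 0"
 proof (rule Lim_null_comparison)
  show "(\<lambda>k. sqrt (LINT w|M. (Y w - BB (a k) w)^2)) \<longlonglongrightarrow> 0"
   by (intro tendsto_sqrt_0 L2_tendstoD(3)[OF a(2)])
  show "\<forall>\<^sub>F k in sequentially. norm ((CLINT w|M. iexp (Y w)) - (CLINT w|M. iexp (BB (a k) w))) \<le> sqrt (LINT w|M. (Y w - BB (a k) w)^2)"
  proof (intro always_eventually allI)
   fix k
   have s: "sqint M (\<lambda>w. Y w - BB (a k) w)" using a by (auto simp: L2_tendsto_def)
   hence s': "sqint M (\<lambda>w. \<bar>Y w - BB (a k) w\<bar>)" by (simp add: sqint_def)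
   have lip: "cmod (iexp x - iexp y) \<le> \<bar>x - y\<bar>" for x y
   proof -
    have "iexp x - iexp y = iexp y * (iexp (x - y) - 1)" by (simp add: algebra_simps exp_diff)
    hence "cmod (iexp x - iexp y) = cmod (iexp (x - y) - 1)" by (simp add: norm_mult)
    also have "... \<le> \<bar>x - y\<bar>" using iexp_approx1[of "x - y" 0] by simp
    finally show ?thesis .
   qed
   have "norm ((CLINT w|M. iexp (Y w)) - (CLINT w|M. iexp (BB (a k) w))) = norm (CLINT w|M. iexp (Y w) - iexp (BB (a k) w))"
    by (subst Bochner_Integration.integral_diff) (auto intro!: integrable_iexp)
   also have "... \<le> (LINT w|M. cmod (iexp (Y w) - iexp (BB (a k) w)))" by (rule integral_norm_bound)
   also have "... \<le> (LINT w|M. \<bar>Y w - BB (a k) w\<bar>)"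
    by (rule integral_mono) (auto intro!: lip sqint_integrable[OF s'] integrable_norm Bochner_Integration.integrable_diff integrable_iexp)
   also have "... \<le> sqrt (LINT w|M. (Y w - BB (a k) w)^2)"
    using cauchy_schwarz_integral[OF s' sqint_const[of 1]] by (intro real_le_rsqrt) (simp add: prob_space)
   finally show "norm ((CLINT w|M. iexp (Y w)) - (CLINT w|M. iexp (BB (a k) w))) \<le> sqrt (LINT w|M. (Y w - BB (a k) w)^2)" .
  qed
 qed
 from tendsto_diff[OF tendsto_const[of "CLINT w|M. iexp (Y w)"] this]
 have "(\<lambda>k. CLINT w|M. iexp (BB (a k) w)) \<longlonglongrightarrow> (CLINT w|M. iexp (Y w))" by simp
 from LIMSEQ_unique[OF this 1] show ?thesis .
qed

lemma gsp_standardize: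
 assumes Y: "Y \<in> gsp" and v: "v = (LINT w|M. (Y w)^2)" "v > 0"
 shows "distr M borel (\<lambda>w. Y w / sqrt v) = std_normal_distribution"
proof (rule Levy_uniqueness)
 have [measurable]: "Y \<in> borel_measurable M" using gsp_sqint[OF Y] by auto
 show "real_distribution (distr M borel (\<lambda>w. Y w / sqrt v))" by (rule real_distribution_distr) measurable
 show "char (distr M borel (\<lambda>w. Y w / sqrt v)) = char std_normal_distribution"
 proof
  fix t
  have "char (distr M borel (\<lambda>w. Y w / sqrt v)) t = (CLINT w|M. iexp (t * (Y w / sqrt v)))"
   unfolding char_def by (subst integral_distr) auto
  also have "... = (CLINT w|M. iexp ((t / sqrt v) * Y w))" by simp
  also have "... = exp (- (LINT w|M. ((t / sqrt v) * Y w)^2) / 2)" by (rule char_gsp[OF gsp_cmult[OF Y]])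
  also have "(LINT w|M. ((t / sqrt v) * Y w)^2) = t^2"
   using v by (simp add: power_mult_distrib power_divide)
  finally show "char (distr M borel (\<lambda>w. Y w / sqrt v)) t = char std_normal_distribution t"
   by (simp add: char_std_normal_distribution)
 qed
qed (rule real_dist_normal_dist)

lemma gsp_moment:
 assumes Y: "Y \<in> gsp"
 shows "integrable M (\<lambda>w. (Y w) ^ (2 * m))"
  and "(LINT w|M. (Y w) ^ (2 * m)) = (fact (2 * m) / (2 ^ m * fact m)) * (LINT w|M. (Y w)^2) ^ m"
proof -
 have [measurable]: "Y \<in> borel_measurable M" using gsp_sqint[OF Y] by auto
 define v where "v = (LINT w|M. (Y w)^2)"
 have "integrable M (\<lambda>w. (Y w) ^ (2 * m)) \<and> (LINT w|M. (Y w) ^ (2 * m)) = (fact (2 * m) / (2 ^ m * fact m)) * v ^ m"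
 proof (cases "v = 0")
  case True
  have AE: "AE w in M. Y w = 0" using integral_square_eq_0[OF gsp_sqint[OF Y]] True by (simp add: v_def)
  have "integrable M (\<lambda>w. (Y w) ^ (2 * m))"
   by (rule integrable_cong_AE_imp[of _ "\<lambda>_. 0 ^ (2 * m)"]) (use AE in auto)
  moreover have "(LINT w|M. (Y w) ^ (2 * m)) = (LINT w|M. 0 ^ (2 * m))" by (rule integral_cong_AE) (use AE in auto)
  ultimately show ?thesis using True by (cases m) (auto simp: prob_space)
 next
  case False
  moreover have "v \<ge> 0" by (simp add: v_def)
  ultimately have v: "v > 0" by simp
  note d = gsp_standardize[OF Y v_def v]
  have "integrable (distr M borel (\<lambda>w. Y w / sqrt v)) (\<lambda>x. x ^ (2 * m))" unfolding d by (rule std_normal_distribution_even_moments)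
  hence "integrable M (\<lambda>w. (Y w / sqrt v) ^ (2 * m))" by (subst (asm) integrable_distr_eq) auto
  hence i: "integrable M (\<lambda>w. v ^ m * (Y w / sqrt v) ^ (2 * m))" by (rule integrable_mult_right)
  have eq: "v ^ m * (Y w / sqrt v) ^ (2 * m) = (Y w) ^ (2 * m)" for w using v by (simp add: power_divide power_mult)
  have "(LINT x|std_normal_distribution. x ^ (2 * m)) = (LINT w|M. (Y w / sqrt v) ^ (2 * m))"
   unfolding d[symmetric] by (subst integral_distr) auto
  hence "(LINT w|M. (Y w / sqrt v) ^ (2 * m)) = fact (2 * m) / (2 ^ m * fact m)"
   by (simp add: std_normal_distribution_even_moments)
  hence "(LINT w|M. v ^ m * (Y w / sqrt v) ^ (2 * m)) = v ^ m * (fact (2 * m) / (2 ^ m * fact m))" by simp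
  thus ?thesis using i unfolding eq by (simp add: mult.commute)
 qed
 thus "integrable M (\<lambda>w. (Y w) ^ (2 * m))"
  "(LINT w|M. (Y w) ^ (2 * m)) = (fact (2 * m) / (2 ^ m * fact m)) * (LINT w|M. (Y w)^2) ^ m" by (auto simp: v_def)
qed

end

section \<open>Uniqueness of joint laws and Gaussian integration by parts\<close>

context prob_space begin

text \<open>Fourier uniqueness for signed densities: the positive and the negative part of \<open>W\<close> have the same mass, and after
  normalisation the laws of \<open>G\<close> under both have the same characteristic function.\<close>

lemma char_zero_imp_indicator_zero_real:
 fixes W G :: "'a => real"
 assumes W: "integrable M W" and [measurable]: "G \<in> borel_measurable M"
  and zero: "\<And>s. (CLINT w|M. W w * iexp (s * G w)) = 0" and A [measurable]: "A \<in> sets borel"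
 shows "(LINT w|M. W w * indicator A (G w)) = 0"
proof -
 have [measurable]: "W \<in> borel_measurable M" using W by auto
 define p where "p w = max 0 (W w)" for w
 define n where "n w = max 0 (- W w)" for w
 have pn: "integrable M p" "integrable M n" unfolding p_def[abs_def] n_def[abs_def] using W by auto
 have [measurable]: "p \<in> borel_measurable M" "n \<in> borel_measurable M" using pn by auto
 have Wpn: "W w = p w - n w" for w by (simp add: p_def n_def)
 have nn: "0 \<le> p w" "0 \<le> n w" for w by (auto simp: p_def n_def)
 have bi: "integrable M (\<lambda>w. complex_of_real (f w) * iexp (s * G w))" if f: "integrable M f" for f :: "'a => real" and s
 proof (rule Bochner_Integration.integrable_bound[OF f])
  show "(\<lambda>w. complex_of_real (f w) * iexp (s * G w)) \<in> borel_measurable M" using f by measurable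
 qed (simp add: norm_mult)
 have bA: "integrable M (\<lambda>w. f w * indicator A (G w))" if f: "integrable M f" for f :: "'a => real"
  by (rule Bochner_Integration.integrable_bound[OF f]) (use f in \<open>auto simp: indicator_def\<close>)
 define c where "c = (LINT w|M. p w)"
 have "(CLINT w|M. W w * iexp (0 * G w)) = complex_of_real (LINT w|M. W w)" by simp
 hence "(LINT w|M. W w) = 0" using zero[of 0] by simp
 hence cn: "(LINT w|M. n w) = c" using pn by (simp add: Wpn c_def)
 have c0: "c \<ge> 0" by (simp add: c_def nn)
 show ?thesis
 proof (cases "c = 0")
  case True
  have "AE w in M. p w = 0" using integral_nonneg_eq_0_iff_AE[OF pn(1)] True nn by (auto simp: c_def)
  moreover have "AE w in M. n w = 0" using integral_nonneg_eq_0_iff_AE[OF pn(2)] True nn cn by auto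
  ultimately have "AE w in M. W w * indicator A (G w) = 0" by eventually_elim (simp add: Wpn)
  thus ?thesis by (intro integral_eq_zero_AE)
 next
  case False
  hence c: "c > 0" using c0 by simp
  define D where "D f = distr (density M (\<lambda>w. ennreal (f w / c))) borel G" for f :: "'a => real"
  have rd: "real_distribution (D f)" if "integrable M f" "\<And>w. 0 \<le> f w" "(LINT w|M. f w) = c" for f
  proof -
   have [measurable]: "f \<in> borel_measurable M" using that by auto
   have "emeasure (density M (\<lambda>w. ennreal (f w / c))) (space M) = (\<integral>\<^sup>+w. ennreal (f w / c) \<partial>M)"
    by (subst emeasure_density) (auto intro!: nn_integral_cong)
   also have "... = ennreal (LINT w|M. f w / c)" using that c by (intro nn_integral_eq_integral) auto
   also have "... = 1" using that c by simp
   finally interpret P: prob_space "density M (\<lambda>w. ennreal (f w / c))" by (intro prob_spaceI) simp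
   show ?thesis unfolding D_def by (rule P.real_distribution_distr) simp
  qed
  have ch: "char (D f) s = (CLINT w|M. f w * iexp (s * G w)) / c" if [measurable]: "f \<in> borel_measurable M" and "\<And>w. 0 \<le> f w" for f s
  proof -
   have "char (D f) s = (CLINT w|density M (\<lambda>w. ennreal (f w / c)). iexp (s * G w))"
    unfolding char_def D_def by (subst integral_distr) auto
   also have "... = (CLINT w|M. (f w / c) *\<^sub>R iexp (s * G w))" using that c by (subst integral_density) auto
   also have "... = (CLINT w|M. (f w * iexp (s * G w)) / c)" by (intro Bochner_Integration.integral_cong) (auto simp: scaleR_conv_of_real)
   finally show ?thesis by simp
  qed
  have "char (D p) = char (D n)"
  proof
   fix s
   have "(CLINT w|M. p w * iexp (s * G w)) - (CLINT w|M. n w * iexp (s * G w)) = (CLINT w|M. W w * iexp (s * G w))"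
    by (subst Bochner_Integration.integral_diff[symmetric])
     (use bi[OF pn(1), of s] bi[OF pn(2), of s] in \<open>simp_all add: Wpn algebra_simps\<close>)
   thus "char (D p) s = char (D n) s" using zero[of s] nn by (simp add: ch)
  qed
  from Levy_uniqueness[OF rd rd this] pn nn cn have eq: "D p = D n" by (simp add: c_def)
  have iA: "(LINT x|D f. indicator A x) = (LINT w|M. f w * indicator A (G w)) / c"
   if [measurable]: "f \<in> borel_measurable M" and "\<And>w. 0 \<le> f w" for f
  proof -
   have "(LINT x|D f. indicator A x) = (LINT w|density M (\<lambda>w. ennreal (f w / c)). indicator A (G w) :: real)"
    unfolding D_def by (subst integral_distr) auto
   also have "... = (LINT w|M. (f w / c) *\<^sub>R indicator A (G w))" using that c by (subst integral_density) auto
   also have "... = (LINT w|M. (f w * indicator A (G w)) / c)" by (intro Bochner_Integration.integral_cong) auto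
   finally show ?thesis by simp
  qed
  have "(LINT w|M. p w * indicator A (G w)) = (LINT w|M. n w * indicator A (G w))"
   using iA[of p] iA[of n] nn eq c by simp
  thus ?thesis using bA[OF pn(1)] bA[OF pn(2)] by (simp add: Wpn left_diff_distrib)
 qed
qed

lemma char_zero_imp_indicator_zero:
 fixes W :: "'a => complex" and G :: "'a => real"
 assumes W: "integrable M W" and [measurable]: "G \<in> borel_measurable M"
  and zero: "\<And>s. (CLINT w|M. W w * iexp (s * G w)) = 0" and A [measurable]: "A \<in> sets borel"
 shows "(CLINT w|M. W w * indicator A (G w)) = 0"
proof -
 have [measurable]: "W \<in> borel_measurable M" using W by auto
 have i: "integrable M (\<lambda>w. W w * iexp (s * G w))" for s
  by (rule Bochner_Integration.integrable_bound[OF W]) (auto simp: norm_mult)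
 have [measurable]: "(\<lambda>w. cnj (W w)) \<in> borel_measurable M"
  by (rule measurable_compose[OF _ borel_measurable_continuous_onI[OF continuous_on_cnj[OF continuous_on_id]]]) measurable
 have conj: "(CLINT w|M. cnj (W w) * iexp (s * G w)) = 0" for s
 proof -
  have "cnj (CLINT w|M. W w * iexp ((- s) * G w)) = (CLINT w|M. cnj (W w * iexp ((- s) * G w)))"
   by (rule integral_bounded_linear[OF bounded_linear_cnj i, symmetric])
  also have "... = (CLINT w|M. cnj (W w) * iexp (s * G w))" by (simp add: exp_cnj)
  finally show ?thesis using zero[of "-s"] by simp
 qed
 have ic: "integrable M (\<lambda>w. cnj (W w) * iexp (s * G w))" for s
  by (rule Bochner_Integration.integrable_bound[OF W]) (auto simp: norm_mult)
 have Re: "(CLINT w|M. Re (W w) * iexp (s * G w)) = 0" for s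
 proof -
  have "(CLINT w|M. Re (W w) * iexp (s * G w)) = (CLINT w|M. (W w * iexp (s * G w) + cnj (W w) * iexp (s * G w)) / 2)"
   by (intro Bochner_Integration.integral_cong) (auto simp: distrib_right[symmetric] complex_add_cnj)
  also have "... = 0" using i[of s] ic[of s] zero[of s] conj[of s] by simp
  finally show ?thesis .
 qed
 have Im: "(CLINT w|M. Im (W w) * iexp (s * G w)) = 0" for s
 proof -
  have "(CLINT w|M. Im (W w) * iexp (s * G w)) = (CLINT w|M. (W w * iexp (s * G w) - cnj (W w) * iexp (s * G w)) / (2 * \<i>))"
  proof (intro Bochner_Integration.integral_cong refl)
   fix w
   have "W w * iexp (s * G w) - cnj (W w) * iexp (s * G w) = (complex_of_real (2 * Im (W w)) * \<i>) * iexp (s * G w)"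
    by (simp only: left_diff_distrib[symmetric] complex_diff_cnj)
   thus "complex_of_real (Im (W w)) * iexp (s * G w) = (W w * iexp (s * G w) - cnj (W w) * iexp (s * G w)) / (2 * \<i>)"
    by (simp add: divide_simps mult_ac)
  qed
  also have "... = 0" using i[of s] ic[of s] zero[of s] conj[of s] by simp
  finally show ?thesis .
 qed
 have r: "(LINT w|M. Re (W w) * indicator A (G w)) = 0" "(LINT w|M. Im (W w) * indicator A (G w)) = 0"
  by (rule char_zero_imp_indicator_zero_real; use W Re Im in \<open>auto intro: integrable_Re integrable_Im\<close>)+
 have ir: "integrable M (\<lambda>w. W w * indicator A (G w))"
  by (rule Bochner_Integration.integrable_bound[OF W]) (auto simp: norm_mult indicator_def)
 have "Re (CLINT w|M. W w * indicator A (G w)) = (LINT w|M. Re (W w) * indicator A (G w))"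
  by (subst integral_Re[OF ir, symmetric]) (intro Bochner_Integration.integral_cong, auto simp: indicator_def)
 moreover have "Im (CLINT w|M. W w * indicator A (G w)) = (LINT w|M. Im (W w) * indicator A (G w))"
  by (subst integral_Im[OF ir, symmetric]) (intro Bochner_Integration.integral_cong, auto simp: indicator_def)
 ultimately show ?thesis using r by (simp add: complex_eq_iff)
qed

text \<open>Fourier uniqueness in several variables, by replacing the exponentials with indicators one
  coordinate at a time.\<close>

lemma char_zero_imp_box_zero:
 fixes W :: "'a => complex" and G :: "nat => 'a => real"
 assumes "integrable M W" and "\<And>i. i < k ==> G i \<in> borel_measurable M"
  and "\<And>s. (CLINT w|M. W w * iexp (\<Sum>i<k. s i * G i w)) = 0" and "\<And>i. i < k ==> A i \<in> sets borel"
 shows "(CLINT w|M. W w * (\<Prod>i<k. indicator (A i) (G i w))) = 0"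
 using assms
proof (induction k arbitrary: W)
 case 0 thus ?case by simp
next
 case (Suc k)
 have [measurable]: "W \<in> borel_measurable M" using Suc.prems(1) by auto
 have mG [measurable]: "G k \<in> borel_measurable M" "\<And>i. i < k ==> G i \<in> borel_measurable M" using Suc.prems(2) by auto
 have mA: "A k \<in> sets borel" "\<And>i. i < k ==> A i \<in> sets borel" using Suc.prems(4) by auto
 have mi: "(\<lambda>w. \<Prod>i<k. indicator (A i) (G i w) :: complex) \<in> borel_measurable M"
  using mG(2) mA(2) by (intro borel_measurable_prod) (auto intro!: measurable_compose[OF _ borel_measurable_indicator])
 have "(CLINT w|M. (W w * (\<Prod>i<k. indicator (A i) (G i w))) * indicator (A k) (G k w)) = 0"
 proof (rule char_zero_imp_indicator_zero)
  show "integrable M (\<lambda>w. W w * (\<Prod>i<k. indicator (A i) (G i w)))"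
  proof (rule Bochner_Integration.integrable_bound[OF Suc.prems(1)])
   have "cmod (\<Prod>i<k. indicator (A i) (G i w)) \<le> 1" for w
    unfolding prod_norm[symmetric] by (intro prod_le_1) (auto simp: indicator_def)
   thus "AE w in M. cmod (W w * (\<Prod>i<k. indicator (A i) (G i w))) \<le> cmod (W w)"
    by (intro AE_I2) (simp only: norm_mult, rule mult_left_le, auto)
  qed (use mi in measurable)
  fix t
  have "(CLINT w|M. (W w * iexp (t * G k w)) * (\<Prod>i<k. indicator (A i) (G i w))) = 0"
  proof (rule Suc.IH)
   show "integrable M (\<lambda>w. W w * iexp (t * G k w))"
    by (rule Bochner_Integration.integrable_bound[OF Suc.prems(1)]) (auto simp: norm_mult)
   fix s
   have eq: "W w * iexp (t * G k w) * iexp (\<Sum>i<k. s i * G i w) = W w * iexp (\<Sum>i<Suc k. (s(k := t)) i * G i w)" for w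
    by (simp add: exp_add[symmetric] algebra_simps)
   show "(CLINT w|M. W w * iexp (t * G k w) * iexp (\<Sum>i<k. s i * G i w)) = 0"
    by (simp only: eq Suc.prems(3))
  qed (use mG mA in auto)
  thus "(CLINT w|M. W w * (\<Prod>i<k. indicator (A i) (G i w)) * iexp (t * G k w)) = 0"
   by (simp add: mult_ac)
 qed (use mA in auto)
 thus ?case by (simp add: mult_ac)
qed

end

lemma integrable_std_normal_poly: "integrable lborel (\<lambda>x. std_normal_density x * (1 + \<bar>x\<bar>) ^ m)"
proof -
 have "std_normal_density x * (1 + \<bar>x\<bar>) ^ m = (\<Sum>i\<le>m. of_nat (m choose i) * (std_normal_density x * \<bar>x\<bar> ^ (m - i)))" for x
  by (simp add: binomial_ring sum_distrib_left mult_ac)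
 thus ?thesis by (simp add: integrable_std_normal_moment_abs)
qed

lemma std_normal_poly_tendsto: "((\<lambda>x. std_normal_density x * (1 + \<bar>x\<bar>) ^ m) \<longlongrightarrow> 0) at_top"
proof (rule Lim_null_comparison)
 have "filterlim (\<lambda>x::real. 1 + x) at_top at_top" by (rule filterlim_tendsto_add_at_top[OF tendsto_const filterlim_ident])
 hence "filterlim (\<lambda>x::real. x + 1) at_top at_top" by (simp add: add.commute)
 from filterlim_compose[OF tendsto_power_div_exp_0 this, of m]
 have "((\<lambda>x::real. exp 1 * ((x + 1) ^ m / exp (x + 1))) \<longlongrightarrow> exp 1 * 0) at_top" by (intro tendsto_mult_left)
 thus "((\<lambda>x::real. exp 1 * ((x + 1) ^ m / exp (x + 1))) \<longlongrightarrow> 0) at_top" by simp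
 show "\<forall>\<^sub>F x in at_top. norm (std_normal_density x * (1 + \<bar>x\<bar>) ^ m) \<le> exp 1 * ((x + 1) ^ m / exp (x + 1))"
  using eventually_ge_at_top[of "2::real"]
 proof eventually_elim
  case (elim x)
  have "x^2 / 2 \<ge> x" using mult_right_mono[of 2 x x] elim by (simp add: power2_eq_square)
  hence "exp (- (x^2 / 2)) \<le> exp (- x)" by simp
  moreover have "1 / sqrt (2 * pi) \<le> 1" using pi_gt3 by simp
  ultimately have "std_normal_density x \<le> 1 * exp (- x)"
   unfolding std_normal_density_def by (intro mult_mono) auto
  hence "std_normal_density x * (1 + x) ^ m \<le> exp (- x) * (1 + x) ^ m" using elim by (intro mult_right_mono) auto
  also have "... = exp 1 * ((x + 1) ^ m / exp (x + 1))" by (simp add: exp_add exp_minus field_simps)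
  finally show ?case using elim by (simp add: normal_density_nonneg)
 qed
qed

text \<open>Integration by parts against the Gaussian density; polynomial growth makes the boundary terms vanish.\<close>

lemma stein_identity:
 fixes h h' :: "real => real"
 assumes d: "\<And>x. (h has_real_derivative h' x) (at x)" and c: "continuous_on UNIV h'"
  and b: "\<And>x. \<bar>h x\<bar> \<le> C * (1 + \<bar>x\<bar>) ^ m" "\<And>x. \<bar>h' x\<bar> \<le> C * (1 + \<bar>x\<bar>) ^ m"
 shows "(LINT x|std_normal_distribution. h x * x) = (LINT x|std_normal_distribution. h' x)"
proof -
 have C: "C \<ge> 0" using b(1)[of 0] by simp
 have hc: "continuous_on UNIV h" using d by (meson DERIV_isCont continuous_at_imp_continuous_on)
 have [measurable]: "h \<in> borel_measurable borel" "h' \<in> borel_measurable borel"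
  using hc c by (auto intro: borel_measurable_continuous_onI)
 define \<phi> where "\<phi> = std_normal_density"
 have p0: "\<phi> x \<ge> 0" for x by (simp add: \<phi>_def normal_density_nonneg)
 have [measurable]: "\<phi> \<in> borel_measurable borel" by (simp add: \<phi>_def)
 have i1: "integrable lborel (\<lambda>x. \<phi> x * h' x)"
 proof (rule Bochner_Integration.integrable_bound)
  show "integrable lborel (\<lambda>x. C * (\<phi> x * (1 + \<bar>x\<bar>) ^ m))" using integrable_std_normal_poly[of m] by (simp add: \<phi>_def)
  show "AE x in lborel. norm (\<phi> x * h' x) \<le> norm (C * (\<phi> x * (1 + \<bar>x\<bar>) ^ m))"
  proof (intro AE_I2)
   fix x show "norm (\<phi> x * h' x) \<le> norm (C * (\<phi> x * (1 + \<bar>x\<bar>) ^ m))"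
    using mult_left_mono[OF b(2)[of x] p0[of x]] C p0[of x] by (simp add: abs_mult mult_ac)
  qed
 qed measurable
 have i2: "integrable lborel (\<lambda>x. \<phi> x * (h x * x))"
 proof (rule Bochner_Integration.integrable_bound)
  show "integrable lborel (\<lambda>x. C * (\<phi> x * (1 + \<bar>x\<bar>) ^ (Suc m)))" using integrable_std_normal_poly[of "Suc m"] by (simp add: \<phi>_def)
  show "AE x in lborel. norm (\<phi> x * (h x * x)) \<le> norm (C * (\<phi> x * (1 + \<bar>x\<bar>) ^ (Suc m)))"
  proof (intro AE_I2)
   fix x
   have "\<bar>h x\<bar> * \<bar>x\<bar> \<le> (C * (1 + \<bar>x\<bar>) ^ m) * (1 + \<bar>x\<bar>)" using b(1)[of x] C by (intro mult_mono) auto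
   from mult_left_mono[OF this p0[of x]] show "norm (\<phi> x * (h x * x)) \<le> norm (C * (\<phi> x * (1 + \<bar>x\<bar>) ^ (Suc m)))"
    using C p0[of x] by (simp add: abs_mult mult_ac)
  qed
 qed measurable
 have dphi: "(\<phi> has_real_derivative - x * \<phi> x) (at x)" for x
 proof -
  have "((\<lambda>x. exp (- x\<^sup>2 / 2)) has_real_derivative - x * exp (- x\<^sup>2 / 2)) (at x)" by (auto intro!: derivative_eq_intros)
  thus ?thesis unfolding \<phi>_def std_normal_density_def[abs_def] by (rule DERIV_cong[OF DERIV_cmult]) simp
 qed
 define f where "f x = \<phi> x * h' x - \<phi> x * (h x * x)" for x
 have bound: "norm (\<phi> x * h x) \<le> C * (\<phi> x * (1 + \<bar>x\<bar>) ^ m)" for x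
  using mult_left_mono[OF b(1)[of x] p0[of x]] p0[of x] by (simp add: abs_mult mult_ac)
 have lim: "((\<lambda>x. C * (\<phi> x * (1 + \<bar>x\<bar>) ^ m)) \<longlongrightarrow> 0) at_top"
  using tendsto_mult_left[OF std_normal_poly_tendsto[of m], of C] by (simp add: \<phi>_def)
 have top: "((\<lambda>x. \<phi> x * h x) \<longlongrightarrow> 0) at_top" by (rule Lim_null_comparison[OF _ lim]) (use bound in auto)
 have "((\<lambda>x. C * (\<phi> (- x) * (1 + \<bar>- x\<bar>) ^ m)) \<longlongrightarrow> 0) at_bot"
  using filterlim_compose[OF lim filterlim_uminus_at_top_at_bot] by simp
 hence lim': "((\<lambda>x. C * (\<phi> x * (1 + \<bar>x\<bar>) ^ m)) \<longlongrightarrow> 0) at_bot" by (simp add: \<phi>_def std_normal_density_def)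
 have bot: "((\<lambda>x. \<phi> x * h x) \<longlongrightarrow> 0) at_bot" by (rule Lim_null_comparison[OF _ lim']) (use bound in auto)
 have fi: "integrable lborel f" unfolding f_def[abs_def] by (intro Bochner_Integration.integrable_diff i1 i2)
 have "(LBINT x=-\<infinity>..\<infinity>. f x) = 0 - 0"
 proof (rule interval_integral_FTC_integrable[where F="\<lambda>x. \<phi> x * h x"])
  show "((\<lambda>x. \<phi> x * h x) has_vector_derivative f x) (at x)" for x
  proof -
   have "((\<lambda>x. \<phi> x * h x) has_real_derivative f x) (at x)"
    using DERIV_mult[OF dphi d, of x] by (simp add: f_def algebra_simps)
   thus ?thesis by (simp add: has_real_derivative_iff_has_vector_derivative)
  qed
  show "isCont f x" for x
  proof -
   have "continuous_on UNIV \<phi>" using dphi by (meson DERIV_isCont continuous_at_imp_continuous_on)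
   hence "continuous_on UNIV f" unfolding f_def[abs_def] by (intro continuous_intros hc c)
   thus ?thesis by (simp add: continuous_on_eq_continuous_at)
  qed
  show "set_integrable lborel (einterval (-\<infinity>) \<infinity>) f" using fi by (simp add: set_integrable_def)
  show "(((\<lambda>x. \<phi> x * h x) \<circ> real_of_ereal) \<longlongrightarrow> 0) (at_right (-\<infinity>))"
   using bot by (simp add: ereal_tendsto_simps)
  show "(((\<lambda>x. \<phi> x * h x) \<circ> real_of_ereal) \<longlongrightarrow> 0) (at_left \<infinity>)"
   using top by (simp add: ereal_tendsto_simps)
 qed simp
 hence "(LINT x|lborel. f x) = 0" by (simp add: interval_lebesgue_integral_def set_lebesgue_integral_def)
 hence "(LINT x|lborel. \<phi> x * h' x) = (LINT x|lborel. \<phi> x * (h x * x))"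
  unfolding f_def by (subst (asm) Bochner_Integration.integral_diff[OF i1 i2]) simp
 thus ?thesis
  by (subst (1 2) integral_density) (auto simp: normal_density_nonneg \<phi>_def)
qed

lemma tendsto_fun_iff: "(g \<longlongrightarrow> (x :: nat => real)) F \<longleftrightarrow> (\<forall>i. ((\<lambda>t. g t i) \<longlongrightarrow> x i) F)"
 using limitin_componentwise[of "\<lambda>_::nat. (euclidean :: real topology)" UNIV g x F]
 unfolding euclidean_product_topology limitin_canonical_iff by simp

lemma pdiff_deriv:
 assumes "\<And>x. (\<lambda>s. f (x(i := s))) differentiable at (x i)"
 shows "((\<lambda>s. f (z(i := s))) has_real_derivative pdiff i f (z(i := s))) (at s)"
proof -
 have "(\<lambda>s'. f ((z(i := s))(i := s'))) differentiable at ((z(i := s)) i)" by (rule assms)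
 hence "(\<lambda>s. f (z(i := s))) differentiable at s" by simp
 thus ?thesis by (simp add: pdiff_def DERIV_deriv_iff_real_differentiable)
qed

text \<open>Along the line, the increment of \<open>f\<close> is split into increments in one coordinate each, to which the mean value
  theorem applies; continuity of the partial derivatives gives the limit.\<close>

lemma chain_rule_line:
 fixes f :: "(nat => real) => real"
 assumes dep: "\<And>x y. (\<And>i. i < k ==> x i = y i) ==> f x = f y"
  and diff: "\<And>i x. i < k ==> (\<lambda>s. f (x(i := s))) differentiable at (x i)"
  and cont: "\<And>i. i < k ==> continuous_on UNIV (pdiff i f)"
 shows "((\<lambda>t. f (\<lambda>i. x i + t * c i)) has_real_derivative (\<Sum>i<k. c i * pdiff i f (\<lambda>i. x i + t0 * c i))) (at t0)"
proof -
 define x0 where "x0 i = x i + t0 * c i" for i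
 define y where "y t j = (\<lambda>i. if i < j then x0 i + t * c i else x0 i)" for t and j :: nat
 define P where "P t j \<xi> \<longleftrightarrow> f (y t (Suc j)) - f (y t j) = t * c j * pdiff j f \<xi> \<and> (\<forall>i. \<bar>\<xi> i - x0 i\<bar> \<le> \<bar>t\<bar> * \<bar>c i\<bar>)" for t j \<xi>
 have P: "\<exists>\<xi>. P t j \<xi>" if j: "j < k" for t j
 proof -
  define g where "g s = f ((y t j)(j := x0 j + s * (t * c j)))" for s
  have "(g has_real_derivative pdiff j f ((y t j)(j := x0 j + s * (t * c j))) * (t * c j)) (at s)" for s
   unfolding g_def[abs_def]
   by (rule DERIV_chain2[where f="\<lambda>s. f ((y t j)(j := s))" and g="\<lambda>s. x0 j + s * (t * c j)"])
    (auto intro!: pdiff_deriv diff[OF j] derivative_eq_intros)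
  from MVT2[of 0 1 g, OF _ this] obtain s where s: "0 < s" "s < 1" "g 1 - g 0 = pdiff j f ((y t j)(j := x0 j + s * (t * c j))) * (t * c j)" by auto
  have "g 1 = f (y t (Suc j))" "g 0 = f (y t j)"
   by (auto simp: g_def y_def intro!: arg_cong[of _ _ f])
  moreover have "\<bar>((y t j)(j := x0 j + s * (t * c j))) i - x0 i\<bar> \<le> \<bar>t\<bar> * \<bar>c i\<bar>" for i
   using s by (auto simp: y_def abs_mult intro!: mult_left_le_one_le)
  ultimately have "P t j ((y t j)(j := x0 j + s * (t * c j)))" using s(3) by (simp add: P_def mult_ac)
  thus ?thesis by blast
 qed
 define \<xi> where "\<xi> t j = (SOME \<xi>. P t j \<xi>)" for t j
 have "P t j (\<xi> t j)" if "j < k" for t j unfolding \<xi>_def by (rule someI_ex[OF P[OF that]])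
 hence \<xi>: "j < k ==> f (y t (Suc j)) - f (y t j) = t * c j * pdiff j f (\<xi> t j)"
  "j < k ==> \<bar>\<xi> t j i - x0 i\<bar> \<le> \<bar>t\<bar> * \<bar>c i\<bar>" for t j i by (auto simp: P_def)
 have fy: "f (y t k) = f (\<lambda>i. x0 i + t * c i)" "f (y t 0) = f x0" for t
  by (auto simp: y_def intro!: dep)
 have tele: "f (\<lambda>i. x0 i + t * c i) - f x0 = (\<Sum>j<k. t * c j * pdiff j f (\<xi> t j))" for t
  using sum_lessThan_telescope[of "\<lambda>j. f (y t j)" k] \<xi>(1) fy[of t] by simp
 have "((\<lambda>h. \<Sum>j<k. c j * pdiff j f (\<xi> h j)) \<longlongrightarrow> (\<Sum>j<k. c j * pdiff j f x0)) (at 0)"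
 proof (intro tendsto_sum tendsto_mult_left)
  fix j assume "j \<in> {..<k}"
  hence j: "j < k" by simp
  have "((\<lambda>h. \<xi> h j) \<longlongrightarrow> x0) (at 0)"
   unfolding tendsto_fun_iff
  proof
   fix i
   have "((\<lambda>h. \<xi> h j i - x0 i) \<longlongrightarrow> 0) (at 0)"
   proof (rule Lim_null_comparison)
    have "((\<lambda>h. \<bar>h\<bar> * \<bar>c i\<bar>) \<longlongrightarrow> \<bar>0\<bar> * \<bar>c i\<bar>) (at 0)" by (intro tendsto_intros)
    thus "((\<lambda>h. \<bar>h\<bar> * \<bar>c i\<bar>) \<longlongrightarrow> 0) (at 0)" by simp
   qed (use \<xi>(2)[OF j] in auto)
   thus "((\<lambda>h. \<xi> h j i) \<longlongrightarrow> x0 i) (at 0)" by (simp add: LIM_zero_iff)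
  qed
  moreover have "isCont (pdiff j f) x0" using cont[OF j] by (simp add: continuous_on_eq_continuous_at)
  ultimately show "((\<lambda>h. pdiff j f (\<xi> h j)) \<longlongrightarrow> pdiff j f x0) (at 0)" by (rule isCont_tendsto_compose[rotated])
 qed
 moreover have "\<forall>\<^sub>F h in at 0. (f (\<lambda>i. x i + (t0 + h) * c i) - f (\<lambda>i. x i + t0 * c i)) / h = (\<Sum>j<k. c j * pdiff j f (\<xi> h j))"
 proof (rule eventually_at_ball'[OF zero_less_one, of 0 UNIV, THEN eventually_mono])
  fix h :: real assume h: "h \<in> ball 0 1 \<and> h \<noteq> 0 \<and> h \<in> UNIV"
  have "(\<lambda>i. x i + (t0 + h) * c i) = (\<lambda>i. x0 i + h * c i)" "(\<lambda>i. x i + t0 * c i) = x0" by (auto simp: x0_def algebra_simps)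
  hence "f (\<lambda>i. x i + (t0 + h) * c i) - f (\<lambda>i. x i + t0 * c i) = (\<Sum>j<k. h * (c j * pdiff j f (\<xi> h j)))"
   using tele[of h] by (simp add: mult_ac)
  also have "... = h * (\<Sum>j<k. c j * pdiff j f (\<xi> h j))" by (rule sum_distrib_left[symmetric])
  finally show "(f (\<lambda>i. x i + (t0 + h) * c i) - f (\<lambda>i. x i + t0 * c i)) / h = (\<Sum>j<k. c j * pdiff j f (\<xi> h j))" using h by simp
 qed
 ultimately have "((\<lambda>h. (f (\<lambda>i. x i + (t0 + h) * c i) - f (\<lambda>i. x i + t0 * c i)) / h) \<longlongrightarrow> (\<Sum>j<k. c j * pdiff j f x0)) (at 0)"
  by (subst tendsto_cong)
 thus ?thesis unfolding DERIV_def by (simp add: x0_def[abs_def])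
qed

context fbm begin

lemma gsp_measurable: "Y \<in> gsp ==> Y \<in> borel_measurable M"
 using gsp_sqint sqint_measurable by blast

lemma iexp_integrable: "Y \<in> borel_measurable M ==> integrable M (\<lambda>w. iexp (Y w))"
 by (rule integrable_iexp) auto

text \<open>Without correlation, the characteristic function of \<open>V\<close> together with a linear combination of the \<open>G i\<close>
  factorises, since it depends on the variance only. Fourier uniqueness, in the \<open>G i\<close> first and then in \<open>V\<close>, turns this
  into independence.\<close>

lemma gsp_uncorrelated_box:
 fixes G :: "nat => 'w => real"
 assumes V: "V \<in> gsp" and G: "\<And>i. i < k ==> G i \<in> gsp"
  and orth: "\<And>i. i < k ==> (LINT w|M. V w * G i w) = 0"
  and A: "A \<in> sets borel" "\<And>i. i < k ==> A' i \<in> sets borel"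
 shows "(LINT w|M. (\<Prod>i<k. indicator (A' i) (G i w)) * indicator A (V w)) =
  (LINT w|M. (\<Prod>i<k. indicator (A' i) (G i w))) * (LINT w|M. indicator A (V w) :: real)"
proof -
 have [measurable]: "V \<in> borel_measurable M" using V by (rule gsp_measurable)
 have mG: "\<And>i. i < k ==> G i \<in> borel_measurable M" using G gsp_measurable by blast
 define er where "er w = (\<Prod>i<k. indicator (A' i) (G i w) :: real)" for w
 define e where "e w = (\<Prod>i<k. indicator (A' i) (G i w) :: complex)" for w
 have e: "e w = complex_of_real (er w)" for w unfolding e_def er_def of_real_prod by (intro prod.cong) (auto simp: indicator_def)
 have [measurable]: "e \<in> borel_measurable M" unfolding e_def[abs_def]
  using mG A(2) by (intro borel_measurable_prod) (auto intro!: measurable_compose[OF _ borel_measurable_indicator])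
 have [measurable]: "er \<in> borel_measurable M" unfolding er_def[abs_def]
  using mG A(2) by (intro borel_measurable_prod) (auto intro!: measurable_compose[OF _ borel_measurable_indicator])
 have er01: "0 \<le> er w" "er w \<le> 1" for w unfolding er_def by (auto intro!: prod_nonneg prod_le_1 simp: indicator_def)
 have ei: "integrable M e" by (rule integrable_const_bound[of _ 1]) (use er01 in \<open>auto simp: e\<close>)
 define cf where "cf t = (CLINT w|M. iexp (t * V w))" for t
 have iV: "integrable M (\<lambda>w. iexp (t * V w))" for t by (rule iexp_integrable) measurable
 have step1: "(CLINT w|M. (iexp (t * V w) - cf t) * e w) = 0" for t
  unfolding e_def
 proof (rule char_zero_imp_box_zero[where W="\<lambda>w. iexp (t * V w) - cf t" and G=G and k=k and A=A'])
  show "integrable M (\<lambda>w. iexp (t * V w) - cf t)" using iV[of t] by simp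
  fix s
  define L where "L w = (\<Sum>i<k. s i * G i w)" for w
  have L: "L \<in> gsp" unfolding L_def[abs_def] by (intro gsp_sum gsp_cmult G) auto
  have [measurable]: "L \<in> borel_measurable M" by (rule gsp_measurable[OF L])
  have tV: "(\<lambda>w. t * V w) \<in> gsp" by (rule gsp_cmult[OF V])
  have LV: "(LINT w|M. (t * V w) * L w) = 0"
  proof -
   have "(LINT w|M. (t * V w) * L w) = (LINT w|M. (\<Sum>i<k. t * s i * (V w * G i w)))"
    unfolding L_def by (simp add: sum_distrib_left mult_ac)
   also have "... = (\<Sum>i<k. t * s i * (LINT w|M. V w * G i w))"
    using gsp_sqint[OF V] gsp_sqint[OF G] by (subst Bochner_Integration.integral_sum) (auto intro!: integrable_mult_right sqint_mult)
   finally show ?thesis using orth by simp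
  qed
  have "(LINT w|M. (t * V w + L w)^2) = (LINT w|M. (t * V w)^2 + (L w)^2 + 2 * ((t * V w) * L w))"
   by (intro Bochner_Integration.integral_cong) (auto simp: power2_sum)
  also have "... = (LINT w|M. (t * V w)^2) + (LINT w|M. (L w)^2)"
   using sqint_sq[OF gsp_sqint[OF tV]] sqint_sq[OF gsp_sqint[OF L]] sqint_mult[OF gsp_sqint[OF tV] gsp_sqint[OF L]] LV by simp
  finally have sq: "(LINT w|M. (t * V w + L w)^2) = (LINT w|M. (t * V w)^2) + (LINT w|M. (L w)^2)" .
  have "(CLINT w|M. iexp (t * V w + L w)) = (CLINT w|M. iexp (t * V w)) * (CLINT w|M. iexp (L w))"
   unfolding char_gsp[OF gsp_add[OF tV L]] char_gsp[OF tV] char_gsp[OF L] sq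
   by (simp only: of_real_mult[symmetric] exp_add[symmetric]) (simp add: field_simps)
  moreover have "(CLINT w|M. (iexp (t * V w) - cf t) * iexp (L w)) = (CLINT w|M. iexp (t * V w + L w) - cf t * iexp (L w))"
   by (intro Bochner_Integration.integral_cong) (auto simp: left_diff_distrib exp_add[symmetric] algebra_simps)
  moreover have "... = (CLINT w|M. iexp (t * V w + L w)) - cf t * (CLINT w|M. iexp (L w))"
   by (subst Bochner_Integration.integral_diff) (auto intro!: iexp_integrable integrable_mult_right simp del: of_real_add)
  ultimately show "(CLINT w|M. (iexp (t * V w) - cf t) * iexp (\<Sum>i<k. s i * G i w)) = 0"
   unfolding L_def[symmetric] by (simp add: cf_def)
 qed (use mG A(2) in auto)
 define p where "p = (CLINT w|M. e w)"
 have ie: "integrable M (\<lambda>w. iexp (t * V w) * e w)" for t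
  by (rule integrable_const_bound[of _ 1]) (use er01 in \<open>auto simp: e norm_mult\<close>)
 have "(CLINT w|M. (e w - p) * indicator A (V w)) = 0"
 proof (rule char_zero_imp_indicator_zero[OF _ _ _ A(1)])
  show "integrable M (\<lambda>w. e w - p)" using ei by simp
  fix t
  have "(CLINT w|M. (iexp (t * V w) - cf t) * e w) = (CLINT w|M. iexp (t * V w) * e w) - cf t * p"
   unfolding left_diff_distrib p_def using ie[of t] ei by (subst Bochner_Integration.integral_diff) auto
  moreover have "(CLINT w|M. (e w - p) * iexp (t * V w)) = (CLINT w|M. iexp (t * V w) * e w - p * iexp (t * V w))"
   by (intro Bochner_Integration.integral_cong) (auto simp: algebra_simps)
  moreover have "... = (CLINT w|M. iexp (t * V w) * e w) - p * cf t"
   unfolding cf_def using ie[of t] iV[of t] by (subst Bochner_Integration.integral_diff) auto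
  ultimately show "(CLINT w|M. (e w - p) * iexp (t * V w)) = 0" using step1[of t] by (simp add: mult.commute)
 qed simp
 moreover have "(CLINT w|M. (e w - p) * indicator A (V w)) = (CLINT w|M. complex_of_real (er w * indicator A (V w))) - p * (CLINT w|M. complex_of_real (indicator A (V w)))"
 proof -
  have "(CLINT w|M. (e w - p) * indicator A (V w)) = (CLINT w|M. complex_of_real (er w * indicator A (V w)) - p * complex_of_real (indicator A (V w)))"
   by (intro Bochner_Integration.integral_cong) (auto simp: e indicator_def)
  also have "... = (CLINT w|M. complex_of_real (er w * indicator A (V w))) - (CLINT w|M. p * complex_of_real (indicator A (V w)))"
  proof (rule Bochner_Integration.integral_diff)
   have [measurable]: "(\<lambda>w. indicator A (V w) :: real) \<in> borel_measurable M" using A(1) by measurable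
   show "complex_integrable M (\<lambda>x. complex_of_real (er x * indicator A (V x)))"
   proof (rule integrable_const_bound[of _ 1])
    show "AE x in M. cmod (complex_of_real (er x * indicator A (V x))) \<le> 1" using er01 by (auto simp: indicator_def)
   qed measurable
   show "complex_integrable M (\<lambda>x. p * complex_of_real (indicator A (V x)))"
   proof (intro integrable_mult_right integrable_const_bound[of _ 1])
    show "AE x in M. cmod (complex_of_real (indicator A (V x))) \<le> 1" by (auto simp: indicator_def)
   qed measurable
  qed
  finally show ?thesis by simp
 qed
 ultimately have "complex_of_real (LINT w|M. er w * indicator A (V w)) = complex_of_real (LINT w|M. er w) * complex_of_real (LINT w|M. indicator A (V w))"
  unfolding p_def e by (simp only: integral_complex_of_real) simp
 hence "(LINT w|M. er w * indicator A (V w)) = (LINT w|M. er w) * (LINT w|M. indicator A (V w))"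
  by (simp only: of_real_mult[symmetric] of_real_eq_iff)
 thus ?thesis by (simp add: er_def)
qed

definition coords :: "nat => (nat => real) measure" where "coords k = PiM {..<k} (\<lambda>_. borel)"

text \<open>Boxes generate the product \<open>\<sigma>\<close>-algebra, so the factorisation on boxes identifies the joint law.\<close>

lemma gsp_uncorrelated_law:
 fixes G :: "nat => 'w => real"
 assumes V: "V \<in> gsp" and G: "\<And>i. i < k ==> G i \<in> gsp"
  and orth: "\<And>i. i < k ==> (LINT w|M. V w * G i w) = 0"
 shows "distr M borel V \<Otimes>\<^sub>M distr M (coords k) (\<lambda>w. \<lambda>i\<in>{..<k}. G i w)
  = distr M (borel \<Otimes>\<^sub>M coords k) (\<lambda>w. (V w, \<lambda>i\<in>{..<k}. G i w))"
proof -
 define \<Gamma> where "\<Gamma> w = (\<lambda>i\<in>{..<k}. G i w)" for w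
 have V' [measurable]: "V \<in> borel_measurable M" using V by (rule gsp_measurable)
 have mG: "\<And>i. i < k ==> G i \<in> borel_measurable M" using G gsp_measurable by blast
 have \<Gamma> [measurable]: "\<Gamma> \<in> M \<rightarrow>\<^sub>M coords k" unfolding \<Gamma>_def[abs_def] coords_def using mG by (intro measurable_restrict) auto
 interpret PV: prob_space "distr M borel V" by (rule prob_space_distr) measurable
 interpret PG: prob_space "distr M (coords k) \<Gamma>" by (rule prob_space_distr) measurable
 have "distr M borel V \<Otimes>\<^sub>M distr M (coords k) \<Gamma> = distr M (borel \<Otimes>\<^sub>M coords k) (\<lambda>w. (V w, \<Gamma> w))"
 proof (rule pair_measure_eqI)
  show "sigma_finite_measure (distr M borel V)" "sigma_finite_measure (distr M (coords k) \<Gamma>)" by unfold_locales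
  show "sets (distr M borel V \<Otimes>\<^sub>M distr M (coords k) \<Gamma>) = sets (distr M (borel \<Otimes>\<^sub>M coords k) (\<lambda>w. (V w, \<Gamma> w)))"
   by (simp cong: sets_pair_measure_cong)
  fix A D assume "A \<in> sets (distr M borel V)" "D \<in> sets (distr M (coords k) \<Gamma>)"
  hence A [measurable]: "A \<in> sets borel" and D [measurable]: "D \<in> sets (coords k)" by auto
  define q where "q = emeasure M (V -` A \<inter> space M)"
  define \<mu>1 where "\<mu>1 = distr (density M (\<lambda>w. indicator A (V w))) (coords k) \<Gamma>"
  define \<mu>2 where "\<mu>2 = scale_measure q (distr M (coords k) \<Gamma>)"
  have e1: "emeasure \<mu>1 D = emeasure M (V -` A \<inter> \<Gamma> -` D \<inter> space M)" if [measurable]: "D \<in> sets (coords k)" for D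
  proof -
   have "emeasure \<mu>1 D = (\<integral>\<^sup>+w. indicator A (V w) * indicator (\<Gamma> -` D \<inter> space M) w \<partial>M)"
    unfolding \<mu>1_def by (subst emeasure_distr) (auto simp: emeasure_density)
   also have "... = (\<integral>\<^sup>+w. indicator (V -` A \<inter> \<Gamma> -` D \<inter> space M) w \<partial>M)"
    by (intro nn_integral_cong) (auto simp: indicator_def)
   also have "... = emeasure M (V -` A \<inter> \<Gamma> -` D \<inter> space M)"
    by (rule nn_integral_indicator) measurable
   finally show ?thesis .
  qed
  have e2: "emeasure \<mu>2 D = q * emeasure M (\<Gamma> -` D \<inter> space M)" if [measurable]: "D \<in> sets (coords k)" for D
   unfolding \<mu>2_def by (simp add: emeasure_distr)
  have "\<mu>1 = \<mu>2"
  proof (rule measure_eqI_PiM_finite[of "{..<k}"])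
   show "sets \<mu>1 = sets (PiM {..<k} (\<lambda>_. borel))" "sets \<mu>2 = sets (PiM {..<k} (\<lambda>_. borel))"
    by (auto simp: \<mu>1_def \<mu>2_def coords_def)
   fix A' :: "nat => real set" assume A': "\<And>i. i \<in> {..<k} ==> A' i \<in> sets borel"
   have box: "Pi\<^sub>E {..<k} A' \<in> sets (coords k)" unfolding coords_def using A' by (intro sets_PiM_I_finite) auto
   note [measurable] = box
   have pr: "(\<Prod>i<k. indicator (A' i) (G i w)) = (indicator (\<Gamma> -` Pi\<^sub>E {..<k} A' \<inter> space M) w :: real)" if "w \<in> space M" for w
   proof (cases "\<forall>i<k. G i w \<in> A' i")
    case True thus ?thesis using that by (auto simp: \<Gamma>_def)
   next
    case False
    then obtain i where "i < k" "G i w \<notin> A' i" by auto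
    hence "\<Gamma> w \<notin> Pi\<^sub>E {..<k} A'" by (auto simp: \<Gamma>_def PiE_def Pi_def)
    moreover have "(\<Prod>i<k. indicator (A' i) (G i w)) = (0 :: real)"
     using \<open>i < k\<close> \<open>G i w \<notin> A' i\<close> by (intro prod_zero bexI[of _ i]) auto
    ultimately show ?thesis by simp
   qed
   have "measure M (V -` A \<inter> \<Gamma> -` Pi\<^sub>E {..<k} A' \<inter> space M) = (LINT w|M. (\<Prod>i<k. indicator (A' i) (G i w)) * indicator A (V w))"
   proof -
    have "(LINT w|M. (\<Prod>i<k. indicator (A' i) (G i w)) * indicator A (V w)) = (LINT w|M. indicator (V -` A \<inter> \<Gamma> -` Pi\<^sub>E {..<k} A' \<inter> space M) w :: real)"
    proof (intro Bochner_Integration.integral_cong refl)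
     fix w assume w: "w \<in> space M"
     show "(\<Prod>i<k. indicator (A' i) (G i w)) * indicator A (V w) = (indicator (V -` A \<inter> \<Gamma> -` Pi\<^sub>E {..<k} A' \<inter> space M) w :: real)"
      unfolding pr[OF w] by (auto simp: indicator_def)
    qed
    also have "... = measure M (V -` A \<inter> \<Gamma> -` Pi\<^sub>E {..<k} A' \<inter> space M)" by (simp add: Int_assoc)
    finally show ?thesis ..
   qed
   moreover have "measure M (\<Gamma> -` Pi\<^sub>E {..<k} A' \<inter> space M) = (LINT w|M. (\<Prod>i<k. indicator (A' i) (G i w)))"
   proof -
    have "(LINT w|M. (\<Prod>i<k. indicator (A' i) (G i w))) = (LINT w|M. indicator (\<Gamma> -` Pi\<^sub>E {..<k} A' \<inter> space M) w :: real)"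
     by (intro Bochner_Integration.integral_cong refl pr)
    also have "... = measure M (\<Gamma> -` Pi\<^sub>E {..<k} A' \<inter> space M)" by (simp add: Int_assoc)
    finally show ?thesis ..
   qed
   moreover have "measure M (V -` A \<inter> space M) = (LINT w|M. indicator A (V w))"
   proof -
    have "(LINT w|M. indicator A (V w)) = (LINT w|M. indicator (V -` A \<inter> space M) w :: real)"
     by (intro Bochner_Integration.integral_cong refl) (auto simp: indicator_def)
    also have "... = measure M (V -` A \<inter> space M)" by (simp add: Int_assoc)
    finally show ?thesis ..
   qed
   ultimately have "measure M (V -` A \<inter> \<Gamma> -` Pi\<^sub>E {..<k} A' \<inter> space M) = measure M (V -` A \<inter> space M) * measure M (\<Gamma> -` Pi\<^sub>E {..<k} A' \<inter> space M)"
    using gsp_uncorrelated_box[where G=G and k=k and A'=A', OF V G orth A] A' by (simp add: mult.commute)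
   thus "emeasure \<mu>1 (Pi\<^sub>E {..<k} A') = emeasure \<mu>2 (Pi\<^sub>E {..<k} A')"
    unfolding e1[OF box] e2[OF box] q_def emeasure_eq_measure by (simp add: ennreal_mult'[symmetric])
  next
   show "range (\<lambda>_::nat. space (PiM {..<k} (\<lambda>_. borel :: real measure))) \<subseteq> prod_algebra {..<k} (\<lambda>_. borel)"
    by (auto simp: space_PiM intro!: prod_algebraI_finite)
   show "(\<Union>i::nat. space (PiM {..<k} (\<lambda>_. borel :: real measure))) = space (PiM {..<k} (\<lambda>_. borel))" by simp
   have "emeasure \<mu>1 (space (coords k)) \<noteq> \<infinity>" by (subst e1) (auto simp: less_top[symmetric])
   thus "emeasure \<mu>1 (space (PiM {..<k} (\<lambda>_. borel))) \<noteq> \<infinity>" by (simp add: coords_def)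
  qed simp
  hence "emeasure \<mu>1 D = emeasure \<mu>2 D" by simp
  hence "emeasure M (V -` A \<inter> \<Gamma> -` D \<inter> space M) = q * emeasure M (\<Gamma> -` D \<inter> space M)" by (simp add: e1 e2)
  moreover have "emeasure (distr M (borel \<Otimes>\<^sub>M coords k) (\<lambda>w. (V w, \<Gamma> w))) (A \<times> D) = emeasure M (V -` A \<inter> \<Gamma> -` D \<inter> space M)"
   by (subst emeasure_distr) (auto intro!: arg_cong[where f="emeasure M"])
  ultimately show "emeasure (distr M borel V) A * emeasure (distr M (coords k) \<Gamma>) D = emeasure (distr M (borel \<Otimes>\<^sub>M coords k) (\<lambda>w. (V w, \<Gamma> w))) (A \<times> D)"
   by (simp add: emeasure_distr q_def)
 qed
 thus ?thesis by (simp add: \<Gamma>_def[abs_def])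
qed

text \<open>The vector of the first \<open>k\<close> variables, padded with zeros as in \<open>gauss_args\<close>.\<close>

definition vec :: "nat => (nat => 'w => real) => 'w => nat => real" where
 "vec k G w i = (if i < k then G i w else 0)"

lemma vec_measurable: "(\<And>i. i < k ==> G i \<in> borel_measurable M) ==> vec k G \<in> borel_measurable M"
proof (rule measurable_coordinatewise_then_product)
 fix i assume "\<And>i. i < k ==> G i \<in> borel_measurable M"
 thus "(\<lambda>w. vec k G w i) \<in> borel_measurable M" by (cases "i < k") (auto simp: vec_def)
qed

lemma sum_power_le:
 fixes a :: "'i => real"
 assumes "finite I" "I \<noteq> {}" "\<And>i. i \<in> I ==> 0 \<le> a i"
 shows "(\<Sum>i\<in>I. a i) ^ m \<le> real (card I) ^ m * (\<Sum>i\<in>I. a i ^ m)"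
proof -
 define x where "x = Max (a ` I)"
 have "x \<in> a ` I" unfolding x_def using assms by (intro Max_in) auto
 then obtain j where j: "j \<in> I" "x = a j" by auto
 have le: "a i \<le> x" if "i \<in> I" for i unfolding x_def using that assms by (intro Max_ge) auto
 have "(\<Sum>i\<in>I. a i) \<le> real (card I) * x" using sum_bounded_above[of I a x] le by simp
 hence "(\<Sum>i\<in>I. a i) ^ m \<le> (real (card I) * x) ^ m" using assms by (intro power_mono sum_nonneg) auto
 also have "... = real (card I) ^ m * a j ^ m" by (simp add: power_mult_distrib j)
 also have "... \<le> real (card I) ^ m * (\<Sum>i\<in>I. a i ^ m)"
  using assms j by (intro mult_left_mono member_le_sum) auto
 finally show ?thesis .
qed

lemma gsp_abs_power_integrable: "Y \<in> gsp ==> integrable M (\<lambda>w. \<bar>Y w\<bar> ^ m)"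
proof -
 assume Y: "Y \<in> gsp"
 have [measurable]: "Y \<in> borel_measurable M" by (rule gsp_measurable[OF Y])
 show ?thesis
 proof (rule Bochner_Integration.integrable_bound[of _ "\<lambda>w. 1 + Y w ^ (2 * m)"])
  show "integrable M (\<lambda>w. 1 + Y w ^ (2 * m))" using gsp_moment(1)[OF Y] by simp
  have "\<bar>y\<bar> ^ m \<le> 1 + y ^ (2 * m)" for y :: real
  proof -
   have "(\<bar>y\<bar> ^ m)^2 = y ^ (2 * m)" by (metis power_even_abs power_mult mult.commute even_mult_iff even_numeral)
   moreover have "0 \<le> (\<bar>y\<bar> ^ m - 1)^2" by simp
   ultimately have "2 * \<bar>y\<bar> ^ m \<le> 1 + y ^ (2 * m)" by (simp add: power2_diff)
   moreover have "0 \<le> \<bar>y\<bar> ^ m" by simp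
   ultimately show ?thesis by linarith
  qed
  thus "AE w in M. norm (\<bar>Y w\<bar> ^ m) \<le> norm (1 + Y w ^ (2 * m))" by (auto simp: power_mult)
 qed measurable
qed

lemma poly_growth_sqint:
 fixes G :: "nat => 'w => real"
 assumes G: "\<And>i. i < k ==> G i \<in> gsp" and [measurable]: "g \<in> borel_measurable borel"
  and b: "\<And>x. \<bar>g x\<bar> \<le> C * (1 + (\<Sum>i<k. \<bar>x i\<bar>)) ^ m"
 shows "sqint M (\<lambda>w. g (vec k G w))"
proof -
 have C: "C \<ge> 0" using b[of "\<lambda>_. 0"] by simp
 have [measurable]: "vec k G \<in> borel_measurable M" using G gsp_measurable by (intro vec_measurable) auto
 have "integrable M (\<lambda>w. (g (vec k G w))^2)"
 proof (rule Bochner_Integration.integrable_bound)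
  show "integrable M (\<lambda>w. C^2 * (real (Suc k) ^ (2 * m) * (1 + (\<Sum>i<k. \<bar>G i w\<bar> ^ (2 * m)))))"
   using G by (intro integrable_mult_right Bochner_Integration.integrable_add Bochner_Integration.integrable_sum gsp_abs_power_integrable) auto
  show "AE w in M. norm ((g (vec k G w))^2) \<le> norm (C^2 * (real (Suc k) ^ (2 * m) * (1 + (\<Sum>i<k. \<bar>G i w\<bar> ^ (2 * m)))))"
  proof (intro AE_I2)
   fix w
   have "(g (vec k G w))^2 \<le> (C * (1 + (\<Sum>i<k. \<bar>vec k G w i\<bar>)) ^ m)^2"
    using b[of "vec k G w"] by (metis abs_ge_zero power2_abs power_mono)
   also have "... = C^2 * (1 + (\<Sum>i<k. \<bar>G i w\<bar>)) ^ (2 * m)"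
    by (simp add: vec_def power_mult_distrib power_mult[symmetric] mult.commute)
   also have "(1 + (\<Sum>i<k. \<bar>G i w\<bar>)) ^ (2 * m) \<le> real (Suc k) ^ (2 * m) * (1 + (\<Sum>i<k. \<bar>G i w\<bar> ^ (2 * m)))"
   proof -
    have "(\<Sum>i<Suc k. if i = k then 1 else \<bar>G i w\<bar>) ^ (2 * m) \<le> real (card {..<Suc k}) ^ (2 * m) * (\<Sum>i<Suc k. (if i = k then 1 else \<bar>G i w\<bar>) ^ (2 * m))"
     by (rule sum_power_le) auto
    thus ?thesis by (simp add: add.commute)
   qed
   finally have "(g (vec k G w))^2 \<le> C^2 * (real (Suc k) ^ (2 * m) * (1 + (\<Sum>i<k. \<bar>G i w\<bar> ^ (2 * m))))"
    by (simp add: mult_left_mono)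
   thus "norm ((g (vec k G w))^2) \<le> norm (C^2 * (real (Suc k) ^ (2 * m) * (1 + (\<Sum>i<k. \<bar>G i w\<bar> ^ (2 * m)))))" by simp
  qed
 qed measurable
 thus ?thesis by (simp add: sqint_def)
qed

text \<open>One derivative suffices for the integration by parts. Unlike smoothness, this class is verified directly for the
  product of \<open>f\<close> with a further coordinate.\<close>

definition (in -) C1_poly :: "nat => ((nat => real) => real) => bool" where
 "C1_poly k f \<longleftrightarrow> (\<forall>x y. (\<forall>i<k. x i = y i) \<longrightarrow> f x = f y) \<and> continuous_on UNIV f \<and>
   (\<forall>i<k. continuous_on UNIV (pdiff i f) \<and> (\<forall>x. (\<lambda>s. f (x(i := s))) differentiable at (x i))) \<and>
   (\<exists>C m. \<forall>x. \<bar>f x\<bar> \<le> C * (1 + (\<Sum>i<k. \<bar>x i\<bar>)) ^ m \<and> (\<forall>i<k. \<bar>pdiff i f x\<bar> \<le> C * (1 + (\<Sum>i<k. \<bar>x i\<bar>)) ^ m))"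

text \<open>Integration by parts, first against a direction of variance one: the component of the
  vector along \<open>V\<close> is split off, the rest is independent of \<open>V\<close>, and Stein's identity applies
  on the line in the direction of the covariances.\<close>

lemma gaussian_ibp_unit:
 assumes f: "C1_poly k f" and G: "\<And>i. i < k ==> G i \<in> gsp" and V: "V \<in> gsp" and V1: "(LINT w|M. (V w)^2) = 1"
 shows "(LINT w|M. f (vec k G w) * V w) = (\<Sum>i<k. (LINT w|M. pdiff i f (vec k G w)) * (LINT w|M. G i w * V w))"
proof -
 obtain C m where b: "\<And>x. \<bar>f x\<bar> \<le> C * (1 + (\<Sum>i<k. \<bar>x i\<bar>)) ^ m" "\<And>i x. i < k ==> \<bar>pdiff i f x\<bar> \<le> C * (1 + (\<Sum>i<k. \<bar>x i\<bar>)) ^ m"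
  using f unfolding C1_poly_def by blast
 have C: "C \<ge> 0" using b(1)[of "\<lambda>_. 0"] by simp
 have dep: "\<And>x y. (\<And>i. i < k ==> x i = y i) ==> f x = f y" using f unfolding C1_poly_def by blast
 have cont: "continuous_on UNIV f" "\<And>i. i < k ==> continuous_on UNIV (pdiff i f)" using f by (auto simp: C1_poly_def)
 have diff: "\<And>i x. i < k ==> (\<lambda>s. f (x(i := s))) differentiable at (x i)" using f by (auto simp: C1_poly_def)
 have mf [measurable]: "f \<in> borel_measurable borel" "\<And>i. i < k ==> pdiff i f \<in> borel_measurable borel"
  using cont by (auto intro: borel_measurable_continuous_onI)
 have Vm [measurable]: "V \<in> borel_measurable M" by (rule gsp_measurable[OF V])
 define c where "c i = (if i < k then LINT w|M. G i w * V w else 0)" for i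
 \<comment> \<open>the component of \<open>G i\<close> orthogonal to \<open>V\<close>\<close>
 define G' where "G' i w = G i w - c i * V w" for i w
 have G': "G' i \<in> gsp" if "i < k" for i unfolding G'_def[abs_def] by (intro gsp_diff gsp_cmult G V that)
 have orth: "(LINT w|M. V w * G' i w) = 0" if "i < k" for i
 proof -
  have "(LINT w|M. V w * G' i w) = (LINT w|M. G i w * V w - c i * (V w)^2)"
   by (intro Bochner_Integration.integral_cong) (auto simp: G'_def algebra_simps power2_eq_square)
  also have "... = c i - c i * 1"
   using sqint_mult[OF gsp_sqint[OF G[OF that]] gsp_sqint[OF V]] sqint_sq[OF gsp_sqint[OF V]] that V1 by (simp add: c_def)
  finally show ?thesis by simp
 qed
 define \<Gamma> where "\<Gamma> w = (\<lambda>i\<in>{..<k}. G' i w)" for w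
 have \<Gamma> [measurable]: "\<Gamma> \<in> M \<rightarrow>\<^sub>M coords k"
  unfolding \<Gamma>_def[abs_def] coords_def using gsp_measurable[OF G'] by (intro measurable_restrict) auto
 have std: "distr M borel V = std_normal_distribution" using gsp_standardize[OF V V1[symmetric]] by simp
 define LG where "LG = distr M (coords k) \<Gamma>"
 have law: "std_normal_distribution \<Otimes>\<^sub>M LG = distr M (borel \<Otimes>\<^sub>M coords k) (\<lambda>w. (V w, \<Gamma> w))"
  using gsp_uncorrelated_law[where G=G' and k=k, OF V G' orth] by (simp add: std LG_def \<Gamma>_def[abs_def])
 interpret N: prob_space std_normal_distribution using real_dist_normal_dist by (simp add: real_distribution_def)
 interpret LG: prob_space LG unfolding LG_def by (rule prob_space_distr) measurable
 interpret pair_sigma_finite std_normal_distribution LG ..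
 \<comment> \<open>For fixed orthogonal component, \<open>G\<close> runs through a line in the direction of the covariances.\<close>
 define pt where "pt v g i = (if i < k then g i else 0) + v * c i" for v :: real and g :: "nat => real" and i
 have pt: "pt (V w) (\<Gamma> w) = vec k G w" for w by (auto simp: pt_def \<Gamma>_def vec_def G'_def c_def)
 have mpt [measurable]: "(\<lambda>p. pt (fst p) (snd p)) \<in> borel \<Otimes>\<^sub>M coords k \<rightarrow>\<^sub>M borel"
 proof (rule measurable_coordinatewise_then_product)
  fix i
  show "(\<lambda>p. pt (fst p) (snd p) i) \<in> borel_measurable (borel \<Otimes>\<^sub>M coords k)"
  proof (cases "i < k")
   case True
   have "(\<lambda>g. g i) \<in> coords k \<rightarrow>\<^sub>M borel" unfolding coords_def using True by (intro measurable_component_singleton) auto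
   from measurable_compose[OF measurable_snd this] have [measurable]: "(\<lambda>p. snd p i) \<in> borel \<Otimes>\<^sub>M coords k \<rightarrow>\<^sub>M borel" .
   show ?thesis using True unfolding pt_def by simp
  qed (simp add: pt_def)
 qed
 define \<Psi>1 where "\<Psi>1 p = f (pt (fst p) (snd p)) * fst p" for p
 define \<Psi>2 where "\<Psi>2 p = (\<Sum>i<k. c i * pdiff i f (pt (fst p) (snd p)))" for p
 have [measurable]: "\<Psi>1 \<in> borel_measurable (borel \<Otimes>\<^sub>M coords k)" unfolding \<Psi>1_def[abs_def] by measurable
 have [measurable]: "\<Psi>2 \<in> borel_measurable (borel \<Otimes>\<^sub>M coords k)" unfolding \<Psi>2_def[abs_def]
  by (intro borel_measurable_sum borel_measurable_times measurable_compose[OF mpt mf(2)]) auto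
 have sf: "sqint M (\<lambda>w. f (vec k G w))" by (rule poly_growth_sqint[OF G mf(1) b(1)])
 have sp: "sqint M (\<lambda>w. pdiff i f (vec k G w))" if "i < k" for i by (rule poly_growth_sqint[OF G mf(2)[OF that] b(2)[OF that]])
 have m2: "(\<lambda>w. (V w, \<Gamma> w)) \<in> M \<rightarrow>\<^sub>M borel \<Otimes>\<^sub>M coords k" by measurable
 have i1: "integrable (std_normal_distribution \<Otimes>\<^sub>M LG) (\<lambda>(v, g). \<Psi>1 (v, g))"
  unfolding law by (subst integrable_distr_eq[OF m2]) (auto simp: \<Psi>1_def pt intro!: sqint_mult sf gsp_sqint[OF V])
 have i2: "integrable (std_normal_distribution \<Otimes>\<^sub>M LG) (\<lambda>(v, g). \<Psi>2 (v, g))"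
  unfolding law by (subst integrable_distr_eq[OF m2])
   (auto simp: \<Psi>2_def pt intro!: Bochner_Integration.integrable_sum integrable_mult_right sqint_integrable sp)
 have "(LINT w|M. f (vec k G w) * V w) = (LINT p|(std_normal_distribution \<Otimes>\<^sub>M LG). (\<lambda>(v, g). \<Psi>1 (v, g)) p)"
  unfolding law by (subst integral_distr[OF m2]) (auto simp: \<Psi>1_def pt)
 also have "... = (LINT g|LG. (LINT v|std_normal_distribution. \<Psi>1 (v, g)))" by (rule integral_snd[OF i1, symmetric])
 also have "... = (LINT g|LG. (LINT v|std_normal_distribution. \<Psi>2 (v, g)))"
 proof (rule Bochner_Integration.integral_cong[OF refl])
  fix g
  define K where "K = 1 + (\<Sum>i<k. \<bar>g i\<bar>) + (\<Sum>i<k. \<bar>c i\<bar>)"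
  have K: "(\<Sum>i<k. \<bar>c i\<bar>) \<ge> 0" "(\<Sum>i<k. \<bar>g i\<bar>) \<ge> 0" by (auto intro: sum_nonneg)
  have grow: "(1 + (\<Sum>i<k. \<bar>pt v g i\<bar>)) ^ m \<le> K ^ m * (1 + \<bar>v\<bar>) ^ m" for v
  proof -
   have "(\<Sum>i<k. \<bar>pt v g i\<bar>) \<le> (\<Sum>i<k. \<bar>g i\<bar> + \<bar>v\<bar> * \<bar>c i\<bar>)"
    by (intro sum_mono) (auto simp: pt_def abs_mult[symmetric] intro!: abs_triangle_ineq[THEN order_trans])
   also have "... = (\<Sum>i<k. \<bar>g i\<bar>) + \<bar>v\<bar> * (\<Sum>i<k. \<bar>c i\<bar>)" by (simp add: sum.distrib sum_distrib_left)
   finally have "1 + (\<Sum>i<k. \<bar>pt v g i\<bar>) \<le> 1 + (\<Sum>i<k. \<bar>g i\<bar>) + \<bar>v\<bar> * (\<Sum>i<k. \<bar>c i\<bar>)" by simp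
   also have "... \<le> K * (1 + \<bar>v\<bar>)" using K by (simp add: K_def algebra_simps)
   finally show ?thesis unfolding power_mult_distrib[symmetric] by (intro power_mono add_nonneg_nonneg sum_nonneg) auto
  qed
  define CC where "CC = (C * K ^ m) * (1 + (\<Sum>i<k. \<bar>c i\<bar>))"
  have CK: "C * K ^ m \<ge> 0" using C K by (auto simp: K_def)
  have CC: "C * K ^ m \<le> CC" using mult_left_mono[OF _ CK, of 1 "1 + (\<Sum>i<k. \<bar>c i\<bar>)"] K by (simp add: CC_def)
  have bf: "\<bar>F\<bar> \<le> C * K ^ m * (1 + \<bar>v\<bar>) ^ m" if "\<bar>F\<bar> \<le> C * (1 + (\<Sum>i<k. \<bar>pt v g i\<bar>)) ^ m" for F v
   using order_trans[OF that mult_left_mono[OF grow[of v] C]] by (simp add: mult.assoc)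
  have "(LINT v|std_normal_distribution. f (pt v g) * v) = (LINT v|std_normal_distribution. \<Psi>2 (v, g))"
  proof (rule stein_identity)
   show "((\<lambda>v. f (pt v g)) has_real_derivative \<Psi>2 (v, g)) (at v)" for v
    unfolding pt_def \<Psi>2_def fst_conv snd_conv by (rule chain_rule_line[OF dep diff cont(2)])
   show "continuous_on UNIV (\<lambda>v. \<Psi>2 (v, g))"
    unfolding \<Psi>2_def fst_conv snd_conv
   proof (intro continuous_intros)
    fix i assume "i \<in> {..<k}"
    moreover have "continuous_on UNIV (\<lambda>v. pt v g)" unfolding pt_def by (intro continuous_intros)
    ultimately show "continuous_on UNIV (\<lambda>v. pdiff i f (pt v g))"
     using continuous_on_compose2[OF cont(2)[of i], of UNIV "\<lambda>v. pt v g"] by auto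
   qed
   fix v
   show "\<bar>f (pt v g)\<bar> \<le> CC * (1 + \<bar>v\<bar>) ^ m"
    using bf[OF b(1)] mult_right_mono[OF CC, of "(1 + \<bar>v\<bar>) ^ m"] by (meson order_trans zero_le_power abs_ge_zero add_nonneg_nonneg zero_le_one)
   have "\<bar>\<Psi>2 (v, g)\<bar> \<le> (\<Sum>i<k. \<bar>c i\<bar> * (C * K ^ m * (1 + \<bar>v\<bar>) ^ m))"
    unfolding \<Psi>2_def fst_conv snd_conv
    by (rule order_trans[OF sum_abs]) (auto simp: abs_mult intro!: sum_mono mult_left_mono bf b(2))
   also have "... = (\<Sum>i<k. \<bar>c i\<bar>) * (C * K ^ m * (1 + \<bar>v\<bar>) ^ m)" by (simp add: sum_distrib_right)
   also have "... \<le> (1 + (\<Sum>i<k. \<bar>c i\<bar>)) * (C * K ^ m * (1 + \<bar>v\<bar>) ^ m)"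
    by (rule mult_right_mono[OF _ mult_nonneg_nonneg[OF CK]]) auto
   finally show "\<bar>\<Psi>2 (v, g)\<bar> \<le> CC * (1 + \<bar>v\<bar>) ^ m" by (simp add: CC_def mult_ac)
  qed
  thus "(LINT v|std_normal_distribution. \<Psi>1 (v, g)) = (LINT v|std_normal_distribution. \<Psi>2 (v, g))" by (simp add: \<Psi>1_def)
 qed
 also have "... = (LINT p|(std_normal_distribution \<Otimes>\<^sub>M LG). (\<lambda>(v, g). \<Psi>2 (v, g)) p)" by (rule integral_snd[OF i2])
 also have "... = (LINT w|M. (\<Sum>i<k. c i * pdiff i f (vec k G w)))"
  unfolding law by (subst integral_distr[OF m2]) (auto simp: \<Psi>2_def pt)
 also have "... = (\<Sum>i<k. c i * (LINT w|M. pdiff i f (vec k G w)))"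
  by (subst Bochner_Integration.integral_sum) (auto intro!: sqint_integrable sp)
 also have "... = (\<Sum>i<k. (LINT w|M. pdiff i f (vec k G w)) * (LINT w|M. G i w * V w))"
  by (intro sum.cong) (auto simp: c_def)
 finally show ?thesis .
qed

lemma gaussian_ibp:
 assumes f: "C1_poly k f" and G: "\<And>i. i < k ==> G i \<in> gsp" and V: "V \<in> gsp"
 shows "(LINT w|M. f (vec k G w) * V w) = (\<Sum>i<k. (LINT w|M. pdiff i f (vec k G w)) * (LINT w|M. G i w * V w))"
proof -
 define v where "v = (LINT w|M. (V w)^2)"
 have [measurable]: "V \<in> borel_measurable M" by (rule gsp_measurable[OF V])
 show ?thesis
 proof (cases "v = 0")
  case True
  have AE: "AE w in M. V w = 0" using integral_square_eq_0[OF gsp_sqint[OF V]] True by (simp add: v_def)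
  hence z: "(LINT w|M. F w * V w) = 0" for F :: "'w => real" by (intro integral_eq_zero_AE) auto
  show ?thesis by (simp add: z)
 next
  case False
  moreover have "v \<ge> 0" by (simp add: v_def)
  ultimately have v: "v > 0" by simp
  define W where "W w = (1 / sqrt v) * V w" for w
  have W: "W \<in> gsp" unfolding W_def[abs_def] by (rule gsp_cmult[OF V])
  have W1: "(LINT w|M. (W w)^2) = 1" using v by (simp add: W_def power_divide v_def[symmetric])
  have VW: "V w = sqrt v * W w" for w using v by (simp add: W_def)
  have mv: "(LINT w|M. F w * V w) = sqrt v * (LINT w|M. F w * W w)" for F :: "'w => real"
   unfolding VW by (simp add: mult.left_commute[of _ "sqrt v"])
  have "(LINT w|M. f (vec k G w) * V w) = sqrt v * (\<Sum>i<k. (LINT w|M. pdiff i f (vec k G w)) * (LINT w|M. G i w * W w))"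
   by (simp only: mv gaussian_ibp_unit[OF f G W W1])
  also have "... = (\<Sum>i<k. (LINT w|M. pdiff i f (vec k G w)) * (LINT w|M. G i w * V w))"
   unfolding sum_distrib_left by (intro sum.cong refl) (simp only: mv mult.left_commute)
  finally show ?thesis .
 qed
qed

end

section \<open>Uniqueness of the divergence\<close>

lemma trig_has_derivative:
 fixes c :: "nat => real"
 assumes "i < k"
 shows "((\<lambda>s. a * cos (\<Sum>j<k. c j * (x(i := s)) j) + b * sin (\<Sum>j<k. c j * (x(i := s)) j)) has_real_derivative
  (b * c i) * cos (\<Sum>j<k. c j * (x(i := s)) j) + (- a * c i) * sin (\<Sum>j<k. c j * (x(i := s)) j)) (at s)"
proof -
 have e: "(\<Sum>j<k. c j * (x(i := s)) j) = c i * s + (\<Sum>j\<in>{..<k} - {i}. c j * x j)" for s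
  using assms by (subst sum.remove[of "{..<k}" i]) auto
 show ?thesis unfolding e by (auto intro!: derivative_eq_intros simp: algebra_simps)
qed

text \<open>This family is closed under partial derivatives, and contains the real and imaginary parts of the exponentials.\<close>

definition trig :: "nat => (nat => real) => real => real => (nat => real) => real" where
 "trig k c a b x = a * cos (\<Sum>j<k. c j * x j) + b * sin (\<Sum>j<k. c j * x j)"

lemma pdiff_trig: "i < k ==> pdiff i (trig k c a b) = trig k c (b * c i) (- a * c i)"
proof
 fix x assume i: "i < k"
 have "deriv (\<lambda>s. trig k c a b (x(i := s))) (x i) = trig k c (b * c i) (- a * c i) (x(i := x i))"
  unfolding trig_def by (rule DERIV_imp_deriv[OF trig_has_derivative[OF i]])
 thus "pdiff i (trig k c a b) x = trig k c (b * c i) (- a * c i) x" by (simp add: pdiff_def)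
qed

lemma smooth_trig: "smooth_poly_growth k (trig k c a b)"
proof -
 have cl: "\<exists>a' b'. foldr pdiff is (trig k c a b) = trig k c a' b'" if "set is \<subseteq> {..<k}" for "is"
  using that by (induction "is") (auto simp: pdiff_trig, metis)
 show ?thesis unfolding smooth_poly_growth_def
 proof (intro conjI allI impI)
  fix x y :: "nat => real" assume "\<forall>i<k. x i = y i"
  hence "(\<Sum>j<k. c j * x j) = (\<Sum>j<k. c j * y j)" by (intro sum.cong) auto
  thus "trig k c a b x = trig k c a b y" by (simp add: trig_def)
 next
  fix "is" assume "set is \<subseteq> {..<k}"
  from cl[OF this] obtain a' b' where e: "foldr pdiff is (trig k c a b) = trig k c a' b'" by blast
  show "continuous_on UNIV (foldr pdiff is (trig k c a b))"
   unfolding e unfolding trig_def[abs_def] by (intro continuous_intros continuous_on_product_coordinates)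
  show "(\<lambda>s. foldr pdiff is (trig k c a b) (x(i := s))) differentiable at (x i)" if "i < k" for i x
   unfolding e unfolding trig_def using trig_has_derivative[OF that] real_differentiable_def by blast
  have "\<bar>trig k c a' b' x\<bar> \<le> \<bar>a'\<bar> + \<bar>b'\<bar>" for x
  proof -
   have "\<bar>trig k c a' b' x\<bar> \<le> \<bar>a'\<bar> * \<bar>cos (\<Sum>j<k. c j * x j)\<bar> + \<bar>b'\<bar> * \<bar>sin (\<Sum>j<k. c j * x j)\<bar>"
    unfolding trig_def by (rule order_trans[OF abs_triangle_ineq]) (simp add: abs_mult)
   also have "... \<le> \<bar>a'\<bar> * 1 + \<bar>b'\<bar> * 1" by (intro add_mono mult_left_mono) auto
   finally show ?thesis by simp
  qed
  thus "\<exists>C m. \<forall>x. \<bar>foldr pdiff is (trig k c a b) x\<bar> \<le> C * (1 + (\<Sum>i<k. \<bar>x i\<bar>)) ^ m"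
   unfolding e by (intro exI[of _ "\<bar>a'\<bar> + \<bar>b'\<bar>"] exI[of _ 0]) simp
 qed
qed

lemma smooth_C1_poly:
 assumes "smooth_poly_growth k f" shows "C1_poly k f"
proof -
 have *: "continuous_on UNIV (foldr pdiff is f)" "\<And>i x. i < k ==> (\<lambda>s. foldr pdiff is f (x(i := s))) differentiable at (x i)"
  "\<exists>C m. \<forall>x. \<bar>foldr pdiff is f x\<bar> \<le> C * (1 + (\<Sum>i<k. \<bar>x i\<bar>)) ^ m" if "set is \<subseteq> {..<k}" for "is"
  using assms that unfolding smooth_poly_growth_def by blast+
 have g: "\<exists>C m. \<forall>x. \<bar>pdiff i f x\<bar> \<le> C * (1 + (\<Sum>i<k. \<bar>x i\<bar>)) ^ m" if "i < k" for i
  using *(3)[of "[i]"] that by simp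
 obtain C0 m0 where 0: "\<And>x. \<bar>f x\<bar> \<le> C0 * (1 + (\<Sum>i<k. \<bar>x i\<bar>)) ^ m0" using *(3)[of "[]"] by auto
 obtain C m where 1: "\<And>i x. i < k ==> \<bar>pdiff i f x\<bar> \<le> C i * (1 + (\<Sum>i<k. \<bar>x i\<bar>)) ^ m i" using g by metis
 define CC where "CC = \<bar>C0\<bar> + (\<Sum>i<k. \<bar>C i\<bar>)"
 define mm where "mm = m0 + (\<Sum>i<k. m i)"
 have le: "c * (1 + (\<Sum>i<k. \<bar>x i\<bar>)) ^ n \<le> CC * (1 + (\<Sum>i<k. \<bar>x i\<bar>)) ^ mm" if "\<bar>c\<bar> \<le> CC" "n \<le> mm" for c n and x :: "nat => real"
  using that by (intro mult_mono power_increasing) (auto intro: sum_nonneg)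
 have ci: "\<bar>C i\<bar> \<le> CC" "m i \<le> mm" if "i < k" for i
 proof -
  have "\<bar>C i\<bar> \<le> (\<Sum>i<k. \<bar>C i\<bar>)" by (rule member_le_sum) (use that in auto)
  thus "\<bar>C i\<bar> \<le> CC" by (simp add: CC_def)
  have "m i \<le> (\<Sum>i<k. m i)" by (rule member_le_sum) (use that in auto)
  thus "m i \<le> mm" by (simp add: mm_def)
 qed
 have c0: "\<bar>C0\<bar> \<le> CC" "m0 \<le> mm" by (auto simp: CC_def mm_def intro: sum_nonneg)
 show ?thesis unfolding C1_poly_def
 proof (intro conjI)
  show "\<forall>x y. (\<forall>i<k. x i = y i) \<longrightarrow> f x = f y" using assms unfolding smooth_poly_growth_def by blast
  show "continuous_on UNIV f" using *(1)[of "[]"] by simp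
  show "\<forall>i<k. continuous_on UNIV (pdiff i f) \<and> (\<forall>x. (\<lambda>s. f (x(i := s))) differentiable at (x i))"
   using *(1)[of "[_]"] *(2)[of "[]"] by auto
  show "\<exists>C m. \<forall>x. \<bar>f x\<bar> \<le> C * (1 + (\<Sum>i<k. \<bar>x i\<bar>)) ^ m \<and> (\<forall>i<k. \<bar>pdiff i f x\<bar> \<le> C * (1 + (\<Sum>i<k. \<bar>x i\<bar>)) ^ m)"
   by (intro exI[of _ CC] exI[of _ mm] allI conjI impI)
    (rule order_trans[OF 0 le[OF c0]], rule order_trans[OF 1 le[OF ci]])
 qed
qed

lemma C1_poly_measurable:
 assumes "C1_poly k f" shows "f \<in> borel_measurable borel" "i < k ==> pdiff i f \<in> borel_measurable borel"
 using assms by (auto simp: C1_poly_def intro: borel_measurable_continuous_onI)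

lemma C1_poly_mult_last:
 assumes f: "C1_poly k f"
 shows "C1_poly (Suc k) (\<lambda>x. f x * x k)" "i < k ==> pdiff i (\<lambda>x. f x * x k) = (\<lambda>x. pdiff i f x * x k)"
  "pdiff k (\<lambda>x. f x * x k) = f"
proof -
 obtain C m where b: "\<And>x. \<bar>f x\<bar> \<le> C * (1 + (\<Sum>i<k. \<bar>x i\<bar>)) ^ m" "\<And>i x. i < k ==> \<bar>pdiff i f x\<bar> \<le> C * (1 + (\<Sum>i<k. \<bar>x i\<bar>)) ^ m"
  using f unfolding C1_poly_def by blast
 have C: "C \<ge> 0" using b(1)[of "\<lambda>_. 0"] by simp
 have dep: "\<And>x y. (\<And>i. i < k ==> x i = y i) ==> f x = f y" using f unfolding C1_poly_def by blast
 have cont: "continuous_on UNIV f" "\<And>i. i < k ==> continuous_on UNIV (pdiff i f)" using f by (auto simp: C1_poly_def)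
 have diff: "\<And>i x. i < k ==> (\<lambda>s. f (x(i := s))) differentiable at (x i)" using f by (auto simp: C1_poly_def)
 have fk: "f (x(k := s)) = f x" for x s by (rule dep) auto
 have d1: "((\<lambda>s. f (x(i := s)) * (x(i := s)) k) has_real_derivative pdiff i f x * x k) (at (x i))" if "i < k" for i x
 proof -
  have k: "(x(i := s)) k = x k" for s using that by auto
  have "((\<lambda>s. f (x(i := s)) * x k) has_real_derivative pdiff i f (x(i := x i)) * x k) (at (x i))"
   by (rule DERIV_cmult_right[OF pdiff_deriv[OF diff[OF that]]])
  thus ?thesis by (simp only: k fun_upd_triv)
 qed
 have d2: "((\<lambda>s. f (x(k := s)) * (x(k := s)) k) has_real_derivative f x) (at (x k))" for x
  unfolding fk by (auto intro!: derivative_eq_intros)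
 show p1: "pdiff i (\<lambda>x. f x * x k) = (\<lambda>x. pdiff i f x * x k)" if "i < k" for i
  using DERIV_imp_deriv[OF d1[OF that]] by (simp add: pdiff_def fun_eq_iff)
 show p2: "pdiff k (\<lambda>x. f x * x k) = f"
  using DERIV_imp_deriv[OF d2] by (simp add: pdiff_def fun_eq_iff)
 have bb: "\<bar>F\<bar> * y \<le> C * (1 + (\<Sum>i<Suc k. \<bar>x i\<bar>)) ^ Suc m"
  if F: "\<bar>F\<bar> \<le> C * (1 + (\<Sum>i<k. \<bar>x i\<bar>)) ^ m" and y: "0 \<le> y" "y \<le> 1 + (\<Sum>i<Suc k. \<bar>x i\<bar>)" for F y x
 proof -
  have "(1 + (\<Sum>i<k. \<bar>x i\<bar>)) ^ m \<le> (1 + (\<Sum>i<Suc k. \<bar>x i\<bar>)) ^ m" by (intro power_mono) (auto intro: sum_nonneg add_nonneg_nonneg)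
  from order_trans[OF F mult_left_mono[OF this C]]
  have "\<bar>F\<bar> * y \<le> (C * (1 + (\<Sum>i<Suc k. \<bar>x i\<bar>)) ^ m) * (1 + (\<Sum>i<Suc k. \<bar>x i\<bar>))"
   using y C by (intro mult_mono) (auto intro!: mult_nonneg_nonneg sum_nonneg zero_le_power add_nonneg_nonneg)
  thus ?thesis by (simp add: mult_ac)
 qed
 have k1: "\<bar>x k\<bar> \<le> 1 + (\<Sum>i<Suc k. \<bar>x i\<bar>)" "1 \<le> 1 + (\<Sum>i<Suc k. \<bar>x i\<bar>)" for x :: "nat => real" by (auto intro: sum_nonneg add_nonneg_nonneg)
 show "C1_poly (Suc k) (\<lambda>x. f x * x k)" unfolding C1_poly_def
 proof (intro conjI)
  show "\<forall>x y. (\<forall>i<Suc k. x i = y i) \<longrightarrow> f x * x k = f y * y k" using dep by (metis less_Suc_eq)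
  show "continuous_on UNIV (\<lambda>x. f x * x k)" by (intro continuous_intros cont continuous_on_product_coordinates)
  show "\<forall>i<Suc k. continuous_on UNIV (pdiff i (\<lambda>x. f x * x k)) \<and> (\<forall>x. (\<lambda>s. f (x(i := s)) * (x(i := s)) k) differentiable at (x i))"
  proof (intro allI impI conjI)
   fix i assume i: "i < Suc k"
   show "continuous_on UNIV (pdiff i (\<lambda>x. f x * x k))"
    using i by (cases "i = k") (auto simp: p1 p2 intro!: continuous_intros cont continuous_on_product_coordinates)
   show "(\<lambda>s. f (x(i := s)) * (x(i := s)) k) differentiable at (x i)" for x
    using i d1[of i x] d2[of x] by (cases "i = k") (auto simp: real_differentiable_def simp del: fun_upd_apply)
  qed
  show "\<exists>C m. \<forall>x. \<bar>f x * x k\<bar> \<le> C * (1 + (\<Sum>i<Suc k. \<bar>x i\<bar>)) ^ m \<and> (\<forall>i<Suc k. \<bar>pdiff i (\<lambda>x. f x * x k) x\<bar> \<le> C * (1 + (\<Sum>i<Suc k. \<bar>x i\<bar>)) ^ m)"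
  proof (intro exI[of _ C] exI[of _ "Suc m"] allI conjI impI)
   fix x :: "nat => real"
   show "\<bar>f x * x k\<bar> \<le> C * (1 + (\<Sum>i<Suc k. \<bar>x i\<bar>)) ^ Suc m" using bb[OF b(1) abs_ge_zero k1(1)] by (simp only: abs_mult)
   fix i assume i: "i < Suc k"
   show "\<bar>pdiff i (\<lambda>x. f x * x k) x\<bar> \<le> C * (1 + (\<Sum>i<Suc k. \<bar>x i\<bar>)) ^ Suc m"
   proof (cases "i = k")
    case True thus ?thesis using bb[OF b(1) zero_le_one k1(2), of x] by (simp only: p2 mult_1_right)
   next
    case False
    hence "i < k" using i by simp
    from bb[OF b(2)[OF this] abs_ge_zero k1(1)] show ?thesis by (simp only: p1[OF \<open>i < k\<close>] abs_mult)
   qed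
  qed
 qed
qed

context fbm begin

lemma C1_poly_sqint:
 assumes f: "C1_poly k f" and G: "\<And>i. i < k ==> G i \<in> gsp"
 shows "sqint M (\<lambda>w. f (vec k G w))" "i < k ==> sqint M (\<lambda>w. pdiff i f (vec k G w))"
proof -
 obtain C m where b: "\<And>x. \<bar>f x\<bar> \<le> C * (1 + (\<Sum>i<k. \<bar>x i\<bar>)) ^ m" "\<And>i x. i < k ==> \<bar>pdiff i f x\<bar> \<le> C * (1 + (\<Sum>i<k. \<bar>x i\<bar>)) ^ m"
  using f unfolding C1_poly_def by blast
 show "sqint M (\<lambda>w. f (vec k G w))" by (rule poly_growth_sqint[where G=G and k=k, OF G C1_poly_measurable(1)[OF f] b(1)])
 show "i < k ==> sqint M (\<lambda>w. pdiff i f (vec k G w))" by (rule poly_growth_sqint[where G=G and k=k, OF G C1_poly_measurable(2)[OF f] b(2)])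
qed

text \<open>The formula for a product with a Gaussian variable is that for \<open>x \<mapsto> f x * x k\<close> in \<open>k + 1\<close> variables.\<close>

lemma C1_poly_mult_sqint:
 assumes f: "C1_poly k f" and G: "\<And>i. i < k ==> G i \<in> gsp" and Y: "Y \<in> gsp"
 shows "sqint M (\<lambda>w. f (vec k G w) * Y w)" "i < k ==> sqint M (\<lambda>w. pdiff i f (vec k G w) * Y w)"
  "\<And>V. V \<in> gsp ==> (LINT w|M. f (vec k G w) * Y w * V w) =
   (\<Sum>i<k. (LINT w|M. pdiff i f (vec k G w) * Y w) * (LINT w|M. G i w * V w)) + (LINT w|M. f (vec k G w)) * (LINT w|M. Y w * V w)"
proof -
 define G' where "G' = G(k := Y)"
 have G': "G' i \<in> gsp" if "i < Suc k" for i using that G Y by (auto simp: G'_def less_Suc_eq)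
 note c = C1_poly_mult_last[OF f]
 have dep: "\<And>x y. (\<And>i. i < k ==> x i = y i) ==> f x = f y" using f unfolding C1_poly_def by blast
 have ek: "vec (Suc k) G' w k = Y w" for w by (simp add: vec_def G'_def)
 have ef: "f (vec (Suc k) G' w) = f (vec k G w)" for w by (rule dep) (auto simp: vec_def G'_def)
 have ep: "pdiff i f (vec (Suc k) G' w) = pdiff i f (vec k G w)" if "i < k" for i w
  unfolding pdiff_def
 proof -
  have "f ((vec (Suc k) G' w)(i := s)) = f ((vec k G w)(i := s))" for s by (rule dep) (auto simp: vec_def G'_def)
  moreover have "vec (Suc k) G' w i = vec k G w i" using that by (auto simp: vec_def G'_def)
  ultimately show "deriv (\<lambda>s. f ((vec (Suc k) G' w)(i := s))) (vec (Suc k) G' w i) = deriv (\<lambda>s. f ((vec k G w)(i := s))) (vec k G w i)" by simp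
 qed
 show "sqint M (\<lambda>w. f (vec k G w) * Y w)" using C1_poly_sqint(1)[where G=G' and k="Suc k", OF c(1) G'] by (simp add: ek ef)
 show "sqint M (\<lambda>w. pdiff i f (vec k G w) * Y w)" if "i < k"
  using C1_poly_sqint(2)[where G=G' and k="Suc k" and i=i, OF c(1) G'] that by (simp add: ek ep c(2))
 fix V assume V: "V \<in> gsp"
 have "(LINT w|M. f (vec k G w) * Y w * V w) =
   (\<Sum>i<Suc k. (LINT w|M. pdiff i (\<lambda>x. f x * x k) (vec (Suc k) G' w)) * (LINT w|M. G' i w * V w))"
  using gaussian_ibp[where G=G' and k="Suc k", OF c(1) G' V] by (simp add: ek ef)
 also have "... = (\<Sum>i<k. (LINT w|M. pdiff i f (vec k G w) * Y w) * (LINT w|M. G i w * V w)) + (LINT w|M. f (vec k G w)) * (LINT w|M. Y w * V w)"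
 proof -
  have "G' i = G i" if "i < k" for i using that by (auto simp: G'_def)
  moreover have "G' k = Y" by (simp add: G'_def)
  ultimately show ?thesis by (simp add: c(2,3) ek ef ep)
 qed
 finally show "(LINT w|M. f (vec k G w) * Y w * V w) =
   (\<Sum>i<k. (LINT w|M. pdiff i f (vec k G w) * Y w) * (LINT w|M. G i w * V w)) + (LINT w|M. f (vec k G w)) * (LINT w|M. Y w * V w)" .
qed

lemma gauss_args_vec: "gauss_args M B k \<psi> w = vec k (\<lambda>i. isonormal M B (\<psi> i)) w"
 by (auto simp: gauss_args_def vec_def)

lemma hinner_malliavin:
 assumes "\<And>i. i < k ==> \<psi> i \<in> hspace H T" "U \<in> hspace H T"
 shows "hinner H (malliavin M B k f \<psi> w) U = (\<Sum>i<k. pdiff i f (vec k (\<lambda>i. isonormal M B (\<psi> i)) w) * hinner H (\<psi> i) U)"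
proof -
 have e: "malliavin M B k f \<psi> w = (\<lambda>m t. \<Sum>i<k. pdiff i f (vec k (\<lambda>i. isonormal M B (\<psi> i)) w) * \<psi> i m t)"
  by (intro ext) (simp add: malliavin_def gauss_args_vec)
 show ?thesis unfolding e by (rule hinner_sum[OF _ assms(2)]) (use assms in auto)
qed

lemma hinner_malliavin_measurable:
 assumes f: "C1_poly k f" and \<psi>: "\<And>i. i < k ==> \<psi> i \<in> hspace H T" and U: "hspace_L2 M H T U"
 shows "(\<lambda>w. hinner H (malliavin M B k f \<psi> w) (U w)) \<in> borel_measurable M"
proof -
 have m: "(\<lambda>w. pdiff i f (vec k (\<lambda>i. isonormal M B (\<psi> i)) w) * hinner H (\<psi> i) (U w)) \<in> borel_measurable M" if "i < k" for i
 proof (rule borel_measurable_times)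
  show "(\<lambda>w. pdiff i f (vec k (\<lambda>i. isonormal M B (\<psi> i)) w)) \<in> borel_measurable M"
   using C1_poly_sqint(2)[OF f gsp_isonormal[OF \<psi>] that] by auto
  show "(\<lambda>w. hinner H (\<psi> i) (U w)) \<in> borel_measurable M" using U \<psi>[OF that] by (auto simp: hspace_L2_def)
 qed
 have "(\<lambda>w. \<Sum>i<k. pdiff i f (vec k (\<lambda>i. isonormal M B (\<psi> i)) w) * hinner H (\<psi> i) (U w)) \<in> borel_measurable M"
  by (intro borel_measurable_sum m) auto
 moreover have "hinner H (malliavin M B k f \<psi> w) (U w) = (\<Sum>i<k. pdiff i f (vec k (\<lambda>i. isonormal M B (\<psi> i)) w) * hinner H (\<psi> i) (U w))" if "w \<in> space M" for w
  by (rule hinner_malliavin[OF \<psi>]) (use U that in \<open>auto simp: hspace_L2_def\<close>)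
 ultimately show ?thesis by (simp cong: measurable_cong)
qed

definition hist_gen :: "real => 'w set set" where
 "hist_gen T = {B t -` A \<inter> space M | t A. t \<in> {0..T} \<and> A \<in> sets borel}"

lemma hist_gen_sets: "hist_gen T \<subseteq> sets M"
 unfolding hist_gen_def by (auto intro!: measurable_sets[OF sqint_measurable[OF B_sqint]])

lemma sets_history: "sets (history M B T) = sigma_sets (space M) (hist_gen T)"
 unfolding history_def hist_gen_def[symmetric] by (rule sets_measure_of) (auto simp: hist_gen_def)

lemma space_history: "space (history M B T) = space M"
 unfolding history_def hist_gen_def[symmetric] by (rule space_measure_of) (auto simp: hist_gen_def)

lemma sets_history_subset: "sets (history M B T) \<subseteq> sets M"
 unfolding sets_history using hist_gen_sets sets.sigma_sets_subset by blast

lemma history_measurable: "f \<in> borel_measurable (history M B T) ==> f \<in> borel_measurable M" for f :: "'w => real"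
 using sets_history_subset[of T] by (auto simp: measurable_def space_history)

lemma B_history_measurable: "0 \<le> t ==> t \<le> T ==> B t \<in> borel_measurable (history M B T)"
proof (rule measurableI)
 fix A :: "real set" assume "0 \<le> t" "t \<le> T" "A \<in> sets borel"
 hence "B t -` A \<inter> space M \<in> hist_gen T" by (auto simp: hist_gen_def)
 thus "B t -` A \<inter> space (history M B T) \<in> sets (history M B T)" by (simp add: sets_history space_history)
qed auto

lemma unit_hspace: "0 \<le> t ==> t \<le> T ==> (\<lambda>m. unit_coeff t) \<in> hspace H T"
proof -
 assume t: "0 \<le> t" "t \<le> T"
 have "L2_tendsto M (\<lambda>k. BB (unit_coeff t)) (BB (unit_coeff t))"
  by (intro L2_tendsto_const BB_sqint) (use t in \<open>simp add: coeffs_def\<close>)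
 from L2_tendsto_hspace[OF _ this, of T] t show ?thesis by (simp add: unit_step_coeffs)
qed

lemma isonormal_unit: "0 \<le> t ==> t \<le> T ==> AE w in M. isonormal M B (\<lambda>m. unit_coeff t) w = B t w"
proof -
 assume t: "0 \<le> t" "t \<le> T"
 have "L2_tendsto M (\<lambda>k. BB (unit_coeff t)) (BB (unit_coeff t))"
  by (intro L2_tendsto_const BB_sqint) (use t in \<open>simp add: coeffs_def\<close>)
 from L2_tendsto_unique[OF isonormal_L2[OF unit_hspace[OF t]] this] show ?thesis by (simp add: BB_def)
qed

text \<open>A square integrable variable of the history that is orthogonal to all trigonometric functions
  of finitely many values of the motion vanishes: the Fourier uniqueness gives its integrals over
  cylinder sets, which generate.\<close>

lemma history_orthogonal_zero:
 assumes D: "D \<in> borel_measurable (history M B T)" "integrable M D"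
  and orth: "\<And>k \<tau> c a b. (\<And>i. i < k ==> \<tau> i \<in> {0..T}) ==> (LINT w|M. trig k c a b (\<lambda>i. B (\<tau> i) w) * D w) = 0"
 shows "AE w in M. D w = 0"
proof -
 have Dm [measurable]: "D \<in> borel_measurable M" using D(2) by auto
 define \<G> where "\<G> = {{w \<in> space M. \<forall>i<k. B (\<tau> i) w \<in> A i} | (k::nat) \<tau> A. (\<forall>i<k. \<tau> i \<in> {0..T} \<and> A i \<in> sets borel)}"
 have \<G>M: "S \<in> sets M" if SG: "S \<in> \<G>" for S
 proof -
  obtain k :: nat and \<tau> A where S: "S = {w \<in> space M. \<forall>i<k. B (\<tau> i) w \<in> A i}" "\<And>i. i < k ==> \<tau> i \<in> {0..T}" "\<And>i. i < k ==> A i \<in> sets borel"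
   using SG unfolding \<G>_def by blast
  have "{w \<in> space M. \<forall>i\<in>{..<k}. B (\<tau> i) w \<in> A i} \<in> sets M"
  proof (rule sets.sets_Collect_finite_All)
   fix i assume "i \<in> {..<k}"
   hence "B (\<tau> i) \<in> borel_measurable M" "A i \<in> sets borel" using S(2,3)[of i] by (auto intro!: sqint_measurable[OF B_sqint])
   from measurable_sets[OF this] show "{w \<in> space M. B (\<tau> i) w \<in> A i} \<in> sets M" by (simp add: vimage_def Int_def conj_commute)
  qed simp
  moreover have "S = {w \<in> space M. \<forall>i\<in>{..<k}. B (\<tau> i) w \<in> A i}" unfolding S(1) by auto
  ultimately show ?thesis by simp
 qed
 have zero_gen: "(LINT w|M. indicator S w * D w) = 0" if SG: "S \<in> \<G>" for S
 proof -
  obtain k :: nat and \<tau> A where S: "S = {w \<in> space M. \<forall>i<k. B (\<tau> i) w \<in> A i}" "\<And>i. i < k ==> \<tau> i \<in> {0..T}" "\<And>i. i < k ==> A i \<in> sets borel"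
   using SG unfolding \<G>_def by blast
  have Bm: "B (\<tau> i) \<in> borel_measurable M" if "i < k" for i by (rule sqint_measurable[OF B_sqint]) (use S(2)[OF that] in simp)
  have "(CLINT w|M. complex_of_real (D w) * (\<Prod>i<k. indicator (A i) (B (\<tau> i) w))) = 0"
  proof (rule char_zero_imp_box_zero[where W="\<lambda>w. complex_of_real (D w)" and G="\<lambda>i. B (\<tau> i)" and k=k and A=A])
   show "complex_integrable M (\<lambda>w. complex_of_real (D w))" using D(2) by simp
   fix s
   define L where "L w = (\<Sum>i<k. s i * B (\<tau> i) w)" for w
   have [measurable]: "L \<in> borel_measurable M" unfolding L_def[abs_def] by (intro borel_measurable_sum borel_measurable_times borel_measurable_const Bm) simp
   have i: "integrable M (\<lambda>w. cos (L w) * D w)" "integrable M (\<lambda>w. sin (L w) * D w)"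
   proof -
    have *: "integrable M (\<lambda>w. g (L w) * D w)" if [measurable]: "g \<in> borel_measurable borel" and g: "\<And>x. \<bar>g x\<bar> \<le> 1" for g
    proof (rule Bochner_Integration.integrable_bound[OF D(2)])
     show "AE w in M. norm (g (L w) * D w) \<le> norm (D w)"
      using g by (intro AE_I2) (simp add: abs_mult mult_left_le_one_le)
    qed measurable
    show "integrable M (\<lambda>w. cos (L w) * D w)" "integrable M (\<lambda>w. sin (L w) * D w)"
     by (rule *; simp)+
   qed
   have "(CLINT w|M. complex_of_real (D w) * iexp (L w)) = (CLINT w|M. complex_of_real (cos (L w) * D w) + \<i> * complex_of_real (sin (L w) * D w))"
    by (intro Bochner_Integration.integral_cong refl) (simp add: exp_Euler cos_of_real sin_of_real algebra_simps)
   also have "... = complex_of_real (LINT w|M. cos (L w) * D w) + \<i> * complex_of_real (LINT w|M. sin (L w) * D w)"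
    using i by (subst Bochner_Integration.integral_add) (auto simp del: of_real_mult simp: integral_complex_of_real intro!: integrable_mult_right)
   also have "... = 0" using orth[of k \<tau> s 1 0, OF S(2)] orth[of k \<tau> s 0 1, OF S(2)] by (simp add: trig_def L_def)
   finally show "(CLINT w|M. complex_of_real (D w) * iexp (\<Sum>i<k. s i * B (\<tau> i) w)) = 0" by (simp add: L_def)
  qed (use Bm S(3) in auto)
  moreover have "complex_of_real (D w) * (\<Prod>i<k. indicator (A i) (B (\<tau> i) w)) = complex_of_real (indicator S w * D w)" if w: "w \<in> space M" for w
  proof (cases "w \<in> S")
   case True thus ?thesis by (auto simp: S(1))
  next
   case False
   then obtain i where "i < k" "B (\<tau> i) w \<notin> A i" using w by (auto simp: S(1))
   hence "(\<Prod>i<k. indicator (A i) (B (\<tau> i) w)) = (0::complex)" by (intro prod_zero bexI[of _ i]) auto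
   thus ?thesis using False by simp
  qed
  ultimately have "(CLINT w|M. complex_of_real (indicator S w * D w)) = 0" by (simp cong: Bochner_Integration.integral_cong del: of_real_mult)
  thus ?thesis by (simp only: integral_complex_of_real of_real_eq_0_iff)
 qed
 have bi: "integrable M (\<lambda>w. indicator S w * D w)" if "S \<in> sets M" for S
  using integrable_mult_indicator[OF that D(2)] by simp
 have stable: "Int_stable \<G>"
 proof (rule Int_stableI)
  fix S S' assume "S \<in> \<G>" "S' \<in> \<G>"
  then obtain k \<tau> A k' \<tau>' A' where S: "S = {w \<in> space M. \<forall>i<(k::nat). B (\<tau> i) w \<in> A i}" "\<forall>i<k. \<tau> i \<in> {0..T} \<and> A i \<in> sets borel"
   and S': "S' = {w \<in> space M. \<forall>i<(k'::nat). B (\<tau>' i) w \<in> A' i}" "\<forall>i<k'. \<tau>' i \<in> {0..T} \<and> A' i \<in> sets borel"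
   unfolding \<G>_def by blast
  define t where "t i = (if i < k then \<tau> i else \<tau>' (i - k))" for i
  define a where "a i = (if i < k then A i else A' (i - k))" for i
  have all: "(\<forall>i<k + k'. P (t i) (a i)) \<longleftrightarrow> (\<forall>i<k. P (\<tau> i) (A i)) \<and> (\<forall>i<k'. P (\<tau>' i) (A' i))" for P :: "real => real set => bool"
  proof (intro iffI conjI allI impI)
   fix i assume "\<forall>i<k + k'. P (t i) (a i)" "i < k'"
   thus "P (\<tau>' i) (A' i)" by (auto simp: t_def a_def dest!: spec[of _ "k + i"])
  next
   fix i assume "\<forall>i<k + k'. P (t i) (a i)" "i < k"
   thus "P (\<tau> i) (A i)" by (auto simp: t_def a_def dest!: spec[of _ i])
  next
   fix i assume "(\<forall>i<k. P (\<tau> i) (A i)) \<and> (\<forall>i<k'. P (\<tau>' i) (A' i))" "i < k + k'"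
   thus "P (t i) (a i)" by (auto simp: t_def a_def)
  qed
  have "S \<inter> S' = {w \<in> space M. \<forall>i<k + k'. B (t i) w \<in> a i}"
  proof -
   have "(\<forall>i<k + k'. B (t i) w \<in> a i) \<longleftrightarrow> (\<forall>i<k. B (\<tau> i) w \<in> A i) \<and> (\<forall>i<k'. B (\<tau>' i) w \<in> A' i)" for w
    by (rule all)
   thus ?thesis unfolding S(1) S'(1) by auto
  qed
  moreover have "\<forall>i<k + k'. t i \<in> {0..T} \<and> a i \<in> sets borel" using all[of "\<lambda>t A. t \<in> {0..T} \<and> A \<in> sets borel"] S(2) S'(2) by blast
  ultimately show "S \<inter> S' \<in> \<G>" unfolding \<G>_def by blast
 qed
 have sp: "space M \<in> \<G>" unfolding \<G>_def by (intro CollectI exI[of _ 0]) auto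
 have gen: "hist_gen T \<subseteq> \<G>"
 proof
  fix S assume "S \<in> hist_gen T"
  then obtain t A where "S = B t -` A \<inter> space M" "t \<in> {0..T}" "A \<in> sets borel" by (auto simp: hist_gen_def)
  thus "S \<in> \<G>" unfolding \<G>_def by (intro CollectI exI[of _ "1::nat"] exI[of _ "\<lambda>_. t"] exI[of _ "\<lambda>_. A"]) auto
 qed
 have sigM: "sigma_sets (space M) \<G> \<subseteq> sets M" using \<G>M sets.sigma_sets_subset by blast
 have zero: "(LINT w|M. indicator S w * D w) = 0" if "S \<in> sigma_sets (space M) \<G>" for S
 proof -
  have "\<G> \<subseteq> Pow (space M)" by (auto simp: \<G>_def)
  from stable this that show ?thesis
  proof (induction rule: sigma_sets_induct_disjoint)
   case (basic A) thus ?case by (rule zero_gen)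
  next
   case empty show ?case by simp
  next
   case (compl A)
   hence AM: "A \<in> sets M" using sigM by blast
   have "(LINT w|M. indicator (space M - A) w * D w) = (LINT w|M. indicator (space M) w * D w - indicator A w * D w)"
    by (intro Bochner_Integration.integral_cong) (auto simp: indicator_def)
   also have "... = 0" using bi[OF AM] bi[of "space M"] compl zero_gen[OF sp] by (subst Bochner_Integration.integral_diff) auto
   finally show ?case .
  next
   case (union A)
   hence AM: "A i \<in> sets M" for i using sigM by blast
   have "(LINT w:(\<Union>i. A i)|M. D w) = (\<Sum>i. (LINT w:A i|M. D w))"
   proof (rule lebesgue_integral_countable_add[OF AM])
    show "A i \<inter> A j = {}" if "i \<noteq> j" for i j using union(1) that by (auto simp: disjoint_family_on_def)
    show "set_integrable M (\<Union>i. A i) D" unfolding set_integrable_def using bi[of "\<Union>i. A i"] AM by auto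
   qed
   thus ?case using union(3) by (simp add: set_lebesgue_integral_def)
  qed
 qed
 have sub: "sets (history M B T) \<subseteq> sigma_sets (space M) \<G>"
  unfolding sets_history by (rule sigma_sets_mono') (rule gen)
 \<comment> \<open>The event \<open>s D > 0\<close> belongs to the history, so that \<open>s D\<close> has integral zero over it.\<close>
 have half: "AE w in M. s * D w \<le> 0" if "s \<in> {-1, 1}" for s :: real
 proof -
  define S where "S = {w \<in> space (history M B T). s * D w > 0}"
  have "S \<in> sets (history M B T)" unfolding S_def using D(1) by measurable
  hence S: "S \<in> sigma_sets (space M) \<G>" "S \<in> sets M" using sub sets_history_subset by auto
  have eq: "s * (indicator S w * D w) = max 0 (s * D w)" if "w \<in> space M" for w
   using that by (auto simp: S_def space_history indicator_def max_def)
  have "(LINT w|M. max 0 (s * D w)) = (LINT w|M. s * (indicator S w * D w))"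
   by (intro Bochner_Integration.integral_cong refl) (simp add: eq)
  also have "... = 0" using zero[OF S(1)] by simp
  finally have "AE w in M. max 0 (s * D w) = 0"
   by (subst (asm) integral_nonneg_eq_0_iff_AE) (use D(2) in auto)
  thus ?thesis by eventually_elim (auto simp: max_def split: if_splits)
 qed
 have "AE w in M. D w \<le> 0" "AE w in M. 0 \<le> D w" using half[of 1] half[of "-1"] by auto
 thus ?thesis by eventually_elim simp
qed

text \<open>Applied to trigonometric functionals of values of the motion, the duality relation shows that the difference of two
  integrals is orthogonal to a determining family.\<close>

lemma skorohod_unique:
 assumes "is_skorohod_integral M H B T u Z" "is_skorohod_integral M H B T u Z'"
 shows "AE w in M. Z w = Z' w"
proof -
 obtain U U' where Z: "Z \<in> borel_measurable (history M B T)" "integrable M (\<lambda>w. (Z w)^2)"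
   "hspace_L2 M H T U" "AE w in M. represents H T (U w) (\<lambda>t. u t w)"
   "\<And>k f \<phi>. smooth_poly_growth k f ==> (\<forall>i<k. \<phi> i \<in> hspace H T) ==>
      (LINT w|M. smooth_functional M B k f \<phi> w * Z w) = (LINT w|M. hinner H (malliavin M B k f \<phi> w) (U w))"
  and Z': "Z' \<in> borel_measurable (history M B T)" "integrable M (\<lambda>w. (Z' w)^2)"
   "hspace_L2 M H T U'" "AE w in M. represents H T (U' w) (\<lambda>t. u t w)"
   "\<And>k f \<phi>. smooth_poly_growth k f ==> (\<forall>i<k. \<phi> i \<in> hspace H T) ==>
      (LINT w|M. smooth_functional M B k f \<phi> w * Z' w) = (LINT w|M. hinner H (malliavin M B k f \<phi> w) (U' w))"
  using assms unfolding is_skorohod_integral_def by blast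
 have sq: "sqint M Z" "sqint M Z'" using Z(2) Z'(2) history_measurable[OF Z(1)] history_measurable[OF Z'(1)] unfolding sqint_def by blast+
 have "AE w in M. Z w - Z' w = 0"
 proof (rule history_orthogonal_zero)
  show "(\<lambda>w. Z w - Z' w) \<in> borel_measurable (history M B T)" using Z(1) Z'(1) by measurable
  show "integrable M (\<lambda>w. Z w - Z' w)" using sq by auto
  fix k and \<tau> :: "nat => real" and c a b assume \<tau>: "\<And>i. i < k ==> \<tau> i \<in> {0..T}"
  define \<psi> where "\<psi> i = (\<lambda>m::nat. unit_coeff (\<tau> i))" for i
  have \<psi>: "\<psi> i \<in> hspace H T" if "i < k" for i using unit_hspace[of "\<tau> i" T] \<tau>[OF that] by (simp add: \<psi>_def)
  define f where "f = trig k c a b"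
  have f: "smooth_poly_growth k f" unfolding f_def by (rule smooth_trig)
  have f1: "C1_poly k f" by (rule smooth_C1_poly[OF f])
  have "(LINT w|M. hinner H (malliavin M B k f \<psi> w) (U w)) = (LINT w|M. hinner H (malliavin M B k f \<psi> w) (U' w))"
  proof (rule integral_cong_AE)
   show "(\<lambda>w. hinner H (malliavin M B k f \<psi> w) (U w)) \<in> borel_measurable M" by (rule hinner_malliavin_measurable[OF f1 \<psi> Z(3)])
   show "(\<lambda>w. hinner H (malliavin M B k f \<psi> w) (U' w)) \<in> borel_measurable M" by (rule hinner_malliavin_measurable[OF f1 \<psi> Z'(3)])
   show "AE w in M. hinner H (malliavin M B k f \<psi> w) (U w) = hinner H (malliavin M B k f \<psi> w) (U' w)"
    using Z(4) Z'(4)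
   proof eventually_elim
    case (elim w)
    have "malliavin M B k f \<psi> w \<in> hspace H T"
     unfolding malliavin_def[abs_def] by (rule hspace_sum(1)) (use \<psi> in auto)
    from hinner_represents_unique[OF elim this] show ?case .
   qed
  qed
  hence eq: "(LINT w|M. smooth_functional M B k f \<psi> w * Z w) = (LINT w|M. smooth_functional M B k f \<psi> w * Z' w)"
   using Z(5)[OF f] Z'(5)[OF f] \<psi> by simp
  have sf: "sqint M (smooth_functional M B k f \<psi>)"
   unfolding smooth_functional_def[abs_def] gauss_args_vec by (rule C1_poly_sqint(1)[OF f1 gsp_isonormal[OF \<psi>]])
  have "AE w in M. \<forall>i\<in>{..<k}. isonormal M B (\<psi> i) w = B (\<tau> i) w"
   using isonormal_unit \<tau> by (intro AE_finite_allI) (auto simp: \<psi>_def)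
  hence AE: "AE w in M. smooth_functional M B k f \<psi> w = f (\<lambda>i. B (\<tau> i) w)"
  proof eventually_elim
   case (elim w)
   hence "(\<Sum>j<k. c j * gauss_args M B k \<psi> w j) = (\<Sum>j<k. c j * B (\<tau> j) w)" by (intro sum.cong) (auto simp: gauss_args_def)
   thus ?case by (simp add: smooth_functional_def f_def trig_def)
  qed
  have mB: "(\<lambda>w. f (\<lambda>i. B (\<tau> i) w)) \<in> borel_measurable M"
   unfolding f_def trig_def using \<tau> B_sqint by (intro borel_measurable_add borel_measurable_times borel_measurable_const measurable_compose[OF _ borel_measurable_cos] measurable_compose[OF _ borel_measurable_sin] borel_measurable_sum) auto
  have "(LINT w|M. f (\<lambda>i. B (\<tau> i) w) * (Z w - Z' w)) = (LINT w|M. smooth_functional M B k f \<psi> w * Z w - smooth_functional M B k f \<psi> w * Z' w)"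
  proof (rule integral_cong_AE)
   show "AE w in M. f (\<lambda>i. B (\<tau> i) w) * (Z w - Z' w) = smooth_functional M B k f \<psi> w * Z w - smooth_functional M B k f \<psi> w * Z' w"
    using AE by eventually_elim (simp add: algebra_simps)
   show "(\<lambda>w. f (\<lambda>i. B (\<tau> i) w) * (Z w - Z' w)) \<in> borel_measurable M"
    by (rule borel_measurable_times[OF mB borel_measurable_diff[OF sqint_measurable[OF sq(1)] sqint_measurable[OF sq(2)]]])
   show "(\<lambda>w. smooth_functional M B k f \<psi> w * Z w - smooth_functional M B k f \<psi> w * Z' w) \<in> borel_measurable M"
    by (intro borel_measurable_diff borel_measurable_times sqint_measurable[OF sf] sqint_measurable[OF sq(1)] sqint_measurable[OF sq(2)])
  qed
  also have "... = 0" using eq sqint_mult[OF sf sq(1)] sqint_mult[OF sf sq(2)] by simp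
  finally show "(LINT w|M. trig k c a b (\<lambda>i. B (\<tau> i) w) * (Z w - Z' w)) = 0" by (simp add: f_def)
 qed
 thus ?thesis by simp
qed

end

section \<open>The deterministic Ornstein-Uhlenbeck equation\<close>

abbreviation itg :: "real => real => (real => real) => real" where
 "itg a b f \<equiv> LINT s:{a..b}|lborel. f s"

lemma cont_set_integrable: "continuous_on UNIV f ==> set_integrable lborel {a..b} f" for f :: "real => real"
 by (rule borel_integrable_atLeastAtMost') (rule continuous_on_subset, auto)

lemma itg_eq_integral: "continuous_on UNIV f ==> itg a b f = integral {a..b} f"
 by (rule set_borel_integral_eq_integral(2)[OF cont_set_integrable])

lemma itg_deriv:
 assumes "continuous_on UNIV f" "0 \<le> t" "t \<le> T"
 shows "((\<lambda>t. itg 0 t f) has_real_derivative f t) (at t within {0..T})"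
 unfolding itg_eq_integral[OF assms(1)] has_real_derivative_iff_has_vector_derivative
 by (rule integral_has_vector_derivative) (use assms in \<open>auto intro: continuous_on_subset\<close>)

lemma itg_zero [simp]: "(LINT s:{a}|lborel. f s) = 0" for f :: "real => real"
proof -
 have "AE x in lborel. x \<noteq> (a::real)" by (rule AE_lborel_singleton)
 hence "AE x in lborel. indicator {a} x *\<^sub>R f x = 0" by eventually_elim (auto simp: indicator_def)
 thus ?thesis unfolding set_lebesgue_integral_def by (rule integral_eq_zero_AE)
qed

lemma itg_max: "itg 0 (max 0 t) f = itg 0 t f"
proof (cases "t \<ge> 0")
 case False
 hence "{0..t} = {}" "max 0 t = 0" by auto
 thus ?thesis using itg_zero[of 0 f] by (simp only: set_lebesgue_integral_def) (simp add: set_lebesgue_integral_def)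
qed simp

lemma itg_continuous:
 assumes "continuous_on UNIV f" shows "continuous_on UNIV (\<lambda>t. itg 0 t f)"
proof -
 have 1: "continuous_on {0..} (\<lambda>t. itg 0 t f)"
  unfolding continuous_on_eq_continuous_within
 proof
  fix t :: real assume "t \<in> {0..}"
  hence "((\<lambda>t. itg 0 t f) has_real_derivative f t) (at t within {0..t+1})" by (intro itg_deriv assms) auto
  hence "continuous (at t within {0..t+1}) (\<lambda>t. itg 0 t f)" by (rule DERIV_continuous)
  moreover have "at t within {0..t+1} = at t within {0..}"
   by (rule at_within_nhd[of _ "{..<t+1}"]) auto
  ultimately show "continuous (at t within {0..}) (\<lambda>t. itg 0 t f)" by (simp add: continuous_within)
 qed
 have "continuous_on UNIV (\<lambda>t. itg 0 (max 0 t) f)"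
  by (rule continuous_on_compose2[OF 1]) (auto intro!: continuous_intros)
 thus ?thesis by (simp add: itg_max)
qed

lemma itg_const_zero_deriv:
 fixes D :: "real => real"
 assumes "\<And>s. 0 \<le> s ==> s \<le> t ==> (D has_real_derivative 0) (at s within {0..t})" "0 \<le> t"
 shows "D t = D 0"
proof -
 have "\<exists>c. \<forall>x\<in>{0..t}. D x = c"
 proof (rule has_field_derivative_zero_constant)
  fix x assume "x \<in> {0..t}"
  thus "(D has_real_derivative 0) (at x within {0..t})" by (intro assms(1)) simp_all
 qed simp
 then obtain c where c: "\<forall>x\<in>{0..t}. D x = c" ..
 thus ?thesis using assms(2) by simp
qed

text \<open>The solution of \<open>x(t) = S(t) - \<alpha> \<integral>\<^sub>0\<^sup>t x(s) ds\<close>, after an integration by parts that removes the integral against \<open>dS\<close>.\<close>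

definition ou :: "real => (real => real) => real => real" where
 "ou \<alpha> S t = S t - \<alpha> * itg 0 t (\<lambda>s. exp (- \<alpha> * (t - s)) * S s)"

lemma ou_exp: "itg 0 t (\<lambda>s. exp (- \<alpha> * (t - s)) * S s) = exp (- \<alpha> * t) * itg 0 t (\<lambda>s. exp (\<alpha> * s) * S s)"
proof -
 have "exp (- \<alpha> * (t - s)) * S s = exp (- \<alpha> * t) * (exp (\<alpha> * s) * S s)" for s
 proof -
  have "- \<alpha> * (t - s) = - \<alpha> * t + \<alpha> * s" by (simp add: right_diff_distrib)
  hence "exp (- \<alpha> * (t - s)) = exp (- \<alpha> * t) * exp (\<alpha> * s)" by (simp only: exp_add)
  thus ?thesis by (simp only: mult.assoc)
 qed
 thus ?thesis by (simp only: set_integral_mult_right)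
qed

lemma ou_continuous:
 assumes "continuous_on UNIV S" shows "continuous_on UNIV (ou \<alpha> S)"
 unfolding ou_def[abs_def] ou_exp by (intro continuous_intros assms itg_continuous)

lemma ou_solves:
 assumes S: "continuous_on UNIV S" and t: "0 \<le> t"
 shows "ou \<alpha> S t = S t - \<alpha> * itg 0 t (ou \<alpha> S)"
proof -
 define K where "K t = exp (- \<alpha> * t) * itg 0 t (\<lambda>s. exp (\<alpha> * s) * S s)" for t
 have ouK: "ou \<alpha> S t = S t - \<alpha> * K t" for t unfolding ou_def ou_exp K_def ..
 have c: "continuous_on UNIV (\<lambda>s. exp (\<alpha> * s) * S s)" by (intro continuous_intros S)
 define D where "D t = K t - itg 0 t (ou \<alpha> S)" for t
 have "D t = D 0"
 proof (rule itg_const_zero_deriv[OF _ t])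
  fix s assume s: "0 \<le> s" "s \<le> t"
  have 1: "((\<lambda>t. exp (- \<alpha> * t)) has_real_derivative - \<alpha> * exp (- \<alpha> * s)) (at s within {0..t})"
   by (auto intro!: derivative_eq_intros)
  have "(K has_real_derivative - \<alpha> * exp (- \<alpha> * s) * itg 0 s (\<lambda>s. exp (\<alpha> * s) * S s) + (exp (\<alpha> * s) * S s) * exp (- \<alpha> * s)) (at s within {0..t})"
   unfolding K_def[abs_def] by (rule DERIV_mult[OF 1 itg_deriv[OF c s]])
  moreover have "- \<alpha> * exp (- \<alpha> * s) * itg 0 s (\<lambda>s. exp (\<alpha> * s) * S s) + (exp (\<alpha> * s) * S s) * exp (- \<alpha> * s) = ou \<alpha> S s"
   by (simp add: ouK K_def exp_minus)
  ultimately have "(K has_real_derivative ou \<alpha> S s) (at s within {0..t})" by simp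
  from DERIV_diff[OF this itg_deriv[OF ou_continuous[where \<alpha>=\<alpha>, OF S] s]]
  show "(D has_real_derivative 0) (at s within {0..t})" by (simp add: D_def[abs_def])
 qed
 thus ?thesis by (simp add: D_def ouK K_def)
qed

text \<open>Two solutions differ by a function with zero derivative, after multiplication with the integrating factor.\<close>

lemma ou_unique:
 assumes S: "continuous_on UNIV S" and x: "continuous_on UNIV x"
  and eq: "\<And>t. 0 \<le> t ==> x t = S t - \<alpha> * itg 0 t x" and t: "0 \<le> t"
 shows "x t = ou \<alpha> S t"
proof -
 define J where "J t = itg 0 t (\<lambda>s. exp (\<alpha> * s) * S s)" for t
 have c: "continuous_on UNIV (\<lambda>s. exp (\<alpha> * s) * S s)" by (intro continuous_intros S)
 define D where "D t = exp (\<alpha> * t) * itg 0 t x - J t" for t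
 have "D t = D 0"
 proof (rule itg_const_zero_deriv[OF _ t])
  fix s assume s: "0 \<le> s" "s \<le> t"
  have 1: "((\<lambda>t. exp (\<alpha> * t)) has_real_derivative \<alpha> * exp (\<alpha> * s)) (at s within {0..t})"
   by (auto intro!: derivative_eq_intros)
  have "(D has_real_derivative \<alpha> * exp (\<alpha> * s) * itg 0 s x + x s * exp (\<alpha> * s) - exp (\<alpha> * s) * S s) (at s within {0..t})"
   unfolding D_def[abs_def] J_def by (rule DERIV_diff[OF DERIV_mult[OF 1 itg_deriv[OF x s]] itg_deriv[OF c s]])
  thus "(D has_real_derivative 0) (at s within {0..t})" using eq[OF s(1)] by (simp add: algebra_simps)
 qed
 hence "exp (\<alpha> * t) * itg 0 t x = J t" by (simp add: D_def J_def)
 hence "itg 0 t x = exp (- \<alpha> * t) * J t" by (simp add: exp_minus field_simps)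
 thus ?thesis using eq[OF t] unfolding ou_def ou_exp J_def by simp
qed

lemma ou_add:
 assumes "continuous_on UNIV S" "continuous_on UNIV S'"
 shows "ou \<alpha> (\<lambda>t. S t + S' t) t = ou \<alpha> S t + ou \<alpha> S' t"
proof -
 have "itg 0 t (\<lambda>s. exp (- \<alpha> * (t - s)) * S s + exp (- \<alpha> * (t - s)) * S' s) = itg 0 t (\<lambda>s. exp (- \<alpha> * (t - s)) * S s) + itg 0 t (\<lambda>s. exp (- \<alpha> * (t - s)) * S' s)"
  by (intro set_integral_add(2) cont_set_integrable continuous_intros assms)
 thus ?thesis by (simp add: ou_def algebra_simps)
qed

lemma itg_FTC:
 assumes "\<And>s. (F has_real_derivative f s) (at s)" "continuous_on UNIV f" "a \<le> b"
 shows "itg a b f = F b - F a"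
proof -
 have "(f has_integral (F b - F a)) {a..b}"
  by (rule fundamental_theorem_of_calculus[OF assms(3)])
   (metis assms(1) has_field_derivative_at_within has_real_derivative_iff_has_vector_derivative)
 thus ?thesis by (simp add: itg_eq_integral[OF assms(2)] integral_unique)
qed

lemma itg_weight: "0 \<le> t ==> itg 0 t (\<lambda>s. \<alpha> * exp (- \<alpha> * (t - s))) = 1 - exp (- \<alpha> * t)"
 by (subst itg_FTC[where F="\<lambda>s. exp (- \<alpha> * (t - s))"]) (auto intro!: derivative_eq_intros continuous_intros)

text \<open>Up to the factor \<open>exp (- \<alpha> t)\<close> of the first term, an average of increments of \<open>S\<close> with weights of total mass one.
  Hence bounds for increments that are polynomial in the elapsed time give bounds uniform in \<open>t\<close>.\<close>

lemma ou_average: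
 assumes S: "continuous_on UNIV S" and t: "0 \<le> t"
 shows "ou \<alpha> S t = exp (- \<alpha> * t) * S t + itg 0 t (\<lambda>s. \<alpha> * exp (- \<alpha> * (t - s)) * (S t - S s))"
proof -
 have "itg 0 t (\<lambda>s. (\<alpha> * exp (- \<alpha> * (t - s))) * S t - \<alpha> * (exp (- \<alpha> * (t - s)) * S s))
   = itg 0 t (\<lambda>s. (\<alpha> * exp (- \<alpha> * (t - s))) * S t) - itg 0 t (\<lambda>s. \<alpha> * (exp (- \<alpha> * (t - s)) * S s))"
  by (intro set_integral_diff(2) cont_set_integrable continuous_intros S)
 also have "... = (1 - exp (- \<alpha> * t)) * S t - \<alpha> * itg 0 t (\<lambda>s. exp (- \<alpha> * (t - s)) * S s)"
  using itg_weight[OF t, of \<alpha>] by simp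
 finally show ?thesis by (simp add: ou_def algebra_simps)
qed

lemma itg_abs_le':
 assumes "set_integrable lborel {a..b} f" "set_integrable lborel {a..b} g" "\<And>s. a \<le> s ==> s \<le> b ==> \<bar>f s\<bar> \<le> g s"
 shows "\<bar>itg a b f\<bar> \<le> itg a b g"
proof -
 have "itg a b f \<le> itg a b g" by (rule set_integral_mono[OF assms(1,2)]) (use assms(3) in fastforce)
 moreover have "itg a b (\<lambda>s. - f s) \<le> itg a b g"
  by (rule set_integral_mono[OF _ assms(2)]) (use assms(1,3) in \<open>fastforce simp: set_integrable_def\<close>)+
 moreover have "itg a b (\<lambda>s. - f s) = - itg a b f" by (simp add: set_lebesgue_integral_def)
 ultimately show ?thesis by linarith
qed

lemma itg_abs_le: "continuous_on UNIV f ==> continuous_on UNIV g ==> (\<And>s. a \<le> s ==> s \<le> b ==> \<bar>f s\<bar> \<le> g s) ==> \<bar>itg a b f\<bar> \<le> itg a b g"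
 by (rule itg_abs_le'[OF cont_set_integrable cont_set_integrable])

text \<open>Jensen's inequality for this average.\<close>

lemma ou_square_le:
 assumes S: "continuous_on UNIV S" and t: "0 \<le> t" and a: "\<alpha> > 0"
 shows "(ou \<alpha> S t)^2 \<le> exp (- \<alpha> * t) * (S t)^2 + itg 0 t (\<lambda>s. \<alpha> * exp (- \<alpha> * (t - s)) * (S t - S s)^2)"
proof -
 define w where "w s = \<alpha> * exp (- \<alpha> * (t - s))" for s
 define x where "x = ou \<alpha> S t"
 define A where "A = itg 0 t (\<lambda>s. w s * (S t - S s))"
 define Q where "Q = itg 0 t (\<lambda>s. w s * (S t - S s)^2)"
 have cw: "continuous_on UNIV w" unfolding w_def[abs_def] by (intro continuous_intros)
 have W: "itg 0 t w = 1 - exp (- \<alpha> * t)" unfolding w_def[abs_def] by (rule itg_weight[OF t])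
 have x: "x = exp (- \<alpha> * t) * S t + A" unfolding x_def A_def w_def by (rule ou_average[OF S t])
 have "0 \<le> itg 0 t (\<lambda>s. w s * (S t - S s - x)^2)"
  unfolding set_lebesgue_integral_def by (rule integral_nonneg_AE) (use a in \<open>auto simp: w_def\<close>)
 also have "itg 0 t (\<lambda>s. w s * (S t - S s - x)^2) = itg 0 t (\<lambda>s. (w s * (S t - S s)^2 - (2 * x) * (w s * (S t - S s))) + x^2 * w s)"
  by (simp add: power2_eq_square algebra_simps)
 also have "... = itg 0 t (\<lambda>s. w s * (S t - S s)^2 - (2 * x) * (w s * (S t - S s))) + itg 0 t (\<lambda>s. x^2 * w s)"
  by (intro set_integral_add(2) cont_set_integrable continuous_intros S cw)
 also have "itg 0 t (\<lambda>s. w s * (S t - S s)^2 - (2 * x) * (w s * (S t - S s))) = Q - itg 0 t (\<lambda>s. (2 * x) * (w s * (S t - S s)))"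
  unfolding Q_def by (intro set_integral_diff(2) cont_set_integrable continuous_intros S cw)
 finally have 1: "0 \<le> Q - 2 * x * A + x^2 * (1 - exp (- \<alpha> * t))" by (simp add: A_def W)
 have 2: "0 \<le> exp (- \<alpha> * t) * (S t - x)^2" by simp
 have A: "A = x - exp (- \<alpha> * t) * S t" using x by simp
 have "x^2 \<le> exp (- \<alpha> * t) * (S t)^2 + Q" using 1 2 unfolding A by (simp add: power2_eq_square algebra_simps)
 thus ?thesis unfolding x_def Q_def w_def .
qed

lemma exp_weight_quadratic:
 assumes t: "0 \<le> t" and a: "\<alpha> > 0"
 shows "exp (- \<alpha> * t) * (1 + t^2) + itg 0 t (\<lambda>s. \<alpha> * exp (- \<alpha> * (t - s)) * (1 + (t - s)^2)) \<le> 1 + 2 / \<alpha>^2"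
proof -
 have "itg 0 t (\<lambda>s. \<alpha> * exp (- \<alpha> * (t - s)) * (1 + (t - s)^2)) =
   exp (- \<alpha> * (t - t)) * (1 + (t - t)^2 + 2 * (t - t) / \<alpha> + 2 / \<alpha>^2) - exp (- \<alpha> * (t - 0)) * (1 + (t - 0)^2 + 2 * (t - 0) / \<alpha> + 2 / \<alpha>^2)"
  by (rule itg_FTC[where F="\<lambda>s. exp (- \<alpha> * (t - s)) * (1 + (t - s)^2 + 2 * (t - s) / \<alpha> + 2 / \<alpha>^2)"])
   (use a t in \<open>auto intro!: derivative_eq_intros continuous_intros simp: field_simps power2_eq_square\<close>)
 also have "... \<le> 1 + 2 / \<alpha>^2 - exp (- \<alpha> * t) * (1 + t^2)"
 proof -
  have "0 \<le> exp (- \<alpha> * t) * (2 * t / \<alpha> + 2 / \<alpha>^2)" using a t by (intro mult_nonneg_nonneg add_nonneg_nonneg) auto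
  thus ?thesis by (simp add: distrib_left)
 qed
 finally show ?thesis by simp
qed

lemma exp_weight_linear:
 assumes t: "0 \<le> t" and a: "\<alpha> > 0"
 shows "exp (- \<alpha> * t) * t + itg 0 t (\<lambda>s. \<alpha> * exp (- \<alpha> * (t - s)) * (t - s)) \<le> 1 / \<alpha>"
proof -
 have "itg 0 t (\<lambda>s. \<alpha> * exp (- \<alpha> * (t - s)) * (t - s)) =
   exp (- \<alpha> * (t - t)) * ((t - t) + 1 / \<alpha>) - exp (- \<alpha> * (t - 0)) * ((t - 0) + 1 / \<alpha>)"
  by (rule itg_FTC[where F="\<lambda>s. exp (- \<alpha> * (t - s)) * ((t - s) + 1 / \<alpha>)"])
   (use a t in \<open>auto intro!: derivative_eq_intros continuous_intros simp: field_simps\<close>)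
 also have "... \<le> 1 / \<alpha> - exp (- \<alpha> * t) * t"
 proof -
  have "0 \<le> exp (- \<alpha> * t) * (1 / \<alpha>)" using a by simp
  thus ?thesis by (simp add: distrib_left)
 qed
 finally show ?thesis by simp
qed

lemma ou_lipschitz_bound:
 assumes S: "continuous_on UNIV S" and lip: "\<And>s t. 0 \<le> s ==> s \<le> t ==> \<bar>S t - S s\<bar> \<le> K * (t - s)" and S0: "S 0 = 0"
  and t: "0 \<le> t" and a: "\<alpha> > 0"
 shows "\<bar>ou \<alpha> S t\<bar> \<le> K / \<alpha>"
proof -
 have K: "K \<ge> 0" using lip[of 0 1] by auto
 have "\<bar>ou \<alpha> S t\<bar> \<le> \<bar>exp (- \<alpha> * t) * S t\<bar> + \<bar>itg 0 t (\<lambda>s. \<alpha> * exp (- \<alpha> * (t - s)) * (S t - S s))\<bar>"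
  unfolding ou_average[OF S t] by (rule abs_triangle_ineq)
 also have "\<bar>exp (- \<alpha> * t) * S t\<bar> \<le> exp (- \<alpha> * t) * (K * t)" using lip[of 0 t] S0 t by (simp add: abs_mult)
 also have "\<bar>itg 0 t (\<lambda>s. \<alpha> * exp (- \<alpha> * (t - s)) * (S t - S s))\<bar> \<le> itg 0 t (\<lambda>s. K * (\<alpha> * exp (- \<alpha> * (t - s)) * (t - s)))"
 proof (rule itg_abs_le)
  fix s assume s: "0 \<le> s" "s \<le> t"
  have "\<bar>\<alpha> * exp (- \<alpha> * (t - s)) * (S t - S s)\<bar> = \<alpha> * exp (- \<alpha> * (t - s)) * \<bar>S t - S s\<bar>" using a by (simp add: abs_mult)
  also have "... \<le> \<alpha> * exp (- \<alpha> * (t - s)) * (K * (t - s))" using lip[OF s] a by (intro mult_left_mono) auto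
  finally show "\<bar>\<alpha> * exp (- \<alpha> * (t - s)) * (S t - S s)\<bar> \<le> K * (\<alpha> * exp (- \<alpha> * (t - s)) * (t - s))" by (simp add: mult_ac)
 qed (intro continuous_intros S)+
 also have "exp (- \<alpha> * t) * (K * t) + itg 0 t (\<lambda>s. K * (\<alpha> * exp (- \<alpha> * (t - s)) * (t - s)))
   = K * (exp (- \<alpha> * t) * t + itg 0 t (\<lambda>s. \<alpha> * exp (- \<alpha> * (t - s)) * (t - s)))"
  unfolding set_integral_mult_right by (simp only: distrib_left mult.left_commute)
 also have "... \<le> K * (1 / \<alpha>)" by (intro mult_left_mono exp_weight_linear t a K)
 finally show ?thesis by simp
qed

lemma itg_split:
 assumes "set_integrable lborel {a..c} f" "a \<le> b" "b \<le> c"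
 shows "itg a c f = itg a b f + itg b c f"
proof -
 have i: "set_integrable lborel {a..b} f" "set_integrable lborel {b..c} f"
  by (rule set_integrable_subset[OF assms(1)]; use assms in auto)+
 have "integral {a..b} f + integral {b..c} f = integral {a..c} f"
  by (rule Henstock_Kurzweil_Integration.integral_combine[OF assms(2,3) set_borel_integral_eq_integral(1)[OF assms(1)]])
 thus ?thesis using set_borel_integral_eq_integral(2)[OF assms(1)] set_borel_integral_eq_integral(2)[OF i(1)] set_borel_integral_eq_integral(2)[OF i(2)] by simp
qed

lemma itg_cells:
 assumes f: "\<And>a b. set_integrable lborel {a..b} f" and T: "0 < T" "0 < N"
 shows "itg 0 T f = (\<Sum>j<N. itg (node T N j) (node T N (Suc j)) f)"
proof -
 have "(\<Sum>j<n. itg (node T N j) (node T N (Suc j)) f) = itg 0 (node T N n) f" for n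
 proof (induction n)
  case (Suc n)
  show ?case using Suc itg_split[OF f, of 0 "node T N n" "node T N (Suc n)"] T node_nonneg[of T N n] node_mono[of T n "Suc n" N] by simp
 qed simp
 from this[of N] T show ?thesis by simp
qed

lemma abel_sum:
 fixes w b :: "nat => real"
 shows "(\<Sum>j<n. w j * (b (Suc j) - b j)) = w n * b n - w 0 * b 0 - (\<Sum>j<n. (w (Suc j) - w j) * b (Suc j))"
 by (induction n) (auto simp: algebra_simps)

text \<open>Summation by parts turns the Riemann-Stieltjes sums against \<open>dS\<close> into Riemann sums of a continuous function.\<close>

lemma ou_riemann:
 assumes S: "continuous_on UNIV S" and S0: "S 0 = 0" and t: "0 < t" and a: "\<alpha> > 0"
 shows "(\<lambda>k. \<Sum>j<Suc k. exp (- \<alpha> * (t - node t (Suc k) j)) * (S (node t (Suc k) (Suc j)) - S (node t (Suc k) j))) \<longlonglongrightarrow> ou \<alpha> S t"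
proof (rule LIMSEQ_I)
 fix e :: real assume e: "e > 0"
 have "uniformly_continuous_on {0..t} S" using S by (intro compact_uniformly_continuous) (auto intro: continuous_on_subset)
 then obtain d where d: "d > 0" "\<And>x y. x \<in> {0..t} ==> y \<in> {0..t} ==> dist y x < d ==> dist (S y) (S x) < e / 2"
  using e unfolding uniformly_continuous_on_def by (metis half_gt_zero)
 have "(\<lambda>k. t * inverse (real (Suc k))) \<longlonglongrightarrow> t * 0" by (intro tendsto_intros LIMSEQ_inverse_real_of_nat)
 hence "\<forall>\<^sub>F k in sequentially. t * inverse (real (Suc k)) < d" using d(1) by (intro order_tendstoD) auto
 then obtain k0 where k0: "\<And>k. k \<ge> k0 ==> t / real (Suc k) < d" by (auto simp: eventually_sequentially divide_inverse)
 show "\<exists>k0. \<forall>k\<ge>k0. norm ((\<Sum>j<Suc k. exp (- \<alpha> * (t - node t (Suc k) j)) * (S (node t (Suc k) (Suc j)) - S (node t (Suc k) j))) - ou \<alpha> S t) < e"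
 proof (intro exI[of _ k0] allI impI)
  fix k assume k: "k \<ge> k0"
  define N where "N = Suc k"
  have N: "0 < N" by (simp add: N_def)
  define w where "w s = \<alpha> * exp (- \<alpha> * (t - s))" for s
  have cw: "continuous_on UNIV w" unfolding w_def[abs_def] by (intro continuous_intros)
  have ww: "itg x y w = exp (- \<alpha> * (t - y)) - exp (- \<alpha> * (t - x))" if "x \<le> y" for x y
   unfolding w_def[abs_def] by (rule itg_FTC) (use that in \<open>auto intro!: derivative_eq_intros continuous_intros\<close>)
  have nm: "node t N j \<le> node t N (Suc j)" for j using t by (intro node_mono) auto
  define I where "I j = itg (node t N j) (node t N (Suc j)) (\<lambda>s. w s * S s)" for j
  have "itg 0 t (\<lambda>s. w s * S s) = (\<Sum>j<N. I j)" unfolding I_def by (intro itg_cells cont_set_integrable continuous_intros cw S t N)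
  moreover have "\<alpha> * itg 0 t (\<lambda>s. exp (- \<alpha> * (t - s)) * S s) = itg 0 t (\<lambda>s. w s * S s)"
   by (simp add: w_def mult.assoc)
  ultimately have ou: "ou \<alpha> S t = S t - (\<Sum>j<N. I j)" by (simp add: ou_def)
  have "(\<Sum>j<N. exp (- \<alpha> * (t - node t N j)) * (S (node t N (Suc j)) - S (node t N j)))
   = S t - (\<Sum>j<N. itg (node t N j) (node t N (Suc j)) w * S (node t N (Suc j)))"
   using abel_sum[of "\<lambda>j. exp (- \<alpha> * (t - node t N j))" "\<lambda>j. S (node t N j)" N] N S0 by (simp add: ww[OF nm])
  hence "(\<Sum>j<N. exp (- \<alpha> * (t - node t N j)) * (S (node t N (Suc j)) - S (node t N j))) - ou \<alpha> S t
   = (\<Sum>j<N. I j - itg (node t N j) (node t N (Suc j)) w * S (node t N (Suc j)))" by (simp add: ou sum_subtractf)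
  also have "\<bar>...\<bar> \<le> (\<Sum>j<N. (e / 2) * itg (node t N j) (node t N (Suc j)) w)"
  proof (rule order_trans[OF sum_abs], rule sum_mono)
   fix j assume "j \<in> {..<N}"
   hence j: "j < N" by simp
   have "I j - itg (node t N j) (node t N (Suc j)) w * S (node t N (Suc j)) = I j - itg (node t N j) (node t N (Suc j)) (\<lambda>s. w s * S (node t N (Suc j)))" by simp
   also have "... = itg (node t N j) (node t N (Suc j)) (\<lambda>s. w s * S s - w s * S (node t N (Suc j)))"
    unfolding I_def by (intro set_integral_diff(2)[symmetric] cont_set_integrable continuous_intros cw S)
   also have "\<bar>...\<bar> \<le> itg (node t N j) (node t N (Suc j)) (\<lambda>s. (e / 2) * w s)"
   proof (rule itg_abs_le)
    fix s assume s: "node t N j \<le> s" "s \<le> node t N (Suc j)"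
    have nn: "0 \<le> node t N j" "node t N (Suc j) \<le> t" using node_nonneg[of t N j] node_le[of t "Suc j" N] t j by auto
    have "dist s (node t N (Suc j)) < d"
     using s k0[OF k] by (auto simp: node_Suc dist_real_def N_def)
    hence "dist (S s) (S (node t N (Suc j))) < e / 2" using s nn by (intro d(2)) auto
    hence "\<bar>S s - S (node t N (Suc j))\<bar> \<le> e / 2" by (simp add: dist_real_def)
    moreover have "w s \<ge> 0" using a by (simp add: w_def)
    ultimately have "w s * \<bar>S s - S (node t N (Suc j))\<bar> \<le> w s * (e / 2)" by (intro mult_left_mono)
    thus "\<bar>w s * S s - w s * S (node t N (Suc j))\<bar> \<le> (e / 2) * w s"
    proof -
     have "\<bar>w s * S s - w s * S (node t N (Suc j))\<bar> = w s * \<bar>S s - S (node t N (Suc j))\<bar>"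
      using \<open>w s \<ge> 0\<close> by (simp only: right_diff_distrib[symmetric] abs_mult abs_of_nonneg)
     thus ?thesis using \<open>w s * \<bar>S s - S (node t N (Suc j))\<bar> \<le> w s * (e / 2)\<close> by (simp only: mult.commute)
    qed
   qed (intro continuous_intros cw S)+
   finally show "\<bar>I j - itg (node t N j) (node t N (Suc j)) w * S (node t N (Suc j))\<bar> \<le> (e / 2) * itg (node t N j) (node t N (Suc j)) w" by simp
  qed
  also have "... = (e / 2) * itg 0 t w" using itg_cells[OF cont_set_integrable[OF cw] t N] by (simp only: sum_distrib_left)
  also have "itg 0 t w = 1 - exp (- \<alpha> * t)" using ww[of 0 t] t by simp
  also have "(e / 2) * (1 - exp (- \<alpha> * t)) \<le> (e / 2) * 1" using e by (intro mult_left_mono) auto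
  also have "... < e" using e by simp
  finally show "norm ((\<Sum>j<Suc k. exp (- \<alpha> * (t - node t (Suc k) j)) * (S (node t (Suc k) (Suc j)) - S (node t (Suc k) j))) - ou \<alpha> S t) < e"
   by (simp add: N_def)
 qed
qed

section \<open>Integrals of processes\<close>

lemma continuous_bounded_Icc: "continuous_on UNIV (g :: real => real) ==> \<exists>K. \<forall>s. a \<le> s \<and> s \<le> b \<longrightarrow> \<bar>g s\<bar> \<le> K"
proof -
 assume "continuous_on UNIV g"
 hence "compact (g ` {a..b})" by (intro compact_continuous_image) (auto intro: continuous_on_subset)
 thus ?thesis using compact_imp_bounded by (force simp: bounded_iff)
qed

lemma bounded_set_integrable:
 assumes [measurable]: "f \<in> borel_measurable borel" and b: "\<And>x. a \<le> x ==> x \<le> b ==> \<bar>f x\<bar> \<le> K"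
 shows "set_integrable lborel {a..b} (f :: real => real)"
 unfolding set_integrable_def
proof (rule Bochner_Integration.integrable_bound[of _ "\<lambda>x. indicator {a..b} x *\<^sub>R \<bar>K\<bar>"])
 show "integrable lborel (\<lambda>x. indicator {a..b} x *\<^sub>R \<bar>K\<bar>)" by (auto simp: emeasure_lborel_Icc_eq intro!: integrable_mult_left integrable_real_indicator)
 show "AE x in lborel. norm (indicator {a..b} x *\<^sub>R f x) \<le> norm (indicator {a..b} x *\<^sub>R \<bar>K\<bar>)"
  using b by (intro AE_I2) (fastforce simp: indicator_def)
qed measurable

lemma itg_const: "a \<le> b ==> itg a b (\<lambda>_. c) = c * (b - a)"
 by (simp add: set_lebesgue_integral_def)

lemma itg_square_le:
 assumes f: "set_integrable lborel {a..b} f" "set_integrable lborel {a..b} (\<lambda>x. (f x)^2)" and "a \<le> b"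
 shows "(itg a b f)^2 \<le> (b - a) * itg a b (\<lambda>x. (f x)^2)"
proof -
 have sq: "(indicator {a..b} x *\<^sub>R f x)^2 = indicator {a..b} x *\<^sub>R (f x)^2" for x by (auto simp: indicator_def)
 have "sqint lborel (\<lambda>x. indicator {a..b} x *\<^sub>R f x)"
  unfolding sqint_def sq using f by (auto simp: set_integrable_def)
 moreover have "sqint lborel (indicator {a..b} :: real => real)"
  using \<open>a \<le> b\<close> by (auto simp: sqint_def power2_eq_square indicator_inter_arith[symmetric] emeasure_lborel_Icc_eq intro!: integrable_real_indicator)
 ultimately have "(LINT x|lborel. indicator {a..b} x * (indicator {a..b} x *\<^sub>R f x))^2 \<le>
   (LINT x|lborel. (indicator {a..b} x)^2) * (LINT x|lborel. (indicator {a..b} x *\<^sub>R f x)^2)"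
  by (intro cauchy_schwarz_integral)
 moreover have "indicator {a..b} x * (indicator {a..b} x *\<^sub>R f x) = indicator {a..b} x *\<^sub>R f x" for x by (auto simp: indicator_def)
 moreover have "(LINT x|lborel. (indicator {a..b} x)^2) = b - a"
  using \<open>a \<le> b\<close> by (simp add: power2_eq_square indicator_inter_arith[symmetric])
 ultimately show ?thesis by (simp only: sq set_lebesgue_integral_def)
qed

text \<open>A process with continuous paths is jointly measurable, as a limit of its values at the
  grid points \<open>\<lfloor>ns\<rfloor> / n\<close>.\<close>

lemma continuous_jointly_measurable:
 fixes f :: "real => 'w => real"
 assumes c: "\<And>w. w \<in> space M ==> continuous_on UNIV (\<lambda>s. f s w)" and m: "\<And>s. f s \<in> borel_measurable M"
 shows "(\<lambda>p. f (fst p) (snd p)) \<in> borel_measurable (lborel \<Otimes>\<^sub>M M)"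
proof (rule borel_measurable_LIMSEQ_real)
 fix n :: nat
 show "(\<lambda>p :: real \<times> 'w. f (real_of_int \<lfloor>fst p * real (Suc n)\<rfloor> / real (Suc n)) (snd p)) \<in> borel_measurable (lborel \<Otimes>\<^sub>M M)"
 proof (rule measurable_compose_countable[where g="\<lambda>p :: real \<times> 'w. \<lfloor>fst p * real (Suc n)\<rfloor>"])
  fix i :: int
  show "(\<lambda>p :: real \<times> 'w. f (real_of_int i / real (Suc n)) (snd p)) \<in> borel_measurable (lborel \<Otimes>\<^sub>M M)"
   by (rule measurable_compose[OF measurable_snd m])
 qed measurable
next
 fix p :: "real \<times> 'w" assume "p \<in> space (lborel \<Otimes>\<^sub>M M)"
 hence s: "snd p \<in> space M" by (auto simp: space_pair_measure)
 have "(\<lambda>n. real_of_int \<lfloor>fst p * real (Suc n)\<rfloor> / real (Suc n)) \<longlonglongrightarrow> fst p"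
 proof (rule LIM_zero_cancel, rule Lim_null_comparison[OF _ LIMSEQ_inverse_real_of_nat])
  show "\<forall>\<^sub>F n in sequentially. norm (real_of_int \<lfloor>fst p * real (Suc n)\<rfloor> / real (Suc n) - fst p) \<le> inverse (real (Suc n))"
  proof (intro always_eventually allI)
   fix n
   have "\<bar>real_of_int \<lfloor>fst p * real (Suc n)\<rfloor> - fst p * real (Suc n)\<bar> \<le> 1" by linarith
   hence "\<bar>real_of_int \<lfloor>fst p * real (Suc n)\<rfloor> - fst p * real (Suc n)\<bar> / real (Suc n) \<le> 1 / real (Suc n)" by (intro divide_right_mono) auto
   moreover have "real_of_int \<lfloor>fst p * real (Suc n)\<rfloor> / real (Suc n) - fst p = (real_of_int \<lfloor>fst p * real (Suc n)\<rfloor> - fst p * real (Suc n)) / real (Suc n)"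
    by (simp add: field_simps del: of_nat_Suc)
   ultimately show "norm (real_of_int \<lfloor>fst p * real (Suc n)\<rfloor> / real (Suc n) - fst p) \<le> inverse (real (Suc n))"
    by (simp add: abs_divide inverse_eq_divide del: of_nat_Suc)
  qed
 qed
 moreover have "isCont (\<lambda>s. f s (snd p)) (fst p)" using c[OF s] by (simp add: continuous_on_eq_continuous_at)
 ultimately show "(\<lambda>n. f (real_of_int \<lfloor>fst p * real (Suc n)\<rfloor> / real (Suc n)) (snd p)) \<longlonglongrightarrow> f (fst p) (snd p)"
  by (rule isCont_tendsto_compose[rotated])
qed

text \<open>The uniform bound on the second moments makes the product integrable on \<open>[a,b] \<times> \<Omega>\<close>.\<close>

lemma (in prob_space) fubini_itg:
 fixes h :: "real => 'a => real"
 assumes h: "(\<lambda>p. h (fst p) (snd p)) \<in> borel_measurable (lborel \<Otimes>\<^sub>M M)"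
  and sq: "\<And>s. a \<le> s ==> s \<le> b ==> sqint M (h s)" and K: "\<And>s. a \<le> s ==> s \<le> b ==> (LINT w|M. (h s w)^2) \<le> K"
  and W: "sqint M W"
 shows "integrable M (\<lambda>w. W w * itg a b (\<lambda>s. h s w))"
  "set_integrable lborel {a..b} (\<lambda>s. LINT w|M. W w * h s w)"
  "(LINT w|M. W w * itg a b (\<lambda>s. h s w)) = itg a b (\<lambda>s. LINT w|M. W w * h s w)"
proof -
 interpret pair_sigma_finite lborel M ..
 note [measurable] = h
 have [measurable]: "W \<in> borel_measurable M" using W by auto
 define F where "F s w = indicator {a..b} s * (W w * h s w)" for s w
 have Fm: "case_prod F \<in> borel_measurable (lborel \<Otimes>\<^sub>M M)" unfolding F_def case_prod_beta by measurable
 have Fi: "integrable (lborel \<Otimes>\<^sub>M M) (case_prod F)"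
 proof (rule integrableI_bounded[OF Fm])
  have "(\<integral>\<^sup>+p. ennreal (norm (case_prod F p)) \<partial>(lborel \<Otimes>\<^sub>M M)) = (\<integral>\<^sup>+s. (\<integral>\<^sup>+w. ennreal (norm (F s w)) \<partial>M) \<partial>lborel)"
  proof -
   have "sigma_finite_measure M" by unfold_locales
   from sigma_finite_measure.nn_integral_fst[OF this, of "\<lambda>p. ennreal (norm (case_prod F p))" lborel]
   show ?thesis using Fm by simp
  qed
  also have "... \<le> (\<integral>\<^sup>+s. ennreal ((LINT w|M. (W w)^2) + K) * indicator {a..b} s \<partial>lborel)"
  proof (rule nn_integral_mono)
   fix s
   show "(\<integral>\<^sup>+w. ennreal (norm (F s w)) \<partial>M) \<le> ennreal ((LINT w|M. (W w)^2) + K) * indicator {a..b} s"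
   proof (cases "s \<in> {a..b}")
    case True
    hence hs: "sqint M (h s)" "(LINT w|M. (h s w)^2) \<le> K" using sq K by auto
    have "(\<integral>\<^sup>+w. ennreal (norm (F s w)) \<partial>M) \<le> (\<integral>\<^sup>+w. ennreal ((W w)^2 + (h s w)^2) \<partial>M)"
    proof (intro nn_integral_mono ennreal_leI)
     fix w
     have "0 \<le> (\<bar>W w\<bar> - \<bar>h s w\<bar>)^2" by simp
     hence "2 * (\<bar>W w\<bar> * \<bar>h s w\<bar>) \<le> (W w)^2 + (h s w)^2" by (simp add: power2_diff)
     moreover have "0 \<le> \<bar>W w\<bar> * \<bar>h s w\<bar>" by simp
     ultimately have "\<bar>W w\<bar> * \<bar>h s w\<bar> \<le> (W w)^2 + (h s w)^2" by linarith
     thus "norm (F s w) \<le> (W w)^2 + (h s w)^2" using True by (simp add: F_def abs_mult)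
    qed
    also have "... = ennreal (LINT w|M. (W w)^2 + (h s w)^2)"
     by (rule nn_integral_eq_integral) (use sqint_sq[OF W] sqint_sq[OF hs(1)] in auto)
    also have "... \<le> ennreal ((LINT w|M. (W w)^2) + K)"
     using hs(2) sqint_sq[OF W] sqint_sq[OF hs(1)] by (intro ennreal_leI) simp
    finally show ?thesis using True by simp
   qed (simp add: F_def)
  qed
  also have "... < \<infinity>" by (simp add: nn_integral_cmult ennreal_mult_less_top emeasure_lborel_Icc_eq)
  finally show "(\<integral>\<^sup>+p. ennreal (norm (case_prod F p)) \<partial>(lborel \<Otimes>\<^sub>M M)) < \<infinity>" .
 qed
 have e1: "(LINT s|lborel. F s w) = W w * itg a b (\<lambda>s. h s w)" for w
  unfolding F_def set_lebesgue_integral_def by (simp add: mult.left_commute)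
 have e2: "(LINT w|M. F s w) = indicator {a..b} s *\<^sub>R (LINT w|M. W w * h s w)" for s
  unfolding F_def by simp
 show "integrable M (\<lambda>w. W w * itg a b (\<lambda>s. h s w))" using integrable_snd[OF Fi] by (simp add: e1)
 show "set_integrable lborel {a..b} (\<lambda>s. LINT w|M. W w * h s w)"
  using integrable_fst[OF Fi] by (simp add: e2 set_integrable_def)
 show "(LINT w|M. W w * itg a b (\<lambda>s. h s w)) = itg a b (\<lambda>s. LINT w|M. W w * h s w)"
  using Fubini_integral[OF Fi] by (simp add: e1 e2 set_lebesgue_integral_def)
qed

lemma (in prob_space) sqint_itg:
 fixes h :: "real => 'a => real"
 assumes h: "(\<lambda>p. h (fst p) (snd p)) \<in> borel_measurable (lborel \<Otimes>\<^sub>M M)"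
  and sq: "\<And>s. a \<le> s ==> s \<le> b ==> sqint M (h s)" and K: "\<And>s. a \<le> s ==> s \<le> b ==> (LINT w|M. (h s w)^2) \<le> K"
  and path: "\<And>w. w \<in> space M ==> set_integrable lborel {a..b} (\<lambda>s. h s w)"
   "\<And>w. w \<in> space M ==> set_integrable lborel {a..b} (\<lambda>s. (h s w)^2)" and ab: "a \<le> b"
 shows "sqint M (\<lambda>w. itg a b (\<lambda>s. h s w))" "(LINT w|M. (itg a b (\<lambda>s. h s w))^2) \<le> K * (b - a)^2"
proof -
 interpret pair_sigma_finite lborel M ..
 note [measurable] = h
 have [measurable]: "(\<lambda>p. h (snd p) (fst p)) \<in> borel_measurable (M \<Otimes>\<^sub>M lborel)"
  using measurable_compose[OF measurable_Pair[OF measurable_snd measurable_fst] h] by simp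
 have [measurable]: "(\<lambda>w. itg a b (\<lambda>s. h s w)) \<in> borel_measurable M"
  using fubini_itg(1)[OF h sq K sqint_const[of 1]] by auto
 have "0 \<le> (LINT w|M. (h a w)^2)" by simp
 also have "... \<le> K" by (rule K) (use ab in auto)
 finally have K0: "K \<ge> 0" .
 have "(\<integral>\<^sup>+w. ennreal ((itg a b (\<lambda>s. h s w))^2) \<partial>M) \<le> (\<integral>\<^sup>+w. ennreal (b - a) * (\<integral>\<^sup>+s. ennreal (indicator {a..b} s * (h s w)^2) \<partial>lborel) \<partial>M)"
 proof (rule nn_integral_mono)
  fix w assume w: "w \<in> space M"
  have "ennreal ((itg a b (\<lambda>s. h s w))^2) \<le> ennreal ((b - a) * itg a b (\<lambda>s. (h s w)^2))"
   by (intro ennreal_leI itg_square_le path w ab)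
  also have "... = ennreal (b - a) * ennreal (itg a b (\<lambda>s. (h s w)^2))" using ab by (simp add: ennreal_mult')
  also have "ennreal (itg a b (\<lambda>s. (h s w)^2)) = (\<integral>\<^sup>+s. ennreal (indicator {a..b} s * (h s w)^2) \<partial>lborel)"
   using path(2)[OF w] unfolding set_lebesgue_integral_def set_integrable_def by (subst nn_integral_eq_integral) auto
  finally show "ennreal ((itg a b (\<lambda>s. h s w))^2) \<le> ennreal (b - a) * (\<integral>\<^sup>+s. ennreal (indicator {a..b} s * (h s w)^2) \<partial>lborel)" .
 qed
 also have "... = ennreal (b - a) * (\<integral>\<^sup>+w. (\<integral>\<^sup>+s. ennreal (indicator {a..b} s * (h s w)^2) \<partial>lborel) \<partial>M)"
  by (rule nn_integral_cmult) measurable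
 also have "(\<integral>\<^sup>+w. (\<integral>\<^sup>+s. ennreal (indicator {a..b} s * (h s w)^2) \<partial>lborel) \<partial>M) = (\<integral>\<^sup>+s. (\<integral>\<^sup>+w. ennreal (indicator {a..b} s * (h s w)^2) \<partial>M) \<partial>lborel)"
  by (rule Fubini') measurable
 also have "... \<le> (\<integral>\<^sup>+s. ennreal K * indicator {a..b} s \<partial>lborel)"
 proof (rule nn_integral_mono)
  fix s
  show "(\<integral>\<^sup>+w. ennreal (indicator {a..b} s * (h s w)^2) \<partial>M) \<le> ennreal K * indicator {a..b} s"
  proof (cases "s \<in> {a..b}")
   case True
   hence "(\<integral>\<^sup>+w. ennreal (indicator {a..b} s * (h s w)^2) \<partial>M) = ennreal (LINT w|M. (h s w)^2)"
    using sqint_sq[OF sq[of s]] by (simp add: nn_integral_eq_integral)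
   thus ?thesis using K[of s] True by (simp add: ennreal_leI)
  qed simp
 qed
 also have "... = ennreal (K * (b - a))" using ab K0 by (simp add: nn_integral_cmult_indicator ennreal_mult'[symmetric])
 also have "ennreal (b - a) * ... = ennreal (K * (b - a)^2)" using ab by (simp add: ennreal_mult'[symmetric] power2_eq_square mult_ac)
 finally have le: "(\<integral>\<^sup>+w. ennreal ((itg a b (\<lambda>s. h s w))^2) \<partial>M) \<le> ennreal (K * (b - a)^2)" by (simp add: mult_left_mono)
 have i: "integrable M (\<lambda>w. (itg a b (\<lambda>s. h s w))^2)"
  by (rule integrableI_nonneg) (use le in \<open>auto simp: less_top[symmetric] top_unique\<close>)
 thus "sqint M (\<lambda>w. itg a b (\<lambda>s. h s w))" by (simp add: sqint_def)
 show "(LINT w|M. (itg a b (\<lambda>s. h s w))^2) \<le> K * (b - a)^2"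
  using le nn_integral_eq_integral[OF i] K0 by simp
qed

section \<open>The Ornstein-Uhlenbeck process\<close>

locale fou = fbm H M B for H :: real and M :: "'w measure" and B +
 fixes C \<alpha> :: real and \<phi> :: "'p::finite => real => real" and \<mu> :: "real^'p" and X :: "real => 'w => real"
 assumes \<phi>_measurable [measurable]: "\<And>i. \<phi> i \<in> borel_measurable borel"
  and C_pos: "C > 0" and \<phi>_bound: "\<And>i t. \<bar>\<phi> i t\<bar> \<le> C"
  and \<phi>_periodic: "\<And>i t. \<phi> i (t + 1) = \<phi> i t"
  and \<phi>_orthonormal: "\<And>i j. (LINT t:{0..1}|lborel. \<phi> i t * \<phi> j t) = (if i = j then 1 else 0)"
  and \<alpha>_pos: "\<alpha> > 0"
  and X_sol: "periodic_fOU M B \<phi> \<mu> \<alpha> X"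
begin

definition L :: "real => real" where "L t = (\<Sum>i\<in>UNIV. \<mu> $ i * \<phi> i t)"
definition CL :: real where "CL = (\<Sum>i\<in>UNIV. \<bar>\<mu> $ i\<bar> * C)"

lemma L_measurable [measurable]: "L \<in> borel_measurable borel" unfolding L_def[abs_def] by measurable

lemma L_bound: "\<bar>L t\<bar> \<le> CL"
 unfolding L_def CL_def by (rule order_trans[OF sum_abs]) (auto simp: abs_mult intro!: sum_mono mult_left_mono \<phi>_bound)

lemma CL_nonneg: "CL \<ge> 0" using L_bound[of 0] by linarith

lemma L_integrable: "set_integrable lborel {a..b} L" by (rule bounded_set_integrable) (auto intro: L_bound)

definition Lam :: "real => real" where "Lam t = itg 0 t L"

lemma Lam_lipschitz: "0 \<le> s ==> s \<le> t ==> \<bar>Lam t - Lam s\<bar> \<le> CL * (t - s)"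
proof -
 assume s: "0 \<le> s" "s \<le> t"
 have "Lam t - Lam s = itg s t L" unfolding Lam_def using itg_split[OF L_integrable s] by simp
 also have "\<bar>...\<bar> \<le> itg s t (\<lambda>_. CL)"
  by (rule itg_abs_le'[OF L_integrable]) (auto intro: L_bound bounded_set_integrable[of _ _ _ CL] simp: CL_nonneg)
 finally show ?thesis using s by (simp add: itg_const)
qed

lemma Lam_0: "Lam 0 = 0" by (simp add: Lam_def)

lemma Lam_continuous: "continuous_on UNIV Lam"
proof -
 have 1: "continuous_on {0..} Lam"
 proof (rule continuous_onI)
  fix x e :: real assume x: "x \<in> {0..}" and e: "e > 0"
  show "\<exists>d>0. \<forall>x'\<in>{0..}. dist x' x < d \<longrightarrow> dist (Lam x') (Lam x) \<le> e"
  proof (intro exI[of _ "e / (CL + 1)"] conjI ballI impI)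
   show "0 < e / (CL + 1)" using e CL_nonneg by simp
   fix y :: real assume y: "y \<in> {0..}" "dist y x < e / (CL + 1)"
   have "\<bar>Lam y - Lam x\<bar> \<le> CL * \<bar>y - x\<bar>"
    using Lam_lipschitz[of x y] Lam_lipschitz[of y x] x y by (cases "x \<le> y") (auto simp: abs_minus_commute)
   also have "... \<le> (CL + 1) * \<bar>y - x\<bar>" by (simp add: algebra_simps)
   also have "... \<le> e" using y(2) CL_nonneg by (simp add: dist_real_def pos_less_divide_eq mult.commute)
   finally show "dist (Lam y) (Lam x) \<le> e" by (simp add: dist_real_def)
  qed
 qed
 have "continuous_on UNIV (\<lambda>t. Lam (max 0 t))"
  by (rule continuous_on_compose2[OF 1]) (auto intro!: continuous_intros)
 thus ?thesis by (simp add: Lam_def itg_max)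
qed

definition m :: "real => real" where "m = ou \<alpha> Lam"

lemma m_continuous: "continuous_on UNIV m" unfolding m_def by (rule ou_continuous[OF Lam_continuous])

lemma m_measurable [measurable]: "m \<in> borel_measurable borel" by (rule borel_measurable_continuous_onI[OF m_continuous])

lemma m_bound: "0 \<le> t ==> \<bar>m t\<bar> \<le> CL / \<alpha>"
 unfolding m_def by (rule ou_lipschitz_bound[OF Lam_continuous Lam_lipschitz Lam_0 _ \<alpha>_pos])

lemma m_solves: "0 \<le> t ==> m t = Lam t - \<alpha> * itg 0 t m"
 unfolding m_def by (rule ou_solves[OF Lam_continuous])

definition good :: "'w => bool" where
 "good w \<longleftrightarrow> continuous_on {0..} (\<lambda>t. B t w) \<and> X 0 w = 0 \<and>
   (\<forall>t\<ge>0. set_integrable lborel {0..t} (drift \<phi> \<mu> \<alpha> X w) \<and> X t w = itg 0 t (drift \<phi> \<mu> \<alpha> X w) + B t w)"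

lemma AE_good: "AE w in M. good w"
 using fBm X_sol unfolding good_def fractional_brownian_motion_def periodic_fOU_def by (auto simp: AE_conj_iff)

text \<open>One exceptional set fixed once and for all gives versions of the processes below that are measurable and have
  continuous paths for every sample point.\<close>

definition Nul :: "'w set" where "Nul = (SOME N. N \<in> null_sets M \<and> {w \<in> space M. \<not> good w} \<subseteq> N)"

lemma Nul: "Nul \<in> null_sets M" "w \<in> space M ==> w \<notin> Nul ==> good w"
proof -
 have "\<exists>N. N \<in> null_sets M \<and> {w \<in> space M. \<not> good w} \<subseteq> N"
  using AE_good by (auto elim!: AE_E simp: null_sets_def)
 from someI_ex[OF this] have "Nul \<in> null_sets M \<and> {w \<in> space M. \<not> good w} \<subseteq> Nul" by (simp add: Nul_def)
 thus "Nul \<in> null_sets M" "w \<in> space M ==> w \<notin> Nul ==> good w" by auto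
qed

lemma Nul_sets [measurable]: "Nul \<in> sets M" using Nul(1) by auto

lemma AE_not_Nul: "AE w in M. w \<in> space M \<and> w \<notin> Nul"
 using AE_not_in[OF Nul(1)] AE_space by eventually_elim simp

text \<open>The paths of \<open>B\<close>, replaced by zero on a null set, so that all of them are continuous.\<close>

definition Bc :: "real => 'w => real" where "Bc t w = indicator (space M - Nul) w * B (max 0 t) w"

lemma Bc_eq: "w \<in> space M ==> w \<notin> Nul ==> 0 \<le> t ==> Bc t w = B t w" by (simp add: Bc_def)

lemma Bc_AE: "0 \<le> t ==> AE w in M. Bc t w = B t w"
 using AE_not_Nul by eventually_elim (simp add: Bc_eq)

lemma Bc_measurable [measurable]: "Bc t \<in> borel_measurable M"
 unfolding Bc_def[abs_def] using sqint_measurable[OF B_sqint[of "max 0 t"]] by measurable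

lemma Bc_sqint: "0 \<le> t ==> sqint M (Bc t)"
 by (rule sqint_cong_AE[OF B_sqint _ Bc_measurable]) (use Bc_AE[of t] in \<open>auto elim: AE_mp\<close>)

lemma Bc_continuous: "continuous_on UNIV (\<lambda>t. Bc t w)"
proof (cases "w \<in> space M - Nul")
 case True
 hence "continuous_on {0..} (\<lambda>t. B t w)" using Nul(2) by (auto simp: good_def)
 hence "continuous_on UNIV (\<lambda>t. B (max 0 t) w)"
  by (rule continuous_on_compose2) (auto intro!: continuous_intros)
 thus ?thesis using True by (simp add: Bc_def)
qed (simp add: Bc_def)

lemma Bc_0: "Bc 0 w = 0"
proof (cases "w \<in> space M - Nul")
 case True
 hence "good w" using Nul(2) by auto
 hence "X 0 w = 0" "X 0 w = itg 0 0 (drift \<phi> \<mu> \<alpha> X w) + B 0 w" unfolding good_def by auto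
 thus ?thesis by (simp add: Bc_def)
qed (simp add: Bc_def)

lemma B_increment:
 assumes "0 \<le> s" "s \<le> t" shows "(LINT w|M. (B t w - B s w)^2) = (t - s) powr (2 * H)"
proof -
 have i: "integrable M (\<lambda>w. B t w * B t w)" "integrable M (\<lambda>w. B t w * B s w)" "integrable M (\<lambda>w. B s w * B s w)"
  using assms by (auto intro!: sqint_mult B_sqint)
 have "(LINT w|M. (B t w - B s w)^2) = (LINT w|M. B t w * B t w - 2 * (B t w * B s w) + B s w * B s w)"
  by (intro Bochner_Integration.integral_cong) (auto simp: power2_eq_square algebra_simps)
 also have "... = fbm_cov H t t - 2 * fbm_cov H t s + fbm_cov H s s" using i assms by (simp add: B_cov)
 also have "... = (t - s) powr (2 * H)" using assms by (simp add: fbm_cov_def field_simps)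
 finally show ?thesis .
qed

lemma Bc_increment:
 assumes "0 \<le> s" "s \<le> t" shows "(LINT w|M. (Bc t w - Bc s w)^2) = (t - s) powr (2 * H)"
proof -
 have [measurable]: "B t \<in> borel_measurable M" "B s \<in> borel_measurable M" using assms by (auto intro!: sqint_measurable[OF B_sqint])
 have "(LINT w|M. (Bc t w - Bc s w)^2) = (LINT w|M. (B t w - B s w)^2)"
 proof (rule integral_cong_AE)
  show "AE w in M. (Bc t w - Bc s w)^2 = (B t w - B s w)^2"
   using AE_not_Nul by eventually_elim (use assms in \<open>simp add: Bc_eq\<close>)
 qed measurable
 thus ?thesis using B_increment[OF assms] by simp
qed

lemma powr_H_le: "0 \<le> u ==> u powr (2 * H) \<le> 1 + u^2"
proof (cases "u \<le> 1")
 case True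
 assume "0 \<le> u"
 hence "u powr (2 * H) \<le> 1 powr (2 * H)" using True H_gt by (intro powr_mono2) auto
 thus ?thesis by (simp add: add_increasing2)
next
 case False
 hence "u powr (2 * H) \<le> u powr 2" using H_lt by (intro powr_mono) auto
 thus ?thesis using False by simp
qed

definition Z :: "real => 'w => real" where "Z t w = ou \<alpha> (\<lambda>s. Bc s w) t"

lemma Z_continuous: "continuous_on UNIV (\<lambda>t. Z t w)"
 unfolding Z_def by (rule ou_continuous[OF Bc_continuous])

lemma Z_solves: "0 \<le> t ==> Z t w = Bc t w - \<alpha> * itg 0 t (\<lambda>s. Z s w)"
 unfolding Z_def by (rule ou_solves[OF Bc_continuous])

lemma Z_neg: "t \<le> 0 ==> Z t w = 0"
proof -
 assume t: "t \<le> 0"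
 have "Bc t w = Bc 0 w" using t by (simp add: Bc_def max_def)
 moreover have "itg 0 t f = 0" for f using t itg_max[of t f] by (simp add: max_def split: if_splits)
 ultimately show ?thesis by (simp add: Z_def ou_def Bc_0)
qed

text \<open>Both sides solve the same integral equation, with the continuous right hand side \<open>Lam + B\<close>.\<close>

lemma X_eq:
 assumes w: "w \<in> space M" "w \<notin> Nul" and t: "0 \<le> t"
 shows "X t w = m t + Z t w"
proof -
 have g: "good w" by (rule Nul(2)[OF w])
 define x where "x t = X (max 0 t) w" for t
 have di: "set_integrable lborel {0..t} (drift \<phi> \<mu> \<alpha> X w)" if "0 \<le> t" for t using g that by (simp add: good_def)
 have Xt: "X t w = itg 0 t (drift \<phi> \<mu> \<alpha> X w) + B t w" if "0 \<le> t" for t using g that by (simp add: good_def)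
 have "continuous_on {0..} (\<lambda>t. itg 0 t (drift \<phi> \<mu> \<alpha> X w))"
  unfolding continuous_on_eq_continuous_within
 proof
  fix t :: real assume t: "t \<in> {0..}"
  have "continuous_on {0..t+1} (\<lambda>u. integral {0..u} (drift \<phi> \<mu> \<alpha> X w))"
   using t by (intro indefinite_integral_continuous_1 set_borel_integral_eq_integral(1) di) auto
  hence "continuous_on {0..t+1} (\<lambda>u. itg 0 u (drift \<phi> \<mu> \<alpha> X w))"
   by (rule continuous_on_cong[THEN iffD1, rotated -1]) (auto simp: set_borel_integral_eq_integral(2)[OF di])
  hence "continuous (at t within {0..t+1}) (\<lambda>u. itg 0 u (drift \<phi> \<mu> \<alpha> X w))"
   using t by (auto simp: continuous_on_eq_continuous_within)
  moreover have "at t within {0..t+1} = at t within {0..}"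
   by (rule at_within_nhd[of _ "{..<t+1}"]) auto
  ultimately show "continuous (at t within {0..}) (\<lambda>u. itg 0 u (drift \<phi> \<mu> \<alpha> X w))" by (simp add: continuous_within)
 qed
 moreover have "continuous_on {0..} (\<lambda>t. B t w)" using g by (simp add: good_def)
 ultimately have "continuous_on {0..} (\<lambda>t. itg 0 t (drift \<phi> \<mu> \<alpha> X w) + B t w)" by (intro continuous_intros)
 hence "continuous_on {0..} (\<lambda>t. X t w)" by (rule continuous_on_cong[THEN iffD1, rotated -1]) (auto simp: Xt)
 hence xc: "continuous_on UNIV x" unfolding x_def[abs_def]
  by (rule continuous_on_compose2) (auto intro!: continuous_intros)
 define S where "S t = Lam t + Bc t w" for t
 have Sc: "continuous_on UNIV S" unfolding S_def[abs_def] by (intro continuous_intros Lam_continuous Bc_continuous)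
 have "x t = ou \<alpha> S t"
 proof (rule ou_unique[OF Sc xc _ t])
  fix t :: real assume t: "0 \<le> t"
  have "itg 0 t (drift \<phi> \<mu> \<alpha> X w) = itg 0 t (\<lambda>s. L s - \<alpha> * x s)"
   by (rule set_lebesgue_integral_cong) (auto simp: drift_def L_def x_def max_def)
  also have "... = itg 0 t L - itg 0 t (\<lambda>s. \<alpha> * x s)"
   by (intro set_integral_diff(2) L_integrable cont_set_integrable continuous_intros xc)
  finally show "x t = S t - \<alpha> * itg 0 t x" using Xt[OF t] t w by (simp add: x_def S_def Lam_def Bc_eq max_def[of 0 t])
 qed
 also have "... = m t + Z t w" unfolding S_def[abs_def] m_def Z_def by (rule ou_add[OF Lam_continuous Bc_continuous])
 finally show ?thesis using t by (simp add: x_def max_def)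
qed

text \<open>The coefficients of the step functions approximating \<open>s \<mapsto> exp (- \<alpha> (t - s))\<close>, the integrand of \<open>Z t\<close>.\<close>

definition Zc :: "real => nat => real => real" where
 "Zc t k = cells t (Suc k) (\<lambda>j. exp (- \<alpha> * (t - node t (Suc k) j)))"

lemma Z_riemann: "0 < t ==> (\<lambda>k. \<Sum>j<Suc k. exp (- \<alpha> * (t - node t (Suc k) j)) * (Bc (node t (Suc k) (Suc j)) w - Bc (node t (Suc k) j) w)) \<longlonglongrightarrow> Z t w"
 unfolding Z_def by (rule ou_riemann[OF Bc_continuous Bc_0 _ \<alpha>_pos])

lemma Z_measurable [measurable]: "Z t \<in> borel_measurable M"
proof (cases "t > 0")
 case True
 show ?thesis by (rule borel_measurable_LIMSEQ_real[OF Z_riemann[OF True]]) measurable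
next
 case False
 hence "Z t = (\<lambda>_. 0)" using Z_neg by auto
 thus ?thesis by simp
qed

lemma Z_L2:
 assumes t: "0 < t" shows "L2_tendsto M (\<lambda>k. BB (Zc t k)) (Z t)"
proof (rule L2_Cauchy_AE_tendsto[where r=id])
 have "represents H t (Zc t) (\<lambda>s. exp (- \<alpha> * (t - s)))"
  unfolding Zc_def[abs_def] by (rule represents_cells[OF t]) (intro continuous_intros)
 hence h: "Zc t \<in> hspace H t" by (simp add: represents_def)
 show "sqint M (BB (Zc t k))" for k by (rule BB_sqint[OF hspace_coeffs[OF h]])
 show "\<exists>N. \<forall>j\<ge>N. \<forall>k\<ge>N. (LINT w|M. (BB (Zc t j) w - BB (Zc t k) w)^2) \<le> e" if "e > 0" for e
  by (rule L2_tendsto_Cauchy[OF isonormal_L2[OF h] that])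
 show "AE w in M. (\<lambda>k. BB (Zc t (id k)) w) \<longlonglongrightarrow> Z t w"
  using AE_not_Nul
 proof eventually_elim
  case (elim w)
  have "BB (Zc t k) w = (\<Sum>j<Suc k. exp (- \<alpha> * (t - node t (Suc k) j)) * (Bc (node t (Suc k) (Suc j)) w - Bc (node t (Suc k) j) w))" for k
   unfolding BB_def Zc_def lin_cells by (intro sum.cong refl) (use elim t in \<open>simp add: Bc_eq node_nonneg\<close>)
  thus ?case using Z_riemann[OF t, of w] by simp
 qed
qed (auto simp: strict_mono_def)

lemma Zc_coeffs: "0 \<le> t ==> Zc t k \<in> step_coeffs t" unfolding Zc_def by (rule cells_step_coeffs)

lemma Z_gsp: "Z t \<in> gsp"
proof (cases "t > 0")
 case True
 thus ?thesis using Z_L2[OF True] Zc_coeffs[of t] step_coeffs_coeffs unfolding gsp_def by (intro CollectI exI[of _ "Zc t"]) auto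
next
 case False
 hence "Z t = (\<lambda>_. 0)" using Z_neg by auto
 thus ?thesis by (simp add: gsp_zero)
qed

lemma Z_sqint: "sqint M (Z t)" by (rule gsp_sqint[OF Z_gsp])

definition cov :: "real => real => real" where "cov s t = (LINT w|M. Z s w * Z t w)"

lemma Zc_step_nonneg: "0 < t ==> x \<noteq> 0 ==> step_fun (Zc t k) x \<ge> 0"
 unfolding Zc_def by (rule step_fun_cells_nonneg) auto

text \<open>The approximating step functions and the kernel are nonnegative.\<close>

lemma cov_nonneg: "cov s t \<ge> 0"
proof (cases "s > 0 \<and> t > 0")
 case True
 hence s: "s > 0" and t: "t > 0" by auto
 have "(\<lambda>k. LINT w|M. BB (Zc s k) w * BB (Zc t k) w) \<longlonglongrightarrow> cov s t"
  unfolding cov_def by (rule L2_tendsto_mult[OF Z_L2[OF s] Z_L2[OF t]])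
 moreover have "(LINT w|M. BB (Zc s k) w * BB (Zc t k) w) \<ge> 0" for k
 proof -
  have c: "Zc s k \<in> step_coeffs s" "Zc t k \<in> step_coeffs t" using s t by (auto intro: Zc_coeffs)
  show ?thesis unfolding BB_inner[OF step_coeffs_coeffs[OF c(1)] step_coeffs_coeffs[OF c(2)]]
   by (rule step_inner_nonneg_of_nonneg[OF c]) (use s t in \<open>auto intro: Zc_step_nonneg\<close>)
 qed
 ultimately show ?thesis by (intro LIMSEQ_le_const) auto
next
 case False
 hence "Z s = (\<lambda>_. 0) \<or> Z t = (\<lambda>_. 0)" using Z_neg by (metis ext not_less)
 thus ?thesis by (auto simp: cov_def)
qed

definition KZ :: real where "KZ = 1 + 2 / \<alpha>^2"

lemma KZ_pos: "KZ \<ge> 1" using \<alpha>_pos by (simp add: KZ_def)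

lemma Bc_joint: "(\<lambda>p. Bc (fst p) (snd p)) \<in> borel_measurable (lborel \<Otimes>\<^sub>M M)"
 by (rule continuous_jointly_measurable[OF Bc_continuous Bc_measurable])

lemma Z_joint [measurable]: "(\<lambda>p. Z (fst p) (snd p)) \<in> borel_measurable (lborel \<Otimes>\<^sub>M M)"
 by (rule continuous_jointly_measurable[OF Z_continuous Z_measurable])

text \<open>By \<open>ou_square_le\<close> the second moment is at most a weighted average of \<open>E (B\<^sub>t - B\<^sub>s)\<^sup>2 = (t - s)\<^bsup>2H\<^esup> \<le> 1 + (t - s)\<^sup>2\<close>, and
  \<open>exp_weight_quadratic\<close> evaluates the average.\<close>

lemma Z_second_moment: "(LINT w|M. (Z t w)^2) \<le> KZ"
proof (cases "t > 0")
 case True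
 hence t: "0 \<le> t" by simp
 interpret pair_sigma_finite lborel M ..
 note [measurable] = Bc_joint
 have [measurable]: "(\<lambda>p. Bc (snd p) (fst p)) \<in> borel_measurable (M \<Otimes>\<^sub>M lborel)"
  using measurable_compose[OF measurable_Pair[OF measurable_snd measurable_fst] Bc_joint] by simp
 define wt where "wt s = \<alpha> * exp (- \<alpha> * (t - s))" for s
 have wt0: "wt s \<ge> 0" for s using \<alpha>_pos by (simp add: wt_def)
 have cwt: "continuous_on UNIV wt" unfolding wt_def[abs_def] by (intro continuous_intros)
 have [measurable]: "wt \<in> borel_measurable borel" by (rule borel_measurable_continuous_onI[OF cwt])
 have "(\<integral>\<^sup>+w. ennreal ((Z t w)^2) \<partial>M) \<le> (\<integral>\<^sup>+w. ennreal (exp (- \<alpha> * t) * (Bc t w)^2) + (\<integral>\<^sup>+s. ennreal (indicator {0..t} s * (wt s * (Bc t w - Bc s w)^2)) \<partial>lborel) \<partial>M)"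
 proof (rule nn_integral_mono)
  fix w
  have c: "continuous_on UNIV (\<lambda>s. wt s * (Bc t w - Bc s w)^2)" by (intro continuous_intros cwt Bc_continuous)
  have "ennreal ((Z t w)^2) \<le> ennreal (exp (- \<alpha> * t) * (Bc t w)^2 + itg 0 t (\<lambda>s. wt s * (Bc t w - Bc s w)^2))"
   unfolding Z_def wt_def by (intro ennreal_leI ou_square_le Bc_continuous t \<alpha>_pos)
  also have "... = ennreal (exp (- \<alpha> * t) * (Bc t w)^2) + ennreal (itg 0 t (\<lambda>s. wt s * (Bc t w - Bc s w)^2))"
   by (rule ennreal_plus) (auto simp: set_lebesgue_integral_def wt0)
  also have "ennreal (itg 0 t (\<lambda>s. wt s * (Bc t w - Bc s w)^2)) = (\<integral>\<^sup>+s. ennreal (indicator {0..t} s * (wt s * (Bc t w - Bc s w)^2)) \<partial>lborel)"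
   using cont_set_integrable[OF c, of 0 t] unfolding set_lebesgue_integral_def set_integrable_def
   by (subst nn_integral_eq_integral) (auto simp: wt0)
  finally show "ennreal ((Z t w)^2) \<le> ennreal (exp (- \<alpha> * t) * (Bc t w)^2) + (\<integral>\<^sup>+s. ennreal (indicator {0..t} s * (wt s * (Bc t w - Bc s w)^2)) \<partial>lborel)" .
 qed
 also have "... = (\<integral>\<^sup>+w. ennreal (exp (- \<alpha> * t) * (Bc t w)^2) \<partial>M) + (\<integral>\<^sup>+w. (\<integral>\<^sup>+s. ennreal (indicator {0..t} s * (wt s * (Bc t w - Bc s w)^2)) \<partial>lborel) \<partial>M)"
  by (rule nn_integral_add) measurable
 also have "(\<integral>\<^sup>+w. ennreal (exp (- \<alpha> * t) * (Bc t w)^2) \<partial>M) = ennreal (exp (- \<alpha> * t) * t powr (2 * H))"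
 proof -
  have "(LINT w|M. (Bc t w)^2) = t powr (2 * H)" using Bc_increment[of 0 t] t by (simp add: Bc_0)
  thus ?thesis by (subst nn_integral_eq_integral) (use sqint_sq[OF Bc_sqint[OF t]] in auto)
 qed
 also have "(\<integral>\<^sup>+w. (\<integral>\<^sup>+s. ennreal (indicator {0..t} s * (wt s * (Bc t w - Bc s w)^2)) \<partial>lborel) \<partial>M) = (\<integral>\<^sup>+s. (\<integral>\<^sup>+w. ennreal (indicator {0..t} s * (wt s * (Bc t w - Bc s w)^2)) \<partial>M) \<partial>lborel)"
  by (rule Fubini') measurable
 also have "... \<le> (\<integral>\<^sup>+s. ennreal (indicator {0..t} s * (wt s * (1 + (t - s)^2))) \<partial>lborel)"
 proof (rule nn_integral_mono)
  fix s
  show "(\<integral>\<^sup>+w. ennreal (indicator {0..t} s * (wt s * (Bc t w - Bc s w)^2)) \<partial>M) \<le> ennreal (indicator {0..t} s * (wt s * (1 + (t - s)^2)))"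
  proof (cases "s \<in> {0..t}")
   case True
   have "sqint M (\<lambda>w. Bc t w - Bc s w)" using True t by (intro sqint_diff Bc_sqint) auto
   hence "(\<integral>\<^sup>+w. ennreal (wt s * (Bc t w - Bc s w)^2) \<partial>M) = ennreal (wt s * (t - s) powr (2 * H))"
    using Bc_increment[of s t] True wt0 by (subst nn_integral_eq_integral) auto
   also have "... \<le> ennreal (wt s * (1 + (t - s)^2))" using powr_H_le[of "t - s"] True wt0[of s] by (intro ennreal_leI mult_left_mono) auto
   finally show ?thesis using True by simp
  qed simp
 qed
 also have "... = ennreal (itg 0 t (\<lambda>s. wt s * (1 + (t - s)^2)))"
 proof -
  have c: "continuous_on UNIV (\<lambda>s. wt s * (1 + (t - s)^2))" by (intro continuous_intros cwt)
  show ?thesis using cont_set_integrable[OF c, of 0 t] unfolding set_lebesgue_integral_def set_integrable_def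
   by (subst nn_integral_eq_integral) (auto simp: wt0)
 qed
 also have "ennreal (exp (- \<alpha> * t) * t powr (2 * H)) + ... \<le> ennreal (exp (- \<alpha> * t) * (1 + t^2)) + ennreal (itg 0 t (\<lambda>s. wt s * (1 + (t - s)^2)))"
  using powr_H_le[OF t] by (intro add_right_mono ennreal_leI mult_left_mono) auto
 also have "... = ennreal (exp (- \<alpha> * t) * (1 + t^2) + itg 0 t (\<lambda>s. wt s * (1 + (t - s)^2)))"
  by (rule ennreal_plus[symmetric]) (auto simp: set_lebesgue_integral_def wt0 add_nonneg_nonneg)
 also have "... \<le> ennreal KZ" unfolding wt_def KZ_def by (intro ennreal_leI exp_weight_quadratic t \<alpha>_pos)
 finally have "(\<integral>\<^sup>+w. ennreal ((Z t w)^2) \<partial>M) \<le> ennreal KZ"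
  by (simp add: add_left_mono)
 hence "ennreal (LINT w|M. (Z t w)^2) \<le> ennreal KZ"
  using nn_integral_eq_integral[OF sqint_sq[OF Z_sqint[of t]]] by simp
 thus ?thesis using KZ_pos by (simp add: ennreal_le_iff)
next
 case False
 thus ?thesis using Z_neg[of t] KZ_pos by simp
qed

lemma cov_le: "cov s t \<le> KZ"
proof -
 have "(cov s t)^2 \<le> (LINT w|M. (Z s w)^2) * (LINT w|M. (Z t w)^2)"
  unfolding cov_def by (rule cauchy_schwarz_integral[OF Z_sqint Z_sqint])
 also have "... \<le> KZ * KZ" using KZ_pos by (intro mult_mono Z_second_moment) auto
 finally have "(cov s t)^2 \<le> KZ^2" by (simp add: power2_eq_square)
 moreover have "0 \<le> KZ" using KZ_pos by linarith
 ultimately show ?thesis by (rule power2_le_imp_le)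
qed

text \<open>The integrand of \<open>Z t\<close> dominates a multiple of the indicator of the last unit interval, and
  the norm is monotone on nonnegative functions.\<close>

lemma Z_second_moment_lower:
 assumes t: "1 \<le> t" shows "exp (- 4 * \<alpha>) \<le> (LINT w|M. (Z t w)^2)"
proof (rule LIMSEQ_le_const)
 have t0: "0 < t" using t by simp
 show "(\<lambda>k. LINT w|M. (BB (Zc t k) w)^2) \<longlonglongrightarrow> (LINT w|M. (Z t w)^2)" by (rule L2_tendsto_square[OF Z_L2[OF t0]])
 obtain k0 :: nat where k0: "real k0 > t" using reals_Archimedean2 by blast
 show "\<exists>k0. \<forall>k\<ge>k0. exp (- 4 * \<alpha>) \<le> (LINT w|M. (BB (Zc t k) w)^2)"
 proof (intro exI[of _ k0] allI impI)
  fix k assume k: "k0 \<le> k"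
  define a where "a = Zc t k"
  \<comment> \<open>Cells that meet the last unit interval start after \<open>t - 2\<close>, where the integrand is at least \<open>exp (- 2 \<alpha>)\<close>.\<close>
 define b where "b s = exp (- 2 * \<alpha>) * (unit_coeff t s - unit_coeff (t - 1) s)" for s
  have a: "a \<in> step_coeffs t" unfolding a_def using t0 by (intro Zc_coeffs) simp
  have u: "(\<lambda>s. unit_coeff t s - unit_coeff (t - 1) s) \<in> step_coeffs t"
   using t by (intro step_coeffs_diff unit_step_coeffs) auto
  have b: "b \<in> step_coeffs t" unfolding b_def[abs_def]
   using step_coeffs_sum[of "{()}" "\<lambda>_. (\<lambda>s. unit_coeff t s - unit_coeff (t - 1) s)" t "\<lambda>_. exp (- 2 * \<alpha>)"] u by simp
  have sb: "step_fun b x = exp (- 2 * \<alpha>) * (indicator {0..t} x - indicator {0..t - 1} x)" for x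
   unfolding step_fun_lin b_def[abs_def] lin_cmult by (simp add: lin_diff)
  have sb0: "step_fun b x \<ge> 0" for x unfolding sb using t by (auto simp: indicator_def)
  have sab: "step_fun (\<lambda>s. a s - b s) x \<ge> 0" if x: "x \<noteq> 0" for x
  proof -
   have e: "step_fun (\<lambda>s. a s - b s) x = step_fun a x - step_fun b x"
    using a b by (intro step_fun_diff) (auto simp: step_coeffs_def)
   show ?thesis
   proof (cases "t - 1 < x \<and> x \<le> t")
    case True
    hence x0: "0 < x" using t by simp
    obtain j where j: "j < Suc k" "node t (Suc k) j < x" "x \<le> node t (Suc k) (Suc j)"
     using cell_exists[of t "Suc k" x] t0 x0 True by auto
    have "t / real (Suc k) \<le> 1" using k k0 by (simp add: field_simps)
    hence "t - 2 \<le> node t (Suc k) j" using j(3) True unfolding node_Suc by linarith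
    hence "\<alpha> * (t - node t (Suc k) j) \<le> \<alpha> * 2" using \<alpha>_pos by (intro mult_left_mono) auto
    hence "exp (- 2 * \<alpha>) \<le> step_fun a x" unfolding a_def Zc_def step_fun_cells_eq[OF t0 j] by simp
    thus ?thesis unfolding e sb using True x0 t by (simp add: indicator_def)
   next
    case False
    hence "step_fun b x = 0" unfolding sb by (auto simp: indicator_def)
    thus ?thesis unfolding e using Zc_step_nonneg[OF t0 x] by (simp add: a_def)
   qed
  qed
  have sa0: "step_fun a x \<ge> 0" if "x \<noteq> 0" for x using Zc_step_nonneg[OF t0 that] by (simp add: a_def)
  have ab: "(\<lambda>s. a s - b s) \<in> step_coeffs t" by (rule step_coeffs_diff[OF a b])
  note ca = step_coeffs_coeffs[OF a] and cb = step_coeffs_coeffs[OF b] and cab = step_coeffs_coeffs[OF ab]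
  have 1: "0 \<le> (LINT w|M. BB (\<lambda>s. a s - b s) w * BB a w)"
   unfolding BB_inner[OF cab ca] by (rule step_inner_nonneg_of_nonneg[OF ab a sab sa0])
  have 2: "0 \<le> (LINT w|M. BB (\<lambda>s. a s - b s) w * BB b w)"
   unfolding BB_inner[OF cab cb] by (rule step_inner_nonneg_of_nonneg[OF ab b sab sb0])
  have i: "integrable M (\<lambda>w. BB a w * BB a w)" "integrable M (\<lambda>w. BB b w * BB a w)" "integrable M (\<lambda>w. BB a w * BB b w)" "integrable M (\<lambda>w. BB b w * BB b w)"
   by (intro sqint_mult BB_sqint ca cb)+
  have "(LINT w|M. BB b w * BB b w) \<le> (LINT w|M. BB a w * BB b w)" using 2 i by (simp add: BB_diff[OF ca cb] left_diff_distrib)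
  also have "... = (LINT w|M. BB b w * BB a w)" by (simp add: mult.commute)
  also have "... \<le> (LINT w|M. BB a w * BB a w)" using 1 i by (simp add: BB_diff[OF ca cb] left_diff_distrib)
  finally have "(LINT w|M. (BB b w)^2) \<le> (LINT w|M. (BB a w)^2)" by (simp add: power2_eq_square)
  moreover have "BB b w = exp (- 2 * \<alpha>) * (B t w - B (t - 1) w)" for w
   unfolding BB_def b_def[abs_def] lin_cmult by (simp add: lin_diff)
  hence "(LINT w|M. (BB b w)^2) = (exp (- 2 * \<alpha>))^2 * (LINT w|M. (B t w - B (t - 1) w)^2)" by (simp add: power_mult_distrib)
  moreover have "(exp (- 2 * \<alpha>))^2 = exp (- 4 * \<alpha>)" by (simp add: exp_double[symmetric])
  ultimately show "exp (- 4 * \<alpha>) \<le> (LINT w|M. (BB (Zc t k) w)^2)" using B_increment[of "t - 1" t] t by (simp add: a_def)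
 qed
qed

end

section \<open>The divergence of the Ornstein-Uhlenbeck process\<close>

text \<open>A pointwise convergent sequence bounded in \<open>L\<^sup>2\<close> converges weakly: where \<open>\<bar>\<eta>\<bar>\<close> exceeds \<open>\<bar>D\<bar> / \<delta>\<close> the product
  \<open>D \<eta>\<close> is at most \<open>\<delta> \<eta>\<^sup>2\<close>, elsewhere it is dominated by \<open>D\<^sup>2 / \<delta>\<close>.\<close>

lemma L2_bounded_weak_limit:
 assumes D: "sqint M D" and \<xi>: "\<And>k. sqint M (\<xi> k)" and K: "\<And>k. (LINT w|M. (\<xi> k w)^2) \<le> K"
  and \<xi>0 [measurable]: "\<xi>0 \<in> borel_measurable M" and lim: "AE w in M. (\<lambda>k. \<xi> k w) \<longlonglongrightarrow> \<xi>0 w"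
 shows "sqint M \<xi>0" "(LINT w|M. (\<xi>0 w)^2) \<le> K" "(\<lambda>k. LINT w|M. D w * \<xi> k w) \<longlonglongrightarrow> (LINT w|M. D w * \<xi>0 w)"
proof -
 have [measurable]: "D \<in> borel_measurable M" "\<And>k. \<xi> k \<in> borel_measurable M" using D \<xi> by auto
 have "0 \<le> (LINT w|M. (\<xi> 0 w)^2)" by simp
 also have "... \<le> K" by (rule K)
 finally have K0: "K \<ge> 0" .
 have "(\<integral>\<^sup>+w. ennreal ((\<xi>0 w)^2) \<partial>M) = (\<integral>\<^sup>+w. liminf (\<lambda>k. ennreal ((\<xi> k w)^2)) \<partial>M)"
 proof (rule nn_integral_cong_AE, use lim in eventually_elim)
  case (elim w)
  hence "(\<lambda>k. ennreal ((\<xi> k w)^2)) \<longlonglongrightarrow> ennreal ((\<xi>0 w)^2)" by (intro tendsto_ennrealI tendsto_intros)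
  from lim_imp_Liminf[OF sequentially_bot this] show ?case by simp
 qed
 also have "... \<le> liminf (\<lambda>k. \<integral>\<^sup>+w. ennreal ((\<xi> k w)^2) \<partial>M)" by (rule nn_integral_liminf) measurable
 also have "... \<le> ennreal K"
 proof (rule Liminf_le)
  show "\<forall>\<^sub>F k in sequentially. (\<integral>\<^sup>+w. ennreal ((\<xi> k w)^2) \<partial>M) \<le> ennreal K"
   by (intro always_eventually allI) (subst nn_integral_eq_integral[OF sqint_sq[OF \<xi>]], auto intro!: ennreal_leI K)
 qed simp
 finally have le: "(\<integral>\<^sup>+w. ennreal ((\<xi>0 w)^2) \<partial>M) \<le> ennreal K" .
 have i0: "integrable M (\<lambda>w. (\<xi>0 w)^2)"
  by (rule integrableI_nonneg) (use le in \<open>auto simp: less_top[symmetric] top_unique\<close>)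
 thus s0: "sqint M \<xi>0" by (simp add: sqint_def)
 show le0: "(LINT w|M. (\<xi>0 w)^2) \<le> K" using le nn_integral_eq_integral[OF i0] K0 by simp
 define \<eta> where "\<eta> k w = \<xi> k w - \<xi>0 w" for k w
 have \<eta>: "sqint M (\<eta> k)" for k unfolding \<eta>_def[abs_def] by (rule sqint_diff[OF \<xi> s0])
 have \<eta>m [measurable]: "\<eta> k \<in> borel_measurable M" for k using \<eta> by auto
 have \<eta>K: "(LINT w|M. (\<eta> k w)^2) \<le> 4 * K" for k
  using integral_square_add_le[OF \<xi>[of k] sqint_cmult[OF s0, of "-1"]] K[of k] le0 by (simp add: \<eta>_def)
 have "(\<lambda>k. (LINT w|M. D w * \<xi> k w) - (LINT w|M. D w * \<xi>0 w)) \<longlonglongrightarrow> 0"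
 proof (rule LIMSEQ_I)
  fix e :: real assume e: "e > 0"
  \<comment> \<open>The deviations have square norm at most \<open>4 K\<close>, so the first part contributes at most \<open>e / 2\<close>.\<close>
  define \<delta> where "\<delta> = e / (8 * (K + 1))"
  have \<delta>: "\<delta> > 0" using e K0 by (simp add: \<delta>_def)
  have \<delta>K: "\<delta> * (4 * K) \<le> e / 2"
  proof -
   have "\<delta> * (4 * K) \<le> \<delta> * (4 * (K + 1))" using \<delta> by (intro mult_left_mono) auto
   also have "... = e / 2" using K0 by (simp add: \<delta>_def field_simps)
   finally show ?thesis .
  qed
  have "(\<lambda>k. LINT w|M. min \<bar>D w * \<eta> k w\<bar> ((D w)^2 / \<delta>)) \<longlonglongrightarrow> (LINT w|M. 0)"
  proof (rule integral_dominated_convergence[where w="\<lambda>w. (D w)^2 / \<delta>"])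
   show "integrable M (\<lambda>w. (D w)^2 / \<delta>)" using D by auto
   show "AE w in M. (\<lambda>k. min \<bar>D w * \<eta> k w\<bar> ((D w)^2 / \<delta>)) \<longlonglongrightarrow> 0"
    using lim
   proof eventually_elim
    case (elim w)
    have "(\<lambda>k. min \<bar>D w * (\<xi> k w - \<xi>0 w)\<bar> ((D w)^2 / \<delta>)) \<longlonglongrightarrow> min \<bar>D w * (\<xi>0 w - \<xi>0 w)\<bar> ((D w)^2 / \<delta>)"
     by (intro tendsto_intros elim)
    thus ?case using \<delta> by (simp add: \<eta>_def)
   qed
   show "AE w in M. norm (min \<bar>D w * \<eta> k w\<bar> ((D w)^2 / \<delta>)) \<le> (D w)^2 / \<delta>" for k
    using \<delta> by (intro AE_I2) (auto simp: min_def)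
  qed measurable
  from LIMSEQ_D[OF this, of "e / 2"] e
  obtain k0 where k0: "\<And>k. k \<ge> k0 ==> \<bar>LINT w|M. min \<bar>D w * \<eta> k w\<bar> ((D w)^2 / \<delta>)\<bar> < e / 2" by auto
  show "\<exists>k0. \<forall>k\<ge>k0. norm ((LINT w|M. D w * \<xi> k w) - (LINT w|M. D w * \<xi>0 w) - 0) < e"
  proof (intro exI[of _ k0] allI impI)
   fix k assume k: "k \<ge> k0"
   have im: "integrable M (\<lambda>w. min \<bar>D w * \<eta> k w\<bar> ((D w)^2 / \<delta>))"
    by (rule Bochner_Integration.integrable_bound[of _ "\<lambda>w. (D w)^2 / \<delta>"]) (use D \<delta> in \<open>auto simp: min_def\<close>)
   have "norm ((LINT w|M. D w * \<xi> k w) - (LINT w|M. D w * \<xi>0 w) - 0) = \<bar>LINT w|M. D w * \<eta> k w\<bar>"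
    using sqint_mult[OF D \<xi>[of k]] sqint_mult[OF D s0] by (simp add: \<eta>_def right_diff_distrib)
   also have "... \<le> (LINT w|M. \<bar>D w * \<eta> k w\<bar>)" using integral_norm_bound[of M "\<lambda>w. D w * \<eta> k w"] by simp
   also have "... \<le> (LINT w|M. min \<bar>D w * \<eta> k w\<bar> ((D w)^2 / \<delta>) + \<delta> * (\<eta> k w)^2)"
   proof (rule integral_mono)
    show "integrable M (\<lambda>w. \<bar>D w * \<eta> k w\<bar>)" using sqint_mult[OF D \<eta>[of k]] by simp
    show "integrable M (\<lambda>w. min \<bar>D w * \<eta> k w\<bar> ((D w)^2 / \<delta>) + \<delta> * (\<eta> k w)^2)"
     using im sqint_sq[OF \<eta>[of k]] by simp
    fix w
    show "\<bar>D w * \<eta> k w\<bar> \<le> min \<bar>D w * \<eta> k w\<bar> ((D w)^2 / \<delta>) + \<delta> * (\<eta> k w)^2"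
    proof (cases "\<delta> * \<bar>\<eta> k w\<bar> \<le> \<bar>D w\<bar>")
     case True
     have "\<bar>D w\<bar> * (\<delta> * \<bar>\<eta> k w\<bar>) \<le> \<bar>D w\<bar> * \<bar>D w\<bar>" by (intro mult_left_mono True) auto
     hence "\<bar>D w * \<eta> k w\<bar> \<le> (D w)^2 / \<delta>" using \<delta> by (simp add: abs_mult power2_eq_square pos_le_divide_eq mult_ac)
     thus ?thesis using \<delta> by (simp add: min_def)
    next
     case False
     hence "\<bar>D w\<bar> * \<bar>\<eta> k w\<bar> \<le> (\<delta> * \<bar>\<eta> k w\<bar>) * \<bar>\<eta> k w\<bar>" by (intro mult_right_mono) auto
     hence "\<bar>D w * \<eta> k w\<bar> \<le> \<delta> * (\<eta> k w)^2" by (simp add: abs_mult power2_eq_square mult.assoc)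
     moreover have "0 \<le> min \<bar>D w * \<eta> k w\<bar> ((D w)^2 / \<delta>)" using \<delta> by simp
     ultimately show ?thesis by linarith
    qed
   qed
   also have "... = (LINT w|M. min \<bar>D w * \<eta> k w\<bar> ((D w)^2 / \<delta>)) + \<delta> * (LINT w|M. (\<eta> k w)^2)"
    using im sqint_sq[OF \<eta>[of k]] by simp
   also have "\<delta> * (LINT w|M. (\<eta> k w)^2) \<le> \<delta> * (4 * K)" using \<eta>K[of k] \<delta> by (intro mult_left_mono) auto
   finally show "norm ((LINT w|M. D w * \<xi> k w) - (LINT w|M. D w * \<xi>0 w) - 0) < e" using \<delta>K k0[OF k] by linarith
  qed
 qed
 thus "(\<lambda>k. LINT w|M. D w * \<xi> k w) \<longlonglongrightarrow> (LINT w|M. D w * \<xi>0 w)" by (simp add: LIM_zero_iff)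
qed

lemma fourth_sum_le: "((a::real) + b) ^ 4 \<le> 8 * a ^ 4 + 8 * b ^ 4"
proof -
 have "(a + b) ^ 4 = ((a + b)^2)^2" by simp
 also have "... \<le> (2 * a^2 + 2 * b^2)^2" by (intro power_mono square_sum_le) simp
 also have "... \<le> 2 * (2 * a^2)^2 + 2 * (2 * b^2)^2" by (rule square_sum_le)
 finally show ?thesis by (simp add: power_mult_distrib)
qed

definition int4 :: "'w measure => ('w => real) => bool" where
 "int4 M Y \<longleftrightarrow> Y \<in> borel_measurable M \<and> integrable M (\<lambda>w. (Y w) ^ 4)"

lemma int4_sq: "int4 M Y ==> sqint M (\<lambda>w. (Y w)^2)"
 by (auto simp: int4_def sqint_def intro: borel_measurable_power)

lemma int4_add:
 assumes "int4 M Y" "int4 M Z" shows "int4 M (\<lambda>w. Y w + Z w)"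
proof -
 have [measurable]: "Y \<in> borel_measurable M" "Z \<in> borel_measurable M" using assms by (auto simp: int4_def)
 have "integrable M (\<lambda>w. (Y w + Z w) ^ 4)"
 proof (rule Bochner_Integration.integrable_bound)
  show "integrable M (\<lambda>w. 8 * (Y w) ^ 4 + 8 * (Z w) ^ 4)" using assms by (auto simp: int4_def)
  show "AE w in M. norm ((Y w + Z w) ^ 4) \<le> norm (8 * (Y w) ^ 4 + 8 * (Z w) ^ 4)"
  proof (intro AE_I2)
   fix w
   have "0 \<le> (Y w + Z w) ^ 4" by simp
   thus "norm ((Y w + Z w) ^ 4) \<le> norm (8 * (Y w) ^ 4 + 8 * (Z w) ^ 4)"
    using fourth_sum_le[of "Y w" "Z w"] by simp
  qed
 qed measurable
 thus ?thesis by (auto simp: int4_def)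
qed

lemma int4_cmult: "int4 M Y ==> int4 M (\<lambda>w. c * Y w)"
 by (auto simp: int4_def power_mult_distrib)

lemma int4_diff: "int4 M Y ==> int4 M Z ==> int4 M (\<lambda>w. Y w - Z w)"
 using int4_add[of M Y "\<lambda>w. (-1) * Z w"] int4_cmult[of M Z "-1"] by simp

lemma int4_mult:
 assumes "int4 M Y" "int4 M Z"
 shows "sqint M (\<lambda>w. Y w * Z w)" "((LINT w|M. (Y w * Z w)^2))^2 \<le> (LINT w|M. (Y w) ^ 4) * (LINT w|M. (Z w) ^ 4)"
proof -
 note i = int4_sq[OF assms(1)] int4_sq[OF assms(2)]
 have [measurable]: "Y \<in> borel_measurable M" "Z \<in> borel_measurable M" using assms by (auto simp: int4_def)
 show "sqint M (\<lambda>w. Y w * Z w)" using sqint_mult[OF i] by (simp add: sqint_def power_mult_distrib)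
 show "((LINT w|M. (Y w * Z w)^2))^2 \<le> (LINT w|M. (Y w) ^ 4) * (LINT w|M. (Z w) ^ 4)"
  using cauchy_schwarz_integral[OF i] by (simp add: power_mult_distrib)
qed

lemma (in finite_measure) int4_const: "int4 M (\<lambda>_. c)" by (simp add: int4_def)

lemma (in finite_measure) int4_sqint: "int4 M Y ==> sqint M Y"
 using int4_mult(1)[OF _ int4_const[of 1], of Y] by simp

lemma (in fbm) gsp_int4: "Y \<in> gsp ==> int4 M Y"
 using gsp_moment(1)[of Y 2] gsp_measurable[of Y] by (simp add: int4_def)

lemma (in fbm) gsp_fourth_moment: "Y \<in> gsp ==> (LINT w|M. (Y w) ^ 4) = 3 * (LINT w|M. (Y w)^2)^2"
 using gsp_moment(2)[of Y 2] by (simp add: fact_numeral)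

lemma (in fbm) gsp_mean: "V \<in> gsp ==> (LINT w|M. V w) = 0"
proof -
 assume V: "V \<in> gsp"
 have "C1_poly 0 (\<lambda>_. 1)" by (auto simp: C1_poly_def intro!: exI[of _ 1])
 from gaussian_ibp[OF this _ V] show ?thesis by simp
qed

lemma (in hurst) cells_L2:
 assumes T: "0 < T" "0 < N"
 shows "step_inner H (cells T N c) (cells T N c) \<le> 2 * kern1 T * (\<Sum>j<N. (c j)^2 * (T / N))"
proof -
 define f where "f x = (\<Sum>j<N. (c j)^2 * indicator {node T N j<..node T N (Suc j)} x)" for x :: real
 have AE: "AE x in lborel. (step_fun (cells T N c) x)^2 = f x"
  using AE_lborel_singleton[of 0]
 proof eventually_elim
  case (elim x)
  show ?case
  proof (cases "0 < x \<and> x \<le> T")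
   case True
   then obtain j where j: "j < N" "node T N j < x" "x \<le> node T N (Suc j)" using cell_exists[OF T, of x] by auto
   have "f x = (\<Sum>i<N. if i = j then (c j)^2 else 0)"
    unfolding f_def
   proof (rule sum.cong[OF refl])
    fix i assume "i \<in> {..<N}"
    consider "i < j" | "i = j" | "i > j" by linarith
    thus "(c i)^2 * indicator {node T N i<..node T N (Suc i)} x = (if i = j then (c j)^2 else 0)"
    proof cases
     case 1
     hence "node T N (Suc i) \<le> node T N j" using T by (intro node_mono) auto
     thus ?thesis using j 1 by auto
    next
     case 3
     hence "node T N (Suc j) \<le> node T N i" using T by (intro node_mono) auto
     thus ?thesis using j 3 by auto
    qed (use j in auto)
   qed
   thus ?thesis using step_fun_cells_eq[OF T(1) j, of c] j by simp
  next
   case False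
   have "f x = 0" unfolding f_def
   proof (rule sum.neutral, rule ballI)
    fix j assume "j \<in> {..<N}"
    hence "0 \<le> node T N j" "node T N (Suc j) \<le> T" using T node_nonneg[of T N j] node_le[of T "Suc j" N] by auto
    thus "(c j)^2 * indicator {node T N j<..node T N (Suc j)} x = 0" using False elim by auto
   qed
   moreover have "step_fun (cells T N c) x = 0" using False elim T by (intro step_fun_support[OF cells_step_coeffs]) auto
   ultimately show ?thesis by simp
  qed
 qed
 have [measurable]: "f \<in> borel_measurable borel" unfolding f_def by measurable
 have "(LINT x|lborel. (step_fun (cells T N c) x)^2) = (LINT x|lborel. f x)" by (rule integral_cong_AE) (use AE in auto)
 also have "... = (\<Sum>j<N. (c j)^2 * (T / N))"
  unfolding f_def using T by (subst Bochner_Integration.integral_sum) (auto intro!: integrable_mult_right integrable_real_indicator sum.cong simp: node_Suc)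
 finally show ?thesis using step_inner_le_L2[OF cells_step_coeffs[of T N c]] T by simp
qed

context fou begin

text \<open>The continuous version of \<open>X\<close>, defined on the whole sample space, and its drift.\<close>

definition Xc :: "real => 'w => real" where "Xc t w = m t + Z t w"
definition Dr :: "real => 'w => real" where "Dr t w = L t - \<alpha> * Xc t w"

lemma Xc_continuous: "continuous_on UNIV (\<lambda>t. Xc t w)"
 unfolding Xc_def by (intro continuous_intros m_continuous Z_continuous)

lemma Xc_measurable [measurable]: "Xc t \<in> borel_measurable M" unfolding Xc_def[abs_def] by measurable

lemma Xc_joint [measurable]: "(\<lambda>p. Xc (fst p) (snd p)) \<in> borel_measurable (lborel \<Otimes>\<^sub>M M)"
 by (rule continuous_jointly_measurable[OF Xc_continuous Xc_measurable])

lemma Xc_path_measurable [measurable]: "(\<lambda>s. Xc s w) \<in> borel_measurable borel"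
 by (rule borel_measurable_continuous_onI[OF Xc_continuous])

lemma Dr_joint [measurable]: "(\<lambda>p. Dr (fst p) (snd p)) \<in> borel_measurable (lborel \<Otimes>\<^sub>M M)"
 unfolding Dr_def by measurable

lemma Dr_path_measurable [measurable]: "(\<lambda>s. Dr s w) \<in> borel_measurable borel" unfolding Dr_def by measurable

lemma Dr_path_bounded: "\<exists>K. \<forall>s. a \<le> s \<and> s \<le> b \<longrightarrow> \<bar>Dr s w\<bar> \<le> K"
proof -
 obtain K where K: "\<And>s. a \<le> s ==> s \<le> b ==> \<bar>Xc s w\<bar> \<le> K" using continuous_bounded_Icc[OF Xc_continuous, of a b] by blast
 have "\<bar>Dr s w\<bar> \<le> CL + \<alpha> * K" if "a \<le> s" "s \<le> b" for s
 proof -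
  have "\<bar>Dr s w\<bar> \<le> \<bar>L s\<bar> + \<alpha> * \<bar>Xc s w\<bar>" unfolding Dr_def using \<alpha>_pos by (intro order_trans[OF abs_triangle_ineq4]) (simp add: abs_mult)
  also have "... \<le> CL + \<alpha> * K" using L_bound[of s] K[OF that] \<alpha>_pos by (intro add_mono mult_left_mono) auto
  finally show ?thesis .
 qed
 thus ?thesis by blast
qed

lemma cont_times_Dr_integrable:
 assumes g: "continuous_on UNIV g"
 shows "set_integrable lborel {a..b} (\<lambda>s. g s * Dr s w)" "set_integrable lborel {a..b} (\<lambda>s. (g s * Dr s w)^2)"
proof -
 obtain K K' where K: "\<And>s. a \<le> s ==> s \<le> b ==> \<bar>Dr s w\<bar> \<le> K" "\<And>s. a \<le> s ==> s \<le> b ==> \<bar>g s\<bar> \<le> K'"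
  using Dr_path_bounded[of a b w] continuous_bounded_Icc[OF g, of a b] by blast
 have [measurable]: "g \<in> borel_measurable borel" by (rule borel_measurable_continuous_onI[OF g])
 have b: "\<bar>g s * Dr s w\<bar> \<le> \<bar>K'\<bar> * \<bar>K\<bar>" if "a \<le> s" "s \<le> b" for s
  unfolding abs_mult using K(1)[OF that] K(2)[OF that] by (intro mult_mono) auto
 show "set_integrable lborel {a..b} (\<lambda>s. g s * Dr s w)" by (rule bounded_set_integrable[OF _ b]) measurable
 have "\<bar>(g s * Dr s w)^2\<bar> \<le> (\<bar>K'\<bar> * \<bar>K\<bar>)^2" if "a \<le> s" "s \<le> b" for s
  using power_mono[OF b[OF that], of 2] by simp
 thus "set_integrable lborel {a..b} (\<lambda>s. (g s * Dr s w)^2)" by (intro bounded_set_integrable) measurable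
qed

lemma Dr_integrable: "set_integrable lborel {a..b} (\<lambda>s. Dr s w)"
 using cont_times_Dr_integrable(1)[of "\<lambda>_. 1"] by simp

lemma Xc_solves: "0 \<le> t ==> Xc t w = itg 0 t (\<lambda>s. Dr s w) + Bc t w"
proof -
 assume t: "0 \<le> t"
 have "itg 0 t (\<lambda>s. Dr s w) = itg 0 t L - itg 0 t (\<lambda>s. \<alpha> * Xc s w)"
  unfolding Dr_def by (intro set_integral_diff(2) L_integrable cont_set_integrable continuous_intros Xc_continuous)
 also have "itg 0 t (\<lambda>s. \<alpha> * Xc s w) = \<alpha> * (itg 0 t m + itg 0 t (\<lambda>s. Z s w))"
  unfolding Xc_def set_integral_mult_right by (subst set_integral_add(2)) (auto intro!: cont_set_integrable m_continuous Z_continuous)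
 finally show ?thesis using m_solves[OF t] Z_solves[OF t, of w] by (simp add: Xc_def Lam_def algebra_simps)
qed

lemma Bc_increment_eq:
 assumes "0 \<le> s" "s \<le> t" shows "Bc t w - Bc s w = Xc t w - Xc s w - itg s t (\<lambda>u. Dr u w)"
 using Xc_solves[of t w] Xc_solves[of s w] itg_split[OF Dr_integrable assms, of w] assms by simp

subsection \<open>Fourth moments\<close>

lemma Z_int4: "int4 M (Z t)" by (rule gsp_int4[OF Z_gsp])
lemma Xc_int4: "int4 M (Xc t)" unfolding Xc_def[abs_def] by (intro int4_add int4_const Z_int4)
lemma Dr_int4: "int4 M (Dr t)" unfolding Dr_def[abs_def] by (intro int4_diff int4_const int4_cmult Xc_int4)
lemma Xc_sqint: "sqint M (Xc t)" by (rule int4_sqint[OF Xc_int4])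

lemma Z_fourth: "(LINT w|M. (Z t w) ^ 4) \<le> 3 * KZ^2"
 unfolding gsp_fourth_moment[OF Z_gsp] using Z_second_moment[of t] by (intro mult_left_mono power_mono) auto

definition KX :: real where "KX = 8 * (CL / \<alpha>) ^ 4 + 24 * KZ^2"
definition KD :: real where "KD = 8 * CL ^ 4 + 8 * \<alpha> ^ 4 * KX"

lemma KX_nonneg: "KX \<ge> 0" by (simp add: KX_def)
lemma fourth_moment_add:
 assumes "int4 M Y" "int4 M W"
 shows "(LINT w|M. (Y w + W w) ^ 4) \<le> 8 * (LINT w|M. (Y w) ^ 4) + 8 * (LINT w|M. (W w) ^ 4)"
proof -
 have "(LINT w|M. (Y w + W w) ^ 4) \<le> (LINT w|M. 8 * (Y w) ^ 4 + 8 * (W w) ^ 4)"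
  by (rule integral_mono) (use assms int4_add[OF assms] fourth_sum_le in \<open>auto simp: int4_def\<close>)
 also have "... = 8 * (LINT w|M. (Y w) ^ 4) + 8 * (LINT w|M. (W w) ^ 4)" using assms by (simp add: int4_def)
 finally show ?thesis .
qed

lemma power4_mono_abs: "\<bar>x\<bar> \<le> y ==> x ^ 4 \<le> y ^ 4" for x y :: real
 using power_mono[of "\<bar>x\<bar>" y 4] by simp

lemma Xc_fourth: "0 \<le> t ==> (LINT w|M. (Xc t w) ^ 4) \<le> KX"
proof -
 assume t: "0 \<le> t"
 have "(LINT w|M. (Xc t w) ^ 4) \<le> 8 * (LINT w|M. (m t) ^ 4) + 8 * (LINT w|M. (Z t w) ^ 4)"
  unfolding Xc_def by (rule fourth_moment_add[OF int4_const Z_int4])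
 also have "... \<le> 8 * (CL / \<alpha>) ^ 4 + 8 * (3 * KZ^2)"
  using Z_fourth[of t] power4_mono_abs[OF m_bound[OF t]] by (simp add: prob_space)
 finally show ?thesis by (simp add: KX_def)
qed

lemma Dr_fourth: "0 \<le> t ==> (LINT w|M. (Dr t w) ^ 4) \<le> KD"
proof -
 assume t: "0 \<le> t"
 have "(LINT w|M. (L t + (- \<alpha>) * Xc t w) ^ 4) \<le> 8 * (LINT w|M. (L t) ^ 4) + 8 * (LINT w|M. ((- \<alpha>) * Xc t w) ^ 4)"
  by (rule fourth_moment_add[OF int4_const int4_cmult[OF Xc_int4]])
 also have "... \<le> 8 * CL ^ 4 + 8 * (\<alpha> ^ 4 * KX)"
 proof -
  have "\<alpha> ^ 4 * (LINT w|M. (Xc t w) ^ 4) \<le> \<alpha> ^ 4 * KX" by (intro mult_left_mono Xc_fourth t) simp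
  thus ?thesis using power4_mono_abs[OF L_bound[of t]] by (simp add: prob_space power_mult_distrib)
 qed
 finally show ?thesis by (simp add: KD_def Dr_def mult.assoc)
qed

definition KI :: real where "KI = 8 * (2 * CL) ^ 4 + 24 * (2 + 2 * \<alpha>^2 * KZ)^2"

lemma KI_nonneg: "KI \<ge> 0" by (simp add: KI_def)

lemma Z_int_sqint:
 assumes "s \<le> t"
 shows "sqint M (\<lambda>w. itg s t (\<lambda>u. Z u w))" "(LINT w|M. (itg s t (\<lambda>u. Z u w))^2) \<le> KZ * (t - s)^2"
 by (rule sqint_itg[OF Z_joint Z_sqint Z_second_moment];
   use assms in \<open>auto intro!: cont_set_integrable continuous_intros Z_continuous\<close>)+

text \<open>The increment is that of the motion plus a term of order \<open>t - s\<close>. Fourth moments of Gaussian variables are squares of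
  second moments.\<close>

lemma Xc_increment_fourth:
 assumes s: "0 \<le> s" "s \<le> t" "t - s \<le> 1"
 shows "(LINT w|M. (Xc t w - Xc s w) ^ 4) \<le> KI * (t - s) powr (4 * H)"
proof -
 have st: "0 \<le> t" "0 \<le> t - s" using s by auto
 have pw: "(t - s) ^ n \<le> (t - s) powr p" if "p \<le> real n" "n > 0" for n p
 proof (cases "t = s")
  case False
  hence "(t - s) ^ n = (t - s) powr real n" using s by (simp add: powr_realpow)
  also have "... \<le> (t - s) powr p" using s False that by (intro powr_mono') auto
  finally show ?thesis .
 qed (use that in \<open>simp add: power_0_left\<close>)
 have "m t - m s = Lam t - Lam s - \<alpha> * itg s t m"
  using m_solves[OF s(1)] m_solves[OF st(1)] itg_split[OF cont_set_integrable[OF m_continuous] s(1,2)] by (simp add: algebra_simps)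
 moreover have "\<bar>itg s t m\<bar> \<le> itg s t (\<lambda>_. CL / \<alpha>)"
  by (rule itg_abs_le[OF m_continuous]) (use s m_bound in auto)
 hence "\<alpha> * \<bar>itg s t m\<bar> \<le> \<alpha> * (CL / \<alpha> * (t - s))" using \<alpha>_pos s by (intro mult_left_mono) (auto simp: itg_const)
 hence "\<bar>\<alpha> * itg s t m\<bar> \<le> CL * (t - s)" using \<alpha>_pos by (simp add: abs_mult)
 ultimately have "\<bar>m t - m s\<bar> \<le> 2 * CL * (t - s)" using Lam_lipschitz[OF s(1,2)] by linarith
 from power4_mono_abs[OF this] have m4: "(m t - m s) ^ 4 \<le> (2 * CL) ^ 4 * (t - s) ^ 4" by (simp only: power_mult_distrib)
 have "(t - s) ^ 4 \<le> (t - s) powr (4 * H)" using H_lt by (intro pw) auto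
 hence m4': "(m t - m s) ^ 4 \<le> (2 * CL) ^ 4 * (t - s) powr (4 * H)" by (intro order_trans[OF m4] mult_left_mono) auto
 have ZI: "Z t w - Z s w = (Bc t w - Bc s w) + (- \<alpha>) * itg s t (\<lambda>u. Z u w)" for w
  using Z_solves[OF s(1), of w] Z_solves[OF st(1), of w] itg_split[OF cont_set_integrable[OF Z_continuous] s(1,2), of w] by (simp add: algebra_simps)
 have "(LINT w|M. (Z t w - Z s w)^2) \<le> 2 * (LINT w|M. (Bc t w - Bc s w)^2) + 2 * (LINT w|M. ((- \<alpha>) * itg s t (\<lambda>u. Z u w))^2)"
  unfolding ZI using s by (intro integral_square_add_le sqint_diff sqint_cmult Bc_sqint Z_int_sqint) auto
 also have "... = 2 * (t - s) powr (2 * H) + 2 * \<alpha>^2 * (LINT w|M. (itg s t (\<lambda>u. Z u w))^2)"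
  using Bc_increment[OF s(1,2)] by (simp add: power_mult_distrib)
 also have "... \<le> 2 * (t - s) powr (2 * H) + 2 * \<alpha>^2 * (KZ * (t - s) powr (2 * H))"
 proof -
  have "(t - s)^2 \<le> (t - s) powr (2 * H)" using H_lt by (intro pw) auto
  hence "KZ * (t - s)^2 \<le> KZ * (t - s) powr (2 * H)" using KZ_pos by (intro mult_left_mono) auto
  thus ?thesis using Z_int_sqint(2)[OF s(2)] by (intro add_left_mono mult_left_mono) auto
 qed
 finally have Z2: "(LINT w|M. (Z t w - Z s w)^2) \<le> (2 + 2 * \<alpha>^2 * KZ) * (t - s) powr (2 * H)" by (simp add: algebra_simps)
 have dZ: "(\<lambda>w. Z t w - Z s w) \<in> gsp" by (rule gsp_diff[OF Z_gsp Z_gsp])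
 have "(LINT w|M. (Z t w - Z s w) ^ 4) \<le> 3 * ((2 + 2 * \<alpha>^2 * KZ) * (t - s) powr (2 * H))^2"
  unfolding gsp_fourth_moment[OF dZ] using Z2 by (intro mult_left_mono power_mono) auto
 also have "... = 3 * (2 + 2 * \<alpha>^2 * KZ)^2 * (t - s) powr (4 * H)"
  by (simp add: power_mult_distrib power2_eq_square powr_add[symmetric])
 finally have Z4: "(LINT w|M. (Z t w - Z s w) ^ 4) \<le> 3 * (2 + 2 * \<alpha>^2 * KZ)^2 * (t - s) powr (4 * H)" .
 have "(LINT w|M. (Xc t w - Xc s w) ^ 4) = (LINT w|M. ((m t - m s) + (Z t w - Z s w)) ^ 4)"
  by (simp add: Xc_def algebra_simps)
 also have "... \<le> 8 * (LINT w|M. (m t - m s) ^ 4) + 8 * (LINT w|M. (Z t w - Z s w) ^ 4)"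
  by (rule fourth_moment_add[OF int4_const int4_diff[OF Z_int4 Z_int4]])
 also have "... \<le> 8 * ((2 * CL) ^ 4 * (t - s) powr (4 * H)) + 8 * (3 * (2 + 2 * \<alpha>^2 * KZ)^2 * (t - s) powr (4 * H))"
  using m4' Z4 by (simp add: prob_space)
 finally show ?thesis by (simp add: KI_def algebra_simps)
qed

end

lemma integral_sum_square_le:
 assumes Y: "\<And>j. j < N ==> sqint M (Y j)" and K: "\<And>j. j < N ==> (LINT w|M. (Y j w)^2) \<le> K"
 shows "(LINT w|M. (\<Sum>j<N. Y j w)^2) \<le> (real N)^2 * K"
proof -
 have i: "integrable M (\<lambda>w. (Y j w)^2)" if "j < N" for j by (rule sqint_sq[OF Y[OF that]])
 have s: "sqint M (\<lambda>w. \<Sum>j<N. Y j w)" by (rule sqint_sum) (use Y in simp)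
 have "(LINT w|M. (\<Sum>j<N. Y j w)^2) \<le> (LINT w|M. (\<Sum>j<N. (Y j w)^2) * real N)"
 proof (rule integral_mono)
  show "integrable M (\<lambda>w. (\<Sum>j<N. Y j w)^2)" by (rule sqint_sq[OF s])
  show "integrable M (\<lambda>w. (\<Sum>j<N. (Y j w)^2) * real N)" using i by (intro integrable_mult_left Bochner_Integration.integrable_sum) auto
  show "(\<Sum>j<N. Y j w)^2 \<le> (\<Sum>j<N. (Y j w)^2) * real N" for w
   using sum_squared_le_sum_of_squares[of "\<lambda>j. Y j w" "{..<N}"] by (simp add: mult.commute)
 qed
 also have "... = (\<Sum>j<N. LINT w|M. (Y j w)^2) * real N" using i by (simp add: Bochner_Integration.integral_sum)
 also have "... \<le> (\<Sum>j<N. K) * real N" by (intro mult_right_mono sum_mono K) auto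
 finally show ?thesis by (simp add: power2_eq_square mult_ac)
qed

lemma L2_tendsto_cong_AE:
 assumes Y: "L2_tendsto M Y Z" and AE: "\<And>k. AE w in M. Y k w = Y' k w" and m: "\<And>k. Y' k \<in> borel_measurable M"
 shows "L2_tendsto M Y' Z"
proof -
 note d = L2_tendstoD[OF Y]
 have s: "sqint M (Y' k)" for k by (rule sqint_cong_AE[OF d(1) AE m])
 have "(LINT w|M. (Z w - Y' k w)^2) = (LINT w|M. (Z w - Y k w)^2)" for k
 proof (rule integral_cong_AE)
  show "(\<lambda>w. (Z w - Y' k w)^2) \<in> borel_measurable M" using sqint_sq[OF sqint_diff[OF d(2) s]] by (rule borel_measurable_integrable)
  show "(\<lambda>w. (Z w - Y k w)^2) \<in> borel_measurable M" using sqint_sq[OF sqint_diff[OF d(2) d(1)]] by (rule borel_measurable_integrable)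
  show "AE w in M. (Z w - Y' k w)^2 = (Z w - Y k w)^2" using AE[of k] by eventually_elim simp
 qed
 thus ?thesis using d s by (simp add: L2_tendsto_def)
qed

lemma (in hurst) represents_cong: "(\<And>x. x \<in> {0..T} ==> f x = g x) ==> represents H T h f \<longleftrightarrow> represents H T h g"
proof -
 assume "\<And>x. x \<in> {0..T} ==> f x = g x"
 hence "(\<lambda>x. indicator {0..T} x * f x) = (\<lambda>x. indicator {0..T} x * g x)" by (intro ext) (simp split: split_indicator)
 hence "indicator {0..T} x * f x = indicator {0..T} x * g x" for x by (rule fun_cong)
 thus ?thesis unfolding represents_def set_measurable_iff by (simp only:)
qed

context fbm begin

text \<open>By completeness within the smaller \<open>\<sigma>\<close>-algebra, a limit of variables of the history has a version in the history.\<close>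

lemma L2_limit_history:
 assumes Y: "L2_tendsto M Y Z" and m: "\<And>k. Y k \<in> borel_measurable (history M B T)"
 shows "\<exists>Z'. Z' \<in> borel_measurable (history M B T) \<and> (AE w in M. Z w = Z' w)"
proof -
 have "\<exists>Z'. Z' \<in> borel_measurable (history M B T) \<and> L2_tendsto M Y Z' \<and> (\<exists>r. strict_mono r \<and> (AE w in M. (\<lambda>k. Y (r k) w) \<longlonglongrightarrow> Z' w))"
  by (rule L2_complete[OF L2_tendstoD(1)[OF Y] L2_tendsto_Cauchy[OF Y] m history_measurable])
 then obtain Z' where Z': "Z' \<in> borel_measurable (history M B T)" "L2_tendsto M Y Z'" by (elim exE conjE)
 show ?thesis by (intro exI[of _ Z'] conjI Z'(1) L2_tendsto_unique[OF Y Z'(2)])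
qed

lemma BB_history: "a \<in> step_coeffs T ==> BB a \<in> borel_measurable (history M B T)"
proof -
 assume a: "a \<in> step_coeffs T"
 show ?thesis unfolding BB_def[abs_def] lin_def
  by (intro borel_measurable_sum borel_measurable_times borel_measurable_const B_history_measurable) (use a in \<open>auto simp: step_coeffs_def\<close>)
qed

text \<open>For an affine factor \<open>c + W\<close> with \<open>W\<close> in the Gaussian space, the integration by parts formula
  produces one term per derivative of \<open>f\<close> and one from \<open>W\<close> itself; the latter is the product of the
  expectations, which is why the divergence of a process is an integral minus its mean.\<close>

lemma affine_ibp:
 fixes G :: "nat => 'w => real"
 assumes f: "C1_poly k f" and G: "\<And>i. i < k ==> G i \<in> gsp" and W: "W \<in> gsp" and V: "V \<in> gsp"
 shows "(LINT w|M. f (vec k G w) * ((c + W w) * V w)) =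
  (\<Sum>i<k. (LINT w|M. pdiff i f (vec k G w) * (c + W w)) * (LINT w|M. G i w * V w))
  + (LINT w|M. f (vec k G w)) * (LINT w|M. (c + W w) * V w)"
proof -
 have F: "sqint M (\<lambda>w. f (vec k G w))" by (rule C1_poly_sqint(1)[where G=G and k=k, OF f G])
 have D: "sqint M (\<lambda>w. pdiff i f (vec k G w))" if "i < k" for i by (rule C1_poly_sqint(2)[where G=G and k=k, OF f G that])
 have FW: "sqint M (\<lambda>w. f (vec k G w) * W w)" by (rule C1_poly_mult_sqint(1)[where G=G and k=k, OF f G W])
 note sW = gsp_sqint[OF W] and sV = gsp_sqint[OF V]
 have "(LINT w|M. f (vec k G w) * ((c + W w) * V w)) = (LINT w|M. c * (f (vec k G w) * V w) + f (vec k G w) * W w * V w)"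
  by (intro Bochner_Integration.integral_cong refl) (simp add: algebra_simps)
 also have "... = c * (LINT w|M. f (vec k G w) * V w) + (LINT w|M. f (vec k G w) * W w * V w)"
  using sqint_mult[OF F sV] sqint_mult[OF FW sV] by simp
 also have "... = c * (\<Sum>i<k. (LINT w|M. pdiff i f (vec k G w)) * (LINT w|M. G i w * V w)) +
   ((\<Sum>i<k. (LINT w|M. pdiff i f (vec k G w) * W w) * (LINT w|M. G i w * V w)) + (LINT w|M. f (vec k G w)) * (LINT w|M. W w * V w))"
  using gaussian_ibp[where G=G and k=k, OF f G V] C1_poly_mult_sqint(3)[where G=G and k=k, OF f G W V] by simp
 also have "(LINT w|M. W w * V w) = (LINT w|M. (c + W w) * V w)"
  using gsp_mean[OF V] sqint_mult[OF sW sV] sqint_integrable[OF sV] by (simp add: distrib_right)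
 also have "c * (\<Sum>i<k. (LINT w|M. pdiff i f (vec k G w)) * (LINT w|M. G i w * V w)) +
   ((\<Sum>i<k. (LINT w|M. pdiff i f (vec k G w) * W w) * (LINT w|M. G i w * V w)) + (LINT w|M. f (vec k G w)) * (LINT w|M. (c + W w) * V w))
   = (\<Sum>i<k. (c * (LINT w|M. pdiff i f (vec k G w)) + (LINT w|M. pdiff i f (vec k G w) * W w)) * (LINT w|M. G i w * V w))
    + (LINT w|M. f (vec k G w)) * (LINT w|M. (c + W w) * V w)"
  by (simp add: sum_distrib_left sum.distrib distrib_right mult.assoc)
 also have "(\<Sum>i<k. (c * (LINT w|M. pdiff i f (vec k G w)) + (LINT w|M. pdiff i f (vec k G w) * W w)) * (LINT w|M. G i w * V w))
  = (\<Sum>i<k. (LINT w|M. pdiff i f (vec k G w) * (c + W w)) * (LINT w|M. G i w * V w))"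
 proof (rule sum.cong[OF refl])
  fix i assume "i \<in> {..<k}"
  hence i: "i < k" by simp
  have "(LINT w|M. pdiff i f (vec k G w) * (c + W w)) = (LINT w|M. c * pdiff i f (vec k G w) + pdiff i f (vec k G w) * W w)"
   by (intro Bochner_Integration.integral_cong refl) (simp add: algebra_simps)
  also have "... = c * (LINT w|M. pdiff i f (vec k G w)) + (LINT w|M. pdiff i f (vec k G w) * W w)"
   using sqint_integrable[OF D[OF i]] sqint_mult[OF D[OF i] sW] by simp
  finally show "(c * (LINT w|M. pdiff i f (vec k G w)) + (LINT w|M. pdiff i f (vec k G w) * W w)) * (LINT w|M. G i w * V w)
   = (LINT w|M. pdiff i f (vec k G w) * (c + W w)) * (LINT w|M. G i w * V w)" by simp
 qed
 finally show ?thesis .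
qed

end

context fou begin

text \<open>The symmetric integral of \<open>X\<close> against \<open>B\<close>, as the chain rule evaluates it, and its Riemann sums.\<close>

definition Sk :: "real => 'w => real" where
 "Sk T w = (Xc T w)^2 / 2 - itg 0 T (\<lambda>s. Xc s w * Dr s w)"

definition Rs :: "real => nat => 'w => real" where
 "Rs T N w = (\<Sum>j<N. Xc (node T N j) w * (B (node T N (Suc j)) w - B (node T N j) w))"

lemma Xc_0: "Xc 0 w = 0" using Xc_solves[of 0 w] by (simp add: Bc_0)

text \<open>Summing \<open>2 x (y - x) = y\<^sup>2 - x\<^sup>2 - (y - x)\<^sup>2\<close> over a partition. The two sums on the right are the quadratic
  variation and the error of the Riemann sums for the drift integral.\<close>

lemma Rs_remainder:
 assumes T: "0 < T" "0 < N"
 shows "AE w in M. Rs T N w = Sk T w - (1 / 2 * (\<Sum>j<N. (Xc (node T N (Suc j)) w - Xc (node T N j) w)^2)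
  - (\<Sum>j<N. itg (node T N j) (node T N (Suc j)) (\<lambda>s. (Xc s w - Xc (node T N j) w) * Dr s w)))"
 using AE_not_Nul
proof eventually_elim
 case (elim w)
 define x where "x j = Xc (node T N j) w" for j
 define I where "I j = itg (node T N j) (node T N (Suc j)) (\<lambda>s. Xc s w * Dr s w)" for j
 define J where "J j = itg (node T N j) (node T N (Suc j)) (\<lambda>s. Dr s w)" for j
 have nn: "0 \<le> node T N j" "node T N j \<le> node T N (Suc j)" for j using T node_nonneg[of T N j] node_mono[of T j "Suc j" N] by auto
 have b: "B (node T N (Suc j)) w - B (node T N j) w = x (Suc j) - x j - J j" for j
  using Bc_increment_eq[OF nn, of j w] Bc_eq[of w "node T N j"] Bc_eq[of w "node T N (Suc j)"] elim nn[of j] nn[of "Suc j"]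
  by (simp add: x_def J_def)
 have I: "itg (node T N j) (node T N (Suc j)) (\<lambda>s. (Xc s w - Xc (node T N j) w) * Dr s w) = I j - x j * J j" for j
 proof -
  have "itg (node T N j) (node T N (Suc j)) (\<lambda>s. Xc s w * Dr s w - x j * Dr s w) = I j - itg (node T N j) (node T N (Suc j)) (\<lambda>s. x j * Dr s w)"
   unfolding I_def by (intro set_integral_diff(2) cont_times_Dr_integrable Xc_continuous continuous_intros)
  thus ?thesis by (simp add: left_diff_distrib x_def J_def)
 qed
 have S: "Sk T w = (x N)^2 / 2 - (\<Sum>j<N. I j)"
  using itg_cells[OF cont_times_Dr_integrable(1)[OF Xc_continuous] T, of w w] T by (simp add: Sk_def x_def I_def)
 have tele: "(\<Sum>j<n. (x (Suc j))^2) - (\<Sum>j<n. (x j)^2) = (x n)^2" for n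
  by (induction n) (simp_all add: x_def Xc_0)
 have "Rs T N w = (\<Sum>j<N. 1 / 2 * ((x (Suc j))^2 - (x j)^2) - (1 / 2 * (x (Suc j) - x j)^2 + x j * J j))"
  unfolding Rs_def by (intro sum.cong refl) (simp add: b x_def[symmetric] power2_eq_square algebra_simps add_divide_distrib diff_divide_distrib)
 also have "... = 1 / 2 * (x N)^2 - (1 / 2 * (\<Sum>j<N. (x (Suc j) - x j)^2) + (\<Sum>j<N. x j * J j))"
  unfolding sum_subtractf sum.distrib sum_distrib_left[symmetric] by (simp only: tele)
 finally show ?case unfolding I S by (simp add: x_def sum_subtractf)
qed

lemma Xc_Dr_sqint:
 "0 \<le> s ==> sqint M (\<lambda>w. Xc s w * Dr s w)" "0 \<le> s ==> (LINT w|M. (Xc s w * Dr s w)^2) \<le> sqrt (KX * KD)"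
proof -
 show "sqint M (\<lambda>w. Xc s w * Dr s w)" by (rule int4_mult(1)[OF Xc_int4 Dr_int4])
 assume s: "0 \<le> s"
 have "(LINT w|M. (Xc s w * Dr s w)^2)^2 \<le> KX * KD"
  by (rule order_trans[OF int4_mult(2)[OF Xc_int4 Dr_int4]]) (intro mult_mono Xc_fourth Dr_fourth s KX_nonneg; simp)
 thus "(LINT w|M. (Xc s w * Dr s w)^2) \<le> sqrt (KX * KD)" by (rule real_le_rsqrt)
qed

lemma Sk_sqint: "0 \<le> T ==> sqint M (Sk T)"
proof -
 assume T: "0 \<le> T"
 have j: "(\<lambda>p. Xc (fst p) (snd p) * Dr (fst p) (snd p)) \<in> borel_measurable (lborel \<Otimes>\<^sub>M M)" by measurable
 have "sqint M (\<lambda>w. itg 0 T (\<lambda>s. Xc s w * Dr s w))"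
  by (rule sqint_itg(1)[OF j]) (use T Xc_Dr_sqint in \<open>auto intro!: cont_times_Dr_integrable Xc_continuous\<close>)
 from sqint_diff[OF sqint_cmult[OF int4_sq[OF Xc_int4[of T]], of "1/2"] this] show ?thesis unfolding Sk_def[abs_def] by simp
qed

text \<open>With mesh \<open>h = T / N\<close>, the quadratic variation has square norm of order \<open>N\<^sup>2 h\<^bsup>4H\<^esup> = T\<^sup>2 h\<^bsup>4H-2\<^esup>\<close>, and the error of the drift
  integral one of order \<open>h\<^bsup>2H\<^esup>\<close>.\<close>

lemma Rs_L2_tendsto:
 assumes T: "0 < T" shows "L2_tendsto M (\<lambda>n. Rs T (Suc n)) (Sk T)"
proof -
 define Q where "Q N w = (\<Sum>j<N. (Xc (node T N (Suc j)) w - Xc (node T N j) w)^2)" for N w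
 define I where "I N j w = itg (node T N j) (node T N (Suc j)) (\<lambda>s. (Xc s w - Xc (node T N j) w) * Dr s w)" for N j w
 have Rm: "Rs T N \<in> borel_measurable M" for N
  unfolding Rs_def[abs_def]
  by (intro borel_measurable_sum borel_measurable_times borel_measurable_diff Xc_measurable sqint_measurable[OF B_sqint] node_nonneg) (use T in auto)
 have Qs: "sqint M (Q N)" for N unfolding Q_def[abs_def] by (intro sqint_sum int4_sq int4_diff Xc_int4)
 have node_d: "node T N (Suc j) - node T N j = T / N" "0 \<le> node T N j" "node T N j \<le> node T N (Suc j)" for N j
  using T node_nonneg[of T N j] by (auto simp: node_Suc)
 have Q2: "(LINT w|M. (Q N w)^2) \<le> (real N)^2 * (KI * (T / N) powr (4 * H))" if N: "N > 0" "real N \<ge> T" for N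
  unfolding Q_def
 proof (rule integral_sum_square_le)
  fix j
  show "sqint M (\<lambda>w. (Xc (node T N (Suc j)) w - Xc (node T N j) w)^2)" by (intro int4_sq int4_diff Xc_int4)
  show "(LINT w|M. ((Xc (node T N (Suc j)) w - Xc (node T N j) w)^2)^2) \<le> KI * (T / N) powr (4 * H)"
   using Xc_increment_fourth[OF node_d(2,3), of N j] node_d(1)[of N j] N by simp
 qed
 have I2: "sqint M (I N j)" "real N \<ge> T ==> (LINT w|M. (I N j w)^2) \<le> sqrt (KI * (T / N) powr (4 * H) * KD) * (T / N)^2" if N: "N > 0" for N j
 proof -
  define a where "a = node T N j"
  have a: "0 \<le> a" using node_d(2) by (simp add: a_def)
  have jm: "(\<lambda>p. (Xc (fst p) (snd p) - Xc a (snd p)) * Dr (fst p) (snd p)) \<in> borel_measurable (lborel \<Otimes>\<^sub>M M)" by measurable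
  have sq: "sqint M (\<lambda>w. (Xc s w - Xc a w) * Dr s w)" for s by (intro int4_mult(1) int4_diff Xc_int4 Dr_int4)
  have path: "set_integrable lborel {c..d} (\<lambda>s. (Xc s w - Xc a w) * Dr s w)" "set_integrable lborel {c..d} (\<lambda>s. ((Xc s w - Xc a w) * Dr s w)^2)" for c d w
   by (intro cont_times_Dr_integrable continuous_intros Xc_continuous)+
  have b0: "(LINT w|M. ((Xc s w - Xc a w) * Dr s w)^2) \<le> sqrt ((8 * KX + 8 * KX) * KD)" if s: "0 \<le> s" for s
  proof (rule real_le_rsqrt, rule order_trans[OF int4_mult(2)[OF int4_diff[OF Xc_int4 Xc_int4] Dr_int4]], rule mult_mono)
   have "(LINT w|M. (Xc s w + (-1) * Xc a w) ^ 4) \<le> 8 * (LINT w|M. (Xc s w) ^ 4) + 8 * (LINT w|M. ((-1) * Xc a w) ^ 4)"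
    by (rule fourth_moment_add[OF Xc_int4 int4_cmult[OF Xc_int4]])
   thus "(LINT w|M. (Xc s w - Xc a w) ^ 4) \<le> 8 * KX + 8 * KX" using Xc_fourth[OF s] Xc_fourth[OF a] by simp
   show "(LINT w|M. (Dr s w) ^ 4) \<le> KD" by (rule Dr_fourth[OF s])
  qed (use KX_nonneg in simp_all)
  show "sqint M (I N j)" unfolding I_def[abs_def] a_def[symmetric]
   by (rule sqint_itg(1)[OF jm sq b0 path]) (use a node_d(3)[of N j] a_def in auto)
  assume NT: "real N \<ge> T"
  have "(LINT w|M. (I N j w)^2) \<le> sqrt (KI * (T / N) powr (4 * H) * KD) * (node T N (Suc j) - a)^2"
   unfolding I_def a_def[symmetric]
  proof (rule sqint_itg(2)[OF jm sq _ path])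
   fix s assume s: "a \<le> s" "s \<le> node T N (Suc j)"
   have sa: "s - a \<le> T / N" using s node_d(1)[of N j] by (simp add: a_def)
   have TN: "T / N \<le> 1" using N NT T by simp
   show "(LINT w|M. ((Xc s w - Xc a w) * Dr s w)^2) \<le> sqrt (KI * (T / N) powr (4 * H) * KD)"
   proof (rule real_le_rsqrt, rule order_trans[OF int4_mult(2)[OF int4_diff[OF Xc_int4 Xc_int4] Dr_int4]], rule mult_mono)
    have "(LINT w|M. (Xc s w - Xc a w) ^ 4) \<le> KI * (s - a) powr (4 * H)" by (rule Xc_increment_fourth) (use s a sa TN in auto)
    also have "... \<le> KI * (T / N) powr (4 * H)" using sa s H_gt by (intro mult_left_mono KI_nonneg powr_mono2) auto
    finally show "(LINT w|M. (Xc s w - Xc a w) ^ 4) \<le> KI * (T / N) powr (4 * H)" .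
    show "(LINT w|M. (Dr s w) ^ 4) \<le> KD" by (rule Dr_fourth) (use s a in auto)
   qed (use KI_nonneg in simp_all)
  qed (use node_d(3)[of N j] a_def in simp_all)
  thus "(LINT w|M. (I N j w)^2) \<le> sqrt (KI * (T / N) powr (4 * H) * KD) * (T / N)^2" using node_d(1)[of N j] by (simp add: a_def)
 qed
 have IS: "sqint M (\<lambda>w. \<Sum>j<N. I N j w)" if "N > 0" for N by (intro sqint_sum I2(1) that)
 have rem: "AE w in M. Rs T N w = Sk T w - (1 / 2 * Q N w - (\<Sum>j<N. I N j w))" if "N > 0" for N
  unfolding Q_def I_def by (rule Rs_remainder[OF T that])
 have sub: "sqint M (\<lambda>w. 1 / 2 * Q N w - (\<Sum>j<N. I N j w))" if "N > 0" for N
  by (intro sqint_diff sqint_cmult Qs IS that)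
 have L2: "L2_tendsto M (\<lambda>n w. Sk T w - (1 / 2 * Q (Suc n) w - (\<Sum>j<Suc n. I (Suc n) j w))) (Sk T)"
  unfolding L2_tendsto_def
 proof (intro conjI allI sqint_diff[OF Sk_sqint sub] Sk_sqint)
  let ?h = "\<lambda>n::nat. T / real (Suc n)"
  define u where "u n = 1 / 2 * (T^2 * KI * ?h n powr (4 * H - 2)) + 2 * T^2 * sqrt (KI * ?h n powr (4 * H) * KD)" for n
  have h0: "(\<lambda>n. ?h n) \<longlonglongrightarrow> 0" using LIMSEQ_Suc[OF lim_const_over_n[of T]] by simp
  have hp: "\<forall>\<^sub>F n in sequentially. 0 \<le> ?h n" using T by (intro always_eventually) simp
  have p1: "(\<lambda>n. ?h n powr (4 * H - 2)) \<longlonglongrightarrow> 0" using H_gt by (intro tendsto_zero_powrI[OF h0 tendsto_const hp]) simp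
  have p2: "(\<lambda>n. ?h n powr (4 * H)) \<longlonglongrightarrow> 0" using H_gt by (intro tendsto_zero_powrI[OF h0 tendsto_const hp]) simp
  have "u \<longlonglongrightarrow> 1 / 2 * (T^2 * KI * 0) + 2 * T^2 * sqrt (KI * 0 * KD)" unfolding u_def by (intro tendsto_intros p1 p2)
  hence u0: "u \<longlonglongrightarrow> 0" by simp
  have le: "(LINT w|M. (Sk T w - (Sk T w - (1 / 2 * Q (Suc n) w - (\<Sum>j<Suc n. I (Suc n) j w))))^2) \<le> u n" if n: "real (Suc n) \<ge> T" for n
  proof -
   let ?N = "Suc n"
   have "(LINT w|M. (Sk T w - (Sk T w - (1 / 2 * Q ?N w - (\<Sum>j<?N. I ?N j w))))^2) = (LINT w|M. (1 / 2 * Q ?N w + (-1) * (\<Sum>j<?N. I ?N j w))^2)" by simp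
   also have "... \<le> 2 * (LINT w|M. (1 / 2 * Q ?N w)^2) + 2 * (LINT w|M. ((-1) * (\<Sum>j<?N. I ?N j w))^2)"
    by (intro integral_square_add_le sqint_cmult Qs IS) simp
   also have "... = 1 / 2 * (LINT w|M. (Q ?N w)^2) + 2 * (LINT w|M. (\<Sum>j<?N. I ?N j w)^2)" by (simp add: power_divide del: sum.lessThan_Suc)
   also have "... \<le> 1 / 2 * ((real ?N)^2 * (KI * ?h n powr (4 * H))) + 2 * ((real ?N)^2 * (sqrt (KI * ?h n powr (4 * H) * KD) * (?h n)^2))"
    by (intro add_mono mult_left_mono Q2 integral_sum_square_le I2 n) auto
   also have "(real ?N)^2 * (KI * ?h n powr (4 * H)) = T^2 * KI * ?h n powr (4 * H - 2)"
   proof -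
    have "?h n powr (4 * H) = ?h n powr (4 * H - 2 + 2)" by simp
    also have "... = ?h n powr (4 * H - 2) * (?h n)^2" using T by (subst powr_add) (simp add: powr_realpow)
    finally have p: "?h n powr (4 * H) = ?h n powr (4 * H - 2) * (?h n)^2" .
    have "(real ?N)^2 * (KI * (?h n powr (4 * H - 2) * (?h n)^2)) = ((real ?N)^2 * (?h n)^2) * KI * ?h n powr (4 * H - 2)"
     by (simp only: mult_ac)
    also have "(real ?N)^2 * (?h n)^2 = T^2" by (simp add: power_divide del: of_nat_Suc)
    finally show ?thesis by (simp only: p)
   qed
   also have "(real ?N)^2 * (sqrt (KI * ?h n powr (4 * H) * KD) * (?h n)^2) = T^2 * sqrt (KI * ?h n powr (4 * H) * KD)"
    by (simp add: power_divide del: of_nat_Suc)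
   finally show ?thesis by (simp add: u_def)
  qed
  obtain n0 :: nat where n0: "real n0 \<ge> T" using real_arch_simple by blast
  show "(\<lambda>n. LINT w|M. (Sk T w - (Sk T w - (1 / 2 * Q (Suc n) w - (\<Sum>j<Suc n. I (Suc n) j w))))^2) \<longlonglongrightarrow> 0"
  proof (rule tendsto_sandwich[OF _ _ tendsto_const u0])
   show "\<forall>\<^sub>F n in sequentially. (LINT w|M. (Sk T w - (Sk T w - (1 / 2 * Q (Suc n) w - (\<Sum>j<Suc n. I (Suc n) j w))))^2) \<le> u n"
    unfolding eventually_sequentially by (intro exI[of _ n0] allI impI le) (use n0 in simp)
  qed (intro always_eventually allI integral_nonneg_AE AE_I2 zero_le_power2)
 qed (use T in auto)
 show ?thesis
 proof (rule L2_tendsto_cong_AE[OF L2 _ Rm])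
  show "AE w in M. Sk T w - (1 / 2 * Q (Suc k) w - (\<Sum>j<Suc k. I (Suc k) j w)) = Rs T (Suc k) w" for k
   using rem[of "Suc k", OF zero_less_Suc] by eventually_elim (rule sym)
 qed
qed

lemma Z_history: "0 \<le> t ==> t \<le> T ==> \<exists>Z'. Z' \<in> borel_measurable (history M B T) \<and> (AE w in M. Z t w = Z' w)"
proof (cases "t = 0")
 case True
 thus ?thesis by (intro exI[of _ "\<lambda>_. 0"]) (simp add: Z_neg)
next
 case False
 assume t: "0 \<le> t" "t \<le> T"
 have "Zc t k \<in> step_coeffs T" for k using Zc_coeffs[OF t(1), of k] t by (force simp: step_coeffs_def)
 from L2_limit_history[OF Z_L2 BB_history[OF this]] False t show ?thesis by simp
qed

lemma Sk_history:
 assumes T: "0 < T" shows "\<exists>S. S \<in> borel_measurable (history M B T) \<and> (AE w in M. Sk T w = S w)"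
proof -
 have "\<forall>t. \<exists>Z'. 0 \<le> t \<and> t \<le> T \<longrightarrow> Z' \<in> borel_measurable (history M B T) \<and> (AE w in M. Z t w = Z' w)"
  using Z_history by blast
 then obtain Z' where Z': "\<And>t. 0 \<le> t ==> t \<le> T ==> Z' t \<in> borel_measurable (history M B T)" "\<And>t. 0 \<le> t ==> t \<le> T ==> AE w in M. Z t w = Z' t w"
  by metis
 define R where "R N w = (\<Sum>j<N. (m (node T N j) + Z' (node T N j) w) * (B (node T N (Suc j)) w - B (node T N j) w))" for N w
 have nd: "0 \<le> node T N j" "j \<le> N ==> node T N j \<le> T" for N j using T node_nonneg[of T N j] node_le[of T j N] by auto
 have Rh: "R N \<in> borel_measurable (history M B T)" for N
  unfolding R_def[abs_def]
  by (intro borel_measurable_sum borel_measurable_times borel_measurable_diff borel_measurable_add borel_measurable_const Z' B_history_measurable nd) auto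
 have RA: "AE w in M. Rs T N w = R N w" for N
 proof -
  have "AE w in M. \<forall>j\<in>{..<N}. Z (node T N j) w = Z' (node T N j) w"
   by (intro AE_finite_allI Z'(2) nd) auto
  thus ?thesis by eventually_elim (auto simp: Rs_def R_def Xc_def intro!: sum.cong)
 qed
 have "L2_tendsto M (\<lambda>n. R (Suc n)) (Sk T)"
  by (rule L2_tendsto_cong_AE[OF Rs_L2_tendsto[OF T] RA history_measurable[OF Rh]])
 from L2_limit_history[OF this Rh] show ?thesis .
qed

text \<open>The integrand as a random vector: its step function approximation on an equidistant grid.\<close>

definition Uc :: "real => 'w => nat => real => real" where
 "Uc T w n = cells T (Suc n) (\<lambda>j. Xc (node T (Suc n) j) w)"

lemma Uc_represents: "0 < T ==> represents H T (Uc T w) (\<lambda>s. Xc s w)"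
 unfolding Uc_def[abs_def] by (rule represents_cells) (auto intro: continuous_on_subset[OF Xc_continuous])

lemma Uc_hspace: "0 < T ==> Uc T w \<in> hspace H T"
 using Uc_represents by (simp add: represents_def)

lemma Uc_coeffs: "0 < T ==> Uc T w n \<in> coeffs" by (rule hspace_coeffs[OF Uc_hspace])

lemma Xc_second_moment: "0 \<le> t ==> (LINT w|M. (Xc t w)^2) \<le> 1 + KX"
proof -
 assume t: "0 \<le> t"
 have "(Xc t w)^2 \<le> 1 + (Xc t w) ^ 4" for w
 proof -
  have "0 \<le> (1 - (Xc t w)^2)^2 + 1 + (Xc t w) ^ 4" by simp
  thus ?thesis by (simp add: power2_diff power_mult[symmetric])
 qed
 hence "(LINT w|M. (Xc t w)^2) \<le> (LINT w|M. 1 + (Xc t w) ^ 4)"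
  using Xc_sqint[of t] Xc_int4[of t] by (intro integral_mono) (auto simp: sqint_def int4_def)
 also have "... = 1 + (LINT w|M. (Xc t w) ^ 4)" using Xc_int4[of t] by (simp add: int4_def prob_space)
 finally show ?thesis using Xc_fourth[OF t] by simp
qed

lemma Uc_norm_bound:
 assumes T: "0 < T"
 shows "integrable M (\<lambda>w. step_inner H (Uc T w n) (Uc T w n))"
  "(LINT w|M. step_inner H (Uc T w n) (Uc T w n)) \<le> 2 * kern1 T * (T * (1 + KX))"
proof -
 let ?N = "Suc n"
 have nd: "0 \<le> node T ?N j" for j using T by (simp add: node_nonneg)
 have k1: "kern1 T \<ge> 0" using kern1_mono[of 0 T] T by (simp add: kern1_def)
 let ?b = "\<lambda>w. 2 * kern1 T * (\<Sum>j<?N. (Xc (node T ?N j) w)^2 * (T / ?N))"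
 have le: "step_inner H (Uc T w n) (Uc T w n) \<le> ?b w" for w
  unfolding Uc_def by (rule cells_L2[OF T]) simp
 have ge: "0 \<le> step_inner H (Uc T w n) (Uc T w n)" for w by (rule step_inner_self_nonneg[OF Uc_coeffs[OF T]])
 have bi: "integrable M ?b" using Xc_sqint by (intro integrable_mult_right Bochner_Integration.integrable_sum integrable_mult_left sqint_sq)
 have meas: "(\<lambda>w. step_inner H (Uc T w n) (Uc T w n)) \<in> borel_measurable M"
  unfolding step_inner_lin Uc_def lin_cells by measurable
 show i: "integrable M (\<lambda>w. step_inner H (Uc T w n) (Uc T w n))"
  by (rule Bochner_Integration.integrable_bound[OF bi meas]) (use le ge in \<open>auto intro!: AE_I2 intro: order_trans[OF _ abs_ge_self]\<close>)
 have "(LINT w|M. step_inner H (Uc T w n) (Uc T w n)) \<le> (LINT w|M. ?b w)" by (rule integral_mono[OF i bi le])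
 also have "... = 2 * kern1 T * (\<Sum>j<?N. (LINT w|M. (Xc (node T ?N j) w)^2) * (T / ?N))"
  unfolding integral_mult_right_zero
  by (subst Bochner_Integration.integral_sum) (auto simp del: of_nat_Suc sum.lessThan_Suc intro!: integrable_divide integrable_mult_left integrable_mult_right sqint_sq Xc_sqint)
 also have "... \<le> 2 * kern1 T * (\<Sum>j<?N. (1 + KX) * (T / ?N))"
  using T k1 by (intro mult_left_mono sum_mono mult_right_mono Xc_second_moment nd) auto
 also have "... = 2 * kern1 T * (T * (1 + KX))" by (simp add: field_simps del: of_nat_Suc)
 finally show "(LINT w|M. step_inner H (Uc T w n) (Uc T w n)) \<le> 2 * kern1 T * (T * (1 + KX))" .
qed

lemma Uc_hinner_tendsto:
 assumes T: "0 < T" and h: "h \<in> hspace H T"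
 shows "(\<lambda>n. step_inner H (h n) (Uc T w n)) \<longlonglongrightarrow> hinner H h (Uc T w)"
 unfolding hinner_eq[OF h Uc_hspace[OF T]] by (rule hinner_tendsto[OF h Uc_hspace[OF T]])

text \<open>The norms of the step functions have bounded expectation, and Fatou's lemma bounds that of the limit.\<close>

lemma Uc_hspace_L2:
 assumes T: "0 < T" shows "hspace_L2 M H T (Uc T)"
 unfolding hspace_L2_def
proof (intro conjI ballI Uc_hspace[OF T])
 fix h assume h: "h \<in> hspace H T"
 show "(\<lambda>w. hinner H h (Uc T w)) \<in> borel_measurable M"
 proof (rule borel_measurable_LIMSEQ_real[OF Uc_hinner_tendsto[OF T h]])
  show "(\<lambda>w. step_inner H (h n) (Uc T w n)) \<in> borel_measurable M" for n
   unfolding step_inner_lin Uc_def lin_cells unfolding lin_def by measurable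
 qed
next
 \<comment> \<open>The norms themselves, so that \<open>L2_bounded_weak_limit\<close> with test variable zero applies to their squares.\<close>
 define \<xi> where "\<xi> n w = sqrt (step_inner H (Uc T w n) (Uc T w n))" for n w
 have ge: "0 \<le> step_inner H (Uc T w n) (Uc T w n)" for w n by (rule step_inner_self_nonneg[OF Uc_coeffs[OF T]])
 have sq: "(\<xi> n w)^2 = step_inner H (Uc T w n) (Uc T w n)" for n w using ge by (simp add: \<xi>_def)
 have m: "(\<lambda>w. step_inner H (Uc T w n) (Uc T w n)) \<in> borel_measurable M" for n
  using Uc_norm_bound(1)[OF T] by (rule borel_measurable_integrable)
 have \<xi>: "sqint M (\<xi> n)" for n
  using Uc_norm_bound(1)[OF T, of n] m[of n] by (simp add: sqint_def sq) (simp add: \<xi>_def[abs_def])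
 have lim: "(\<lambda>n. step_inner H (Uc T w n) (Uc T w n)) \<longlonglongrightarrow> hinner H (Uc T w) (Uc T w)" for w
  by (rule Uc_hinner_tendsto[OF T Uc_hspace[OF T]])
 have nn: "0 \<le> hinner H (Uc T w) (Uc T w)" for w by (rule LIMSEQ_le_const[OF lim]) (use ge in auto)
 have "sqint M (\<lambda>w. sqrt (hinner H (Uc T w) (Uc T w)))"
 proof (rule L2_bounded_weak_limit(1)[OF sqint_zero \<xi>])
  show "(LINT w|M. (\<xi> k w)^2) \<le> 2 * kern1 T * (T * (1 + KX))" for k unfolding sq by (rule Uc_norm_bound(2)[OF T])
  show "(\<lambda>w. sqrt (hinner H (Uc T w) (Uc T w))) \<in> borel_measurable M"
  proof (rule borel_measurable_LIMSEQ_real[where u=\<xi>])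
   show "(\<lambda>n. \<xi> n w) \<longlonglongrightarrow> sqrt (hinner H (Uc T w) (Uc T w))" for w unfolding \<xi>_def by (intro tendsto_real_sqrt lim)
  qed (rule sqint_measurable[OF \<xi>])
  show "AE w in M. (\<lambda>k. \<xi> k w) \<longlonglongrightarrow> sqrt (hinner H (Uc T w) (Uc T w))"
   unfolding \<xi>_def by (intro AE_I2 tendsto_real_sqrt lim)
 qed
 thus "integrable M (\<lambda>w. hinner H (Uc T w) (Uc T w))" using nn by (simp add: sqint_def)
qed

text \<open>Integration by parts in each term of the Riemann sum produces the derivatives of \<open>f\<close>, paired with the step
  functions \<open>Uc\<close>, and the product of the means. The pairing converges for every sample point and with bounded
  second moments, which suffices by \<open>L2_bounded_weak_limit\<close>.\<close>

lemma Sk_duality: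
 assumes T: "0 < T" and f: "C1_poly k f" and \<psi>: "\<And>i. i < k ==> \<psi> i \<in> hspace H T"
 shows "(LINT w|M. smooth_functional M B k f \<psi> w * (Sk T w - (LINT w|M. Sk T w))) =
  (LINT w|M. hinner H (malliavin M B k f \<psi> w) (Uc T w))"
proof -
 define G where "G i = isonormal M B (\<psi> i)" for i
 define F where "F w = f (vec k G w)" for w
 define D where "D i w = pdiff i f (vec k G w)" for i w
 have G: "G i \<in> gsp" if "i < k" for i unfolding G_def by (rule gsp_isonormal[OF \<psi>[OF that]])
 have sF: "smooth_functional M B k f \<psi> = F"
  by (intro ext) (simp add: smooth_functional_def gauss_args_vec F_def G_def[abs_def])
 have Fs: "sqint M F" unfolding F_def[abs_def] by (rule C1_poly_sqint(1)[where G=G and k=k, OF f G])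
 have Ds: "sqint M (D i)" if "i < k" for i unfolding D_def[abs_def] by (rule C1_poly_sqint(2)[where G=G and k=k, OF f G that])
 define V where "V n j w = B (node T (Suc n) (Suc j)) w - B (node T (Suc n) j) w" for n j w
 have V: "V n j \<in> gsp" for n j unfolding V_def[abs_def] by (intro gsp_diff gsp_B node_nonneg) (use T in auto)
 define x where "x n j w = Xc (node T (Suc n) j) w" for n j w
 define \<xi> where "\<xi> i n w = (\<Sum>j<Suc n. x n j w * (LINT w|M. G i w * V n j w))" for i n w
 have xV: "sqint M (\<lambda>w. x n j w * V n j w)" for n j
  unfolding x_def by (intro int4_mult(1) Xc_int4 gsp_int4 V)
 have xs: "sqint M (x n j)" for n j unfolding x_def[abs_def] by (rule Xc_sqint)
 have Rs_eq: "Rs T (Suc n) w = (\<Sum>j<Suc n. x n j w * V n j w)" for n w by (simp add: Rs_def x_def V_def)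
 have ibp: "(LINT w|M. F w * Rs T (Suc n) w) = (\<Sum>i<k. LINT w|M. D i w * \<xi> i n w) + (LINT w|M. F w) * (LINT w|M. Rs T (Suc n) w)" for n
 proof -
  have "(LINT w|M. F w * Rs T (Suc n) w) = (\<Sum>j<Suc n. LINT w|M. F w * (x n j w * V n j w))"
   unfolding Rs_eq sum_distrib_left by (rule Bochner_Integration.integral_sum) (intro sqint_mult Fs xV)
  also have "... = (\<Sum>j<Suc n. (\<Sum>i<k. (LINT w|M. D i w * x n j w) * (LINT w|M. G i w * V n j w)) + (LINT w|M. F w) * (LINT w|M. x n j w * V n j w))"
   unfolding F_def D_def x_def Xc_def by (intro sum.cong refl affine_ibp[where G=G and k=k, OF f G Z_gsp V])
  also have "... = (\<Sum>j<Suc n. \<Sum>i<k. (LINT w|M. D i w * x n j w) * (LINT w|M. G i w * V n j w)) + (LINT w|M. F w) * (\<Sum>j<Suc n. LINT w|M. x n j w * V n j w)"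
   by (simp only: sum.distrib sum_distrib_left)
  also have "(\<Sum>j<Suc n. \<Sum>i<k. (LINT w|M. D i w * x n j w) * (LINT w|M. G i w * V n j w)) = (\<Sum>i<k. \<Sum>j<Suc n. (LINT w|M. D i w * x n j w) * (LINT w|M. G i w * V n j w))"
   by (rule sum.swap)
  also have "... = (\<Sum>i<k. LINT w|M. D i w * \<xi> i n w)"
  proof (rule sum.cong[OF refl])
   fix i assume "i \<in> {..<k}"
   hence i: "i < k" by simp
   have "(LINT w|M. D i w * \<xi> i n w) = (LINT w|M. (\<Sum>j<Suc n. D i w * x n j w * (LINT w|M. G i w * V n j w)))"
    unfolding \<xi>_def sum_distrib_left by (simp only: mult.assoc)
   also have "... = (\<Sum>j<Suc n. LINT w|M. D i w * x n j w * (LINT w|M. G i w * V n j w))"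
    by (rule Bochner_Integration.integral_sum) (intro integrable_mult_left sqint_mult Ds i xs)
   also have "... = (\<Sum>j<Suc n. (LINT w|M. D i w * x n j w) * (LINT w|M. G i w * V n j w))" by simp
   finally show "(\<Sum>j<Suc n. (LINT w|M. D i w * x n j w) * (LINT w|M. G i w * V n j w)) = (LINT w|M. D i w * \<xi> i n w)" by (rule sym)
  qed
  also have "(\<Sum>j<Suc n. LINT w|M. x n j w * V n j w) = (LINT w|M. Rs T (Suc n) w)"
   unfolding Rs_eq by (rule Bochner_Integration.integral_sum[symmetric]) (intro sqint_integrable xV)
  finally show ?thesis .
 qed
 have \<xi>_eq: "\<xi> i n w = (LINT w'|M. G i w' * BB (Uc T w n) w')" if "i < k" for i n w
 proof -
  have "(LINT w'|M. G i w' * BB (Uc T w n) w') = (LINT w'|M. (\<Sum>j<Suc n. x n j w * (G i w' * V n j w')))"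
   unfolding BB_def Uc_def lin_cells sum_distrib_left V_def x_def by (simp only: mult.left_commute)
  also have "... = (\<Sum>j<Suc n. LINT w'|M. x n j w * (G i w' * V n j w'))"
   by (rule Bochner_Integration.integral_sum) (intro integrable_mult_right sqint_mult gsp_sqint G that V)
  finally show ?thesis unfolding \<xi>_def by simp
 qed
 have \<xi>s: "sqint M (\<xi> i n)" for i n
 proof -
  have "sqint M (\<lambda>w. \<Sum>j<Suc n. (LINT w|M. G i w * V n j w) * x n j w)" by (intro sqint_sum sqint_cmult xs)
  thus ?thesis unfolding \<xi>_def[abs_def] by (simp only: mult.commute)
 qed
 have wl: "(\<lambda>n. LINT w|M. D i w * \<xi> i n w) \<longlonglongrightarrow> (LINT w|M. D i w * hinner H (\<psi> i) (Uc T w))"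
  and hs: "sqint M (\<lambda>w. hinner H (\<psi> i) (Uc T w))" if i: "i < k" for i
 proof -
  have bd: "(LINT w|M. (\<xi> i n w)^2) \<le> (LINT w|M. (G i w)^2) * (2 * kern1 T * (T * (1 + KX)))" for n
  proof -
   have "(\<xi> i n w)^2 \<le> (LINT w|M. (G i w)^2) * step_inner H (Uc T w n) (Uc T w n)" for w
    unfolding \<xi>_eq[OF i] BB_norm[OF Uc_coeffs[OF T], symmetric]
    by (rule cauchy_schwarz_integral) (intro gsp_sqint G i BB_sqint Uc_coeffs T)+
   hence "(LINT w|M. (\<xi> i n w)^2) \<le> (LINT w|M. (LINT w|M. (G i w)^2) * step_inner H (Uc T w n) (Uc T w n))"
    by (intro integral_mono sqint_sq \<xi>s integrable_mult_right Uc_norm_bound(1) T)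
   also have "... = (LINT w|M. (G i w)^2) * (LINT w|M. step_inner H (Uc T w n) (Uc T w n))" by simp
   also have "... \<le> (LINT w|M. (G i w)^2) * (2 * kern1 T * (T * (1 + KX)))"
    by (intro mult_left_mono Uc_norm_bound(2) T) simp
   finally show ?thesis .
  qed
  have hm: "(\<lambda>w. hinner H (\<psi> i) (Uc T w)) \<in> borel_measurable M"
   using Uc_hspace_L2[OF T] \<psi>[OF i] by (simp add: hspace_L2_def)
  have pl: "AE w in M. (\<lambda>n. \<xi> i n w) \<longlonglongrightarrow> hinner H (\<psi> i) (Uc T w)"
  proof (rule AE_I2)
   fix w
   show "(\<lambda>n. \<xi> i n w) \<longlonglongrightarrow> hinner H (\<psi> i) (Uc T w)"
    unfolding \<xi>_eq[OF i] hinner_eq[OF \<psi>[OF i] Uc_hspace[OF T]] G_def[symmetric]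
    by (rule L2_tendsto_mult[OF L2_tendsto_const[OF gsp_sqint[OF G[OF i]]] isonormal_L2[OF Uc_hspace[OF T]]])
  qed
  show "(\<lambda>n. LINT w|M. D i w * \<xi> i n w) \<longlonglongrightarrow> (LINT w|M. D i w * hinner H (\<psi> i) (Uc T w))"
   by (rule L2_bounded_weak_limit(3)[OF Ds[OF i] \<xi>s bd hm pl])
  show "sqint M (\<lambda>w. hinner H (\<psi> i) (Uc T w))" by (rule L2_bounded_weak_limit(1)[OF Ds[OF i] \<xi>s bd hm pl])
 qed
 have "(\<lambda>n. (LINT w|M. F w * Rs T (Suc n) w) - (LINT w|M. F w) * (LINT w|M. Rs T (Suc n) w)) \<longlonglongrightarrow>
   (LINT w|M. F w * Sk T w) - (LINT w|M. F w) * (LINT w|M. Sk T w)"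
  by (intro tendsto_diff tendsto_mult tendsto_const L2_tendsto_mult[OF L2_tendsto_const[OF Fs] Rs_L2_tendsto[OF T]] L2_tendsto_integral[OF Rs_L2_tendsto[OF T]])
 moreover have "(\<lambda>n. (LINT w|M. F w * Rs T (Suc n) w) - (LINT w|M. F w) * (LINT w|M. Rs T (Suc n) w)) \<longlonglongrightarrow> (\<Sum>i<k. LINT w|M. D i w * hinner H (\<psi> i) (Uc T w))"
  unfolding ibp by (simp, intro tendsto_sum wl) simp
 ultimately have eq: "(LINT w|M. F w * Sk T w) - (LINT w|M. F w) * (LINT w|M. Sk T w) = (\<Sum>i<k. LINT w|M. D i w * hinner H (\<psi> i) (Uc T w))"
  by (rule LIMSEQ_unique)
 have "(LINT w|M. F w * (Sk T w - (LINT w|M. Sk T w))) = (LINT w|M. F w * Sk T w) - (LINT w|M. F w) * (LINT w|M. Sk T w)"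
  using sqint_mult[OF Fs Sk_sqint[of T]] sqint_integrable[OF Fs] T by (simp add: right_diff_distrib)
 also have "... = (LINT w|M. (\<Sum>i<k. D i w * hinner H (\<psi> i) (Uc T w)))"
  unfolding eq by (rule Bochner_Integration.integral_sum[symmetric]) (intro sqint_mult Ds hs; simp)
 also have "... = (LINT w|M. hinner H (malliavin M B k f \<psi> w) (Uc T w))"
  unfolding D_def G_def by (intro Bochner_Integration.integral_cong refl hinner_malliavin[where T=T, symmetric] \<psi> Uc_hspace T)
 finally show ?thesis unfolding sF .
qed

lemma skorohod_X:
 assumes T: "0 < T"
 shows "AE w in M. skorohod_integral M H B T X w = Sk T w - (LINT w|M. Sk T w)"
proof -
 define E where "E = (LINT w|M. Sk T w)"
 obtain S where S: "S \<in> borel_measurable (history M B T)" "AE w in M. Sk T w = S w" using Sk_history[OF T] by blast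
 have Sm: "S \<in> borel_measurable M" by (rule history_measurable[OF S(1)])
 have sk: "sqint M (Sk T)" using T by (intro Sk_sqint) simp
 have Ss: "sqint M S" by (rule sqint_cong_AE[OF sk S(2) Sm])
 have isk: "is_skorohod_integral M H B T X (\<lambda>w. S w - E)"
  unfolding is_skorohod_integral_def
 proof (intro conjI exI[of _ "Uc T"] allI impI Uc_hspace_L2[OF T])
  show "(\<lambda>w. S w - E) \<in> borel_measurable (history M B T)" by (intro borel_measurable_diff S(1) borel_measurable_const)
  show "integrable M (\<lambda>w. (S w - E)^2)" by (rule sqint_sq[OF sqint_diff[OF Ss sqint_const]])
  show "AE w in M. represents H T (Uc T w) (\<lambda>t. X t w)"
   using AE_not_Nul
  proof eventually_elim
   case (elim w)
   have "represents H T (Uc T w) (\<lambda>t. X t w) \<longleftrightarrow> represents H T (Uc T w) (\<lambda>t. Xc t w)"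
    by (rule represents_cong) (use elim X_eq in \<open>auto simp: Xc_def\<close>)
   thus ?case using Uc_represents[OF T] by simp
  qed
  fix k f and \<psi> :: "nat => nat => real => real" assume a: "smooth_poly_growth k f \<and> (\<forall>i<k. \<psi> i \<in> hspace H T)"
  have f: "C1_poly k f" using a smooth_C1_poly by blast
  have \<psi>: "\<psi> i \<in> hspace H T" if "i < k" for i using a that by blast
  have Fm: "smooth_functional M B k f \<psi> \<in> borel_measurable M"
   using sqint_measurable[OF C1_poly_sqint(1)[where G="\<lambda>i. isonormal M B (\<psi> i)" and k=k, OF f gsp_isonormal[OF \<psi>]]]
   by (simp add: smooth_functional_def[abs_def] gauss_args_vec)
  have "(LINT w|M. smooth_functional M B k f \<psi> w * (S w - E)) = (LINT w|M. smooth_functional M B k f \<psi> w * (Sk T w - E))"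
  proof (rule integral_cong_AE)
   show "(\<lambda>w. smooth_functional M B k f \<psi> w * (S w - E)) \<in> borel_measurable M"
    by (intro borel_measurable_times borel_measurable_diff borel_measurable_const Fm Sm)
   show "(\<lambda>w. smooth_functional M B k f \<psi> w * (Sk T w - E)) \<in> borel_measurable M"
    by (intro borel_measurable_times borel_measurable_diff borel_measurable_const Fm sqint_measurable[OF sk])
   show "AE w in M. smooth_functional M B k f \<psi> w * (S w - E) = smooth_functional M B k f \<psi> w * (Sk T w - E)"
    using S(2) by eventually_elim simp
  qed
  also have "... = (LINT w|M. hinner H (malliavin M B k f \<psi> w) (Uc T w))"
   unfolding E_def by (rule Sk_duality[OF T f \<psi>])
  finally show "(LINT w|M. smooth_functional M B k f \<psi> w * (S w - E)) = (LINT w|M. hinner H (malliavin M B k f \<psi> w) (Uc T w))" .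
 qed
 have "is_skorohod_integral M H B T X (skorohod_integral M H B T X)"
  unfolding skorohod_integral_def by (rule someI[of "is_skorohod_integral M H B T X", OF isk])
 from skorohod_unique[OF this isk] S(2) show ?thesis unfolding E_def[symmetric] by eventually_elim simp
qed

end

section \<open>Laws of large numbers\<close>

lemma powr_decay:
 assumes x: "1 \<le> (x::real)" and q: "real q * (2 - 2 * H) \<ge> 2"
 shows "(x powr (2 * H)) ^ q / (x ^ q)^2 \<le> x powr (- 2)" "(x ^ q) powr (2 * H) / (x ^ q)^2 \<le> x powr (- 2)"
proof -
 have a: "(x powr (2 * H)) ^ q = x powr (2 * H * q)" using x by (simp add: powr_realpow[symmetric] powr_powr)
 have b: "(x ^ q) powr (2 * H) = x powr (2 * H * q)" using x by (simp add: powr_realpow[symmetric] powr_powr mult_ac)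
 have c: "(x ^ q)^2 = x powr (2 * q)" using x by (simp add: powr_realpow[symmetric] powr_powr mult_ac)
 have "x powr (2 * H * q) / x powr (2 * q) = x powr (2 * H * q - 2 * q)" using x by (simp add: powr_diff)
 also have "... \<le> x powr (- 2)" using x q by (intro powr_mono) (auto simp: algebra_simps)
 finally have "x powr (2 * H * q) / x powr (2 * q) \<le> x powr (- 2)" .
 thus "(x powr (2 * H)) ^ q / (x ^ q)^2 \<le> x powr (- 2)" "(x ^ q) powr (2 * H) / (x ^ q)^2 \<le> x powr (- 2)"
  by (simp_all only: a b c)
qed

lemma summable_Suc_powr: "summable (\<lambda>k. c * real (Suc k) powr (- 2))"
proof -
 have "summable (\<lambda>n. real n powr (- 2))" by (subst summable_real_powr_iff) simp
 hence "summable (\<lambda>n. real (Suc n) powr (- 2))" by (subst summable_Suc_iff)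
 thus ?thesis by (rule summable_mult)
qed

lemma powr_exponent_exists:
 assumes "H < (1::real)" shows "\<exists>q::nat. q > 0 \<and> real q * (2 - 2 * H) \<ge> 2"
proof -
 obtain q :: nat where q: "2 / (2 - 2 * H) \<le> real q" using real_arch_simple by blast
 have "q > 0" using q assms by (intro Nat.gr0I) (auto simp: field_simps)
 thus ?thesis using q assms by (intro exI[of _ q]) (simp add: field_simps)
qed

text \<open>A polynomially growing subsequence makes the variances summable; monotonicity transfers the
  convergence to the times in between, because consecutive terms of the subsequence have ratio tending to one.\<close>

lemma monotone_lln:
 fixes V :: "real => 'w => real"
 assumes H: "H < 1" and V: "\<And>t. 1 \<le> t ==> sqint M (V t)" and K: "\<And>t. 1 \<le> t ==> (LINT w|M. (V t w)^2) \<le> K * t powr (2 * H)"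
  and mono: "\<And>s t w. 1 \<le> s ==> s \<le> t ==> d s + V s w \<le> d t + V t w"
  and lip: "\<And>s t. 1 \<le> s ==> s \<le> t ==> d t - d s \<le> K' * (t - s)" and K': "0 \<le> K'"
 shows "AE w in M. (\<lambda>n. V (real n) w / real n) \<longlonglongrightarrow> 0"
proof -
 obtain q :: nat where q: "q > 0" "real q * (2 - 2 * H) \<ge> 2" using powr_exponent_exists[OF H] by blast
 define N where "N k = real (Suc k) ^ q" for k
 have N1: "1 \<le> N k" for k unfolding N_def by (rule one_le_power) simp
 have N0: "0 < N k" for k using N1[of k] by linarith
 have Nmono: "N i \<le> N j" if "i \<le> j" for i j unfolding N_def using that by (intro power_mono) auto
 define Y where "Y k w = V (N k) w / N k" for k w
 have Ys: "sqint M (Y k)" for k using sqint_cmult[OF V[OF N1[of k]], of "1 / N k"] by (simp add: Y_def[abs_def])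
 have "0 \<le> (LINT w|M. (V 1 w)^2)" by simp
 also have "... \<le> K" using K[of 1] by simp
 finally have K0: "0 \<le> K" .
 have YK: "(LINT w|M. (Y k w)^2) \<le> K * real (Suc k) powr (- 2)" for k
 proof -
  have "(LINT w|M. (Y k w)^2) = (LINT w|M. (V (N k) w)^2) / (N k)^2" by (simp add: Y_def power_divide)
  also have "... \<le> K * N k powr (2 * H) / (N k)^2" using N0[of k] by (intro divide_right_mono K N1) simp
  also have "... = K * (N k powr (2 * H) / (N k)^2)" by simp
  also have "... \<le> K * real (Suc k) powr (- 2)" unfolding N_def by (intro mult_left_mono powr_decay(2) q K0) simp
  finally show ?thesis .
 qed
 have "summable (\<lambda>k. LINT w|M. (Y k w)^2)"
  by (rule summable_comparison_test'[OF summable_Suc_powr[of K], of 0]) (use YK in simp)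
 from summable_square_integrals_AE_tendsto_0(2)[OF Ys this]
 show ?thesis
 proof eventually_elim
  case (elim w)
  define r where "r k = N (Suc k) / N k" for k
  have r1: "r \<longlonglongrightarrow> 1"
  proof -
   have "(\<lambda>k. 1 + 1 / real (Suc k)) \<longlonglongrightarrow> 1 + 0" by (intro tendsto_intros LIMSEQ_Suc lim_1_over_n)
   hence "(\<lambda>k. (1 + 1 / real (Suc k)) ^ q) \<longlonglongrightarrow> (1 + 0) ^ q" by (rule tendsto_power)
   moreover have "(1 + 1 / real (Suc k)) ^ q = r k" for k
    unfolding r_def N_def power_divide[symmetric] by (rule arg_cong[where f="\<lambda>x. x ^ q"]) (simp add: field_simps)
   ultimately show ?thesis by simp
  qed
  \<comment> \<open>a bound for \<open>V n / n\<close> that holds whenever \<open>N k \<le> n \<le> N (k + 1)\<close>\<close>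
  define u where "u k = r k * \<bar>Y (Suc k) w\<bar> + \<bar>Y k w\<bar> + K' * (r k - 1)" for k
  have "u \<longlonglongrightarrow> 1 * \<bar>0\<bar> + \<bar>0\<bar> + K' * (1 - 1)"
   unfolding u_def by (intro tendsto_intros r1 elim LIMSEQ_Suc[OF elim])
  hence u0: "u \<longlonglongrightarrow> 0" by simp
  show "(\<lambda>n. V (real n) w / real n) \<longlonglongrightarrow> 0"
  proof (rule LIMSEQ_I)
   fix e :: real assume "e > 0"
   from LIMSEQ_D[OF u0 this] obtain k0 where k0': "\<And>k. k \<ge> k0 ==> \<bar>u k\<bar> < e" by auto
   have k0: "u k < e" if "k \<ge> k0" for k using k0'[OF that] by linarith
   show "\<exists>n0. \<forall>n\<ge>n0. norm (V (real n) w / real n - 0) < e"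
   proof (intro exI[of _ "nat \<lceil>N k0\<rceil>"] allI impI)
    fix n :: nat assume "n \<ge> nat \<lceil>N k0\<rceil>"
    hence nk0: "N k0 \<le> real n" by linarith
    define k1 where "k1 = (LEAST j. real n < N j)"
    have "real n < real (Suc n)" by simp
    also have "... \<le> N n" unfolding N_def using q by (intro self_le_power) auto
    finally have k1: "real n < N k1" unfolding k1_def by (rule LeastI)
    have "k0 < k1" using k1 nk0 Nmono[of k1 k0] by (intro not_le_imp_less notI) auto
    then obtain k where k: "k1 = Suc k" "k0 \<le> k" by (cases k1) auto
    have Nn: "N k \<le> real n" using not_less_Least[of k "\<lambda>j. real n < N j"] k by (simp add: k1_def not_less)
    have nN: "real n \<le> N (Suc k)" using k1 k by simp
    have n0: "0 < real n" using N0[of k] Nn by linarith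
    have n1: "1 \<le> real n" using N1[of k] Nn by linarith
    have VN: "V (N j) w = Y j w * N j" for j using N0[of j] by (simp add: Y_def)
    have Kn: "K' * (N (Suc k) - real n) \<le> K' * (N (Suc k) - N k)" "K' * (real n - N k) \<le> K' * (N (Suc k) - N k)"
     using Nn nN K' by (auto intro!: mult_left_mono)
    have yb: "Y j w * N j \<le> \<bar>Y j w\<bar> * N j" "- (Y j w * N j) \<le> \<bar>Y j w\<bar> * N j" for j
     using mult_right_mono[of "Y j w" "\<bar>Y j w\<bar>" "N j"] mult_right_mono[of "- Y j w" "\<bar>Y j w\<bar>" "N j"] N0[of j] by auto
    have up: "V (real n) w \<le> \<bar>Y (Suc k) w\<bar> * N (Suc k) + K' * (N (Suc k) - N k)"
     using mono[OF n1 nN, of w] lip[OF n1 nN] Kn(1) VN[of "Suc k"] yb(1)[of "Suc k"] by linarith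
    have lo: "- V (real n) w \<le> \<bar>Y k w\<bar> * N k + K' * (N (Suc k) - N k)"
     using mono[OF N1 Nn, of w] lip[OF N1 Nn] Kn(2) VN[of k] yb(2)[of k] by linarith
    have y0: "0 \<le> \<bar>Y j w\<bar> * N j" for j using N0[of j] by simp
    have d0: "0 \<le> K' * (N (Suc k) - N k)" using Nmono[of k "Suc k"] K' by simp
    have "\<bar>V (real n) w\<bar> \<le> \<bar>Y (Suc k) w\<bar> * N (Suc k) + \<bar>Y k w\<bar> * N k + K' * (N (Suc k) - N k)" (is "_ \<le> ?b")
     using up lo y0[of k] y0[of "Suc k"] by linarith
    hence "\<bar>V (real n) w\<bar> / real n \<le> ?b / real n" using n0 by (intro divide_right_mono) auto
    also have "... \<le> ?b / N k" using y0[of k] y0[of "Suc k"] d0 N0[of k] Nn by (intro divide_left_mono mult_pos_pos n0) auto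
    also have "... = u k" using N0[of k] by (simp add: u_def r_def field_simps)
    also have "... < e" by (rule k0[OF k(2)])
    finally show "norm (V (real n) w / real n - 0) < e" using n0 by simp
   qed
  qed
 qed
qed

lemma bounded_cont_integrable:
 fixes f g :: "real => real"
 assumes [measurable]: "g \<in> borel_measurable borel" and g: "\<And>s. a \<le> s ==> s \<le> b ==> \<bar>g s\<bar> \<le> \<kappa>" and f: "continuous_on UNIV f"
 shows "set_integrable lborel {a..b} (\<lambda>s. g s * f s)"
proof -
 obtain K where K: "\<And>s. a \<le> s ==> s \<le> b ==> \<bar>f s\<bar> \<le> K" using continuous_bounded_Icc[OF f, of a b] by blast
 have [measurable]: "f \<in> borel_measurable borel" by (rule borel_measurable_continuous_onI[OF f])
 have "\<bar>g s * f s\<bar> \<le> \<bar>\<kappa>\<bar> * \<bar>K\<bar>" if "a \<le> s" "s \<le> b" for s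
  unfolding abs_mult using g[OF that] K[OF that] by (intro mult_mono) auto
 thus ?thesis by (intro bounded_set_integrable) measurable
qed

text \<open>Polarisation of the Gaussian fourth moment: \<open>(y + z)\<^sup>4 + (y - z)\<^sup>4 = 2 y\<^sup>4 + 12 y\<^sup>2 z\<^sup>2 + 2 z\<^sup>4\<close>.\<close>

lemma (in fbm) gsp_square_cov:
 assumes Y: "Y \<in> gsp" and W: "W \<in> gsp"
 shows "(LINT w|M. ((Y w)^2 - (LINT w|M. (Y w)^2)) * ((W w)^2 - (LINT w|M. (W w)^2))) = 2 * (LINT w|M. Y w * W w)^2"
proof -
 define a b c where "a = (LINT w|M. (Y w)^2)" and "b = (LINT w|M. (W w)^2)" and "c = (LINT w|M. Y w * W w)"
 note s = gsp_sqint[OF Y] gsp_sqint[OF W]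
 have iYW: "integrable M (\<lambda>w. Y w * W w)" by (rule sqint_mult[OF s])
 have i2: "integrable M (\<lambda>w. (Y w)^2)" "integrable M (\<lambda>w. (W w)^2)" by (rule sqint_sq[OF s(1)], rule sqint_sq[OF s(2)])
 have i22: "integrable M (\<lambda>w. (Y w)^2 * (W w)^2)" by (rule sqint_mult[OF int4_sq[OF gsp_int4[OF Y]] int4_sq[OF gsp_int4[OF W]]])
 have i4: "integrable M (\<lambda>w. (Y w) ^ 4)" "integrable M (\<lambda>w. (W w) ^ 4)" using gsp_int4[OF Y] gsp_int4[OF W] by (auto simp: int4_def)
 have p: "(LINT w|M. (Y w + W w)^2) = a + b + 2 * c" "(LINT w|M. (Y w - W w)^2) = a + b - 2 * c"
  unfolding power2_sum power2_diff a_def b_def c_def using iYW i2 by (simp_all add: mult.assoc)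
 have ip: "integrable M (\<lambda>w. (Y w + W w) ^ 4)" "integrable M (\<lambda>w. (Y w - W w) ^ 4)"
  using gsp_int4[OF gsp_add[OF Y W]] gsp_int4[OF gsp_diff[OF Y W]] by (auto simp: int4_def)
 have "(LINT w|M. (Y w + W w) ^ 4) + (LINT w|M. (Y w - W w) ^ 4) = (LINT w|M. (Y w + W w) ^ 4 + (Y w - W w) ^ 4)" using ip by simp
 also have "... = (LINT w|M. 2 * (Y w) ^ 4 + 12 * ((Y w)^2 * (W w)^2) + 2 * (W w) ^ 4)"
  by (intro Bochner_Integration.integral_cong refl) (simp add: power4_eq_xxxx power2_eq_square algebra_simps)
 also have "... = 2 * (3 * a^2) + 12 * (LINT w|M. (Y w)^2 * (W w)^2) + 2 * (3 * b^2)"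
  using i4 i22 gsp_fourth_moment[OF Y] gsp_fourth_moment[OF W] by (simp add: a_def b_def)
 finally have "3 * (a + b + 2 * c)^2 + 3 * (a + b - 2 * c)^2 = 2 * (3 * a^2) + 12 * (LINT w|M. (Y w)^2 * (W w)^2) + 2 * (3 * b^2)"
  unfolding gsp_fourth_moment[OF gsp_add[OF Y W]] gsp_fourth_moment[OF gsp_diff[OF Y W]] p .
 hence e: "(LINT w|M. (Y w)^2 * (W w)^2) = a * b + 2 * c^2" by (simp add: power2_eq_square algebra_simps)
 have "(LINT w|M. ((Y w)^2 - a) * ((W w)^2 - b)) = (LINT w|M. (Y w)^2 * (W w)^2 - b * (Y w)^2 - a * (W w)^2 + a * b)"
  by (intro Bochner_Integration.integral_cong refl) (simp add: algebra_simps)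
 also have "... = (LINT w|M. (Y w)^2 * (W w)^2) - b * a - a * b + a * b" using i22 i2 by (simp add: prob_space a_def b_def)
 finally show ?thesis unfolding e a_def[symmetric] b_def[symmetric] c_def[symmetric] by simp
qed

context fou begin

text \<open>Both second moments are double integrals of covariances, and those of \<open>Z\<close> are nonnegative.\<close>

lemma cov_compare:
 fixes h :: "real => 'w => real"
 assumes h: "(\<lambda>p. h (fst p) (snd p)) \<in> borel_measurable (lborel \<Otimes>\<^sub>M M)"
  and sq: "\<And>s. 0 \<le> s ==> s \<le> t ==> sqint M (h s)" and K: "\<And>s. 0 \<le> s ==> s \<le> t ==> (LINT w|M. (h s w)^2) \<le> K"
  and path: "\<And>w. w \<in> space M ==> set_integrable lborel {0..t} (\<lambda>s. h s w)"
   "\<And>w. w \<in> space M ==> set_integrable lborel {0..t} (\<lambda>s. (h s w)^2)" and t: "0 \<le> t"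
  and c: "\<And>s u. 0 \<le> s ==> s \<le> t ==> 0 \<le> u ==> u \<le> t ==> \<bar>LINT w|M. h s w * h u w\<bar> \<le> c * cov s u"
 shows "(LINT w|M. (itg 0 t (\<lambda>s. h s w))^2) \<le> c * (LINT w|M. (itg 0 t (\<lambda>s. Z s w))^2)"
proof -
 define W where "W w = itg 0 t (\<lambda>s. h s w)" for w
 define WZ where "WZ w = itg 0 t (\<lambda>s. Z s w)" for w
 have Ws: "sqint M W" unfolding W_def[abs_def] by (rule sqint_itg(1)[OF h sq K path t])
 have WZs: "sqint M WZ" unfolding WZ_def[abs_def] by (rule Z_int_sqint(1)[OF t])
 have inner: "\<bar>LINT w|M. W w * h s w\<bar> \<le> c * (LINT w|M. WZ w * Z s w)" if s: "0 \<le> s" "s \<le> t" for s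
 proof -
  have "(LINT w|M. W w * h s w) = (LINT w|M. h s w * itg 0 t (\<lambda>u. h u w))" by (simp add: W_def mult.commute)
  also have "... = itg 0 t (\<lambda>u. LINT w|M. h s w * h u w)" by (rule fubini_itg(3)[OF h sq K sq[OF s]])
  finally have "\<bar>LINT w|M. W w * h s w\<bar> = \<bar>itg 0 t (\<lambda>u. LINT w|M. h s w * h u w)\<bar>" by simp
  also have "... \<le> itg 0 t (\<lambda>u. c * (LINT w|M. Z s w * Z u w))"
  proof (rule itg_abs_le')
   show "set_integrable lborel {0..t} (\<lambda>u. LINT w|M. h s w * h u w)" by (rule fubini_itg(2)[OF h sq K sq[OF s]])
   show "set_integrable lborel {0..t} (\<lambda>u. c * (LINT w|M. Z s w * Z u w))"
    by (intro set_integrable_mult_right fubini_itg(2)[where h=Z, OF Z_joint Z_sqint Z_second_moment Z_sqint])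
  qed (use c[OF s] in \<open>simp add: cov_def\<close>)
  also have "... = c * itg 0 t (\<lambda>u. LINT w|M. Z s w * Z u w)" by simp
  also have "itg 0 t (\<lambda>u. LINT w|M. Z s w * Z u w) = (LINT w|M. Z s w * itg 0 t (\<lambda>u. Z u w))"
   by (rule fubini_itg(3)[where h=Z, OF Z_joint Z_sqint Z_second_moment Z_sqint, symmetric])
  finally show ?thesis by (simp add: WZ_def mult.commute)
 qed
 have "(LINT w|M. (W w)^2) = (LINT w|M. W w * itg 0 t (\<lambda>s. h s w))" by (simp add: W_def power2_eq_square)
 also have "... = itg 0 t (\<lambda>s. LINT w|M. W w * h s w)" by (rule fubini_itg(3)[OF h sq K Ws])
 also have "... \<le> \<bar>...\<bar>" by simp
 also have "... \<le> itg 0 t (\<lambda>s. c * (LINT w|M. WZ w * Z s w))"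
 proof (rule itg_abs_le')
  show "set_integrable lborel {0..t} (\<lambda>s. LINT w|M. W w * h s w)" by (rule fubini_itg(2)[OF h sq K Ws])
  show "set_integrable lborel {0..t} (\<lambda>s. c * (LINT w|M. WZ w * Z s w))"
   by (intro set_integrable_mult_right fubini_itg(2)[where h=Z, OF Z_joint Z_sqint Z_second_moment WZs])
 qed (rule inner)
 also have "... = c * itg 0 t (\<lambda>s. LINT w|M. WZ w * Z s w)" by simp
 also have "itg 0 t (\<lambda>s. LINT w|M. WZ w * Z s w) = (LINT w|M. WZ w * itg 0 t (\<lambda>s. Z s w))"
  by (rule fubini_itg(3)[where h=Z, OF Z_joint Z_sqint Z_second_moment WZs, symmetric])
 finally show ?thesis by (simp add: W_def WZ_def power2_eq_square)
qed

definition KV :: real where "KV = (2 + 2 * KZ) / \<alpha>^2"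

text \<open>The equation itself bounds the time integral: it is a linear combination of the driving motion and the process.\<close>

lemma Z_integral_variance:
 assumes t: "1 \<le> t" shows "(LINT w|M. (itg 0 t (\<lambda>s. Z s w))^2) \<le> KV * t powr (2 * H)"
proof -
 have t0: "0 \<le> t" using t by simp
 have e: "itg 0 t (\<lambda>s. Z s w) = (1 / \<alpha>) * (Bc t w + (-1) * Z t w)" for w using Z_solves[OF t0, of w] \<alpha>_pos by (simp add: field_simps)
 have "(LINT w|M. (itg 0 t (\<lambda>s. Z s w))^2) = (1 / \<alpha>^2) * (LINT w|M. (Bc t w + (-1) * Z t w)^2)"
  unfolding e power_mult_distrib by (simp add: power_divide)
 also have "... \<le> (1 / \<alpha>^2) * (2 * (LINT w|M. (Bc t w)^2) + 2 * (LINT w|M. ((-1) * Z t w)^2))"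
  by (intro mult_left_mono integral_square_add_le Bc_sqint t0 sqint_cmult Z_sqint) simp
 also have "... \<le> (1 / \<alpha>^2) * (2 * t powr (2 * H) + 2 * (KZ * t powr (2 * H)))"
 proof -
  have "KZ * 1 \<le> KZ * t powr (2 * H)" using t KZ_pos H_gt by (intro mult_left_mono ge_one_powr_ge_zero) auto
  thus ?thesis using Bc_increment[of 0 t] t0 Z_second_moment[of t] by (intro mult_left_mono) (auto simp: Bc_0)
 qed
 also have "... = KV * t powr (2 * H)" by (simp add: KV_def algebra_simps add_divide_distrib)
 finally show ?thesis .
qed

definition v :: "real => real" where "v s = (LINT w|M. (Z s w)^2)"

lemma v_measurable [measurable]: "v \<in> borel_measurable borel"
proof -
 have "(\<lambda>s. LINT w|M. (Z s w)^2) \<in> borel_measurable lborel" by measurable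
 thus ?thesis unfolding v_def[abs_def] by simp
qed

lemma v_bound: "0 \<le> v s" "v s \<le> KZ" unfolding v_def using Z_second_moment by simp_all

lemma v_integrable: "set_integrable lborel {a..b} v"
 by (rule bounded_set_integrable[where K=KZ]) (use v_bound in auto)

text \<open>Bounds are required at nonnegative times only, because the mean function \<open>m\<close> is bounded there.\<close>

definition bdg :: "real => (real => real) => bool" where
 "bdg \<kappa> g \<longleftrightarrow> g \<in> borel_measurable borel \<and> (\<forall>s\<ge>0. \<bar>g s\<bar> \<le> \<kappa>)"

lemma bdg_nonneg: "bdg \<kappa> g ==> 0 \<le> \<kappa>" unfolding bdg_def by (meson abs_ge_zero order_refl order_trans)

text \<open>The two kinds of fluctuation that the law of large numbers has to control.\<close>

definition Wg :: "(real => real) => real => 'w => real" where "Wg g t w = itg 0 t (\<lambda>s. g s * Z s w)"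
definition Wq :: "real => 'w => real" where "Wq t w = itg 0 t (\<lambda>s. (Z s w)^2 - v s)"

lemma bdg_integrable:
 assumes "bdg \<kappa> g" "continuous_on UNIV f" "0 \<le> a" shows "set_integrable lborel {a..b} (\<lambda>s. g s * f s)"
 by (rule bounded_cont_integrable[where \<kappa>=\<kappa>]) (use assms in \<open>auto simp: bdg_def\<close>)

lemma Wg_moments:
 assumes g: "bdg \<kappa> g" and t: "0 \<le> t"
 shows "sqint M (Wg g t)" "(LINT w|M. Wg g t w) = 0" "1 \<le> t ==> (LINT w|M. (Wg g t w)^2) \<le> \<kappa>^2 * KV * t powr (2 * H)"
proof -
 have [measurable]: "g \<in> borel_measurable borel" using g by (simp add: bdg_def)
 have gb: "\<bar>g s\<bar> \<le> \<kappa>" if "0 \<le> s" for s :: real using g that by (simp add: bdg_def)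
 note \<kappa> = bdg_nonneg[OF g]
 have j: "(\<lambda>p. g (fst p) * Z (fst p) (snd p)) \<in> borel_measurable (lborel \<Otimes>\<^sub>M M)" by measurable
 have sq: "sqint M (\<lambda>w. g s * Z s w)" for s by (rule sqint_cmult[OF Z_sqint])
 have g2: "(g s)^2 \<le> \<kappa>^2" if "0 \<le> s" for s using gb[OF that] \<kappa> by (simp add: abs_le_square_iff[symmetric])
 have b: "(LINT w|M. (g s * Z s w)^2) \<le> \<kappa>^2 * KZ" if "0 \<le> s" for s
  unfolding power_mult_distrib using g2[OF that] Z_second_moment[of s] by (simp, intro mult_mono) auto
 have p1: "set_integrable lborel {0..t} (\<lambda>s. g s * Z s w)" for w by (rule bdg_integrable[OF g Z_continuous]) simp
 have "bdg (\<kappa>^2) (\<lambda>s. (g s)^2)" unfolding bdg_def using g2 by auto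
 hence p2: "set_integrable lborel {0..t} (\<lambda>s. (g s * Z s w)^2)" for w
  unfolding power_mult_distrib by (rule bdg_integrable) (auto intro!: continuous_intros Z_continuous)
 show "sqint M (Wg g t)" unfolding Wg_def[abs_def] by (rule sqint_itg(1)[OF j sq b p1 p2 t])
 have "(LINT w|M. 1 * itg 0 t (\<lambda>s. g s * Z s w)) = itg 0 t (\<lambda>s. LINT w|M. 1 * (g s * Z s w))"
  by (rule fubini_itg(3)[OF j sq b sqint_const])
 also have "... = 0" by (simp add: gsp_mean[OF Z_gsp])
 finally show "(LINT w|M. Wg g t w) = 0" by (simp add: Wg_def)
 assume t1: "1 \<le> t"
 have "(LINT w|M. (Wg g t w)^2) \<le> \<kappa>^2 * (LINT w|M. (itg 0 t (\<lambda>s. Z s w))^2)"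
  unfolding Wg_def
 proof (rule cov_compare[OF j sq b p1 p2 t])
  fix s u :: real assume su: "0 \<le> s" "0 \<le> u"
  have "(LINT w|M. (g s * Z s w) * (g u * Z u w)) = (LINT w|M. (g s * g u) * (Z s w * Z u w))"
   by (intro Bochner_Integration.integral_cong refl) (simp only: mult_ac)
  also have "... = (g s * g u) * cov s u" by (simp add: cov_def)
  finally have "\<bar>LINT w|M. (g s * Z s w) * (g u * Z u w)\<bar> = (\<bar>g s\<bar> * \<bar>g u\<bar>) * cov s u"
   using cov_nonneg[of s u] by (simp add: abs_mult)
  also have "... \<le> (\<kappa> * \<kappa>) * cov s u" using gb su \<kappa> cov_nonneg[of s u] by (intro mult_right_mono mult_mono) auto
  finally show "\<bar>LINT w|M. (g s * Z s w) * (g u * Z u w)\<bar> \<le> \<kappa>^2 * cov s u" by (simp add: power2_eq_square)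
 qed
 also have "... \<le> \<kappa>^2 * (KV * t powr (2 * H))" by (intro mult_left_mono Z_integral_variance t1) simp
 finally show "(LINT w|M. (Wg g t w)^2) \<le> \<kappa>^2 * KV * t powr (2 * H)" by (simp add: mult.assoc)
qed

lemma Wq_moments:
 assumes t: "0 \<le> t"
 shows "sqint M (Wq t)" "(LINT w|M. Wq t w) = 0" "1 \<le> t ==> (LINT w|M. (Wq t w)^2) \<le> 2 * KZ * KV * t powr (2 * H)"
proof -
 have j: "(\<lambda>p. (Z (fst p) (snd p))^2 - v (fst p)) \<in> borel_measurable (lborel \<Otimes>\<^sub>M M)" by measurable
 have sq: "sqint M (\<lambda>w. (Z s w)^2 - v s)" for s by (intro sqint_diff int4_sq Z_int4 sqint_const)
 have E: "(LINT w|M. ((Z s w)^2 - v s) * ((Z u w)^2 - v u)) = 2 * (cov s u)^2" for s u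
  unfolding v_def cov_def by (rule gsp_square_cov[OF Z_gsp Z_gsp])
 have Eb: "2 * (cov s u)^2 \<le> 2 * KZ * cov s u" for s u
  using mult_right_mono[OF cov_le[of s u] cov_nonneg[of s u]] by (simp add: power2_eq_square)
 have b: "(LINT w|M. ((Z s w)^2 - v s)^2) \<le> 2 * KZ * KZ" for s
 proof -
  have "(LINT w|M. ((Z s w)^2 - v s)^2) \<le> 2 * KZ * cov s s" using E[of s s] Eb[of s s] by (simp add: power2_eq_square)
  also have "... \<le> 2 * KZ * KZ" using cov_le[of s s] KZ_pos by (intro mult_left_mono) auto
  finally show ?thesis .
 qed
 have vb: "bdg KZ v" unfolding bdg_def using v_bound by auto
 have v2b: "bdg (KZ^2) (\<lambda>s. (v s)^2)" unfolding bdg_def using v_bound KZ_pos by (auto intro!: power_mono)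
 have p1: "set_integrable lborel {0..t} (\<lambda>s. (Z s w)^2 - v s)" for w
  by (intro set_integral_diff(1) v_integrable cont_set_integrable continuous_intros Z_continuous)
 have p2: "set_integrable lborel {0..t} (\<lambda>s. ((Z s w)^2 - v s)^2)" for w
 proof -
  have "set_integrable lborel {0..t} (\<lambda>s. (Z s w) ^ 4 + (v s)^2 * 1 - v s * (2 * (Z s w)^2))"
   by (intro set_integral_diff(1) set_integral_add(1) bdg_integrable[OF vb] bdg_integrable[OF v2b] cont_set_integrable continuous_intros Z_continuous) simp_all
  moreover have "(Z s w) ^ 4 + (v s)^2 * 1 - v s * (2 * (Z s w)^2) = ((Z s w)^2 - v s)^2" for s
   by (simp add: power2_diff power_mult[symmetric] mult_ac)
  ultimately show ?thesis by simp
 qed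
 show "sqint M (Wq t)" unfolding Wq_def[abs_def] by (rule sqint_itg(1)[OF j sq b p1 p2 t])
 have "(LINT w|M. 1 * itg 0 t (\<lambda>s. (Z s w)^2 - v s)) = itg 0 t (\<lambda>s. LINT w|M. 1 * ((Z s w)^2 - v s))"
  by (rule fubini_itg(3)[OF j sq b sqint_const])
 also have "... = 0" using sqint_sq[OF Z_sqint] by (simp add: prob_space v_def)
 finally show "(LINT w|M. Wq t w) = 0" by (simp add: Wq_def)
 assume t1: "1 \<le> t"
 have "(LINT w|M. (Wq t w)^2) \<le> (2 * KZ) * (LINT w|M. (itg 0 t (\<lambda>s. Z s w))^2)"
  unfolding Wq_def by (rule cov_compare[OF j sq b p1 p2 t]) (use E Eb in simp)
 also have "... \<le> (2 * KZ) * (KV * t powr (2 * H))" using KZ_pos by (intro mult_left_mono Z_integral_variance t1) simp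
 finally show "(LINT w|M. (Wq t w)^2) \<le> 2 * KZ * KV * t powr (2 * H)" by (simp add: mult.assoc)
qed

text \<open>Adding \<open>\<kappa> (1 + Z\<^sup>2)\<close> makes the integrand nonnegative and the integral monotone in time.\<close>

lemma lln_combined:
 assumes g: "bdg \<kappa> g"
 shows "AE w in M. (\<lambda>n. (Wg g (real n) w + \<kappa> * Wq (real n) w) / real n) \<longlonglongrightarrow> 0"
proof (rule monotone_lln[where H=H and V="\<lambda>t w. Wg g t w + \<kappa> * Wq t w" and d="\<lambda>t. \<kappa> * itg 0 t (\<lambda>s. 1 + v s)"
   and K="2 * (\<kappa>^2 * KV) + 2 * (\<kappa>^2 * (2 * KZ * KV))" and K'="\<kappa> * (1 + KZ)"])
 note \<kappa> = bdg_nonneg[OF g]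
 have gb: "\<bar>g s\<bar> \<le> \<kappa>" if "0 \<le> s" for s :: real using g that by (simp add: bdg_def)
 show "H < 1" by (rule H_lt)
 show "0 \<le> \<kappa> * (1 + KZ)" using \<kappa> KZ_pos by simp
 fix t :: real assume t: "1 \<le> t"
 hence t0: "0 \<le> t" by simp
 note G = Wg_moments[OF g t0] and Q = Wq_moments[OF t0]
 show "sqint M (\<lambda>w. Wg g t w + \<kappa> * Wq t w)" by (intro sqint_add sqint_cmult G Q)
 have "(LINT w|M. (Wg g t w + \<kappa> * Wq t w)^2) \<le> 2 * (LINT w|M. (Wg g t w)^2) + 2 * (LINT w|M. (\<kappa> * Wq t w)^2)"
  by (intro integral_square_add_le sqint_cmult G Q)
 also have "... = 2 * (LINT w|M. (Wg g t w)^2) + 2 * (\<kappa>^2 * (LINT w|M. (Wq t w)^2))" by (simp add: power_mult_distrib)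
 also have "... \<le> 2 * (\<kappa>^2 * KV * t powr (2 * H)) + 2 * (\<kappa>^2 * (2 * KZ * KV * t powr (2 * H)))"
  by (intro add_mono mult_left_mono G(3) Q(3) t) auto
 finally show "(LINT w|M. (Wg g t w + \<kappa> * Wq t w)^2) \<le> (2 * (\<kappa>^2 * KV) + 2 * (\<kappa>^2 * (2 * KZ * KV))) * t powr (2 * H)"
  by (simp add: algebra_simps)
next
 fix s t :: real assume st: "1 \<le> s" "s \<le> t"
 note \<kappa> = bdg_nonneg[OF g]
 have iv: "set_integrable lborel {a..b} (\<lambda>s. 1 + v s)" for a b by (intro set_integral_add(1) v_integrable cont_set_integrable continuous_on_const)
 have "\<bar>itg s t (\<lambda>s. 1 + v s)\<bar> \<le> itg s t (\<lambda>_. 1 + KZ)"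
  by (rule itg_abs_le'[OF iv]) (use v_bound in \<open>auto intro!: cont_set_integrable continuous_on_const\<close>)
 hence "itg s t (\<lambda>s. 1 + v s) \<le> (1 + KZ) * (t - s)" using st by (simp add: itg_const)
 moreover have "itg 0 t (\<lambda>s. 1 + v s) = itg 0 s (\<lambda>s. 1 + v s) + itg s t (\<lambda>s. 1 + v s)"
  by (rule itg_split[OF iv]) (use st in auto)
 ultimately have "itg 0 t (\<lambda>s. 1 + v s) - itg 0 s (\<lambda>s. 1 + v s) \<le> (1 + KZ) * (t - s)" by simp
 from mult_left_mono[OF this \<kappa>]
 show "\<kappa> * itg 0 t (\<lambda>s. 1 + v s) - \<kappa> * itg 0 s (\<lambda>s. 1 + v s) \<le> \<kappa> * (1 + KZ) * (t - s)" by (simp add: algebra_simps)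
next
 fix s t :: real and w assume st: "1 \<le> s" "s \<le> t"
 note \<kappa> = bdg_nonneg[OF g]
 let ?F = "\<lambda>s. g s * Z s w + \<kappa> * (1 + (Z s w)^2)"
 have Fi: "set_integrable lborel {a..b} ?F" if "0 \<le> a" for a b
  by (intro set_integral_add(1) bdg_integrable[OF g] that cont_set_integrable continuous_intros Z_continuous)
 have e: "\<kappa> * itg 0 t (\<lambda>s. 1 + v s) + (Wg g t w + \<kappa> * Wq t w) = itg 0 t ?F" for t
 proof -
  have "itg 0 t ?F = Wg g t w + itg 0 t (\<lambda>s. \<kappa> * (1 + (Z s w)^2))" unfolding Wg_def
   by (intro set_integral_add(2) bdg_integrable[OF g] cont_set_integrable continuous_intros Z_continuous) simp
  also have "itg 0 t (\<lambda>s. \<kappa> * (1 + (Z s w)^2)) = \<kappa> * itg 0 t (\<lambda>s. (1 + v s) + ((Z s w)^2 - v s))" by simp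
  also have "itg 0 t (\<lambda>s. (1 + v s) + ((Z s w)^2 - v s)) = itg 0 t (\<lambda>s. 1 + v s) + Wq t w" unfolding Wq_def
   by (intro set_integral_add set_integral_diff(1) v_integrable cont_set_integrable continuous_intros Z_continuous)
  finally show ?thesis by (simp add: algebra_simps)
 qed
 have "0 \<le> itg s t ?F" unfolding set_lebesgue_integral_def
 proof (rule integral_nonneg_AE, rule AE_I2)
  fix u
  show "0 \<le> indicator {s..t} u *\<^sub>R ?F u"
  proof (cases "u \<in> {s..t}")
   case True
   hence "\<bar>g u\<bar> \<le> \<kappa>" using g st by (auto simp: bdg_def)
   hence "\<bar>g u * Z u w\<bar> \<le> \<kappa> * \<bar>Z u w\<bar>" unfolding abs_mult by (rule mult_right_mono) simp
   also have "... \<le> \<kappa> * (1 + (Z u w)^2)"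
   proof (rule mult_left_mono[OF _ \<kappa>])
    have "0 \<le> (1 - \<bar>Z u w\<bar>)^2 + 1 + (Z u w)^2" by simp
    thus "\<bar>Z u w\<bar> \<le> 1 + (Z u w)^2" by (simp add: power2_diff)
   qed
   finally show ?thesis by simp
  qed simp
 qed
 moreover have "itg 0 t ?F = itg 0 s ?F + itg s t ?F" by (rule itg_split) (use st Fi in auto)
 ultimately show "\<kappa> * itg 0 s (\<lambda>s. 1 + v s) + (Wg g s w + \<kappa> * Wq s w) \<le> \<kappa> * itg 0 t (\<lambda>s. 1 + v s) + (Wg g t w + \<kappa> * Wq t w)"
  unfolding e by simp
qed

lemma lln_Wq: "AE w in M. (\<lambda>n. Wq (real n) w / real n) \<longlonglongrightarrow> 0"
proof -
 have "bdg 1 (\<lambda>_. 0)" by (simp add: bdg_def)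
 from lln_combined[OF this] show ?thesis by (simp add: Wg_def)
qed

lemma lln_Wg:
 assumes g: "bdg \<kappa> g" shows "AE w in M. (\<lambda>n. Wg g (real n) w / real n) \<longlonglongrightarrow> 0"
 using lln_combined[OF g] lln_Wq
proof eventually_elim
 case (elim w)
 from tendsto_diff[OF elim(1) tendsto_mult[OF tendsto_const[of \<kappa>] elim(2)]]
 show ?case by (simp add: add_divide_distrib)
qed

lemma Xc_square_over_n: "AE w in M. (\<lambda>n. (Xc (real n) w)^2 / real n) \<longlonglongrightarrow> 0"
proof -
 define Y where "Y k w = (Xc (real (Suc k)) w)^2 / real (Suc k)" for k w
 have Ys: "sqint M (Y k)" for k using sqint_cmult[OF int4_sq[OF Xc_int4[of "real (Suc k)"]], of "1 / real (Suc k)"] by (simp add: Y_def[abs_def])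
 have YK: "(LINT w|M. (Y k w)^2) \<le> KX * real (Suc k) powr (- 2)" for k
 proof -
  have "(LINT w|M. (Y k w)^2) = (LINT w|M. (Xc (real (Suc k)) w) ^ 4) / (real (Suc k))^2"
   by (simp add: Y_def power_divide power_mult[symmetric] del: of_nat_Suc)
  also have "... \<le> KX / (real (Suc k))^2" by (intro divide_right_mono Xc_fourth) auto
  also have "... = KX * real (Suc k) powr (- 2)" by (simp add: powr_minus powr_numeral divide_inverse del: of_nat_Suc)
  finally show ?thesis .
 qed
 have "summable (\<lambda>k. LINT w|M. (Y k w)^2)"
  by (rule summable_comparison_test'[OF summable_Suc_powr[of KX], of 0]) (use YK in simp)
 from summable_square_integrals_AE_tendsto_0(2)[OF Ys this]
 show ?thesis by eventually_elim (rule LIMSEQ_imp_Suc, simp only: Y_def)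
qed

text \<open>The Wiener integrals are Gaussian with variance of order \<open>n\<^bsup>2H\<^esup>\<close>, so a high moment of the normalised
  integral is summable.\<close>

lemma wiener_over_n: "AE w in M. (\<lambda>n. wiener_integral M H B (real n) (\<phi> i) w / real n) \<longlonglongrightarrow> 0"
proof -
 obtain q :: nat where q: "q > 0" "real q * (2 - 2 * H) \<ge> 2" using powr_exponent_exists[OF H_lt] by blast
 define W where "W k = wiener_integral M H B (real (Suc k)) (\<phi> i)" for k
 define c where "c = (fact (2 * q) / (2 ^ q * fact q) :: real)"
 have c0: "0 \<le> c" by (simp add: c_def)
 have W: "W k \<in> gsp \<and> (LINT w|M. (W k w)^2) \<le> 2 * C^2 * real (Suc k) powr (2 * H)" for k
 proof -
  define h where "h = (SOME h. represents H (real (Suc k)) h (\<phi> i))"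
  have "\<exists>h. represents H (real (Suc k)) h (\<phi> i)" by (rule represents_bounded_exists[OF _ \<phi>_measurable \<phi>_bound]) simp
  hence h: "represents H (real (Suc k)) h (\<phi> i)" unfolding h_def by (rule someI_ex)
  hence hs: "h \<in> hspace H (real (Suc k))" by (simp add: represents_def)
  have We: "W k = isonormal M B h" by (simp add: W_def wiener_integral_def h_def)
  have "(LINT w|M. W k w * W k w) \<le> 2 * C^2 * real (Suc k) powr (2 * H)"
   unfolding We by (rule represents_norm_le[OF h \<phi>_bound _ hinner_tendsto[OF hs hs]]) simp
  thus ?thesis using gsp_isonormal[OF hs] by (simp add: We power2_eq_square)
 qed
 \<comment> \<open>The second moments of the power \<open>q\<close> are summable because \<open>q (2 - 2 H) \<ge> 2\<close>.\<close>
 define Y where "Y k w = (W k w / real (Suc k)) ^ q" for k w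
 have Y2: "(Y k w)^2 = (W k w) ^ (2 * q) / (real (Suc k) ^ q)^2" for k w
  by (simp add: Y_def power_divide power_mult[symmetric] mult.commute del: of_nat_Suc)
 have Ym: "Y k \<in> borel_measurable M" for k
  unfolding Y_def[abs_def] using gsp_measurable[of "W k"] W[of k] by (intro borel_measurable_power borel_measurable_divide borel_measurable_const) auto
 have Ys: "sqint M (Y k)" for k unfolding sqint_def Y2 using gsp_moment(1)[of "W k" q] W[of k] Ym[of k] by simp
 have YK: "(LINT w|M. (Y k w)^2) \<le> c * (2 * C^2) ^ q * real (Suc k) powr (- 2)" for k
 proof -
  have "(LINT w|M. (Y k w)^2) = c * (LINT w|M. (W k w)^2) ^ q / (real (Suc k) ^ q)^2"
   unfolding Y2 using gsp_moment(2)[of "W k" q] W[of k] by (simp add: c_def)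
  also have "... \<le> c * (2 * C^2 * real (Suc k) powr (2 * H)) ^ q / (real (Suc k) ^ q)^2"
   using W[of k] c0 by (intro divide_right_mono mult_left_mono power_mono) auto
  also have "... = (c * (2 * C^2) ^ q) * ((real (Suc k) powr (2 * H)) ^ q / (real (Suc k) ^ q)^2)"
   by (simp only: power_mult_distrib times_divide_eq_right mult.assoc)
  also have "... \<le> (c * (2 * C^2) ^ q) * real (Suc k) powr (- 2)"
   using c0 by (intro mult_left_mono powr_decay(1) q) auto
  finally show ?thesis .
 qed
 have "summable (\<lambda>k. LINT w|M. (Y k w)^2)"
  by (rule summable_comparison_test'[OF summable_Suc_powr[of "c * (2 * C^2) ^ q"], of 0]) (use YK in simp)
 from summable_square_integrals_AE_tendsto_0(2)[OF Ys this]
 show ?thesis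
 proof eventually_elim
  case (elim w)
  hence "(\<lambda>k. W k w / real (Suc k)) \<longlonglongrightarrow> 0" unfolding Y_def by (subst (asm) power_tendsto_0_iff[OF q(1)])
  thus ?case unfolding W_def by (rule LIMSEQ_imp_Suc)
 qed
qed

text \<open>Centring removes all deterministic terms of the chain rule expression.\<close>

lemma Sk_centered:
 assumes t: "0 \<le> t"
 shows "Sk t w - (LINT w|M. Sk t w) = ((Xc t w)^2 - (LINT w|M. (Xc t w)^2)) / 2 - Wg (\<lambda>s. L s - 2 * \<alpha> * m s) t w + \<alpha> * Wq t w"
  and "bdg (3 * CL) (\<lambda>s. L s - 2 * \<alpha> * m s)"
proof -
 let ?g = "\<lambda>s. L s - 2 * \<alpha> * m s"
 show g: "bdg (3 * CL) ?g" unfolding bdg_def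
 proof (intro conjI allI impI)
  fix s :: real assume s: "0 \<le> s"
  have "\<alpha> * \<bar>m s\<bar> \<le> \<alpha> * (CL / \<alpha>)" using m_bound[OF s] \<alpha>_pos by (intro mult_left_mono) auto
  hence "\<bar>2 * \<alpha> * m s\<bar> \<le> 2 * CL" using \<alpha>_pos by (simp add: abs_mult)
  thus "\<bar>L s - 2 * \<alpha> * m s\<bar> \<le> 3 * CL" using L_bound[of s] by linarith
 qed measurable
 define D where "D = itg 0 t (\<lambda>s. L s * m s - \<alpha> * (m s)^2 - \<alpha> * v s)"
 have Lb: "bdg CL L" unfolding bdg_def using L_bound by auto
 have i: "set_integrable lborel {0..t} (\<lambda>s. L s * m s - \<alpha> * (m s)^2 - \<alpha> * v s)"
  by (intro set_integral_diff(1) bdg_integrable[OF Lb] set_integrable_mult_right v_integrable cont_set_integrable continuous_intros m_continuous) simp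
 have S: "Sk t w = (Xc t w)^2 / 2 - (D + Wg ?g t w - \<alpha> * Wq t w)" for w
 proof -
  have "(\<lambda>s. Xc s w * Dr s w) = (\<lambda>s. (L s * m s - \<alpha> * (m s)^2 - \<alpha> * v s) + ?g s * Z s w - \<alpha> * ((Z s w)^2 - v s))"
   by (intro ext) (simp add: Xc_def Dr_def algebra_simps power2_eq_square)
  hence "itg 0 t (\<lambda>s. Xc s w * Dr s w) = itg 0 t (\<lambda>s. (L s * m s - \<alpha> * (m s)^2 - \<alpha> * v s) + ?g s * Z s w - \<alpha> * ((Z s w)^2 - v s))" by simp
  also have "... = itg 0 t (\<lambda>s. (L s * m s - \<alpha> * (m s)^2 - \<alpha> * v s) + ?g s * Z s w) - itg 0 t (\<lambda>s. \<alpha> * ((Z s w)^2 - v s))"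
   by (intro set_integral_diff(2) set_integral_add(1) i bdg_integrable[OF g] set_integrable_mult_right set_integral_diff(1) v_integrable cont_set_integrable continuous_intros Z_continuous) simp
  also have "itg 0 t (\<lambda>s. (L s * m s - \<alpha> * (m s)^2 - \<alpha> * v s) + ?g s * Z s w) = D + Wg ?g t w"
   unfolding D_def Wg_def by (intro set_integral_add(2) i bdg_integrable[OF g] Z_continuous) simp
  finally show ?thesis by (simp add: Sk_def Wq_def)
 qed
 note G = Wg_moments[OF g t] and Q = Wq_moments[OF t]
 have iX: "integrable M (\<lambda>w. (Xc t w)^2)" by (rule sqint_sq[OF Xc_sqint])
 have "(LINT w|M. Sk t w) = (LINT w|M. (Xc t w)^2) / 2 - D"
  unfolding S using iX sqint_integrable[OF G(1)] sqint_integrable[OF Q(1)] G(2) Q(2) by (simp add: prob_space)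
 thus "Sk t w - (LINT w|M. Sk t w) = ((Xc t w)^2 - (LINT w|M. (Xc t w)^2)) / 2 - Wg ?g t w + \<alpha> * Wq t w"
  unfolding S by (simp add: diff_divide_distrib)
qed

lemma skorohod_over_n: "AE w in M. (\<lambda>n. skorohod_integral M H B (real n) X w / real n) \<longlonglongrightarrow> 0"
proof -
 have "AE w in M. \<forall>n. n > 0 \<longrightarrow> skorohod_integral M H B (real n) X w = Sk (real n) w - (LINT w|M. Sk (real n) w)"
  unfolding AE_all_countable using skorohod_X by (intro allI AE_impI) auto
 thus ?thesis using Xc_square_over_n lln_Wq lln_Wg[OF Sk_centered(2)[OF order_refl]]
 proof eventually_elim
  case (elim w)
  have EX: "(\<lambda>n. (LINT w|M. (Xc (real n) w)^2) / real n) \<longlonglongrightarrow> 0"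
  proof (rule Lim_null_comparison[OF _ lim_const_over_n[of "1 + KX"]], intro always_eventually allI)
   fix n :: nat
   show "norm ((LINT w|M. (Xc (real n) w)^2) / real n) \<le> (1 + KX) / of_nat n"
    using Xc_second_moment[of "real n"] by (simp add: divide_right_mono)
  qed
  from tendsto_add[OF tendsto_diff[OF tendsto_mult[OF tendsto_const[of "1/2"] tendsto_diff[OF elim(2) EX]] elim(4)] tendsto_mult[OF tendsto_const[of \<alpha>] elim(3)]]
  have "(\<lambda>n. 1 / 2 * ((Xc (real n) w)^2 / real n - (LINT w|M. (Xc (real n) w)^2) / real n) - Wg (\<lambda>s. L s - 2 * \<alpha> * m s) (real n) w / real n + \<alpha> * (Wq (real n) w / real n)) \<longlonglongrightarrow> 0"
   by simp
  moreover have "1 / 2 * ((Xc (real n) w)^2 / real n - (LINT w|M. (Xc (real n) w)^2) / real n) - Wg (\<lambda>s. L s - 2 * \<alpha> * m s) (real n) w / real n + \<alpha> * (Wq (real n) w / real n)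
    = skorohod_integral M H B (real n) X w / real n" for n
  proof (cases "n = 0")
   case False
   hence "skorohod_integral M H B (real n) X w = ((Xc (real n) w)^2 - (LINT w|M. (Xc (real n) w)^2)) / 2 - Wg (\<lambda>s. L s - 2 * \<alpha> * m s) (real n) w + \<alpha> * Wq (real n) w"
    using elim(1) Sk_centered(1)[of "real n" w] by simp
   thus ?thesis by (simp add: add_divide_distrib diff_divide_distrib)
  qed simp
  ultimately show ?case by simp
 qed
qed

end

section \<open>The estimator\<close>

lemma set_integrable_sum:
 assumes "\<And>i. i \<in> I ==> set_integrable M A (f i)" shows "set_integrable M A (\<lambda>x. \<Sum>i\<in>I. (f i x :: real))"
 using assms unfolding set_integrable_def by (simp add: sum_distrib_left)

lemma set_integral_sum:
 assumes "\<And>i. i \<in> I ==> set_integrable M A (f i)"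
 shows "(LINT x:A|M. (\<Sum>i\<in>I. (f i x :: real))) = (\<Sum>i\<in>I. LINT x:A|M. f i x)"
 using assms unfolding set_integrable_def set_lebesgue_integral_def by (simp add: sum_distrib_left)

lemma matrix_inv_inverse:
 fixes A :: "real^'n^'n"
 assumes "invertible A" shows "A ** matrix_inv A = mat 1" "matrix_inv A ** A = mat 1"
proof -
 have "\<exists>A'. A ** A' = mat 1 \<and> A' ** A = mat 1" using assms by (auto simp: invertible_def)
 from someI_ex[OF this] show "A ** matrix_inv A = mat 1" "matrix_inv A ** A = mat 1" by (auto simp: matrix_inv_def)
qed

lemma set_lborel_shift: "itg (a + c) (b + c) f = itg a b (\<lambda>x. f (x + c))" for f :: "real => real"
proof -
 have "(LINT x|lborel. indicator {a + c..b + c} x *\<^sub>R f x) = (LINT x|lborel. indicator {a + c..b + c} (c + 1 * x) *\<^sub>R f (c + 1 * x))"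
  using lborel_integral_real_affine[of 1 "\<lambda>x. indicator {a + c..b + c} x *\<^sub>R f x" c] by simp
 also have "... = (LINT x|lborel. indicator {a..b} x *\<^sub>R f (x + c))"
  by (intro Bochner_Integration.integral_cong refl) (auto simp: indicator_def add.commute)
 finally show ?thesis by (simp only: set_lebesgue_integral_def)
qed

lemma itg_periodic:
 fixes f :: "real => real"
 assumes f: "\<And>a b. set_integrable lborel {a..b} f" and per: "\<And>x. f (x + 1) = f x"
 shows "itg 0 (real n) f = real n * itg 0 1 f"
proof (induction n)
 case (Suc n)
 have p: "f (x + real k) = f x" for x k
  by (induction k) (use per[of "x + real k" for k] in \<open>auto simp: add.assoc[symmetric] add.commute[of 1]\<close>)
 have "itg 0 (real (Suc n)) f = itg 0 (real n) f + itg (real n) (real (Suc n)) f" by (rule itg_split[OF f]) auto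
 also have "itg (real n) (real (Suc n)) f = itg 0 1 f" using set_lborel_shift[of 0 "real n" 1 f] p by (simp add: add.commute)
 finally show ?case using Suc by (simp add: algebra_simps)
qed simp

definition bordered :: "real => ('p::finite => real) => real => real^('p option)^('p option)" where
 "bordered \<nu> a b = (\<chi> k l. case (k, l) of
   (Some i, Some j) => if i = j then \<nu> else 0
  | (Some i, None) => - \<nu> * a i
  | (None, Some j) => - \<nu> * a j
  | (None, None) => \<nu> * b)"

lemma sum_option: "(\<Sum>k\<in>UNIV. f k) = f None + (\<Sum>i\<in>UNIV. f (Some i))" for f :: "'p::finite option => real"
 unfolding UNIV_option_conv by (subst sum.insert) (auto simp: sum.reindex)

text \<open>Elimination of the first unknowns leaves the Schur complement \<open>b - \<bar>a\<bar>\<^sup>2\<close> as the coefficient of the last one.\<close>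

lemma bordered_solve:
 fixes a :: "'p::finite => real"
 assumes \<nu>: "\<nu> > 0" and d: "b - (\<Sum>i\<in>UNIV. (a i)^2) > 0" and eq: "bordered \<nu> a b *v x = r"
 shows "x $ None = (r $ None / \<nu> + (\<Sum>i\<in>UNIV. a i * (r $ Some i / \<nu>))) / (b - (\<Sum>i\<in>UNIV. (a i)^2))"
  and "x $ Some i = r $ Some i / \<nu> + a i * x $ None"
proof -
 have r: "r $ k = (\<Sum>l\<in>UNIV. bordered \<nu> a b $ k $ l * x $ l)" for k
  unfolding eq[symmetric] by (simp add: matrix_vector_mult_def)
 have S: "r $ Some i = \<nu> * (x $ Some i - a i * x $ None)" for i
 proof -
  have "(\<Sum>j\<in>UNIV. (if i = j then \<nu> else 0) * x $ Some j) = \<nu> * x $ Some i"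
   by (subst sum.remove[of _ i]) auto
  thus ?thesis unfolding r sum_option by (simp add: bordered_def algebra_simps)
 qed
 thus x: "x $ Some i = r $ Some i / \<nu> + a i * x $ None" for i using \<nu> by (simp add: field_simps)
 have "r $ None = \<nu> * (b * x $ None - (\<Sum>j\<in>UNIV. a j * x $ Some j))"
  unfolding r[of None] sum_option by (simp add: bordered_def algebra_simps sum_distrib_left sum_negf)
 hence "r $ None / \<nu> = b * x $ None - (\<Sum>j\<in>UNIV. a j * x $ Some j)" using \<nu> by simp
 also have "(\<Sum>j\<in>UNIV. a j * x $ Some j) = (\<Sum>j\<in>UNIV. a j * (r $ Some j / \<nu>)) + x $ None * (\<Sum>j\<in>UNIV. (a j)^2)"
  unfolding x by (simp add: distrib_left sum.distrib sum_distrib_left power2_eq_square mult_ac)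
 finally have "r $ None / \<nu> + (\<Sum>j\<in>UNIV. a j * (r $ Some j / \<nu>)) = x $ None * (b - (\<Sum>i\<in>UNIV. (a i)^2))"
  by (simp add: algebra_simps)
 thus "x $ None = (r $ None / \<nu> + (\<Sum>i\<in>UNIV. a i * (r $ Some i / \<nu>))) / (b - (\<Sum>i\<in>UNIV. (a i)^2))"
  using d by (simp add: field_simps)
qed

lemma bordered_inv:
 fixes a :: "'p::finite => real"
 assumes \<nu>: "\<nu> > 0" and d: "b - (\<Sum>i\<in>UNIV. (a i)^2) > 0"
 shows "invertible (bordered \<nu> a b)"
proof -
 have "x = 0" if "bordered \<nu> a b *v x = 0" for x
 proof -
  note s = bordered_solve[OF \<nu> d that]
  have "x $ None = 0" using s(1) by simp
  hence "x $ k = 0" for k using s(2) by (cases k) auto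
  thus ?thesis by (simp add: vec_eq_iff)
 qed
 hence "\<exists>B. B ** bordered \<nu> a b = mat 1" by (subst matrix_left_invertible_ker) blast
 thus ?thesis by (simp add: invertible_left_inverse)
qed

lemma bordered_consistent:
 fixes a :: "nat => 'p::finite => real" and r :: "nat => real^('p option)" and \<theta> :: "real^('p option)"
 assumes c: "c > 0" "\<forall>\<^sub>F n in sequentially. c \<le> b n - (\<Sum>i\<in>UNIV. (a n i)^2)"
  and K: "\<And>i. \<forall>\<^sub>F n in sequentially. \<bar>a n i\<bar> \<le> K"
  and r: "\<And>k. (\<lambda>n. r n $ k / real n) \<longlonglongrightarrow> 0"
  and \<theta>': "\<forall>\<^sub>F n in sequentially. \<theta>' n = matrix_inv (bordered (real n) (a n) (b n)) *v (bordered (real n) (a n) (b n) *v \<theta> + r n)"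
 shows "\<theta>' \<longlonglongrightarrow> \<theta>"
proof -
 define x where "x n = matrix_inv (bordered (real n) (a n) (b n)) *v r n" for n
 have K': "\<forall>\<^sub>F n in sequentially. \<forall>i. \<bar>a n i\<bar> \<le> K" using K by (simp add: eventually_all_finite)
 have ev: "\<forall>\<^sub>F n in sequentially. \<theta>' n = \<theta> + x n \<and> bordered (real n) (a n) (b n) *v x n = r n"
  using c(2) eventually_gt_at_top[of 0] \<theta>'
 proof eventually_elim
  case (elim n)
  hence inv: "invertible (bordered (real n) (a n) (b n))" using c(1) by (intro bordered_inv) auto
  have "matrix_inv (bordered (real n) (a n) (b n)) *v (bordered (real n) (a n) (b n) *v \<theta> + r n) = \<theta> + x n"
   by (simp add: x_def matrix_vector_right_distrib matrix_vector_mul_assoc matrix_inv_inverse(2)[OF inv])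
  moreover have "bordered (real n) (a n) (b n) *v x n = r n"
   by (simp add: x_def matrix_vector_mul_assoc matrix_inv_inverse(1)[OF inv])
  ultimately show ?case using elim by simp
 qed
 have zl: "(\<lambda>n. (\<bar>r n $ None / real n\<bar> + (\<Sum>i\<in>UNIV. \<bar>K\<bar> * \<bar>r n $ Some i / real n\<bar>)) / c) \<longlonglongrightarrow> 0"
 proof -
  have "(\<lambda>n. (\<bar>r n $ None / real n\<bar> + (\<Sum>i\<in>UNIV. \<bar>K\<bar> * \<bar>r n $ Some i / real n\<bar>)) / c) \<longlonglongrightarrow> (\<bar>0\<bar> + (\<Sum>i\<in>(UNIV :: 'p set). \<bar>K\<bar> * \<bar>0\<bar>)) / c"
   using c(1) by (intro tendsto_intros r) auto
  thus ?thesis by simp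
 qed
 have z: "(\<lambda>n. x n $ None) \<longlonglongrightarrow> 0"
 proof (rule Lim_null_comparison[OF _ zl])
  show "\<forall>\<^sub>F n in sequentially. norm (x n $ None) \<le> (\<bar>r n $ None / real n\<bar> + (\<Sum>i\<in>UNIV. \<bar>K\<bar> * \<bar>r n $ Some i / real n\<bar>)) / c"
   using ev c(2) eventually_gt_at_top[of 0] K'
  proof eventually_elim
   case (elim n)
   have n: "real n > 0" and d: "b n - (\<Sum>i\<in>UNIV. (a n i)^2) > 0" and xr: "bordered (real n) (a n) (b n) *v x n = r n" using elim c(1) by auto
   have "\<bar>\<Sum>i\<in>UNIV. a n i * (r n $ Some i / real n)\<bar> \<le> (\<Sum>i\<in>UNIV. \<bar>a n i * (r n $ Some i / real n)\<bar>)" by (rule sum_abs)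
   also have "... \<le> (\<Sum>i\<in>UNIV. \<bar>K\<bar> * \<bar>r n $ Some i / real n\<bar>)"
    unfolding abs_mult using elim(4) by (intro sum_mono mult_right_mono) (auto intro: order_trans[OF _ abs_ge_self])
   finally have s: "\<bar>r n $ None / real n + (\<Sum>i\<in>UNIV. a n i * (r n $ Some i / real n))\<bar> \<le> \<bar>r n $ None / real n\<bar> + (\<Sum>i\<in>UNIV. \<bar>K\<bar> * \<bar>r n $ Some i / real n\<bar>)"
    by linarith
   have "norm (x n $ None) = \<bar>r n $ None / real n + (\<Sum>i\<in>UNIV. a n i * (r n $ Some i / real n))\<bar> / (b n - (\<Sum>i\<in>UNIV. (a n i)^2))"
    unfolding bordered_solve(1)[OF n d xr] using d by (simp add: abs_divide)
   also have "... \<le> (\<bar>r n $ None / real n\<bar> + (\<Sum>i\<in>UNIV. \<bar>K\<bar> * \<bar>r n $ Some i / real n\<bar>)) / c"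
    using s elim(2) c(1) by (intro frac_le) (auto intro!: add_nonneg_nonneg sum_nonneg)
   finally show ?case .
  qed
 qed
 have xl: "(\<lambda>n. x n $ k) \<longlonglongrightarrow> 0" for k
 proof (cases k)
  case (Some i)
  have l: "(\<lambda>n. \<bar>r n $ Some i / real n\<bar> + \<bar>K\<bar> * \<bar>x n $ None\<bar>) \<longlonglongrightarrow> 0"
   using tendsto_add[OF tendsto_rabs[OF r[of "Some i"]] tendsto_mult[OF tendsto_const[of "\<bar>K\<bar>"] tendsto_rabs[OF z]]] by simp
  show ?thesis unfolding Some
  proof (rule Lim_null_comparison[OF _ l])
   show "\<forall>\<^sub>F n in sequentially. norm (x n $ Some i) \<le> \<bar>r n $ Some i / real n\<bar> + \<bar>K\<bar> * \<bar>x n $ None\<bar>"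
    using ev c(2) eventually_gt_at_top[of 0] K'
   proof eventually_elim
    case (elim n)
    have n: "real n > 0" and d: "b n - (\<Sum>i\<in>UNIV. (a n i)^2) > 0" and xr: "bordered (real n) (a n) (b n) *v x n = r n" using elim c(1) by auto
    have "\<bar>a n i * x n $ None\<bar> \<le> \<bar>K\<bar> * \<bar>x n $ None\<bar>"
     unfolding abs_mult using elim(4) by (intro mult_right_mono) (auto intro: order_trans[OF _ abs_ge_self])
    thus ?case using bordered_solve(2)[OF n d xr, of i] abs_triangle_ineq[of "r n $ Some i / real n" "a n i * x n $ None"] by simp
   qed
  qed
 qed (use z in simp)
 have "(\<lambda>n. \<theta> + x n) \<longlonglongrightarrow> \<theta>"
 proof (rule vec_tendstoI)
  show "(\<lambda>n. (\<theta> + x n) $ k) \<longlonglongrightarrow> \<theta> $ k" for k using tendsto_add[OF tendsto_const[of "\<theta> $ k"] xl[of k]] by simp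
 qed
 thus ?thesis by (rule Lim_transform_eventually) (use ev in eventually_elim, auto)
qed

context fou begin

definition am :: "nat => 'p => real" where "am n i = itg 0 (real n) (\<lambda>s. \<phi> i s * m s) / real n"

lemma \<phi>_bdg: "bdg C (\<phi> i)" using \<phi>_bound by (simp add: bdg_def)

lemma \<phi>_prod_integrable: "set_integrable lborel {a..b} (\<lambda>s. \<phi> i s * \<phi> j s)"
proof (rule bounded_set_integrable)
 show "\<bar>\<phi> i s * \<phi> j s\<bar> \<le> C * C" for s unfolding abs_mult using \<phi>_bound C_pos by (intro mult_mono) auto
qed measurable

lemma \<phi>_gram: "itg 0 (real n) (\<lambda>s. \<phi> i s * \<phi> j s) = (if i = j then real n else 0)"
 using itg_periodic[OF \<phi>_prod_integrable[of _ _ i j], of n] \<phi>_periodic \<phi>_orthonormal[of i j] by simp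

lemma am_bound: "\<bar>am n i\<bar> \<le> C * (CL / \<alpha>)"
proof (cases "n = 0")
 case False
 have "\<bar>itg 0 (real n) (\<lambda>s. \<phi> i s * m s)\<bar> \<le> itg 0 (real n) (\<lambda>_. C * (CL / \<alpha>))"
 proof (rule itg_abs_le')
  show "set_integrable lborel {0..real n} (\<lambda>s. \<phi> i s * m s)" by (rule bdg_integrable[OF \<phi>_bdg m_continuous]) simp
  show "set_integrable lborel {0..real n} (\<lambda>_. C * (CL / \<alpha>))" by (intro cont_set_integrable continuous_on_const)
  show "\<bar>\<phi> i s * m s\<bar> \<le> C * (CL / \<alpha>)" if "0 \<le> s" for s
   unfolding abs_mult using \<phi>_bound m_bound[OF that] C_pos by (intro mult_mono) auto
 qed
 also have "... = C * (CL / \<alpha>) * real n" by (simp add: itg_const)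
 finally show ?thesis using False by (simp add: am_def pos_divide_le_eq)
qed (use C_pos CL_nonneg \<alpha>_pos in \<open>simp add: am_def\<close>)

text \<open>Bessel's inequality for the orthonormal system on \<open>[0,n]\<close>, from the integral of \<open>(m - \<Sum>\<^sub>i am\<^sub>i \<phi>\<^sub>i)\<^sup>2\<close>.\<close>

lemma m_bessel: "n > 0 ==> (\<Sum>i\<in>UNIV. (am n i)^2) \<le> itg 0 (real n) (\<lambda>s. (m s)^2) / real n"
proof -
 assume n: "n > 0"
 define A where "A s = (\<Sum>i\<in>UNIV. am n i * \<phi> i s)" for s
 have Ai: "set_integrable lborel {0..real n} (\<lambda>s. \<phi> i s * m s)" for i by (rule bdg_integrable[OF \<phi>_bdg m_continuous]) simp
 have mi: "set_integrable lborel {0..real n} (\<lambda>s. (m s)^2)" by (intro cont_set_integrable continuous_intros m_continuous)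
 have s1: "set_integrable lborel {0..real n} (\<lambda>s. \<Sum>i\<in>UNIV. am n i * (\<phi> i s * m s))"
  by (intro set_integrable_sum set_integrable_mult_right Ai)
 have s2: "set_integrable lborel {0..real n} (\<lambda>s. \<Sum>j\<in>UNIV. am n i * am n j * (\<phi> i s * \<phi> j s))" for i
  by (intro set_integrable_sum set_integrable_mult_right \<phi>_prod_integrable)
 have s3: "set_integrable lborel {0..real n} (\<lambda>s. \<Sum>i\<in>UNIV. \<Sum>j\<in>UNIV. am n i * am n j * (\<phi> i s * \<phi> j s))"
  by (intro set_integrable_sum s2)
 have e: "(m s - A s)^2 = (m s)^2 - 2 * (\<Sum>i\<in>UNIV. am n i * (\<phi> i s * m s)) + (\<Sum>i\<in>UNIV. \<Sum>j\<in>UNIV. am n i * am n j * (\<phi> i s * \<phi> j s))" for s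
 proof -
  have "(A s)^2 = (\<Sum>i\<in>UNIV. \<Sum>j\<in>UNIV. (am n i * \<phi> i s) * (am n j * \<phi> j s))"
   unfolding A_def power2_eq_square by (rule sum_product)
  hence A2: "(A s)^2 = (\<Sum>i\<in>UNIV. \<Sum>j\<in>UNIV. am n i * am n j * (\<phi> i s * \<phi> j s))" by (simp add: mult_ac)
  have "m s * A s = (\<Sum>i\<in>UNIV. am n i * (\<phi> i s * m s))" unfolding A_def sum_distrib_left by (intro sum.cong refl) (simp only: mult_ac)
  thus ?thesis unfolding power2_diff A2 by (simp only: mult.assoc)
 qed
 have I1: "itg 0 (real n) (\<lambda>s. \<Sum>i\<in>UNIV. am n i * (\<phi> i s * m s)) = real n * (\<Sum>i\<in>UNIV. (am n i)^2)"
  using n by (subst set_integral_sum) (auto intro!: set_integrable_mult_right Ai simp: am_def sum_distrib_left power2_eq_square)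
 have "itg 0 (real n) (\<lambda>s. \<Sum>i\<in>UNIV. \<Sum>j\<in>UNIV. am n i * am n j * (\<phi> i s * \<phi> j s)) = (\<Sum>i\<in>UNIV. \<Sum>j\<in>UNIV. am n i * am n j * (if i = j then real n else 0))"
  by (subst set_integral_sum, (auto intro!: s2)[2], rule sum.cong[OF refl], subst set_integral_sum)
    (auto intro!: set_integrable_mult_right \<phi>_prod_integrable sum.cong simp: \<phi>_gram)
 also have "... = real n * (\<Sum>i\<in>UNIV. (am n i)^2)"
  by (simp add: if_distrib[of "\<lambda>x. _ * x"] sum_distrib_left power2_eq_square mult_ac cong: if_cong)
 finally have I2: "itg 0 (real n) (\<lambda>s. \<Sum>i\<in>UNIV. \<Sum>j\<in>UNIV. am n i * am n j * (\<phi> i s * \<phi> j s)) = real n * (\<Sum>i\<in>UNIV. (am n i)^2)" .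
 have "0 \<le> itg 0 (real n) (\<lambda>s. (m s - A s)^2)" unfolding set_lebesgue_integral_def by (intro integral_nonneg_AE AE_I2) simp
 also have "itg 0 (real n) (\<lambda>s. (m s - A s)^2) = itg 0 (real n) (\<lambda>s. (m s)^2 - 2 * (\<Sum>i\<in>UNIV. am n i * (\<phi> i s * m s))) + itg 0 (real n) (\<lambda>s. (\<Sum>i\<in>UNIV. \<Sum>j\<in>UNIV. am n i * am n j * (\<phi> i s * \<phi> j s)))"
  unfolding e by (intro set_integral_add(2) set_integral_diff(1) set_integrable_mult_right mi s1 s3)
 also have "itg 0 (real n) (\<lambda>s. (m s)^2 - 2 * (\<Sum>i\<in>UNIV. am n i * (\<phi> i s * m s))) = itg 0 (real n) (\<lambda>s. (m s)^2) - itg 0 (real n) (\<lambda>s. 2 * (\<Sum>i\<in>UNIV. am n i * (\<phi> i s * m s)))"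
  by (intro set_integral_diff(2) set_integrable_mult_right mi s1)
 also have "itg 0 (real n) (\<lambda>s. 2 * (\<Sum>i\<in>UNIV. am n i * (\<phi> i s * m s))) = 2 * (real n * (\<Sum>i\<in>UNIV. (am n i)^2))"
  unfolding set_integral_mult_right I1 ..
 also note I2
 finally show ?thesis using n by (simp add: field_simps)
qed

lemma v_lower: "n \<ge> 2 ==> exp (- 4 * \<alpha>) / 2 \<le> itg 0 (real n) v / real n"
proof -
 assume n: "n \<ge> 2"
 have "exp (- 4 * \<alpha>) * (real n - 1) = itg 1 (real n) (\<lambda>_. exp (- 4 * \<alpha>))" using n by (simp add: itg_const)
 also have "... \<le> itg 1 (real n) v"
  by (rule set_integral_mono[OF cont_set_integrable[OF continuous_on_const] v_integrable]) (use Z_second_moment_lower in \<open>auto simp: v_def\<close>)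
 also have "... \<le> itg 0 (real n) v"
 proof -
  have "0 \<le> itg 0 1 v" unfolding set_lebesgue_integral_def using v_bound by (intro integral_nonneg_AE AE_I2) simp
  thus ?thesis using itg_split[OF v_integrable, of 0 1 "real n"] n by simp
 qed
 finally have 1: "exp (- 4 * \<alpha>) * (real n - 1) \<le> itg 0 (real n) v" .
 have "exp (- 4 * \<alpha>) * (real n / 2) \<le> exp (- 4 * \<alpha>) * (real n - 1)" using n by (intro mult_left_mono) auto
 with 1 have "exp (- 4 * \<alpha>) * (real n / 2) \<le> itg 0 (real n) v" by linarith
 thus ?thesis using n by (simp add: field_simps)
qed

text \<open>The error representation \<open>P\<^sub>n = Q\<^sub>n \<theta> + R\<^sub>n\<close>, with the entries of \<open>Q\<^sub>n / n\<close> split into their limiting and fluctuating parts.\<close>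

lemma lse_decomposition:
 assumes w: "w \<in> space M" "w \<notin> Nul" and n: "n > 0"
 defines "a \<equiv> \<lambda>i. am n i + Wg (\<phi> i) (real n) w / real n"
  and "b \<equiv> itg 0 (real n) (\<lambda>s. (m s)^2) / real n + itg 0 (real n) v / real n + 2 * (Wg m (real n) w / real n) + Wq (real n) w / real n"
  and "r \<equiv> (\<chi> k. case k of Some i => wiener_integral M H B (real n) (\<phi> i) w | None => - skorohod_integral M H B (real n) X w)"
 shows "lse M H B \<phi> \<mu> \<alpha> X (real n) w = matrix_inv (bordered (real n) a b) *v (bordered (real n) a b *v param \<mu> \<alpha> + r)"
proof -
 define T where "T = real n"
 have Xe: "X t w = Xc t w" if "t \<in> {0..T}" for t using X_eq[OF w, of t] that by (simp add: Xc_def)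
 have mb: "bdg (CL / \<alpha>) m" unfolding bdg_def using m_bound by auto
 have iX: "set_integrable lborel {0..T} (\<lambda>s. \<phi> i s * Xc s w)" for i by (rule bdg_integrable[OF \<phi>_bdg Xc_continuous]) simp
 have iX2: "set_integrable lborel {0..T} (\<lambda>s. (Xc s w)^2)" by (intro cont_set_integrable continuous_intros Xc_continuous)
 have a: "(LINT t:{0..T}|lborel. \<phi> i t * X t w) = T * a i" for i
 proof -
  have "(LINT t:{0..T}|lborel. \<phi> i t * X t w) = itg 0 T (\<lambda>s. \<phi> i s * m s + \<phi> i s * Z s w)"
   by (rule set_lebesgue_integral_cong) (use Xe in \<open>auto simp: Xc_def algebra_simps\<close>)
  also have "... = itg 0 T (\<lambda>s. \<phi> i s * m s) + Wg (\<phi> i) T w" unfolding Wg_def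
   by (intro set_integral_add(2) bdg_integrable[OF \<phi>_bdg] m_continuous Z_continuous) auto
  finally show ?thesis using n by (simp add: a_def am_def T_def distrib_left)
 qed
 have b: "(LINT t:{0..T}|lborel. (X t w)^2) = T * b"
 proof -
  have "(LINT t:{0..T}|lborel. (X t w)^2) = itg 0 T (\<lambda>s. ((m s)^2 + v s + 2 * (m s * Z s w)) + ((Z s w)^2 - v s))"
   by (rule set_lebesgue_integral_cong) (use Xe in \<open>auto simp: Xc_def power2_sum\<close>)
  also have "... = itg 0 T (\<lambda>s. ((m s)^2 + v s + 2 * (m s * Z s w))) + Wq T w" unfolding Wq_def
   by (intro set_integral_add(2) set_integral_add(1) set_integral_diff(1) v_integrable cont_set_integrable continuous_intros m_continuous Z_continuous)
  also have "itg 0 T (\<lambda>s. ((m s)^2 + v s + 2 * (m s * Z s w))) = itg 0 T (\<lambda>s. (m s)^2 + v s) + itg 0 T (\<lambda>s. 2 * (m s * Z s w))"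
   by (intro set_integral_add(2) set_integral_add(1) v_integrable cont_set_integrable continuous_intros m_continuous Z_continuous)
  also have "itg 0 T (\<lambda>s. (m s)^2 + v s) = itg 0 T (\<lambda>s. (m s)^2) + itg 0 T v"
   by (intro set_integral_add(2) v_integrable cont_set_integrable continuous_intros m_continuous)
  also have "itg 0 T (\<lambda>s. 2 * (m s * Z s w)) = 2 * Wg m T w" by (simp add: Wg_def)
  finally show ?thesis using n by (simp add: b_def T_def distrib_left)
 qed
 have g: "(LINT t:{0..T}|lborel. \<phi> i t * \<phi> j t) = (if i = j then T else 0)" for i j unfolding T_def by (rule \<phi>_gram)
 have Q: "lse_Q \<phi> X T w = bordered T a b"
  unfolding lse_Q_def bordered_def by (simp add: vec_eq_iff a b g split: option.split)
 have P: "lse_P M H B \<phi> \<mu> \<alpha> X T w = bordered T a b *v param \<mu> \<alpha> + r"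
 proof (rule vec_eq_iff[THEN iffD2], rule allI)
  fix k :: "'p option"
  show "lse_P M H B \<phi> \<mu> \<alpha> X T w $ k = (bordered T a b *v param \<mu> \<alpha> + r) $ k"
  proof (cases k)
   case (Some i)
   have "(LINT t:{0..T}|lborel. \<phi> i t * drift \<phi> \<mu> \<alpha> X w t) = itg 0 T (\<lambda>t. (\<Sum>j\<in>UNIV. \<mu> $ j * (\<phi> i t * \<phi> j t)) - \<alpha> * (\<phi> i t * Xc t w))"
    by (rule set_lebesgue_integral_cong) (use Xe in \<open>auto simp: drift_def right_diff_distrib sum_distrib_left mult_ac\<close>)
   also have "... = itg 0 T (\<lambda>t. \<Sum>j\<in>UNIV. \<mu> $ j * (\<phi> i t * \<phi> j t)) - itg 0 T (\<lambda>t. \<alpha> * (\<phi> i t * Xc t w))"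
    by (intro set_integral_diff(2) set_integrable_sum set_integrable_mult_right \<phi>_prod_integrable iX)
   also have "itg 0 T (\<lambda>t. \<Sum>j\<in>UNIV. \<mu> $ j * (\<phi> i t * \<phi> j t)) = (\<Sum>j\<in>UNIV. \<mu> $ j * (if i = j then T else 0))"
    by (subst set_integral_sum) (auto intro!: set_integrable_mult_right \<phi>_prod_integrable sum.cong simp: g)
   also have "itg 0 T (\<lambda>t. \<alpha> * (\<phi> i t * Xc t w)) = \<alpha> * (LINT t:{0..T}|lborel. \<phi> i t * X t w)"
    by (simp, rule disjI2, rule set_lebesgue_integral_cong) (use Xe in auto)
   finally show ?thesis
    unfolding Some a unfolding T_def by (simp add: lse_P_def r_def matrix_vector_mult_def sum_option bordered_def param_def mult_ac T_def)
  next
   case None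
   have iX': "set_integrable lborel {0..T} (\<lambda>s. \<phi> j s * X s w)" for j
    using iX[of j] by (rule set_integrable_cong[THEN iffD1, rotated -1]) (use Xe in auto)
   have "(LINT t:{0..T}|lborel. X t w * drift \<phi> \<mu> \<alpha> X w t) = itg 0 T (\<lambda>t. (\<Sum>j\<in>UNIV. \<mu> $ j * (\<phi> j t * Xc t w)) - \<alpha> * (Xc t w)^2)"
    by (rule set_lebesgue_integral_cong) (use Xe in \<open>auto simp: drift_def right_diff_distrib sum_distrib_left mult_ac power2_eq_square\<close>)
   also have "... = itg 0 T (\<lambda>t. \<Sum>j\<in>UNIV. \<mu> $ j * (\<phi> j t * Xc t w)) - itg 0 T (\<lambda>t. \<alpha> * (Xc t w)^2)"
    by (intro set_integral_diff(2) set_integrable_sum set_integrable_mult_right iX iX2)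
   also have "itg 0 T (\<lambda>t. \<Sum>j\<in>UNIV. \<mu> $ j * (\<phi> j t * Xc t w)) = (\<Sum>j\<in>UNIV. \<mu> $ j * itg 0 T (\<lambda>t. \<phi> j t * Xc t w))"
    by (subst set_integral_sum) (auto intro!: set_integrable_mult_right iX)
   also have "... = (\<Sum>j\<in>UNIV. \<mu> $ j * (LINT t:{0..T}|lborel. \<phi> j t * X t w))"
    by (intro sum.cong refl arg_cong2[where f="\<lambda>x y. x * y"] set_lebesgue_integral_cong) (use Xe in auto)
   also have "itg 0 T (\<lambda>t. \<alpha> * (Xc t w)^2) = \<alpha> * (LINT t:{0..T}|lborel. (X t w)^2)"
    by (simp, rule disjI2, rule set_lebesgue_integral_cong) (use Xe in auto)
   finally show ?thesis
    unfolding None a b unfolding T_def by (simp add: lse_P_def r_def matrix_vector_mult_def sum_option bordered_def param_def mult_ac sum_negf T_def)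
  qed
 qed
 show ?thesis unfolding lse_def T_def[symmetric] Q P ..
qed

lemma lse_consistent: "AE w in M. (\<lambda>n::nat. lse M H B \<phi> \<mu> \<alpha> X (real n) w) \<longlonglongrightarrow> param \<mu> \<alpha>"
proof -
 have mb: "bdg (CL / \<alpha>) m" unfolding bdg_def using m_bound by auto
 have AW: "AE w in M. \<forall>i. (\<lambda>n. wiener_integral M H B (real n) (\<phi> i) w / real n) \<longlonglongrightarrow> 0"
  using AE_finite_allI[where S=UNIV and M=M and Q="\<lambda>i w. (\<lambda>n. wiener_integral M H B (real n) (\<phi> i) w / real n) \<longlonglongrightarrow> 0"] wiener_over_n by simp
 have A\<phi>: "AE w in M. \<forall>i. (\<lambda>n. Wg (\<phi> i) (real n) w / real n) \<longlonglongrightarrow> 0"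
  using AE_finite_allI[where S=UNIV and M=M and Q="\<lambda>i w. (\<lambda>n. Wg (\<phi> i) (real n) w / real n) \<longlonglongrightarrow> 0"] lln_Wg[OF \<phi>_bdg] by simp
 show ?thesis using AE_not_Nul AW A\<phi> lln_Wg[OF mb] lln_Wq skorohod_over_n
 proof eventually_elim
  case (elim w)
  define \<epsilon> where "\<epsilon> n i = Wg (\<phi> i) (real n) w / real n" for n i
  define a where "a n i = am n i + \<epsilon> n i" for n i
  define b where "b n = itg 0 (real n) (\<lambda>s. (m s)^2) / real n + itg 0 (real n) v / real n + 2 * (Wg m (real n) w / real n) + Wq (real n) w / real n" for n :: nat
  define r :: "nat => real^('p option)" where "r n = (\<chi> k. case k of Some i => wiener_integral M H B (real n) (\<phi> i) w | None => - skorohod_integral M H B (real n) X w)" for n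
  have \<epsilon>0: "(\<lambda>n. \<epsilon> n i) \<longlonglongrightarrow> 0" for i unfolding \<epsilon>_def using elim(3) by simp
  \<comment> \<open>what remains of the Schur complement after Bessel and the lower bound for \<open>v\<close>; it tends to zero\<close>
 define \<delta> where "\<delta> n = 2 * (Wg m (real n) w / real n) + Wq (real n) w / real n - (\<Sum>i\<in>UNIV. 2 * (am n i * \<epsilon> n i) + (\<epsilon> n i)^2)" for n
  have ae: "(\<lambda>n. am n i * \<epsilon> n i) \<longlonglongrightarrow> 0" for i
  proof (rule Lim_null_comparison)
   show "(\<lambda>n. C * (CL / \<alpha>) * \<bar>\<epsilon> n i\<bar>) \<longlonglongrightarrow> 0" using tendsto_mult[OF tendsto_const tendsto_rabs[OF \<epsilon>0[of i]], of "C * (CL / \<alpha>)"] by simp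
   show "\<forall>\<^sub>F n in sequentially. norm (am n i * \<epsilon> n i) \<le> C * (CL / \<alpha>) * \<bar>\<epsilon> n i\<bar>"
    by (intro always_eventually allI) (unfold real_norm_def abs_mult, intro mult_right_mono am_bound abs_ge_zero)
  qed
  have "\<delta> \<longlonglongrightarrow> 2 * 0 + 0 - (\<Sum>i\<in>(UNIV :: 'p set). 2 * 0 + 0^2)" unfolding \<delta>_def
   by (intro tendsto_intros ae \<epsilon>0 elim(4) elim(5))
  hence \<delta>0: "\<delta> \<longlonglongrightarrow> 0" by simp
  have ba: "exp (- 4 * \<alpha>) / 2 + \<delta> n \<le> b n - (\<Sum>i\<in>UNIV. (a n i)^2)" if n: "n \<ge> 2" for n
  proof -
   have "(\<Sum>i\<in>UNIV. (a n i)^2) = (\<Sum>i\<in>UNIV. (am n i)^2) + (\<Sum>i\<in>UNIV. 2 * (am n i * \<epsilon> n i) + (\<epsilon> n i)^2)"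
    unfolding sum.distrib[symmetric] a_def by (intro sum.cong refl) (simp add: power2_sum)
   thus ?thesis using m_bessel[of n] v_lower[OF n] n unfolding b_def \<delta>_def by linarith
  qed
  show ?case
  proof (rule bordered_consistent[where a=a and b=b and r=r and c="exp (- 4 * \<alpha>) / 4" and K="C * (CL / \<alpha>) + 1"])
   show "exp (- 4 * \<alpha>) / 4 > 0" by simp
   have "\<forall>\<^sub>F n in sequentially. \<delta> n > - (exp (- 4 * \<alpha>) / 4)" by (rule order_tendstoD(1)[OF \<delta>0]) simp
   thus "\<forall>\<^sub>F n in sequentially. exp (- 4 * \<alpha>) / 4 \<le> b n - (\<Sum>i\<in>UNIV. (a n i)^2)"
    using eventually_ge_at_top[of 2]
   proof eventually_elim
    case (elim n)
    thus ?case using ba[of n] by linarith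
   qed
   fix i
   have "\<forall>\<^sub>F n in sequentially. \<bar>\<epsilon> n i\<bar> < 1" using order_tendstoD(2)[OF tendsto_rabs[OF \<epsilon>0[of i]], of 1] by simp
   thus "\<forall>\<^sub>F n in sequentially. \<bar>a n i\<bar> \<le> C * (CL / \<alpha>) + 1"
   proof eventually_elim
    case (elim n)
    thus ?case using am_bound[of n i] abs_triangle_ineq[of "am n i" "\<epsilon> n i"] unfolding a_def by linarith
   qed
  next
   fix k :: "'p option"
   show "(\<lambda>n. r n $ k / real n) \<longlonglongrightarrow> 0"
    using elim(2) tendsto_minus[OF elim(6)] by (cases k) (simp_all add: r_def)
  next
   show "\<forall>\<^sub>F n in sequentially. lse M H B \<phi> \<mu> \<alpha> X (real n) w = matrix_inv (bordered (real n) (a n) (b n)) *v (bordered (real n) (a n) (b n) *v param \<mu> \<alpha> + r n)"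
    using eventually_gt_at_top[of 0]
   proof eventually_elim
    case (elim n)
    have w: "w \<in> space M" "w \<notin> Nul" using \<open>w \<in> space M \<and> w \<notin> Nul\<close> by auto
    show ?case using lse_decomposition[OF w elim]
     unfolding r_def b_def a_def[abs_def] \<epsilon>_def .
   qed
  qed
 qed
qed

end

theorem theorem1:
  fixes M :: "'w measure" and H C \<alpha> :: real and B X :: "real \<Rightarrow> 'w \<Rightarrow> real"
    and \<phi> :: "'p::finite \<Rightarrow> real \<Rightarrow> real" and \<mu> :: "real^'p"
  assumes "prob_space M"
    and "1/2 < H" and "H < 1"
    and "fractional_brownian_motion M H B"
    and "\<And>i. \<phi> i \<in> borel_measurable borel"
    and "C > 0" and "\<And>i t. \<bar>\<phi> i t\<bar> \<le> C"
    and "\<And>i t. \<phi> i (t + 1) = \<phi> i t"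
    and "\<And>i j. (LINT t:{0..1}|lborel. \<phi> i t * \<phi> j t) = (if i = j then 1 else 0)"
    and "\<alpha> > 0"
    and "periodic_fOU M B \<phi> \<mu> \<alpha> X"
  shows "AE \<omega> in M. (\<lambda>n::nat. lse M H B \<phi> \<mu> \<alpha> X (real n) \<omega>) \<longlonglongrightarrow> param \<mu> \<alpha>"
proof -
  interpret prob_space M by fact
  interpret fou H M B C \<alpha> \<phi> \<mu> X
    by unfold_locales (use assms in auto)
  show ?thesis by (rule lse_consistent)
qed

end
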